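(* Let $m,n$ be positive integers with $m\geqslant n$ and $\gcd(m,n)=1$. If $mn\equiv 0\bmod 2$, then $$\Lambda_{4(m+n)-3}(M_{m,n})=16\pi\left(\sqrt{m^2+2mn}\;E\left(\sqrt{\tfrac{m^2-n^2}{m^2+2mn}}\right)-\frac{mn}{\sqrt{m^2+2mn}}\,K\left(\sqrt{\tfrac{m^2-n^2}{m^2+2mn}}\right)\right).$$ If $mn\equiv 1\bmod 2$, then $$\Lambda_{2(m+n)-3}(M_{m,n})=8\pi\left(\sqrt{m^2+2mn}\;E\left(\sqrt{\tfrac{m^2-n^2}{m^2+2mn}}\right)-\frac{mn}{\sqrt{m^2+2mn}}\,K\left(\sqrt{\tfrac{m^2-n^2}{m^2+2mn}}\right)\right).$$ Moreover, for every such pair $\{m,n\}\neq\{1,1\}$ the metric on $M_{m,n}$ is not maximal for the corresponding functional, i.e. for $\Lambda_{4(m+n)-3}(\mathbb{T}^2,g)$ if $mn$ is even and for $\Lambda_{2(m+n)-3}(\mathbb{T}^2,g)$ if $mn$ is odd.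
   Context: $\mathbb{S}^5$ is the set of unit vectors in $\mathbb{C}^3$. For positive integers $m\geqslant n$ with $\gcd(m,n)=1$, $\varphi_{m,n}\colon\mathbb{R}^2\to\mathbb{S}^5$ is the doubly $2\pi$-periodic immersion $$\varphi_{m,n}(x,y)=\left(\sqrt{\tfrac{m+n}{2m+n}}\,e^{imy}\sin x,\ \sqrt{\tfrac{m+n}{m+2n}}\,e^{iny}\cos x,\ \sqrt{\tfrac{n\cos^2x}{m+2n}+\tfrac{m\sin^2x}{2m+n}}\,e^{-i(m+n)y}\right),$$ and $M_{m,n}$ denotes its image, which is a torus, with the metric induced from the canonical metric of $\mathbb{S}^5$. For a closed surface $M$ with Riemannian metric $g$, let $0=\lambda_0(M,g)<\lambda_1(M,g)\leqslant\lambda_2(M,g)\leqslant\dots$ be the eigenvalues, with multiplicities, of the (nonnegative) Laplace-Beltrami operator, and $\Lambda_i(M,g)=\lambda_i(M,g)\,\mathrm{Area}(M,g)$; $\Lambda_i(M_{m,n})$ is this quantity for $M_{m,n}$ with its induced metric. A metric $g_0$ on $\mathbb{T}^2$ is maximal for $\Lambda_i(\mathbb{T}^2,g)$ if $\Lambda_i(\mathbb{T}^2,g_0)=\sup_g\Lambda_i(\mathbb{T}^2,g)$, the supremum being over all Riemannian metrics $g$ on the torus $\mathbb{T}^2$. The elliptic integrals of the first and second kind are $$K(k)=\int_0^1\frac{dx}{\sqrt{1-x^2}\sqrt{1-k^2x^2}},\qquad E(k)=\int_0^1\frac{\sqrt{1-k^2x^2}}{\sqrt{1-x^2}}\,dx.$$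 *)

theory Defs
  imports "HOL-Analysis.Analysis" "HOL-Library.Function_Algebras"
begin

section \<open>Smooth maps on the plane\<close>

definition partial :: "2 \<Rightarrow> (real^2 \<Rightarrow> 'b::real_normed_vector) \<Rightarrow> real^2 \<Rightarrow> 'b"
  where "partial i f p = frechet_derivative f (at p) (axis i 1)"

definition smooth :: "(real^2 \<Rightarrow> 'b::real_normed_vector) \<Rightarrow> bool"
  where "smooth f \<longleftrightarrow> (\<forall>is p. foldr partial is f differentiable (at p))"


section \<open>Riemannian metrics on the torus and their spectrum\<close>

text \<open>The torus is the quotient of the plane by the integer lattice. Functions, metrics and
  operators on it are represented by their lattice periodic lifts to the plane; a metric is given
  by its Gram matrix in the standard coordinates.\<close>

definition lattice_periodic :: "(real^2 \<Rightarrow> 'b) \<Rightarrow> bool"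
  where "lattice_periodic f \<longleftrightarrow> (\<forall>p v. (\<forall>i. v $ i \<in> \<int>) \<longrightarrow> f (p + v) = f p)"

type_synonym metric = "real^2 \<Rightarrow> real^2^2"

definition torus_metric :: "metric \<Rightarrow> bool"
  where "torus_metric g \<longleftrightarrow> smooth g \<and> lattice_periodic g \<and>
    (\<forall>p. transpose (g p) = g p \<and> (\<forall>v. v \<noteq> 0 \<longrightarrow> 0 < v \<bullet> (g p *v v)))"

definition area :: "metric \<Rightarrow> real"
  where "area g = integral (cbox 0 1) (\<lambda>p. sqrt (det (g p)))"

definition laplace_beltrami :: "metric \<Rightarrow> (real^2 \<Rightarrow> real) \<Rightarrow> real^2 \<Rightarrow> real"
  where "laplace_beltrami g u p =
    - (\<Sum>i\<in>UNIV. partial i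
          (\<lambda>q. sqrt (det (g q)) * (\<Sum>j\<in>UNIV. matrix_inv (g q) $ i $ j * partial j u q)) p)
      / sqrt (det (g p))"

definition eigenspace :: "metric \<Rightarrow> real \<Rightarrow> (real^2 \<Rightarrow> real) set"
  where "eigenspace g \<mu> =
    {u. smooth u \<and> lattice_periodic u \<and> (\<forall>p. laplace_beltrami g u p = \<mu> * u p)}"

global_interpretation funvs: vector_space "\<lambda>(c::real) (u :: real^2 \<Rightarrow> real) p. c * u p"
  by unfold_locales (auto simp: fun_eq_iff algebra_simps)

text \<open>The eigenvalues in nondecreasing order, each one repeated according to its multiplicity.
  At most one sequence has this property.\<close>

definition eigenvalue_sequence :: "metric \<Rightarrow> (nat \<Rightarrow> real) \<Rightarrow> bool"
  where "eigenvalue_sequence g s \<longleftrightarrow> mono s \<and>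
    (\<forall>\<mu>. finite {i. s i = \<mu>} \<and>
      (\<exists>B. finite B \<and> funvs.independent B \<and> funvs.span B = eigenspace g \<mu> \<and>
           card B = card {i. s i = \<mu>}))"

definition eigenvalue :: "nat \<Rightarrow> metric \<Rightarrow> real"
  where "eigenvalue i g = (THE s. eigenvalue_sequence g s) i"

definition Lambda :: "nat \<Rightarrow> metric \<Rightarrow> real"
  where "Lambda i g = eigenvalue i g * area g"

definition maximal_metric :: "nat \<Rightarrow> metric \<Rightarrow> bool"
  where "maximal_metric i g \<longleftrightarrow>
    ereal (Lambda i g) = (SUP h\<in>{h. torus_metric h}. ereal (Lambda i h))"


section \<open>Embedded tori\<close>

text \<open>Injective immersions of the torus with image \<open>M\<close>. The torus being compact, these are exactly
  the diffeomorphisms of the torus onto an embedded surface \<open>M\<close>.\<close>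

definition torus_embedding :: "(real^2 \<Rightarrow> 'b::euclidean_space) \<Rightarrow> 'b set \<Rightarrow> bool"
  where "torus_embedding \<psi> M \<longleftrightarrow> smooth \<psi> \<and>
    (\<forall>p v. v \<noteq> 0 \<longrightarrow> frechet_derivative \<psi> (at p) v \<noteq> 0) \<and>
    (\<forall>p q. \<psi> p = \<psi> q \<longleftrightarrow> (\<forall>i. p $ i - q $ i \<in> \<int>)) \<and>
    range \<psi> = M"

definition pullback_metric :: "(real^2 \<Rightarrow> 'b::euclidean_space) \<Rightarrow> metric"
  where "pullback_metric \<psi> p = (\<chi> i j. partial i \<psi> p \<bullet> partial j \<psi> p)"

text \<open>The metric induced on \<open>M\<close> by the ambient Euclidean space, transported to the torus. The choice
  of the identification changes it only by a diffeomorphism of the torus, which affects neither the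
  spectrum nor the area.\<close>

definition induced_metric :: "'b::euclidean_space set \<Rightarrow> metric"
  where "induced_metric M = pullback_metric (SOME \<psi>. torus_embedding \<psi> M)"


section \<open>The surfaces \<open>M m n\<close>\<close>

text \<open>The surfaces lie in the unit sphere (\<open>phi_in_sphere\<close> below), so that the metric induced from the
  sphere is the one induced from the ambient space, whose real inner product is
  the real part of the Hermitian one.\<close>

definition phi :: "nat \<Rightarrow> nat \<Rightarrow> real \<Rightarrow> real \<Rightarrow> complex^3"
  where "phi m n x y = vector
    [of_real (sqrt (real (m + n) / real (2 * m + n))) * exp (\<i> * of_real (real m * y)) * of_real (sin x),
     of_real (sqrt (real (m + n) / real (m + 2 * n))) * exp (\<i> * of_real (real n * y)) * of_real (cos x),
     of_real (sqrt (real n * (cos x)\<^sup>2 / real (m + 2 * n) + real m * (sin x)\<^sup>2 / real (2 * m + n)))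
       * exp (- \<i> * of_real (real (m + n) * y))]"

definition M :: "nat \<Rightarrow> nat \<Rightarrow> (complex^3) set"
  where "M m n = {phi m n x y | x y. True}"


section \<open>Complete elliptic integrals\<close>

text \<open>The gauge integral covers the singularity at the right end point.\<close>

definition ellK :: "real \<Rightarrow> real"
  where "ellK k = integral {0..1} (\<lambda>x. 1 / (sqrt (1 - x\<^sup>2) * sqrt (1 - k\<^sup>2 * x\<^sup>2)))"

definition ellE :: "real \<Rightarrow> real"
  where "ellE k = integral {0..1} (\<lambda>x. sqrt (1 - k\<^sup>2 * x\<^sup>2) / sqrt (1 - x\<^sup>2))"


section \<open>The surfaces \<open>M m n\<close> are embedded tori in the unit sphere\<close>

text \<open>\<open>ex_torus_embedding\<close> shows that the choice in \<open>induced_metric (M m n)\<close> is a proper one.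
  If \<open>m * n\<close> is even, \<open>phi\<close> is injective modulo its obvious periods; otherwise it is two-to-one.\<close>

lemma partial_eq:
  assumes "\<And>p. (f has_derivative f' p) (at p)"
  shows "partial i f = (\<lambda>p. f' p (axis i 1))"
  using frechet_derivative_at[OF assms] by (simp add: partial_def fun_eq_iff)

lemma smooth_coinduct:
  assumes "P f"
    and step: "\<And>f. P f \<Longrightarrow> (\<forall>p. f differentiable (at p)) \<and> (\<forall>i. P (partial i f))"
  shows "smooth f"
proof -
  have "P (foldr partial is f)" for "is"
    by (induction "is") (use assms in auto)
  then show ?thesis using step by (auto simp: smooth_def)
qed

inductive elementary :: "(real^2 \<Rightarrow> real) \<Rightarrow> bool" where
  el_const: "elementary (\<lambda>p. c)"
| el_coord: "elementary (\<lambda>p. p $ i)"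
| el_add: "elementary f \<Longrightarrow> elementary g \<Longrightarrow> elementary (\<lambda>p. f p + g p)"
| el_mult: "elementary f \<Longrightarrow> elementary g \<Longrightarrow> elementary (\<lambda>p. f p * g p)"
| el_sin: "elementary f \<Longrightarrow> elementary (\<lambda>p. sin (f p))"
| el_cos: "elementary f \<Longrightarrow> elementary (\<lambda>p. cos (f p))"
| el_inverse: "elementary f \<Longrightarrow> (\<And>p. f p \<noteq> 0) \<Longrightarrow> elementary (\<lambda>p. inverse (f p))"
| el_sqrt: "elementary f \<Longrightarrow> (\<And>p. f p > 0) \<Longrightarrow> elementary (\<lambda>p. sqrt (f p))"

lemma elementary_partialI:
  assumes "\<And>p. (f has_derivative f' p) (at p)" "\<And>i. elementary (\<lambda>p. f' p (axis i 1))"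
  shows "(\<forall>p. f differentiable (at p)) \<and> (\<forall>i. elementary (partial i f))"
  using assms partial_eq[OF assms(1)] by (auto simp: differentiable_def)

lemma elementary_partial:
  "elementary f \<Longrightarrow> (\<forall>p. f differentiable (at p)) \<and> (\<forall>i. elementary (partial i f))"
proof (induction rule: elementary.induct)
  case (el_const c)
  show ?case by (rule elementary_partialI[where f' = "\<lambda>p v. 0"]) (auto intro: elementary.intros)
next
  case (el_coord k)
  show ?case
    by (rule elementary_partialI[where f' = "\<lambda>p v. v $ k"])
       (auto intro!: elementary.intros bounded_linear_imp_has_derivative bounded_linear_vec_nth)
next
  case (el_add f g)
  then have d: "(f has_derivative frechet_derivative f (at p)) (at p)"
      "(g has_derivative frechet_derivative g (at p)) (at p)" for p
    by (auto simp: frechet_derivative_works)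
  show ?case
    by (rule elementary_partialI[OF has_derivative_add[OF d]])
       (use el_add in \<open>auto intro!: elementary.intros simp: partial_def[abs_def]\<close>)
next
  case (el_mult f g)
  then have d: "(f has_derivative frechet_derivative f (at p)) (at p)"
      "(g has_derivative frechet_derivative g (at p)) (at p)" for p
    by (auto simp: frechet_derivative_works)
  show ?case
    by (rule elementary_partialI[OF has_derivative_mult[OF d]])
       (use el_mult in \<open>auto intro!: elementary.intros simp: partial_def[abs_def]\<close>)
next
  case (el_sin f)
  then have d: "(f has_derivative frechet_derivative f (at p)) (at p)" for p
    by (auto simp: frechet_derivative_works)
  show ?case
    by (rule elementary_partialI[OF has_derivative_sin[OF d]])
       (use el_sin in \<open>auto intro!: elementary.intros simp: partial_def[abs_def]\<close>)
next
  case (el_cos f)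
  then have d: "(f has_derivative frechet_derivative f (at p)) (at p)" for p
    by (auto simp: frechet_derivative_works)
  show ?case
  proof (rule elementary_partialI)
    show "((\<lambda>p. cos (f p)) has_derivative (\<lambda>v. (-1) * (sin (f p) * frechet_derivative f (at p) v))) (at p)" for p
      by (rule has_derivative_eq_rhs[OF has_derivative_cos[OF d]]) (simp add: fun_eq_iff)
    show "elementary (\<lambda>p. (-1) * (sin (f p) * frechet_derivative f (at p) (axis i 1)))" for i
      by (intro elementary.intros) (use el_cos in \<open>auto simp: partial_def[abs_def]\<close>)
  qed
next
  case (el_inverse f)
  then have d: "(f has_derivative frechet_derivative f (at p)) (at p)" for p
    by (auto simp: frechet_derivative_works)
  have i: "elementary (\<lambda>p. inverse (f p))" using el_inverse by (auto intro: elementary.intros)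
  show ?case
  proof (rule elementary_partialI)
    show "((\<lambda>p. inverse (f p)) has_derivative
        (\<lambda>v. (-1) * (inverse (f p) * frechet_derivative f (at p) v * inverse (f p)))) (at p)" for p
      by (rule has_derivative_eq_rhs[OF Deriv.has_derivative_inverse[OF el_inverse(2) d]]) (simp add: fun_eq_iff)
    show "elementary (\<lambda>p. (-1) * (inverse (f p) * frechet_derivative f (at p) (axis i 1) * inverse (f p)))" for i
      by (intro elementary.el_mult elementary.el_const i)
         (use el_inverse in \<open>auto simp: partial_def[abs_def]\<close>)
  qed
next
  case (el_sqrt f)
  then have d: "(f has_derivative frechet_derivative f (at p)) (at p)" for p
    by (auto simp: frechet_derivative_works)
  have s: "elementary (\<lambda>p. inverse (sqrt (f p)))"
    using el_sqrt by (intro elementary.el_inverse elementary.el_sqrt) (auto simp: less_imp_neq[symmetric])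
  show ?case
  proof (rule elementary_partialI)
    show "((\<lambda>p. sqrt (f p)) has_derivative
        (\<lambda>v. (1/2) * (inverse (sqrt (f p)) * frechet_derivative f (at p) v))) (at p)" for p
      by (rule has_derivative_eq_rhs[OF has_derivative_real_sqrt[OF el_sqrt(2) d]])
         (simp add: fun_eq_iff field_simps)
    show "elementary (\<lambda>p. (1/2) * (inverse (sqrt (f p)) * frechet_derivative f (at p) (axis i 1)))" for i
      by (intro elementary.el_mult elementary.el_const s)
         (use el_sqrt in \<open>auto simp: partial_def[abs_def]\<close>)
  qed
qed

lemma smooth_elementary:
  fixes f :: "real^2 \<Rightarrow> 'b::euclidean_space"
  assumes "\<And>b. b \<in> Basis \<Longrightarrow> elementary (\<lambda>p. f p \<bullet> b)"
  shows "smooth f"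
proof (rule smooth_coinduct[where P = "\<lambda>f. \<forall>b\<in>Basis. elementary (\<lambda>p. f p \<bullet> b)"])
  fix f :: "real^2 \<Rightarrow> 'b"
  assume *: "\<forall>b\<in>Basis. elementary (\<lambda>p. f p \<bullet> b)"
  then have diff: "f differentiable (at p)" for p
    using elementary_partial by (auto simp: differentiable_componentwise_within[of f])
  have "partial i (\<lambda>p. f p \<bullet> b) = (\<lambda>p. partial i f p \<bullet> b)" for i b
  proof -
    have "((\<lambda>p. f p \<bullet> b) has_derivative (\<lambda>v. frechet_derivative f (at p) v \<bullet> b)) (at p)" for p
      using diff[of p] by (auto intro!: derivative_eq_intros simp: frechet_derivative_works)
    from partial_eq[OF this] show ?thesis by (simp add: partial_def fun_eq_iff)
  qed
  then show "(\<forall>p. f differentiable (at p)) \<and> (\<forall>i. \<forall>b\<in>Basis. elementary (\<lambda>p. partial i f p \<bullet> b))"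
    using diff * elementary_partial by metis
qed (use assms in auto)


lemma exp_ii: "exp (\<i> * of_real t) = cis t" "exp (- \<i> * of_real t) = cis (- t)"
  by (simp_all add: cis_conv_exp)

lemma radius_pos:
  assumes "m > 0" "n > 0"
  shows "0 < real n * (cos x)\<^sup>2 / real (m + 2 * n) + real m * (sin x)\<^sup>2 / real (2 * m + n)"
proof (cases "cos x = 0")
  case True
  then have "(sin x)\<^sup>2 = 1" using sin_cos_squared_add[of x] by simp
  then show ?thesis using assms True by simp
next
  case False
  then show ?thesis using assms by (intro add_pos_nonneg divide_pos_pos mult_pos_pos) auto
qed

definition A1 :: "nat \<Rightarrow> nat \<Rightarrow> real" where "A1 m n = sqrt (real (m + n) / real (2 * m + n))"
definition A2 :: "nat \<Rightarrow> nat \<Rightarrow> real" where "A2 m n = sqrt (real (m + n) / real (m + 2 * n))"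
definition R3 :: "nat \<Rightarrow> nat \<Rightarrow> real \<Rightarrow> real" where "R3 m n x =
  sqrt (real n * (cos x)\<^sup>2 / real (m + 2 * n) + real m * (sin x)\<^sup>2 / real (2 * m + n))"

lemma amplitude_pos: "m > 0 \<Longrightarrow> n > 0 \<Longrightarrow> A1 m n > 0" "m > 0 \<Longrightarrow> n > 0 \<Longrightarrow> A2 m n > 0"
  "m > 0 \<Longrightarrow> n > 0 \<Longrightarrow> R3 m n x > 0"
  using radius_pos by (auto simp: A1_def A2_def R3_def)

lemma phi_nth:
  "phi m n x y $ 1 = of_real (A1 m n * sin x) * cis (real m * y)"
  "phi m n x y $ 2 = of_real (A2 m n * cos x) * cis (real n * y)"
  "phi m n x y $ 3 = of_real (R3 m n x) * cis (- (real (m + n) * y))"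
  unfolding phi_def vector_3 exp_ii A1_def A2_def R3_def by (simp_all add: mult_ac)

lemma phi_in_sphere:
  assumes "m > 0" "n > 0"
  shows "phi m n x y \<in> sphere 0 1"
proof -
  have "(norm (phi m n x y))\<^sup>2 = (A1 m n * sin x)\<^sup>2 + (A2 m n * cos x)\<^sup>2 + (R3 m n x)\<^sup>2"
  proof -
    have *: "(norm (of_real a * cis b))\<^sup>2 = a\<^sup>2" for a b
      unfolding norm_mult norm_of_real norm_cis by simp
    have "(norm (phi m n x y))\<^sup>2 = (\<Sum>k\<in>UNIV. (norm (phi m n x y $ k))\<^sup>2)"
      unfolding norm_vec_def L2_set_def by (rule real_sqrt_pow2) (auto intro: sum_nonneg)
    then show ?thesis unfolding sum_3 phi_nth * .
  qed
  also have "\<dots> = (sin x)\<^sup>2 + (cos x)\<^sup>2"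
  proof -
    define P Q S C where "P = real (2 * m + n)" "Q = real (m + 2 * n)" "S = (sin x)\<^sup>2" "C = (cos x)\<^sup>2"
    note defs = this
    have PQ: "P > 0" "Q > 0" using assms by (auto simp: defs)
    have "(R3 m n x)\<^sup>2 = real n * C / Q + real m * S / P"
      using radius_pos[OF assms, of x] unfolding R3_def defs by simp
    moreover have "(A1 m n * sin x)\<^sup>2 = real (m + n) / P * S" "(A2 m n * cos x)\<^sup>2 = real (m + n) / Q * C"
      by (simp_all add: A1_def A2_def defs power_mult_distrib)
    moreover have "real (m + n) / P * S + real (m + n) / Q * C + (real n * C / Q + real m * S / P)
        = ((real (m + n) + real m) / P) * S + ((real (m + n) + real n) / Q) * C"
      by (simp add: add_divide_distrib algebra_simps)
    moreover have "real (m + n) + real m = P" "real (m + n) + real n = Q" by (simp_all add: defs)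
    ultimately have "(A1 m n * sin x)\<^sup>2 + (A2 m n * cos x)\<^sup>2 + (R3 m n x)\<^sup>2 = P / P * S + Q / Q * C"
      by presburger
    also have "\<dots> = S + C" using PQ by simp
    finally show ?thesis unfolding defs .
  qed
  also have "\<dots> = 1" by simp
  finally show ?thesis by (simp add: power2_eq_1_iff) (use norm_ge_zero[of "phi m n x y"] in linarith)
qed

lemma elementary_minus: "elementary f \<Longrightarrow> elementary (\<lambda>p. - f p)"
  using el_mult[OF el_const[of "-1"]] by fastforce

lemma smooth_phi:
  assumes "m > 0" "n > 0" "elementary x" "elementary y"
  shows "smooth (\<lambda>p. phi m n (x p) (y p))"
proof (rule smooth_elementary)
  have R: "elementary (\<lambda>p. R3 m n (x p))"
  proof -
    have "elementary (\<lambda>p. (real n / real (m + 2 * n)) * (cos (x p) * cos (x p))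
        + (real m / real (2 * m + n)) * (sin (x p) * sin (x p)))"
      by (intro elementary.intros assms)
    also have "(\<lambda>p. (real n / real (m + 2 * n)) * (cos (x p) * cos (x p))
        + (real m / real (2 * m + n)) * (sin (x p) * sin (x p))) =
       (\<lambda>p. real n * (cos (x p))\<^sup>2 / real (m + 2 * n) + real m * (sin (x p))\<^sup>2 / real (2 * m + n))"
      by (simp add: power2_eq_square)
    finally show ?thesis using radius_pos[OF assms(1,2)] by (simp add: R3_def el_sqrt)
  qed
  have E: "elementary (\<lambda>p. Re (phi m n (x p) (y p) $ k))"
    "elementary (\<lambda>p. Im (phi m n (x p) (y p) $ k))" for k :: 3
  proof -
    have c: "elementary (\<lambda>p. cos (c * y p))" "elementary (\<lambda>p. sin (c * y p))" for c
      by (intro el_cos el_sin el_mult el_const assms)+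
    have sc: "elementary (\<lambda>p. A1 m n * sin (x p))" "elementary (\<lambda>p. A2 m n * cos (x p))"
      by (intro el_cos el_sin el_mult el_const assms)+
    have "elementary (\<lambda>p. A1 m n * sin (x p) * cos (real m * y p))"
      "elementary (\<lambda>p. A1 m n * sin (x p) * sin (real m * y p))"
      "elementary (\<lambda>p. A2 m n * cos (x p) * cos (real n * y p))"
      "elementary (\<lambda>p. A2 m n * cos (x p) * sin (real n * y p))"
      "elementary (\<lambda>p. R3 m n (x p) * cos (real (m + n) * y p))"
      "elementary (\<lambda>p. - (R3 m n (x p) * sin (real (m + n) * y p)))"
      by (intro elementary_minus el_mult[OF sc(1)] el_mult[OF sc(2)] el_mult[OF R] c)+
    then show "elementary (\<lambda>p. Re (phi m n (x p) (y p) $ k))"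
      "elementary (\<lambda>p. Im (phi m n (x p) (y p) $ k))"
      using exhaust_3[of k] by (auto simp: phi_nth)
  qed
  fix b :: "complex^3" assume "b \<in> Basis"
  then obtain k c where b: "b = axis k c" "c = 1 \<or> c = \<i>"
    by (auto simp: Basis_vec_def Basis_complex_def)
  show "elementary (\<lambda>p. phi m n (x p) (y p) \<bullet> b)"
    using b E[of k] by (auto simp: inner_axis inner_complex_def)
qed

lemma immersion_phi:
  assumes mn: "m > 0" "n > 0"
    and D: "((\<lambda>t. phi m n (x + t * a) (y + t * b)) has_vector_derivative 0) (at 0)"
  shows "a = 0 \<and> b = 0"
proof -
  have *: "((\<lambda>t. Re (phi m n (x + t * a) (y + t * b) $ k)) has_real_derivative 0) (at 0)"
    "((\<lambda>t. Im (phi m n (x + t * a) (y + t * b) $ k)) has_real_derivative 0) (at 0)" for k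
  proof -
    have "bounded_linear (\<lambda>v::complex^3. Re (v $ k))" "bounded_linear (\<lambda>v::complex^3. Im (v $ k))"
      by (auto intro: bounded_linear_compose[OF bounded_linear_Re] bounded_linear_compose[OF bounded_linear_Im]
        bounded_linear_vec_nth)
    from this[THEN bounded_linear.has_vector_derivative, OF D]
    show "((\<lambda>t. Re (phi m n (x + t * a) (y + t * b) $ k)) has_real_derivative 0) (at 0)"
    "((\<lambda>t. Im (phi m n (x + t * a) (y + t * b) $ k)) has_real_derivative 0) (at 0)"
      by (simp_all add: has_real_derivative_iff_has_vector_derivative)
  qed
  have DR: "\<exists>r'. ((\<lambda>t. R3 m n (x + t * a)) has_real_derivative r') (at 0)"
  proof -
    have "\<exists>D. ((\<lambda>t. real n * (cos (x + t * a))\<^sup>2 / real (m + 2 * n)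
        + real m * (sin (x + t * a))\<^sup>2 / real (2 * m + n)) has_real_derivative D) (at 0)"
      using mn by (intro exI) (rule derivative_eq_intros refl | simp)+
    then obtain D where D: "((\<lambda>t. real n * (cos (x + t * a))\<^sup>2 / real (m + 2 * n)
        + real m * (sin (x + t * a))\<^sup>2 / real (2 * m + n)) has_real_derivative D) (at 0)" by blast
    show ?thesis
      unfolding R3_def by (rule exI, rule DERIV_chain2[OF DERIV_real_sqrt D]) (rule radius_pos[OF mn])
  qed
  then obtain r' where r': "((\<lambda>t. R3 m n (x + t * a)) has_real_derivative r') (at 0)" by blast
  define N where "N = real (m + n)"
  have N: "N > 0" using mn by (simp add: N_def)
  define c s r where "c = cos (N * y)" and "s = sin (N * y)" and "r = R3 m n x"
  have cs: "c^2 + s^2 = 1" by (simp add: c_def s_def)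
  have "((\<lambda>t. R3 m n (x + t * a) * cos (- (N * (y + t * b)))) has_real_derivative r' * c - r * s * N * b) (at 0)"
    by (auto intro!: derivative_eq_intros r' simp: c_def s_def r_def)
  moreover have "((\<lambda>t. R3 m n (x + t * a) * cos (- (N * (y + t * b)))) has_real_derivative 0) (at 0)"
    using *(1)[of 3] by (simp add: phi_nth N_def)
  ultimately have 1: "r' * c - r * s * N * b = 0" using DERIV_unique by blast
  have "((\<lambda>t. R3 m n (x + t * a) * sin (- (N * (y + t * b)))) has_real_derivative - r' * s - r * c * N * b) (at 0)"
    by (auto intro!: derivative_eq_intros r' simp: c_def s_def r_def)
  moreover have "((\<lambda>t. R3 m n (x + t * a) * sin (- (N * (y + t * b)))) has_real_derivative 0) (at 0)"
    using *(2)[of 3] by (simp add: phi_nth N_def)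
  ultimately have 2: "- r' * s - r * c * N * b = 0" using DERIV_unique by blast
  have "r * N * b * (c^2 + s^2) = - s * (r' * c - r * s * N * b) - c * (- r' * s - r * c * N * b)"
    by (simp add: algebra_simps power2_eq_square)
  then have "r * N * b = 0" using 1 2 cs by simp
  then have b: "b = 0" using N amplitude_pos(3)[OF mn, of x] by (simp add: r_def)
  have "(\<lambda>t. Re (phi m n (x + t * a) (y + t * b) $ 1)) = (\<lambda>t. A1 m n * sin (x + t * a) * cos (real m * y))"
    "(\<lambda>t. Im (phi m n (x + t * a) (y + t * b) $ 1)) = (\<lambda>t. A1 m n * sin (x + t * a) * sin (real m * y))"
    "(\<lambda>t. Re (phi m n (x + t * a) (y + t * b) $ 2)) = (\<lambda>t. A2 m n * cos (x + t * a) * cos (real n * y))"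
    "(\<lambda>t. Im (phi m n (x + t * a) (y + t * b) $ 2)) = (\<lambda>t. A2 m n * cos (x + t * a) * sin (real n * y))"
    using b by (auto simp: phi_nth)
  note ** = *(1)[of 1, unfolded this] *(2)[of 1, unfolded this] *(1)[of 2, unfolded this] *(2)[of 2, unfolded this]
  have "A1 m n * (cos x * a) * cos (real m * y) = 0"
    by (rule DERIV_unique[OF _ **(1)]) (auto intro!: derivative_eq_intros)
  moreover have "A1 m n * (cos x * a) * sin (real m * y) = 0"
    by (rule DERIV_unique[OF _ **(2)]) (auto intro!: derivative_eq_intros)
  moreover have "A2 m n * (- sin x * a) * cos (real n * y) = 0"
    by (rule DERIV_unique[OF _ **(3)]) (auto intro!: derivative_eq_intros)
  moreover have "A2 m n * (- sin x * a) * sin (real n * y) = 0"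
    by (rule DERIV_unique[OF _ **(4)]) (auto intro!: derivative_eq_intros)
  moreover have nz: "u = 0" if "u * cos v = 0" "u * sin v = 0" for u v :: real
  proof -
    have "u\<^sup>2 * ((sin v)\<^sup>2 + (cos v)\<^sup>2) = (u * sin v)\<^sup>2 + (u * cos v)\<^sup>2"
      by (simp add: power_mult_distrib distrib_left del: sin_cos_squared_add sin_cos_squared_add2)
    then show ?thesis using that by simp
  qed
  ultimately have "A1 m n * (cos x * a) = 0" "A2 m n * (- sin x * a) = 0" by blast+
  then have "a * cos x = 0" "a * sin x = 0" using amplitude_pos(1,2)[OF mn] by auto
  then have "a = 0" by (rule nz)
  with b show ?thesis by simp
qed

lemma cos_int_pi_cases: "cos (pi * of_int k) = (if even k then 1 else -1)"
proof (cases "even k")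
  case True
  then obtain j where "k = 2 * j" by auto
  then show ?thesis using cos_int_2pin[of j] by (simp add: mult_ac)
next
  case False
  then obtain j where "k = 2 * j + 1" by (auto elim: oddE)
  then show ?thesis using cos_int_2pin[of j] by (simp add: algebra_simps)
qed

lemma sin_int_pi: "sin (pi * of_int k) = 0" by (metis mult.commute sin_zero_iff_int2)

lemma cis_int_pi: "cis (pi * of_int k) = (if even k then 1 else -1)"
  by (simp add: complex_eq_iff cos_int_pi_cases sin_int_pi)

lemma phi_fibre:
  assumes mn: "m > 0" "n > 0" "gcd m n = 1"
  shows "phi m n x y = phi m n x' y' \<longleftrightarrow> (\<exists>k l :: int. x - x' = pi * of_int k \<and> y - y' = pi * of_int l \<and>
    even (k + int m * l) \<and> even (k + int n * l))" (is "?L \<longleftrightarrow> ?R")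
proof
  assume ?R
  then obtain k l :: int where *: "x = x' + pi * of_int k" "y = y' + pi * of_int l"
    "even (k + int m * l)" "even (k + int n * l)" by (auto simp: algebra_simps)
  have c: "cis (of_int j * y) = cis (of_int j * y') * cis (pi * of_int (j * l))" for j
    by (simp add: * cis_mult algebra_simps)
  have "even ((int m + int n) * l)" using *(3,4) by (auto simp: algebra_simps)
  then have c3: "cis (- (real (m + n) * y)) = cis (- (real (m + n) * y'))"
  proof -
    assume "even ((int m + int n) * l)"
    then have "cis (pi * of_int (- int (m + n) * l)) = 1" unfolding cis_int_pi by auto
    moreover have "of_int (- int (m + n)) * z = - (real (m + n) * z)" for z :: real by (simp add: algebra_simps)
    ultimately show ?thesis using c[of "- int (m + n)"] by simp
  qed
  have c1: "cis (real m * y) = cis (real m * y') * cis (pi * of_int k)"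
  proof -
    have "cis (pi * of_int (int m * l)) = cis (pi * of_int k)" unfolding cis_int_pi using *(3) by simp
    then show ?thesis using c[of "int m"] by simp
  qed
  have c2: "cis (real n * y) = cis (real n * y') * cis (pi * of_int k)"
  proof -
    have "cis (pi * of_int (int n * l)) = cis (pi * of_int k)" unfolding cis_int_pi using *(4) by simp
    then show ?thesis using c[of "int n"] by simp
  qed
  have sc: "sin x = sin x' * (if even k then 1 else -1)" "cos x = cos x' * (if even k then 1 else -1)"
    by (simp_all add: * sin_add cos_add cos_int_pi_cases sin_int_pi)
  then have r: "R3 m n x = R3 m n x'" by (simp add: R3_def)
  show ?L
    unfolding vec_eq_iff forall_3 phi_nth r c1 c2 c3 using sc by (auto simp: cis_int_pi)
next
  assume ?L
  then have *: "of_real (A1 m n * sin x) * cis (real m * y) = of_real (A1 m n * sin x') * cis (real m * y')"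
    "of_real (A2 m n * cos x) * cis (real n * y) = of_real (A2 m n * cos x') * cis (real n * y')"
    "of_real (R3 m n x) * cis (- (real (m + n) * y)) = of_real (R3 m n x') * cis (- (real (m + n) * y'))"
    unfolding vec_eq_iff forall_3 phi_nth by auto
  define d where "d = y - y'"
  have "norm (of_real (A2 m n * cos x) * cis (real n * y)) = norm (of_real (A2 m n * cos x') * cis (real n * y'))"
    by (rule arg_cong[OF *(2)])
  then have "\<bar>cos x\<bar> = \<bar>cos x'\<bar>"
    using amplitude_pos[OF mn(1,2)] by (simp add: norm_mult abs_mult)
  then have cc: "(cos x)\<^sup>2 = (cos x')\<^sup>2" by (metis power2_abs)
  then have ss: "(sin x)\<^sup>2 = (sin x')\<^sup>2" by (simp add: sin_squared_eq)
  have R: "R3 m n x = R3 m n x'" by (simp add: R3_def cc ss)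
  have y: "cis (j * y) = cis (j * d) * cis (j * y')" for j
    by (simp add: d_def cis_mult algebra_simps)
  have y3: "cis (- (j * y)) = cis (- (j * d)) * cis (- (j * y'))" for j
    by (simp add: d_def cis_mult algebra_simps)
  have e1: "of_real (sin x) * cis (real m * d) = of_real (sin x')"
    using *(1) amplitude_pos(1)[OF mn(1,2)] unfolding y[of "real m"] by (simp add: mult.assoc[symmetric] cis_neq_zero)
  have e2: "of_real (cos x) * cis (real n * d) = of_real (cos x')"
    using *(2) amplitude_pos(2)[OF mn(1,2)] unfolding y[of "real n"] by (simp add: mult.assoc[symmetric] cis_neq_zero)
  have e3: "cis (- (real (m + n) * d)) = 1"
    using *(3) R amplitude_pos(3)[OF mn(1,2), of x'] unfolding y3[of "real (m + n)"] by (simp add: cis_neq_zero)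
  then have "cis (real (m + n) * d) = 1"
    by (simp only: complex_eq_iff cis.sel sin_minus cos_minus) simp
  then have e4: "cis (real m * d) * cis (real n * d) = 1"
    by (simp add: cis_mult distrib_right)
  have "of_real (sin x * cos x) * (cis (real m * d) * cis (real n * d)) = of_real (sin x' * cos x')"
    using arg_cong2[OF e1 e2, of "(*)"] by (simp add: mult_ac)
  then have "sin x * cos x = sin x' * cos x'" unfolding e4 mult_1_right of_real_eq_iff .
  then have "sin (2 * x) = sin (2 * x')" by (simp add: sin_double)
  moreover have "cos (2 * x) = cos (2 * x')" using cc ss by (simp add: cos_double)
  ultimately obtain k :: int where "2 * x = 2 * x' + 2 * pi * of_int k"
    using sin_cos_eq_iff[of "2 * x'" "2 * x"] sin_cos_eq_iff[of "2 * x" "2 * x'"] by metis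
  then have k: "x = x' + pi * of_int k" by simp
  define \<epsilon> :: real where "\<epsilon> = (if even k then 1 else -1)"
  have eps: "\<epsilon> * \<epsilon> = 1" by (simp add: \<epsilon>_def)
  have inv: "z = of_real \<epsilon>" if "of_real \<epsilon> * z = 1" for z :: complex
  proof -
    have "z = of_real (\<epsilon> * \<epsilon>) * z" by (simp add: eps)
    also have "\<dots> = of_real \<epsilon> * (of_real \<epsilon> * z)" by simp
    finally show ?thesis by (simp add: that)
  qed
  have s: "sin x = \<epsilon> * sin x'" "cos x = \<epsilon> * cos x'"
    by (simp_all add: k sin_add cos_add cos_int_pi_cases sin_int_pi \<epsilon>_def)
  have "cis (real m * d) = of_real \<epsilon> \<and> cis (real n * d) = of_real \<epsilon>"
  proof (cases "sin x' = 0")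
    case False
    have "of_real (sin x') * (of_real \<epsilon> * cis (real m * d)) = of_real (sin x') * 1"
      using e1 by (simp add: s(1) mult_ac)
    then have "of_real \<epsilon> * cis (real m * d) = 1" using False by (simp only: mult_cancel_left) simp
    then have m: "cis (real m * d) = of_real \<epsilon>" by (rule inv)
    with e4 inv show ?thesis by simp
  next
    case True
    then have c: "cos x' \<noteq> 0" using sin_cos_squared_add[of x'] by auto
    have "of_real (cos x') * (of_real \<epsilon> * cis (real n * d)) = of_real (cos x') * 1"
      using e2 by (simp add: s(2) mult_ac)
    then have "of_real \<epsilon> * cis (real n * d) = 1" using c by (simp only: mult_cancel_left) simp
    then have m: "cis (real n * d) = of_real \<epsilon>" by (rule inv)
    with e4 inv show ?thesis by (simp add: mult.commute)
  qed
  moreover have "of_real \<epsilon> = cis (pi * of_int k)" by (simp add: cis_int_pi \<epsilon>_def)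
  ultimately have "cis (real m * d) = cis (pi * of_int k)" "cis (real n * d) = cis (pi * of_int k)" by auto
  moreover have cis_eqD: "\<exists>j::int. a = b + 2 * pi * of_int j" if "cis a = cis b" for a b
    using that sin_cos_eq_iff[of a b] by (auto simp: complex_eq_iff)
  ultimately obtain i j :: int where ij: "real m * d = pi * of_int k + 2 * pi * of_int i"
    "real n * d = pi * of_int k + 2 * pi * of_int j" by meson
  obtain u v :: int where uv: "u * int m + v * int n = 1"
    using bezout_int[of "int m" "int n"] mn(3) by auto
  define l where "l = u * (k + 2 * i) + v * (k + 2 * j)"
  have "d = of_int (u * int m + v * int n) * d" by (simp add: uv)
  also have "\<dots> = of_int u * (real m * d) + of_int v * (real n * d)" by (simp add: algebra_simps)
  also have "\<dots> = pi * of_int l" unfolding ij l_def by (simp add: algebra_simps)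
  finally have d: "d = pi * of_int l" .
  have "pi * of_int (int m * l) = pi * of_int (k + 2 * i)" "pi * of_int (int n * l) = pi * of_int (k + 2 * j)"
    using ij unfolding d by (simp_all add: algebra_simps)
  then have "int m * l = k + 2 * i" "int n * l = k + 2 * j" by (simp_all only: mult_cancel_left of_int_eq_iff pi_neq_zero simp_thms)
  then have "even (k + int m * l)" "even (k + int n * l)" by (simp_all del: even_mult_iff)
  moreover have "x - x' = pi * of_int k" "y - y' = pi * of_int l" using k d by (simp_all add: d_def)
  ultimately show ?R by blast
qed

lemma has_derivative_imp_vector_derivative_line:
  fixes f :: "real^2 \<Rightarrow> 'b::real_normed_vector"
  assumes "(f has_derivative D) (at p)"
  shows "((\<lambda>t. f (p + t *\<^sub>R v)) has_vector_derivative D v) (at 0)"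
proof -
  have l: "((\<lambda>t. p + t *\<^sub>R v) has_vector_derivative v) (at 0)"
    by (auto intro!: derivative_eq_intros)
  have "(f has_derivative D) (at (p + 0 *\<^sub>R v) within range (\<lambda>t. p + t *\<^sub>R v))"
    using assms by (simp add: has_derivative_at_withinI)
  from vector_derivative_diff_chain_within[OF l this] show ?thesis by (simp add: o_def)
qed

lemma torus_embedding_phi:
  assumes mn: "m > 0" "n > 0"
    and \<psi>: "\<And>p. \<psi> p = phi m n (a * p $ 1 + b * p $ 2) (c * p $ 1 + d * p $ 2)"
    and det: "a * d - b * c \<noteq> 0"
    and fibre: "\<And>p q. \<psi> p = \<psi> q \<longleftrightarrow> (\<forall>i. p $ i - q $ i \<in> \<int>)"
  shows "torus_embedding \<psi> (M m n)"
proof -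
  have eq: "\<psi> = (\<lambda>p. phi m n (a * p $ 1 + b * p $ 2) (c * p $ 1 + d * p $ 2))"
    using \<psi> by blast
  have sm: "smooth \<psi>"
    unfolding eq by (intro smooth_phi mn el_add el_mult el_const el_coord)
  have inj: "u = 0 \<and> v = 0" if "a * u + b * v = 0" "c * u + d * v = 0" for u v
  proof -
    have "(a * d - b * c) * u = d * (a * u + b * v) - b * (c * u + d * v)"
      "(a * d - b * c) * v = a * (c * u + d * v) - c * (a * u + b * v)"
      by (simp_all add: algebra_simps)
    then have "(a * d - b * c) * u = 0" "(a * d - b * c) * v = 0" unfolding that by simp_all
    then show ?thesis using det by simp
  qed
  have imm: "frechet_derivative \<psi> (at p) v \<noteq> 0" if "v \<noteq> 0" for p v
  proof
    assume 0: "frechet_derivative \<psi> (at p) v = 0"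
    have "foldr partial [] \<psi> differentiable (at p)" using sm unfolding smooth_def by blast
    then have "(\<psi> has_derivative frechet_derivative \<psi> (at p)) (at p)"
      by (simp add: frechet_derivative_works)
    from has_derivative_imp_vector_derivative_line[OF this, of v]
    have "((\<lambda>t. phi m n ((a * p $ 1 + b * p $ 2) + t * (a * v $ 1 + b * v $ 2))
        ((c * p $ 1 + d * p $ 2) + t * (c * v $ 1 + d * v $ 2))) has_vector_derivative 0) (at 0)"
      unfolding 0 unfolding eq by (simp add: algebra_simps)
    from immersion_phi[OF mn this] inj have "v $ 1 = 0 \<and> v $ 2 = 0" by blast
    with that show False by (simp add: vec_eq_iff forall_2)
  qed
  have "phi m n x y \<in> range \<psi>" for x y
  proof -
    define p :: "real^2" where "p = vector [(d * x - b * y) / (a * d - b * c), (a * y - c * x) / (a * d - b * c)]"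
    have "a * p $ 1 + b * p $ 2 = (a * (d * x - b * y) + b * (a * y - c * x)) / (a * d - b * c)"
      "c * p $ 1 + d * p $ 2 = (c * (d * x - b * y) + d * (a * y - c * x)) / (a * d - b * c)"
      by (simp_all add: p_def add_divide_distrib)
    moreover have "a * (d * x - b * y) + b * (a * y - c * x) = x * (a * d - b * c)"
      "c * (d * x - b * y) + d * (a * y - c * x) = y * (a * d - b * c)"
      by (simp_all add: algebra_simps)
    ultimately have "a * p $ 1 + b * p $ 2 = x" "c * p $ 1 + d * p $ 2 = y" using det by simp_all
    then have "\<psi> p = phi m n x y" unfolding \<psi> by simp
    then show ?thesis by (metis rangeI)
  qed
  then have "range \<psi> = M m n" by (auto simp: M_def \<psi>)
  then show ?thesis using sm imm fibre by (simp add: torus_embedding_def)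
qed

lemma ex_torus_embedding:
  assumes "m > 0" "n > 0" "gcd m n = 1"
  shows "\<exists>\<psi>. torus_embedding \<psi> (M m n)"
proof (cases "odd m \<and> odd n")
  case True
  define \<psi> where "\<psi> p = phi m n (pi * p $ 1 + pi * p $ 2) (pi * p $ 1 + (- pi) * p $ 2)" for p :: "real^2"
  have "torus_embedding \<psi> (M m n)"
  proof (rule torus_embedding_phi[OF assms(1,2) \<psi>_def])
    show "pi * - pi - pi * pi \<noteq> 0" by simp
    fix p q :: "real^2"
    have "\<psi> p = \<psi> q \<longleftrightarrow> (\<exists>k l :: int. (p $ 1 - q $ 1) + (p $ 2 - q $ 2) = of_int k
        \<and> (p $ 1 - q $ 1) - (p $ 2 - q $ 2) = of_int l \<and> even (k + l))"
    proof -
      have "pi * p $ 1 + pi * p $ 2 - (pi * q $ 1 + pi * q $ 2) = pi * ((p $ 1 - q $ 1) + (p $ 2 - q $ 2))"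
        "pi * p $ 1 + (- pi) * p $ 2 - (pi * q $ 1 + (- pi) * q $ 2) = pi * ((p $ 1 - q $ 1) - (p $ 2 - q $ 2))"
        by (simp_all add: algebra_simps)
      then show ?thesis
        unfolding \<psi>_def phi_fibre[OF assms] using True by simp
    qed
    also have "\<dots> \<longleftrightarrow> p $ 1 - q $ 1 \<in> \<int> \<and> p $ 2 - q $ 2 \<in> \<int>" (is "?L \<longleftrightarrow> ?R")
    proof
      assume ?L
      then obtain k l :: int where kl: "(p $ 1 - q $ 1) + (p $ 2 - q $ 2) = of_int k"
        "(p $ 1 - q $ 1) - (p $ 2 - q $ 2) = of_int l" "even (k + l)" by blast
      from kl(3) obtain j where j: "k + l = 2 * j" by blast
      then have "real_of_int k + of_int l = 2 * of_int j" by linarith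
      then have "p $ 1 - q $ 1 = of_int j" "p $ 2 - q $ 2 = of_int (k - j)"
        using kl(1,2) by simp_all
      then show ?R by (metis Ints_of_int)
    next
      assume ?R
      then obtain u v :: int where "p $ 1 - q $ 1 = of_int u" "p $ 2 - q $ 2 = of_int v"
        by (auto elim!: Ints_cases)
      then show ?L by (intro exI[of _ "u + v"] exI[of _ "u - v"]) simp
    qed
    finally show "\<psi> p = \<psi> q \<longleftrightarrow> (\<forall>i. p $ i - q $ i \<in> \<int>)" by (simp add: forall_2)
  qed
  then show ?thesis by blast
next
  case False
  define \<psi> where "\<psi> p = phi m n (2 * pi * p $ 1 + 0 * p $ 2) (0 * p $ 1 + 2 * pi * p $ 2)" for p :: "real^2"
  have "odd m \<or> odd n" using assms(3) by (metis gcd_greatest_iff odd_one)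
  with False have par: "even (k + int m * l) \<and> even (k + int n * l) \<longleftrightarrow> even k \<and> even l" for k l
    by auto
  have "torus_embedding \<psi> (M m n)"
  proof (rule torus_embedding_phi[OF assms(1,2) \<psi>_def])
    show "2 * pi * (2 * pi) - 0 * 0 \<noteq> 0" by simp
    fix p q :: "real^2"
    have "\<psi> p = \<psi> q \<longleftrightarrow> (\<exists>k l :: int. 2 * (p $ 1 - q $ 1) = of_int k
        \<and> 2 * (p $ 2 - q $ 2) = of_int l \<and> even k \<and> even l)"
    proof -
      have "2 * pi * p $ 1 + 0 * p $ 2 - (2 * pi * q $ 1 + 0 * q $ 2) = pi * (2 * (p $ 1 - q $ 1))"
        "0 * p $ 1 + 2 * pi * p $ 2 - (0 * q $ 1 + 2 * pi * q $ 2) = pi * (2 * (p $ 2 - q $ 2))"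
        by (simp_all add: algebra_simps)
      then show ?thesis
        unfolding \<psi>_def phi_fibre[OF assms] par by simp
    qed
    also have "\<dots> \<longleftrightarrow> p $ 1 - q $ 1 \<in> \<int> \<and> p $ 2 - q $ 2 \<in> \<int>" (is "?L \<longleftrightarrow> ?R")
    proof
      assume ?L
      then obtain u v :: int where "2 * (p $ 1 - q $ 1) = of_int (2 * u)" "2 * (p $ 2 - q $ 2) = of_int (2 * v)"
        by (auto elim!: evenE)
      then have "p $ 1 - q $ 1 = of_int u" "p $ 2 - q $ 2 = of_int v" by simp_all
      then show ?R by (metis Ints_of_int)
    next
      assume ?R
      then obtain u v :: int where "p $ 1 - q $ 1 = of_int u" "p $ 2 - q $ 2 = of_int v"
        by (auto elim!: Ints_cases)
      then show ?L by (intro exI[of _ "2 * u"] exI[of _ "2 * v"]) simp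
    qed
    finally show "\<psi> p = \<psi> q \<longleftrightarrow> (\<forall>i. p $ i - q $ i \<in> \<int>)" by (simp add: forall_2)
  qed
  then show ?thesis by blast
qed

end

theory Submission
  imports Defs
begin

text \<open>In the coordinates \<open>(x, y)\<close> the induced metric is \<open>\<rho> (dx\<^sup>2 / q + dy\<^sup>2)\<close> with
  \<open>q = 2 m n + n\<^sup>2 cos\<^sup>2 x + m\<^sup>2 sin\<^sup>2 x\<close> and \<open>\<rho> = q - m n\<close>. Separation of variables reduces the spectrum to
  a family of Sturm-Liouville problems on \<open>[0, pi/2]\<close>, one for each frequency \<open>l\<close> in \<open>y\<close> and each choice of
  Neumann or Dirichlet conditions at the end points. Their eigenvalues are counted by Pruefer
  angles, which decrease in \<open>l\<close> and increase in the eigenvalue. As \<open>M m n\<close> is minimal in the sphere, the eigenvalue 2 has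
  the coordinate functions as eigenfunctions; they show that exactly one eigenvalue is below 2 when
  \<open>l < m + n\<close> (Neumann-Neumann), \<open>l < n\<close> (Neumann-Dirichlet), \<open>l < m\<close> (Dirichlet-Neumann), and none in the
  Dirichlet-Dirichlet case. Second eigenvalues below 2 are excluded by an explicit solution for \<open>l = 0\<close>. Hence
  the eigenvalue of the given index is 2, and the area is a complete elliptic integral.

  A flat torus with periods \<open>2 pi N\<close> and \<open>2 pi\<close> has \<open>Lambda (2 * N - 1) = 4 * pi\<^sup>2 * N\<close>, which for the
  relevant \<open>N\<close> exceeds the value of \<open>M m n\<close>, unless \<open>m = n = 1\<close>.\<close>

section \<open>Smooth functions on the plane\<close>

text \<open>\<open>induced_metric\<close> picks its embedding by choice, so nothing can be computed
  in fixed coordinates: an arbitrary embedding is lifted through \<open>phi\<close> to a map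
  \<open>(X, Y)\<close> of the plane, and spectrum and area turn out to depend only on
  \<open>w\<close>, \<open>\<rho>\<close> and the lattice of periods. That lattice contains
  \<open>(pi, pi)\<close> exactly when \<open>m\<close> and \<open>n\<close> are both odd; this
  halves the area and discards the modes that change sign under the shift, whence the two cases.
  Counted with cosine and sine, the three families below 2 have \<open>2 (m + n) - 1\<close>,
  \<open>2 n - 1\<close> and \<open>2 m - 1\<close> members; on the smaller torus there remain
  \<open>m + n - 1\<close>, \<open>n - 1\<close> and \<open>m - 1\<close>. Indices start at 0 with
  the eigenvalue 0, so the number of eigenvalues below 2 is the index sought. Exact multiplicities
  require completeness: an eigenfunction is a finite sum of separated ones, since its Fourier
  coefficients in \<open>y\<close> solve the ordinary equation and only finitely many frequencies
  admit a given eigenvalue. Both indices are odd, hence of the form \<open>2 N - 1\<close>, and both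
  comparisons with flat tori follow from one bound, \<open>pi / 2 * (m + n - 1)\<close>, for the
  integral of \<open>w * \<rho>\<close> over \<open>[0, pi/2]\<close>.\<close>

abbreviation pt :: "real \<Rightarrow> real \<Rightarrow> real^2" where "pt x y \<equiv> vector [x, y]"

lemma pt_eta: "pt (p $ 1) (p $ 2) = p"
  by (simp add: vec_eq_iff forall_2)

lemma pt_axis: "pt x y = x *\<^sub>R axis 1 1 + y *\<^sub>R axis 2 1"
  by (simp add: vec_eq_iff forall_2 axis_def)

lemma pt_minus: "pt a b - pt c d = pt (a - c) (b - d)"
  by (simp add: vec_eq_iff forall_2)

lemma has_derivative_pt [derivative_intros]:
  assumes "(X has_derivative X') F" "(Y has_derivative Y') F"
  shows "((\<lambda>p. pt (X p) (Y p)) has_derivative (\<lambda>v. pt (X' v) (Y' v))) F"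
  unfolding pt_axis by (intro derivative_intros assms)

lemma continuous_on_pt [continuous_intros]:
  "continuous_on S X \<Longrightarrow> continuous_on S Y \<Longrightarrow> continuous_on S (\<lambda>p. pt (X p) (Y p))"
  unfolding pt_axis by (intro continuous_intros)

lemma smooth_iff:
  "smooth f \<longleftrightarrow> (\<forall>p. f differentiable (at p)) \<and> (\<forall>i. smooth (partial i f))"
proof
  assume f: "smooth f"
  \<comment> \<open>\<open>foldr\<close> applies the last entry first, so the innermost derivative
    is appended at the end of the list.\<close>
  have "foldr partial (is @ [i]) f differentiable (at p)" for "is" i p
    using f unfolding smooth_def by blast
  moreover have "foldr partial [] f differentiable (at p)" for p
    using f unfolding smooth_def by blast
  ultimately show "(\<forall>p. f differentiable (at p)) \<and> (\<forall>i. smooth (partial i f))"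
    by (simp add: smooth_def)
next
  assume *: "(\<forall>p. f differentiable (at p)) \<and> (\<forall>i. smooth (partial i f))"
  show "smooth f" unfolding smooth_def
  proof (intro allI)
    fix "is" p
    show "foldr partial is f differentiable (at p)"
      using * by (cases "is" rule: rev_cases) (auto simp: smooth_def)
  qed
qed

lemma smooth_differentiable: "smooth f \<Longrightarrow> f differentiable (at p)"
  and smooth_partial: "smooth f \<Longrightarrow> smooth (partial i f)"
  using smooth_iff by blast+

lemma smooth_has_derivative: "smooth f \<Longrightarrow> (f has_derivative frechet_derivative f (at p)) (at p)"
  using smooth_differentiable frechet_derivative_works by blast

lemma frechet_derivative_partial:
  fixes f :: "real^2 \<Rightarrow> 'b::real_normed_vector"
  assumes "f differentiable (at p)"
  shows "frechet_derivative f (at p) v = (v $ 1) *\<^sub>R partial 1 f p + (v $ 2) *\<^sub>R partial 2 f p"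
proof -
  have l: "linear (frechet_derivative f (at p))"
    using assms linear_frechet_derivative by blast
  have "frechet_derivative f (at p) v = frechet_derivative f (at p) ((v $ 1) *\<^sub>R axis 1 1 + (v $ 2) *\<^sub>R axis 2 1)"
    using pt_axis[of "v $ 1" "v $ 2"] pt_eta[of v] by simp
  also have "\<dots> = (v $ 1) *\<^sub>R partial 1 f p + (v $ 2) *\<^sub>R partial 2 f p"
    unfolding partial_def linear_add[OF l] linear_scale[OF l] ..
  finally show ?thesis .
qed

lemma has_derivative_partial:
  fixes f :: "real^2 \<Rightarrow> 'b::real_normed_vector"
  assumes "f differentiable (at p)"
  shows "(f has_derivative (\<lambda>v. (v $ 1) *\<^sub>R partial 1 f p + (v $ 2) *\<^sub>R partial 2 f p)) (at p)"
  using assms frechet_derivative_partial[OF assms] frechet_derivative_works[of f "at p"]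
  by (metis (no_types, lifting) ext)

lemma has_derivative_compose_pt:
  fixes f :: "real^2 \<Rightarrow> 'b::real_normed_vector"
  assumes "f differentiable (at (pt (X p) (Y p)))"
    and "(X has_derivative X') (at p)" "(Y has_derivative Y') (at p)"
  shows "((\<lambda>p. f (pt (X p) (Y p))) has_derivative
     (\<lambda>v. X' v *\<^sub>R partial 1 f (pt (X p) (Y p)) + Y' v *\<^sub>R partial 2 f (pt (X p) (Y p)))) (at p)"
  using has_derivative_compose[OF has_derivative_pt[OF assms(2,3)] has_derivative_partial[OF assms(1)]]
  by simp

lemma partial_compose_pt:
  fixes f :: "real^2 \<Rightarrow> 'b::real_normed_vector" and X Y :: "real^2 \<Rightarrow> real"
  assumes "\<And>p. f differentiable (at p)" "\<And>p. X differentiable (at p)" "\<And>p. Y differentiable (at p)"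
  shows "partial i (\<lambda>p. f (pt (X p) (Y p))) =
    (\<lambda>p. partial i X p *\<^sub>R partial 1 f (pt (X p) (Y p)) + partial i Y p *\<^sub>R partial 2 f (pt (X p) (Y p)))"
proof -
  have "((\<lambda>p. f (pt (X p) (Y p))) has_derivative
     (\<lambda>v. frechet_derivative X (at p) v *\<^sub>R partial 1 f (pt (X p) (Y p))
        + frechet_derivative Y (at p) v *\<^sub>R partial 2 f (pt (X p) (Y p)))) (at p)" for p
    by (rule has_derivative_compose_pt) (use assms frechet_derivative_works in blast)+
  from partial_eq[OF this] show ?thesis by (simp add: partial_def)
qed

text \<open>Leibniz and chain rules produce sums of products, so iterated differentiation needs a
  class that absorbs them. This one contains the smooth functions and is stable under
  \<open>partial\<close>; hence its members are smooth by coinduction. In \<open>sc_comp\<close> the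
  outer function is smooth itself, so that its derivatives lead to terms of the same form.\<close>

inductive smooth_closure :: "(real^2 \<Rightarrow> real) \<Rightarrow> bool" where
  sc_base: "smooth f \<Longrightarrow> smooth_closure f"
| sc_add: "smooth_closure f \<Longrightarrow> smooth_closure g \<Longrightarrow> smooth_closure (\<lambda>p. f p + g p)"
| sc_mult: "smooth_closure f \<Longrightarrow> smooth_closure g \<Longrightarrow> smooth_closure (\<lambda>p. f p * g p)"
| sc_inverse: "smooth_closure f \<Longrightarrow> (\<And>p. f p \<noteq> 0) \<Longrightarrow> smooth_closure (\<lambda>p. inverse (f p))"
| sc_comp: "smooth f \<Longrightarrow> smooth_closure X \<Longrightarrow> smooth_closure Y \<Longrightarrow> smooth_closure (\<lambda>p. f (pt (X p) (Y p)))"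

lemma partial_add:
  fixes f g :: "real^2 \<Rightarrow> 'b::real_normed_vector"
  assumes "\<And>p. f differentiable (at p)" "\<And>p. g differentiable (at p)"
  shows "partial i (\<lambda>p. f p + g p) = (\<lambda>p. partial i f p + partial i g p)"
proof -
  have "((\<lambda>p. f p + g p) has_derivative
     (\<lambda>v. frechet_derivative f (at p) v + frechet_derivative g (at p) v)) (at p)" for p
    using assms frechet_derivative_works by (intro derivative_intros) blast+
  from partial_eq[OF this] show ?thesis by (simp add: partial_def)
qed

lemma partial_mult:
  fixes f g :: "real^2 \<Rightarrow> real"
  assumes "\<And>p. f differentiable (at p)" "\<And>p. g differentiable (at p)"
  shows "partial i (\<lambda>p. f p * g p) = (\<lambda>p. partial i f p * g p + f p * partial i g p)"
proof -
  have "((\<lambda>p. f p * g p) has_derivative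
     (\<lambda>v. f p * frechet_derivative g (at p) v + frechet_derivative f (at p) v * g p)) (at p)" for p
    using assms frechet_derivative_works by (intro derivative_intros) blast+
  from partial_eq[OF this] show ?thesis by (simp add: partial_def add.commute)
qed

lemma smooth_closure_partial:
  "smooth_closure f \<Longrightarrow> (\<forall>p. f differentiable (at p)) \<and> (\<forall>i. smooth_closure (partial i f))"
proof (induction rule: smooth_closure.induct)
  case (sc_base f)
  then show ?case using smooth_iff smooth_closure.sc_base by blast
next
  case (sc_add f g)
  then show ?case by (simp add: partial_add smooth_closure.sc_add)
next
  case (sc_mult f g)
  then show ?case by (simp add: partial_mult smooth_closure.sc_add smooth_closure.sc_mult)
next
  case (sc_inverse f)
  have d: "((\<lambda>p. inverse (f p)) has_derivative
      (\<lambda>v. - (inverse (f p) * frechet_derivative f (at p) v * inverse (f p)))) (at p)" for p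
    using sc_inverse(2,3) frechet_derivative_works
    by (intro Deriv.has_derivative_inverse) blast+
  have e: "partial i (\<lambda>p. inverse (f p)) = (\<lambda>p. (\<lambda>p. -1) p * (inverse (f p) * partial i f p * inverse (f p)))" for i
    using partial_eq[OF d] by (simp add: partial_def)
  have "smooth (\<lambda>p::real^2. -1::real)"
    using smooth_elementary[of "\<lambda>p. -1::real"] el_const by simp
  then have "smooth_closure (partial i (\<lambda>p. inverse (f p)))" for i
  proof -
    have "smooth_closure (\<lambda>p. inverse (f p))" by (rule smooth_closure.sc_inverse) (use sc_inverse in auto)
    then have "smooth_closure (\<lambda>p. inverse (f p) * partial i f p * inverse (f p))"
      using sc_inverse(3) by (intro smooth_closure.sc_mult) auto
    then show ?thesis
      unfolding e by (rule smooth_closure.sc_mult[OF smooth_closure.sc_base[OF \<open>smooth (\<lambda>p. - 1)\<close>]])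
  qed
  moreover have "(\<lambda>p. inverse (f p)) differentiable (at p)" for p
    using d by (rule differentiableI)
  ultimately show ?case by blast
next
  case (sc_comp f X Y)
  have "(\<lambda>p. f (pt (X p) (Y p))) differentiable (at p)" for p
  proof -
    have "(X has_derivative frechet_derivative X (at p)) (at p)" "(Y has_derivative frechet_derivative Y (at p)) (at p)"
      using sc_comp(4,5) frechet_derivative_works by blast+
    from has_derivative_compose_pt[OF smooth_differentiable[OF sc_comp(1)] this]
    show ?thesis by (rule differentiableI)
  qed
  moreover have "smooth_closure (partial i (\<lambda>p. f (pt (X p) (Y p))))" for i
  proof -
    have "smooth_closure (\<lambda>p. partial j f (pt (X p) (Y p)))" for j
      by (rule smooth_closure.sc_comp[OF smooth_partial[OF sc_comp(1)] sc_comp(2,3)])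
    then have "smooth_closure (\<lambda>p. partial i X p * partial 1 f (pt (X p) (Y p)) + partial i Y p * partial 2 f (pt (X p) (Y p)))"
      using sc_comp(4,5) by (intro smooth_closure.sc_add smooth_closure.sc_mult) auto
    then show ?thesis
      using sc_comp(4,5) smooth_differentiable[OF sc_comp(1)] by (subst partial_compose_pt) auto
  qed
  ultimately show ?case by blast
qed

lemma smooth_closure_smooth: "smooth_closure f \<Longrightarrow> smooth f"
  by (rule smooth_coinduct[where P = smooth_closure]) (use smooth_closure_partial in blast)+

lemma elementary_smooth: "elementary f \<Longrightarrow> smooth f"
  using smooth_elementary[of f] by simp

lemma smooth_const [simp]: "smooth (\<lambda>p. c)"
  by (rule smooth_coinduct[where P = "\<lambda>f. \<exists>c. f = (\<lambda>p. c)"]) (auto simp: partial_eq[OF has_derivative_const])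

lemma smooth_coord [simp]: "smooth (\<lambda>p. p $ i :: real)"
  by (intro elementary_smooth elementary.intros)

lemma smooth_add: "smooth f \<Longrightarrow> smooth g \<Longrightarrow> smooth (\<lambda>p. f p + g p :: real)"
  by (rule smooth_closure_smooth[OF sc_add[OF sc_base sc_base]])

lemma smooth_mult: "smooth f \<Longrightarrow> smooth g \<Longrightarrow> smooth (\<lambda>p. f p * g p :: real)"
  by (rule smooth_closure_smooth[OF sc_mult[OF sc_base sc_base]])

lemma smooth_inverse: "smooth f \<Longrightarrow> (\<And>p. f p \<noteq> 0) \<Longrightarrow> smooth (\<lambda>p. inverse (f p) :: real)"
  by (rule smooth_closure_smooth[OF sc_inverse[OF sc_base]])

lemma smooth_compose: "smooth f \<Longrightarrow> smooth X \<Longrightarrow> smooth Y \<Longrightarrow> smooth (\<lambda>p. f (pt (X p) (Y p)) :: real)"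
  by (rule smooth_closure_smooth[OF sc_comp[OF _ sc_base sc_base]])

lemma smooth_minus: "smooth f \<Longrightarrow> smooth (\<lambda>p. - f p :: real)"
  using smooth_mult[OF smooth_const[of "-1"]] by simp

lemma smooth_diff: "smooth f \<Longrightarrow> smooth g \<Longrightarrow> smooth (\<lambda>p. f p - g p :: real)"
  using smooth_add[OF _ smooth_minus] by fastforce

lemma smooth_divide: "smooth f \<Longrightarrow> smooth g \<Longrightarrow> (\<And>p. g p \<noteq> 0) \<Longrightarrow> smooth (\<lambda>p. f p / g p :: real)"
  using smooth_mult[OF _ smooth_inverse] by (simp add: divide_inverse)

lemma smooth_compose_elementary:
  assumes "elementary (\<lambda>p. f (p $ 1))" "smooth X"
  shows "smooth (\<lambda>p. f (X p) :: real)"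
  using smooth_compose[OF elementary_smooth[OF assms(1)] assms(2,2)] by simp

lemma smooth_sin: "smooth X \<Longrightarrow> smooth (\<lambda>p. sin (X p :: real))"
  by (rule smooth_compose_elementary[of sin X, OF el_sin[OF el_coord]])

lemma smooth_cos: "smooth X \<Longrightarrow> smooth (\<lambda>p. cos (X p :: real))"
  by (rule smooth_compose_elementary[of cos X, OF el_cos[OF el_coord]])

lemma smooth_component:
  fixes f :: "real^2 \<Rightarrow> 'b::euclidean_space"
  assumes "smooth f"
  shows "smooth (\<lambda>p. f p \<bullet> b)"
proof (rule smooth_coinduct[where P = "\<lambda>h. \<exists>f :: real^2 \<Rightarrow> 'b. smooth f \<and> h = (\<lambda>p. f p \<bullet> b)"])
  fix h assume "\<exists>f :: real^2 \<Rightarrow> 'b. smooth f \<and> h = (\<lambda>p. f p \<bullet> b)"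
  then obtain f :: "real^2 \<Rightarrow> 'b" where f: "smooth f" "h = (\<lambda>p. f p \<bullet> b)" by blast
  have d: "(h has_derivative (\<lambda>v. frechet_derivative f (at p) v \<bullet> b)) (at p)" for p
    unfolding f(2) using smooth_has_derivative[OF f(1)] by (auto intro!: derivative_eq_intros)
  have "partial i h = (\<lambda>p. partial i f p \<bullet> b)" for i
    using partial_eq[OF d] by (simp add: partial_def)
  with d show "(\<forall>p. h differentiable (at p)) \<and>
      (\<forall>i. \<exists>f :: real^2 \<Rightarrow> 'b. smooth f \<and> partial i h = (\<lambda>p. f p \<bullet> b))"
    using smooth_partial[OF f(1)] by (auto simp: differentiable_def)
qed (use assms in blast)

lemma smooth_continuous_on: "smooth f \<Longrightarrow> continuous_on S f"
  using smooth_differentiable differentiable_imp_continuous_within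
  by (metis continuous_at_imp_continuous_on)

lemma smooth_continuous_compose:
  "smooth f \<Longrightarrow> continuous_on S g \<Longrightarrow> continuous_on S (\<lambda>x. f (g x))"
  using continuous_on_compose2[OF smooth_continuous_on[of f UNIV]] by blast

lemma smooth_has_real_derivative:
  fixes f :: "real^2 \<Rightarrow> real"
  assumes "smooth f"
  shows "((\<lambda>x. f (pt x y)) has_real_derivative partial 1 f (pt x y)) (at x within S)"
    and "((\<lambda>y. f (pt x y)) has_real_derivative partial 2 f (pt x y)) (at y within S)"
proof -
  have "((\<lambda>x. f (pt x y)) has_real_derivative partial 1 f (pt x y)) (at x)"
    using has_derivative_compose_pt[of f "\<lambda>x. x" x "\<lambda>x. y" "\<lambda>v. v" "\<lambda>v. 0"] assms smooth_differentiable
    by (auto simp: has_field_derivative_def mult.commute[of _ "partial _ _ _"] mult_commute_abs)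
  then show "((\<lambda>x. f (pt x y)) has_real_derivative partial 1 f (pt x y)) (at x within S)"
    by (rule has_field_derivative_at_within)
  have "((\<lambda>y. f (pt x y)) has_real_derivative partial 2 f (pt x y)) (at y)"
    using has_derivative_compose_pt[of f "\<lambda>y. x" y "\<lambda>y. y" "\<lambda>v. 0" "\<lambda>v. v"] assms smooth_differentiable
    by (auto simp: has_field_derivative_def mult.commute[of _ "partial _ _ _"] mult_commute_abs)
  then show "((\<lambda>y. f (pt x y)) has_real_derivative partial 2 f (pt x y)) (at y within S)"
    by (rule has_field_derivative_at_within)
qed

text \<open>The weight \<open>h\<close> is meant for the trigonometric factor of a Fourier
  coefficient; with \<open>h = 1\<close> the rule serves the symmetry of second derivatives.\<close>

lemma deriv_integral_pt:
  fixes f :: "real^2 \<Rightarrow> real" and h :: "real \<Rightarrow> real"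
  assumes f: "smooth f" and h: "continuous_on UNIV h"
  shows "((\<lambda>x. integral {c..d} (\<lambda>y. f (pt x y) * h y)) has_real_derivative
      integral {c..d} (\<lambda>y. partial 1 f (pt x y) * h y)) (at x)"
proof -
  have h': "continuous_on S h" for S using h continuous_on_subset by blast
  have "((\<lambda>x. integral (cbox c d) (\<lambda>y. f (pt x y) * h y)) has_field_derivative
      integral (cbox c d) (\<lambda>y. partial 1 f (pt x y) * h y)) (at x within UNIV)"
  proof (rule leibniz_rule_field_derivative)
    show "((\<lambda>x. f (pt x t) * h t) has_field_derivative partial 1 f (pt x t) * h t) (at x within UNIV)" for x t
      by (intro DERIV_cmult_right smooth_has_real_derivative[OF f])
    show "(\<lambda>y. f (pt x y) * h y) integrable_on cbox c d" for x
      by (intro integrable_continuous continuous_intros smooth_continuous_compose[OF f] h')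
    show "continuous_on (UNIV \<times> cbox c d) (\<lambda>(x, y). partial 1 f (pt x y) * h y)"
      unfolding split_beta
      by (intro continuous_intros smooth_continuous_compose[OF smooth_partial[OF f]] continuous_on_compose2[OF h]) auto
  qed auto
  then show ?thesis by simp
qed

text \<open>Write \<open>f\<close> as the integral of \<open>partial 2 f\<close> in
  \<open>y\<close>, differentiate under the integral sign in \<open>x\<close>, then differentiate
  the integral in \<open>y\<close>.\<close>

lemma partial_commute:
  fixes f :: "real^2 \<Rightarrow> real"
  assumes f: "smooth f"
  shows "partial 2 (partial 1 f) = partial 1 (partial 2 f)"
proof
  fix p :: "real^2"
  define x y where xy: "x = p $ 1" "y = p $ 2"
  define a b where ab: "a = y - 1" "b = y + 1"
  have FTC: "f (pt x' t) = f (pt x' a) + integral {a..t} (\<lambda>s. partial 2 f (pt x' s))" if "t \<in> {a..b}" for x' t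
  proof -
    have "((\<lambda>s. partial 2 f (pt x' s)) has_integral f (pt x' t) - f (pt x' a)) {a..t}"
      by (rule fundamental_theorem_of_calculus)
         (use that smooth_has_real_derivative(2)[OF f] in \<open>auto simp: has_real_derivative_iff_has_vector_derivative\<close>)
    then show ?thesis by (simp add: integral_unique)
  qed
  have e: "partial 1 f (pt x t) = partial 1 f (pt x a) + integral {a..t} (\<lambda>s. partial 1 (partial 2 f) (pt x s))"
    if "t \<in> {a..b}" for t
  proof -
    have "((\<lambda>x'. f (pt x' a) + integral {a..t} (\<lambda>s. partial 2 f (pt x' s) * 1)) has_real_derivative
       (partial 1 f (pt x a) + integral {a..t} (\<lambda>s. partial 1 (partial 2 f) (pt x s) * 1))) (at x)"
      by (intro DERIV_add smooth_has_real_derivative[OF f] deriv_integral_pt[OF smooth_partial[OF f]] continuous_intros)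
    moreover have "(\<lambda>x'. f (pt x' t)) = (\<lambda>x'. f (pt x' a) + integral {a..t} (\<lambda>s. partial 2 f (pt x' s) * 1))"
      using FTC[OF that] by simp
    ultimately have "((\<lambda>x'. f (pt x' t)) has_real_derivative
       (partial 1 f (pt x a) + integral {a..t} (\<lambda>s. partial 1 (partial 2 f) (pt x s) * 1))) (at x)" by simp
    with smooth_has_real_derivative(1)[OF f, of t x UNIV] DERIV_unique show ?thesis by fastforce
  qed
  have y: "y \<in> {a..b}" by (simp add: ab)
  have "((\<lambda>t. integral {a..t} (\<lambda>s. partial 1 (partial 2 f) (pt x s))) has_real_derivative
     partial 1 (partial 2 f) (pt x y)) (at y within {a..b})"
    by (rule integral_has_real_derivative[OF _ y]) (intro continuous_intros smooth_continuous_compose[OF smooth_partial[OF smooth_partial[OF f]]])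
  then have "((\<lambda>t. partial 1 f (pt x a) + integral {a..t} (\<lambda>s. partial 1 (partial 2 f) (pt x s))) has_real_derivative
     partial 1 (partial 2 f) (pt x y)) (at y within {a..b})"
    by (auto intro!: derivative_eq_intros)
  then have "((\<lambda>t. partial 1 f (pt x t)) has_real_derivative
     partial 1 (partial 2 f) (pt x y)) (at y within {a..b})"
    by (rule has_field_derivative_transform_within[OF _ zero_less_one y]) (rule e[symmetric])
  moreover have "at y within {a..b} = at y" by (rule at_within_Icc_at) (auto simp: ab)
  ultimately have "((\<lambda>t. partial 1 f (pt x t)) has_real_derivative partial 1 (partial 2 f) (pt x y)) (at y)" by simp
  with smooth_has_real_derivative(2)[OF smooth_partial[OF f], of 1 x y UNIV]
  have "partial 2 (partial 1 f) (pt x y) = partial 1 (partial 2 f) (pt x y)" using DERIV_unique by blast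
  then show "partial 2 (partial 1 f) p = partial 1 (partial 2 f) p" by (simp add: xy pt_eta)
qed

section \<open>Pruefer angles\<close>

lemma has_real_derivative_square_min:
  "((\<lambda>x::real. (min x 0)\<^sup>2) has_real_derivative 2 * min x 0) (at x)"
proof -
  consider "x > 0" | "x < 0" | "x = 0" by linarith
  then show ?thesis
  proof cases
    case 1
    have "((\<lambda>x::real. 0) has_real_derivative 2 * min x 0) (at x)" using 1 by simp
    then show ?thesis
      by (rule has_field_derivative_transform_within_open[where S = "{0<..}"]) (use 1 in auto)
  next
    case 2
    have "((\<lambda>x::real. x\<^sup>2) has_real_derivative 2 * min x 0) (at x)"
      using 2 by (auto intro!: derivative_eq_intros)
    then show ?thesis
      by (rule has_field_derivative_transform_within_open[where S = "{..<0}"]) (use 2 in auto)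
  next
    case 3
    have "((\<lambda>h::real. (min h 0)\<^sup>2 / h) \<longlongrightarrow> 0) (at 0)"
    proof (rule Lim_null_comparison)
      show "\<forall>\<^sub>F h in at 0. norm ((min h 0)\<^sup>2 / h) \<le> \<bar>h\<bar>"
        by (rule always_eventually) (auto simp: min_def power2_eq_square)
      show "((\<lambda>h::real. \<bar>h\<bar>) \<longlongrightarrow> 0) (at 0)" by (intro tendsto_eq_intros) auto
    qed
    then show ?thesis using 3 by (simp add: DERIV_def)
  qed
qed

text \<open>The squared negative part of \<open>d\<close>, damped by
  \<open>exp (- 2 * C * t)\<close>, is differentiable and nonincreasing, and it vanishes at
  0.\<close>

lemma gronwall_nonneg:
  fixes d d' :: "real \<Rightarrow> real"
  assumes d: "\<And>t. 0 \<le> t \<Longrightarrow> (d has_real_derivative d' t) (at t)"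
    and ge: "\<And>t. 0 \<le> t \<Longrightarrow> - C * \<bar>d t\<bar> \<le> d' t"
    and 0: "0 \<le> d 0" and x: "0 \<le> x"
  shows "0 \<le> d x"
proof -
  define N where "N t = (min (d t) 0)\<^sup>2 * exp (- 2 * C * t)" for t
  have N: "(N has_real_derivative (2 * min (d t) 0 * d' t * exp (- 2 * C * t)
      + (min (d t) 0)\<^sup>2 * (exp (- 2 * C * t) * (- 2 * C)))) (at t)" if "0 \<le> t" for t
    unfolding N_def
    by (rule derivative_eq_intros DERIV_chain2[OF has_real_derivative_square_min d[OF that]] refl | simp)+
  have "2 * min (d t) 0 * d' t * exp (- 2 * C * t)
      + (min (d t) 0)\<^sup>2 * (exp (- 2 * C * t) * (- 2 * C)) \<le> 0" if "0 \<le> t" for t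
  proof (cases "d t \<ge> 0")
    case False
    then have "C * d t \<le> d' t" using ge[OF that] by simp
    then have "d t * d' t \<le> d t * (C * d t)" using False by (intro mult_left_mono_neg) auto
    then have "(2 * exp (- 2 * C * t)) * (d t * d' t - d t * (C * d t)) \<le> 0"
      by (intro mult_nonneg_nonpos) auto
    moreover have "min (d t) 0 = d t" using False by simp
    ultimately show ?thesis by (simp add: algebra_simps power2_eq_square)
  qed simp
  then have "N x \<le> N 0"
    using DERIV_nonpos_imp_nonincreasing[OF x, of N] N by (metis (no_types, lifting))
  also have "N 0 = 0" using 0 by (simp add: N_def)
  finally have "(min (d x) 0)\<^sup>2 \<le> 0" by (simp add: N_def mult_le_0_iff not_le)
  then show ?thesis by simp
qed

lemma primitive_exists:
  fixes g :: "real \<Rightarrow> real"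
  assumes g: "continuous_on UNIV g"
  obtains G where "\<And>x. (G has_real_derivative g x) (at x)" "G 0 = 0"
proof
  define G where "G u = (LBINT y=0..u. g y)" for u :: real
  show "G 0 = 0" by (simp add: G_def zero_ereal_def)
  fix x
  have "(G has_vector_derivative g x) (at x within {- \<bar>x\<bar> - 1 .. \<bar>x\<bar> + 1})"
    unfolding G_def zero_ereal_def
    by (rule interval_integral_FTC2) (use continuous_on_subset[OF g] in auto)
  moreover have "at x within {- \<bar>x\<bar> - 1 .. \<bar>x\<bar> + 1} = at x" by (rule at_within_Icc_at) auto
  ultimately show "(G has_real_derivative g x) (at x)"
    by (simp add: has_real_derivative_iff_has_vector_derivative)
qed

text \<open>Integrating the exponential weight gains the factor \<open>1 / L\<close>; a large
  \<open>L\<close> therefore turns the Picard operator into a contraction. Both signs of the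
  primitive are handled through \<open>s * H\<close>, negative arguments by reflection.\<close>

lemma primitive_exp_bound:
  fixes G g :: "real \<Rightarrow> real"
  assumes G: "\<And>x. (G has_real_derivative g x) (at x)" "G 0 = 0"
    and g: "\<And>x. \<bar>g x\<bar> \<le> B * exp (L * \<bar>x\<bar>)" and "L > 0"
  shows "\<bar>G x\<bar> \<le> B / L * exp (L * \<bar>x\<bar>)"
proof -
  have *: "\<bar>H x\<bar> \<le> B / L * exp (L * x)"
    if H: "\<And>x. (H has_real_derivative h x) (at x)" "H 0 = 0"
      and h: "\<And>x. \<bar>h x\<bar> \<le> B * exp (L * \<bar>x\<bar>)" and "x \<ge> 0" for H h :: "real \<Rightarrow> real" and x
  proof -
    have B: "0 \<le> B" using h[of 0] by simp
    have d: "((\<lambda>x. B / L * exp (L * x) - s * H x) has_real_derivative (B * exp (L * t) - s * h t)) (at t)" for s t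
    proof -
      have "((\<lambda>x. exp (L * x)) has_real_derivative exp (L * t) * L) (at t)"
        by (auto intro!: derivative_eq_intros)
      from DERIV_diff[OF DERIV_cmult[OF this, of "B / L"] DERIV_cmult[OF H(1), of s t]] show ?thesis
        using \<open>L > 0\<close> by (simp add: mult_ac)
    qed
    have "B / L * exp (L * 0) - s * H 0 \<le> B / L * exp (L * x) - s * H x" if "\<bar>s\<bar> = 1" for s
    proof (rule DERIV_nonneg_imp_nondecreasing[OF \<open>x \<ge> 0\<close>])
      fix t assume t: "0 \<le> t" "t \<le> x"
      have "s * h t \<le> \<bar>s * h t\<bar>" by simp
      also have "\<dots> \<le> B * exp (L * t)" using h[of t] t that by (simp add: abs_mult)
      finally have "s * h t \<le> B * exp (L * t)" .
      then show "\<exists>y. ((\<lambda>x. B / L * exp (L * x) - s * H x) has_real_derivative y) (at t) \<and> 0 \<le> y"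
        using d[of s t] by force
    qed
    from this[of 1] this[of "-1"] have "0 \<le> B / L * exp (L * x) - H x - B / L" "0 \<le> B / L * exp (L * x) + H x - B / L"
      using H(2) by auto
    moreover have "0 \<le> B / L" using B \<open>L > 0\<close> by simp
    ultimately show ?thesis by linarith
  qed
  show ?thesis
  proof (cases "x \<ge> 0")
    case True then show ?thesis using *[OF G g] by simp
  next
    case False
    have "\<bar>G (- (- x))\<bar> \<le> B / L * exp (L * (- x))"
    proof (rule *[where H = "\<lambda>x. G (- x)" and h = "\<lambda>x. - g (- x)"])
      fix x
      have "((\<lambda>x. - x :: real) has_real_derivative - 1) (at x)" by (auto intro!: derivative_eq_intros)
      from DERIV_chain2[OF G(1) this] show "((\<lambda>x. G (- x)) has_real_derivative - g (- x)) (at x)" by simp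
      show "\<bar>- g (- x)\<bar> \<le> B * exp (L * \<bar>x\<bar>)" using g[of "- x"] by simp
    qed (use False G(2) in auto)
    with False show ?thesis by simp
  qed
qed

text \<open>Picard's theorem on the whole line: the weight \<open>exp (- L * \<bar>x\<bar>)\<close> turns the integral operator
  into a contraction of the bounded continuous functions.\<close>

lemma scalar_ode_exists:
  fixes f :: "real \<Rightarrow> real \<Rightarrow> real"
  assumes f: "continuous_on UNIV (\<lambda>(x, y). f x y)"
    and lip: "\<And>x y z. \<bar>f x y - f x z\<bar> \<le> K * \<bar>y - z\<bar>"
    and bd: "\<And>x y. \<bar>f x y\<bar> \<le> B"
  obtains y where "\<And>x. (y has_real_derivative f x (y x)) (at x)" "y 0 = y0"
proof -
  define L where "L = 2 * \<bar>K\<bar> + 1"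
  have L: "L > 0" and K: "K / L \<le> 1/2" by (auto simp: L_def field_simps)
  \<comment> \<open>The unknown \<open>z\<close> is the solution divided by the weight
    \<open>exp (L * \<bar>s\<bar>)\<close>; \<open>F\<close> restores the weight before inserting it
    into the equation.\<close>
  define F where "F z s = f s (exp (L * \<bar>s\<bar>) * apply_bcontfun z s)" for z s
  have Fc: "continuous_on UNIV (F z)" for z
    unfolding F_def by (intro continuous_on_compose2[OF f, of _ "\<lambda>s. (s, exp (L * \<bar>s\<bar>) * apply_bcontfun z s)", simplified] continuous_intros continuous_on_apply_bcontfun)
  have "\<exists>G. (\<forall>x. (G has_real_derivative F z x) (at x)) \<and> G 0 = 0" for z
    using primitive_exists[OF Fc] by metis
  then obtain G where G: "\<And>z x. (G z has_real_derivative F z x) (at x)" "\<And>z. G z 0 = 0"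
    by metis
  have Gc: "continuous_on UNIV (G z)" for z
    by (meson G(1) DERIV_isCont continuous_at_imp_continuous_on)
  define T where "T z = Bcontfun (\<lambda>x. exp (- L * \<bar>x\<bar>) * (y0 + G z x))" for z
  have Fb: "\<bar>F z x\<bar> \<le> B * exp (L * \<bar>x\<bar>)" for z x
  proof -
    have "0 \<le> B" using bd[of 0 0] by linarith
    have "\<bar>F z x\<bar> \<le> B * 1" using bd unfolding F_def by simp
    also have "\<dots> \<le> B * exp (L * \<bar>x\<bar>)" using \<open>0 \<le> B\<close> L by (intro mult_left_mono) auto
    finally show ?thesis .
  qed
  have "(\<lambda>x. exp (- L * \<bar>x\<bar>) * (y0 + G z x)) \<in> bcontfun" for z
  proof (rule bcontfun_normI)
    show "continuous_on UNIV (\<lambda>x. exp (- L * \<bar>x\<bar>) * (y0 + G z x))"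
      by (intro continuous_intros Gc)
    fix x
    have "\<bar>y0 + G z x\<bar> \<le> \<bar>y0\<bar> * exp (L * \<bar>x\<bar>) + B / L * exp (L * \<bar>x\<bar>)"
    proof -
      have "\<bar>y0\<bar> * 1 \<le> \<bar>y0\<bar> * exp (L * \<bar>x\<bar>)" using L by (intro mult_left_mono) auto
      then show ?thesis using primitive_exp_bound[OF G Fb L, of z x] by linarith
    qed
    then have "exp (- L * \<bar>x\<bar>) * \<bar>y0 + G z x\<bar> \<le> exp (- L * \<bar>x\<bar>) * ((\<bar>y0\<bar> + B / L) * exp (L * \<bar>x\<bar>))"
      by (intro mult_left_mono) (auto simp: algebra_simps)
    also have "\<dots> = \<bar>y0\<bar> + B / L" by (simp add: exp_minus field_simps)
    finally show "norm (exp (- L * \<bar>x\<bar>) * (y0 + G z x)) \<le> \<bar>y0\<bar> + B / L"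
      by (simp add: abs_mult)
  qed
  then have T: "apply_bcontfun (T z) x = exp (- L * \<bar>x\<bar>) * (y0 + G z x)" for z x
    unfolding T_def by (simp add: Bcontfun_inverse)
  have "dist (T z) (T z') \<le> 1/2 * dist z z'" for z z'
  proof (rule dist_bound)
    fix x
    have "\<bar>F z s - F z' s\<bar> \<le> (K * dist z z') * exp (L * \<bar>s\<bar>)" for s
    proof -
      have "0 \<le> K" using lip[of 0 1 0] abs_ge_zero[of "f 0 1 - f 0 0"] by simp
      have "\<bar>F z s - F z' s\<bar> \<le> K * \<bar>exp (L * \<bar>s\<bar>) * apply_bcontfun z s - exp (L * \<bar>s\<bar>) * apply_bcontfun z' s\<bar>"
        unfolding F_def by (rule lip)
      also have "\<dots> = K * (exp (L * \<bar>s\<bar>) * dist (apply_bcontfun z s) (apply_bcontfun z' s))"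
        by (simp add: dist_real_def abs_mult flip: right_diff_distrib)
      also have "\<dots> \<le> K * (exp (L * \<bar>s\<bar>) * dist z z')"
        using \<open>0 \<le> K\<close> by (intro mult_left_mono dist_bounded) auto
      finally show ?thesis by (simp add: mult_ac)
    qed
    then have "\<bar>G z x - G z' x\<bar> \<le> (K * dist z z') / L * exp (L * \<bar>x\<bar>)"
      by (intro primitive_exp_bound[where G = "\<lambda>x. G z x - G z' x" and g = "\<lambda>s. F z s - F z' s"] L)
         (auto intro!: derivative_intros G simp: G(2))
    then have "exp (- L * \<bar>x\<bar>) * \<bar>G z x - G z' x\<bar> \<le> exp (- L * \<bar>x\<bar>) * ((K * dist z z') / L * exp (L * \<bar>x\<bar>))"
      by (intro mult_left_mono) auto
    also have "\<dots> = K / L * dist z z'" by (simp add: exp_minus field_simps)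
    also have "\<dots> \<le> 1/2 * dist z z'" using K by (intro mult_right_mono) auto
    finally show "dist (apply_bcontfun (T z) x) (apply_bcontfun (T z') x) \<le> 1/2 * dist z z'"
      by (simp add: T dist_real_def abs_mult flip: right_diff_distrib)
  qed
  then have "\<exists>!z. T z = z" by (intro banach_fix_type[of "1/2"]) auto
  then obtain z where z: "T z = z" by blast
  have y: "exp (L * \<bar>x\<bar>) * apply_bcontfun z x = y0 + G z x" for x
    using T[of z x] unfolding z by (simp add: exp_minus field_simps)
  show ?thesis
  proof
    show "y0 + G z 0 = y0" by (simp add: G)
    fix x
    have "((\<lambda>x. y0 + G z x) has_real_derivative 0 + F z x) (at x)" by (intro derivative_intros G)
    then show "((\<lambda>x. y0 + G z x) has_real_derivative f x (y0 + G z x)) (at x)"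
      unfolding F_def y by simp
  qed
qed

lemma sin_squared_diff_le: "\<bar>(sin a)\<^sup>2 - (sin b)\<^sup>2\<bar> \<le> \<bar>a - b\<bar>" for a b :: real
proof -
  have "(sin a)\<^sup>2 - (sin b)\<^sup>2 = sin (a + b) * sin (a - b)"
    using sin_times_sin[of "a+b" "a-b"] cos_double_sin[of a] cos_double_sin[of b] by simp
  also have "\<bar>\<dots>\<bar> \<le> 1 * \<bar>a - b\<bar>"
    unfolding abs_mult by (intro mult_mono abs_sin_le_one abs_sin_x_le_abs_x) auto
  finally show ?thesis by simp
qed

lemma periodic_continuous_bounded:
  fixes f :: "real \<Rightarrow> real"
  assumes f: "continuous_on UNIV f" and per: "\<And>x. f (x + T) = f x" and T: "T > 0"
  obtains c d where "\<And>x. f c \<le> f x" "\<And>x. f x \<le> f d"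
proof -
  have perk: "f (x + of_int k * T) = f x" for x and k :: int
  proof (induction k rule: int_induct[where k=0])
    case (step1 i)
    have "f (x + of_int (i + 1) * T) = f ((x + of_int i * T) + T)" by (simp add: algebra_simps)
    then show ?case using per step1 by simp
  next
    case (step2 i)
    have "f (x + of_int i * T) = f ((x + of_int (i - 1) * T) + T)" by (simp add: algebra_simps)
    then show ?case using per step2 by simp
  qed simp
  have fc: "continuous_on {0..T} f" using f continuous_on_subset by blast
  have red: "\<exists>y\<in>{0..T}. f x = f y" for x
  proof
    define k where "k = \<lfloor>x / T\<rfloor>"
    show "x + of_int (- k) * T \<in> {0..T}"
      using floor_divide_lower[OF T, of x] floor_divide_upper[OF T, of x] by (auto simp: k_def algebra_simps)
    show "f x = f (x + of_int (- k) * T)" by (rule perk[symmetric])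
  qed
  have ne: "{0..T} \<noteq> {}" using T by auto
  obtain c where c: "\<forall>y\<in>{0..T}. f c \<le> f y" using continuous_attains_inf[OF compact_Icc ne fc] by blast
  obtain d where d: "\<forall>y\<in>{0..T}. f y \<le> f d" using continuous_attains_sup[OF compact_Icc ne fc] by blast
  have "f c \<le> f x" for x using red[of x] c by force
  moreover have "f x \<le> f d" for x using red[of x] d by force
  ultimately show ?thesis by (rule that)
qed

text \<open>The functions depending on \<open>x\<close> only in the metric \<open>\<rho> (w\<^sup>2 dx\<^sup>2 + dy\<^sup>2)\<close>. Separating variables by
  \<open>a x * cos (l * y)\<close> turns the eigenvalue equation into \<open>(a'/w)'/w = - k a\<close> with
  \<open>k = lam * \<rho> - l\<^sup>2\<close>, which \<open>solution\<close> states as a system with \<open>b = a'/w\<close>; its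
  Pruefer angle \<open>\<theta>\<close> is given by \<open>a = R sin \<theta>\<close>, \<open>b = R cos \<theta>\<close>.\<close>

locale sturm =
  fixes w \<rho> :: "real \<Rightarrow> real"
  assumes w_elementary: "elementary (\<lambda>p. w (p $ 1))" and \<rho>_elementary: "elementary (\<lambda>p. \<rho> (p $ 1))"
    and w_pos: "w x > 0" and \<rho>_pos: "\<rho> x > 0"
    and w_even: "w (- x) = w x" and \<rho>_even: "\<rho> (- x) = \<rho> x"
    and w_periodic: "w (x + pi) = w x" and \<rho>_periodic: "\<rho> (x + pi) = \<rho> x"
begin

lemma w_cont: "continuous_on S w" and \<rho>_cont: "continuous_on S \<rho>"
proof -
  have "continuous_on S (\<lambda>x. pt x 0)" by (intro continuous_intros)
  note smooth_continuous_compose[OF elementary_smooth[OF w_elementary] this]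
    smooth_continuous_compose[OF elementary_smooth[OF \<rho>_elementary] this]
  then show "continuous_on S w" "continuous_on S \<rho>" by simp_all
qed

lemma w_bounded: obtains W where "W > 0" "\<And>x. w x \<le> W"
proof -
  obtain d where "\<And>x. w x \<le> w d"
    using periodic_continuous_bounded[OF w_cont w_periodic pi_gt_zero] by metis
  then show ?thesis by (rule that[OF w_pos])
qed

lemma \<rho>_bounded: obtains c d where "c > 0" "\<And>x. c \<le> \<rho> x" "\<And>x. \<rho> x \<le> d"
proof -
  obtain c d where "\<And>x. \<rho> c \<le> \<rho> x" "\<And>x. \<rho> x \<le> \<rho> d"
    using periodic_continuous_bounded[OF \<rho>_cont \<rho>_periodic pi_gt_zero] by metis
  then show ?thesis by (rule that[OF \<rho>_pos])
qed

text \<open>With such a coefficient \<open>w * (k - 1)\<close> is bounded, so that the Pruefer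
  equation is globally Lipschitz in the angle and solvable on the whole line.\<close>

definition bcont :: "(real \<Rightarrow> real) \<Rightarrow> bool" where
  "bcont k \<longleftrightarrow> continuous_on UNIV k \<and> bounded (range k)"

definition solution :: "(real \<Rightarrow> real) \<Rightarrow> (real \<Rightarrow> real) \<Rightarrow> (real \<Rightarrow> real) \<Rightarrow> bool" where
  "solution k a b \<longleftrightarrow> (\<forall>x. (a has_real_derivative w x * b x) (at x) \<and>
     (b has_real_derivative - (w x * k x * a x)) (at x))"

text \<open>Differentiating \<open>a = R sin \<theta>\<close>, \<open>b = R cos \<theta>\<close>
  gives \<open>\<theta>' = w (cos^2 \<theta> + k sin^2 \<theta>)\<close>; eliminating the cosine
  leaves one nonlinearity, \<open>sin^2\<close>, with Lipschitz constant 1.\<close>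

definition prufer :: "(real \<Rightarrow> real) \<Rightarrow> (real \<Rightarrow> real) \<Rightarrow> bool" where
  "prufer k \<theta> \<longleftrightarrow> (\<forall>x. (\<theta> has_real_derivative w x * (1 + (k x - 1) * (sin (\<theta> x))\<^sup>2)) (at x))"

lemma bcont_bound:
  assumes "bcont k" obtains C where "C > 0" "\<And>x. w x * \<bar>k x - 1\<bar> \<le> C" "\<And>x. w x \<le> C"
proof -
  obtain W where W: "W > 0" "\<And>x. w x \<le> W" using w_bounded by metis
  obtain B where B: "\<And>x. \<bar>k x\<bar> \<le> B" using assms unfolding bcont_def bounded_iff by auto
  have B0: "0 \<le> B" using B[of 0] by linarith
  show ?thesis
  proof
    show "W * (B + 1) > 0" using W B0 by simp
    show "w x * \<bar>k x - 1\<bar> \<le> W * (B + 1)" for x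
      using W B[of x] w_pos[of x] by (intro mult_mono) (auto intro: less_imp_le)
    show "w x \<le> W * (B + 1)" for x
      using mult_mono[OF W(2)[of x], of 1 "B + 1"] W B0 by simp
  qed
qed

lemma prufer_exists:
  assumes "bcont k" obtains \<theta> where "prufer k \<theta>" "\<theta> 0 = t0"
proof -
  obtain C where C: "C > 0" "\<And>x. w x * \<bar>k x - 1\<bar> \<le> C" "\<And>x. w x \<le> C" using bcont_bound[OF assms] by metis
  have k: "continuous_on UNIV k" using assms by (simp add: bcont_def)
  have "\<bar>w x * (1 + (k x - 1) * (sin y)\<^sup>2) - w x * (1 + (k x - 1) * (sin z)\<^sup>2)\<bar> \<le> C * \<bar>y - z\<bar>" for x y z
  proof -
    have "w x * (1 + (k x - 1) * (sin y)\<^sup>2) - w x * (1 + (k x - 1) * (sin z)\<^sup>2)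
        = (w x * (k x - 1)) * ((sin y)\<^sup>2 - (sin z)\<^sup>2)" by (simp add: algebra_simps)
    also have "\<bar>\<dots>\<bar> \<le> C * \<bar>y - z\<bar>"
      unfolding abs_mult using C w_pos[of x] by (intro mult_mono sin_squared_diff_le) (auto simp: abs_mult)
    finally show ?thesis .
  qed
  moreover have "\<bar>w x * (1 + (k x - 1) * (sin y)\<^sup>2)\<bar> \<le> C + C" for x y
  proof -
    have "\<bar>w x * (k x - 1) * (sin y)\<^sup>2\<bar> \<le> C * 1"
      unfolding abs_mult using C w_pos[of x]
      by (intro mult_mono) (auto simp: abs_square_le_1)
    moreover have "w x * (1 + (k x - 1) * (sin y)\<^sup>2) = w x + w x * (k x - 1) * (sin y)\<^sup>2" by (simp add: algebra_simps)
    ultimately show ?thesis using C(3)[of x] w_pos[of x] by linarith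
  qed
  moreover have "continuous_on UNIV (\<lambda>(x, y). w x * (1 + (k x - 1) * (sin y)\<^sup>2))"
    unfolding split_beta
    by (intro continuous_intros continuous_on_compose2[OF w_cont] continuous_on_compose2[OF k]) auto
  ultimately obtain y where "\<And>x. (y has_real_derivative w x * (1 + (k x - 1) * (sin (y x))\<^sup>2)) (at x)" "y 0 = t0"
    using scalar_ode_exists[of "\<lambda>x y. w x * (1 + (k x - 1) * (sin y)\<^sup>2)" C "C + C" t0] by metis
  then show ?thesis using that by (auto simp: prufer_def)
qed

section \<open>Comparison of Pruefer angles\<close>

lemma prufer_diff_bound:
  assumes "w x * \<bar>k x - 1\<bar> \<le> C"
  shows "- C * \<bar>u - v\<bar> \<le> (w x * (k x - 1)) * ((sin u)\<^sup>2 - (sin v)\<^sup>2)"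
proof -
  have "\<bar>(w x * (k x - 1)) * ((sin u)\<^sup>2 - (sin v)\<^sup>2)\<bar> \<le> C * \<bar>u - v\<bar>"
    unfolding abs_mult using assms w_pos[of x] order_trans[OF _ assms, of 0]
    by (intro mult_mono sin_squared_diff_le) (auto simp: abs_mult)
  then show ?thesis by linarith
qed

text \<open>Sturm comparison: in the derivative of \<open>\<theta>2 - \<theta>1\<close> the part
  from \<open>k2 - k1\<close> is nonnegative and the rest is bounded by a multiple of
  \<open>\<bar>\<theta>2 - \<theta>1\<bar>\<close>, which is what \<open>gronwall_nonneg\<close>
  tolerates.\<close>

lemma prufer_mono:
  assumes k: "bcont k1" and p: "prufer k1 \<theta>1" "prufer k2 \<theta>2" and le: "\<And>x. k1 x \<le> k2 x"
    and 0: "\<theta>1 0 \<le> \<theta>2 0" and x: "0 \<le> x"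
  shows "\<theta>1 x \<le> \<theta>2 x"
proof -
  obtain C where C: "C > 0" "\<And>x. w x * \<bar>k1 x - 1\<bar> \<le> C" using bcont_bound[OF k] by metis
  define d' where "d' t = w t * (1 + (k2 t - 1) * (sin (\<theta>2 t))\<^sup>2) - w t * (1 + (k1 t - 1) * (sin (\<theta>1 t))\<^sup>2)" for t
  have "((\<lambda>t. \<theta>2 t - \<theta>1 t) has_real_derivative d' t) (at t)" for t
    using p unfolding prufer_def d'_def by (intro derivative_intros) auto
  moreover have "- C * \<bar>\<theta>2 t - \<theta>1 t\<bar> \<le> d' t" for t
  proof -
    have "d' t = (w t * (k1 t - 1)) * ((sin (\<theta>2 t))\<^sup>2 - (sin (\<theta>1 t))\<^sup>2) + w t * (k2 t - k1 t) * (sin (\<theta>2 t))\<^sup>2"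
      by (simp add: d'_def algebra_simps)
    moreover have "0 \<le> w t * (k2 t - k1 t) * (sin (\<theta>2 t))\<^sup>2" using w_pos[of t] le[of t] by simp
    ultimately show ?thesis using prufer_diff_bound[where x = t and k = k1 and u = "\<theta>2 t" and v = "\<theta>1 t", OF C(2)] by linarith
  qed
  ultimately have "0 \<le> \<theta>2 x - \<theta>1 x"
    using 0 x by - (rule gronwall_nonneg[of "\<lambda>t. \<theta>2 t - \<theta>1 t" d' C], auto)
  then show ?thesis by simp
qed

text \<open>The weighted difference \<open>e\<close> is nonnegative and nondecreasing, so equality
  at \<open>x\<close> forces it to vanish on \<open>[0, x]\<close>. This contradicts a strict start;
  under strict inequality of the coefficients it makes \<open>sin (\<theta>2 t)\<close> vanish on an
  interval, which is impossible because the angle moves with speed \<open>w > 0\<close> wherever its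
  sine is 0.\<close>

lemma prufer_strict_mono:
  assumes k: "bcont k1" and p: "prufer k1 \<theta>1" "prufer k2 \<theta>2" and le: "\<And>x. k1 x \<le> k2 x"
    and 0: "\<theta>1 0 \<le> \<theta>2 0" and x: "0 < x"
    and strict: "\<theta>1 0 < \<theta>2 0 \<or> (\<forall>x. k1 x < k2 x)"
  shows "\<theta>1 x < \<theta>2 x"
proof (rule ccontr)
  assume "\<not> \<theta>1 x < \<theta>2 x"
  with prufer_mono[OF k p le 0, of x] x have eqx: "\<theta>1 x = \<theta>2 x" by simp
  obtain C where C: "C > 0" "\<And>x. w x * \<bar>k1 x - 1\<bar> \<le> C" using bcont_bound[OF k] by metis
  define d' where "d' t = w t * (1 + (k2 t - 1) * (sin (\<theta>2 t))\<^sup>2) - w t * (1 + (k1 t - 1) * (sin (\<theta>1 t))\<^sup>2)" for t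
  have d: "((\<lambda>t. \<theta>2 t - \<theta>1 t) has_real_derivative d' t) (at t)" for t
    using p unfolding prufer_def d'_def by (intro derivative_intros) auto
  define e where "e t = (\<theta>2 t - \<theta>1 t) * exp (C * t)" for t
  have e: "(e has_real_derivative (d' t + C * (\<theta>2 t - \<theta>1 t)) * exp (C * t)) (at t)" for t
    unfolding e_def by (rule derivative_eq_intros d refl | simp add: algebra_simps)+
  have low: "w t * (k2 t - k1 t) * (sin (\<theta>2 t))\<^sup>2 \<le> d' t + C * (\<theta>2 t - \<theta>1 t)" if "t \<ge> 0" for t
  proof -
    have "d' t = (w t * (k1 t - 1)) * ((sin (\<theta>2 t))\<^sup>2 - (sin (\<theta>1 t))\<^sup>2) + w t * (k2 t - k1 t) * (sin (\<theta>2 t))\<^sup>2"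
      by (simp add: d'_def algebra_simps)
    then show ?thesis using prufer_diff_bound[where x = t and k = k1 and u = "\<theta>2 t" and v = "\<theta>1 t", OF C(2)] prufer_mono[OF k p le 0 that]
      by auto
  qed
  have nn: "0 \<le> w t * (k2 t - k1 t) * (sin (\<theta>2 t))\<^sup>2" for t using w_pos[of t] le[of t] by simp
  have mono: "e s \<le> e t" if "0 \<le> s" "s \<le> t" for s t
  proof (rule DERIV_nonneg_imp_nondecreasing[OF that(2)])
    fix u assume "s \<le> u" "u \<le> t"
    then show "\<exists>y. (e has_real_derivative y) (at u) \<and> 0 \<le> y"
      using e[of u] low[of u] nn[of u] that by (intro exI[of _ "(d' u + C * (\<theta>2 u - \<theta>1 u)) * exp (C * u)"]) auto
  qed
  have e0: "0 \<le> e t" if "t \<ge> 0" for t using prufer_mono[OF k p le 0 that] by (simp add: e_def)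
  have ez: "e t = 0" if "0 \<le> t" "t \<le> x" for t
    using mono[OF that] e0[OF that(1)] eqx by (simp add: e_def)
  then have "e 0 = 0" using x by simp
  then have kk: "\<forall>x. k1 x < k2 x" using strict by (simp add: e_def)
  have sz: "sin (\<theta>2 t) = 0" if "0 < t" "t < x" for t
  proof -
    have "(e has_real_derivative 0) (at t)"
      by (rule has_field_derivative_transform_within_open[of "\<lambda>t. 0" _ _ "{0<..<x}"]) (use that ez in auto)
    then have "(d' t + C * (\<theta>2 t - \<theta>1 t)) * exp (C * t) = 0" using e DERIV_unique by blast
    then have "w t * (k2 t - k1 t) * (sin (\<theta>2 t))\<^sup>2 \<le> 0" using low[of t] that by simp
    then show ?thesis using w_pos[of t] kk by (simp add: mult_le_0_iff not_le) (smt (verit))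
  qed
  define t where "t = x / 2"
  have t: "0 < t" "t < x" using x by (auto simp: t_def)
  have "((\<lambda>t. sin (\<theta>2 t)) has_real_derivative 0) (at t)"
    by (rule has_field_derivative_transform_within_open[of "\<lambda>t. 0" _ _ "{0<..<x}"]) (use sz t in auto)
  moreover have "(\<theta>2 has_real_derivative w t) (at t)" using p(2) sz[OF t] unfolding prufer_def by (metis add_0_right mult_1_right mult_zero_right power_zero_numeral)
  then have "((\<lambda>t. sin (\<theta>2 t)) has_real_derivative cos (\<theta>2 t) * w t) (at t)" by (intro DERIV_chain2[OF DERIV_sin])
  ultimately have "cos (\<theta>2 t) * w t = 0" using DERIV_unique by blast
  then show False using w_pos[of t] sz[OF t] sin_cos_squared_add[of "\<theta>2 t"] by simp
qed

text \<open>The speed of the angle is at least \<open>w - C * \<bar>\<theta>\<bar>\<close>. Hence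
  the angle first stays nonnegative, and then its product with \<open>exp (C * t)\<close> increases
  strictly.\<close>

lemma prufer_pos:
  assumes k: "bcont k" and p: "prufer k \<theta>" and 0: "0 \<le> \<theta> 0" and x: "0 < x"
  shows "0 < \<theta> x"
proof -
  obtain C where C: "C > 0" "\<And>x. w x * \<bar>k x - 1\<bar> \<le> C" using bcont_bound[OF k] by metis
  have low: "w t - C * \<bar>\<theta> t\<bar> \<le> w t * (1 + (k t - 1) * (sin (\<theta> t))\<^sup>2)" for t
    using prufer_diff_bound[where x = t and k = k and u = "\<theta> t" and v = 0, OF C(2)] by (simp add: algebra_simps)
  have nn: "0 \<le> \<theta> t" if "0 \<le> t" for t
  proof (rule gronwall_nonneg[of \<theta> _ C, OF _ _ 0 that])
    show "(\<theta> has_real_derivative w t * (1 + (k t - 1) * (sin (\<theta> t))\<^sup>2)) (at t)" for t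
      using p by (simp add: prufer_def)
    show "- C * \<bar>\<theta> t\<bar> \<le> w t * (1 + (k t - 1) * (sin (\<theta> t))\<^sup>2)" for t
      using low[of t] w_pos[of t] by simp
  qed
  define e where "e t = \<theta> t * exp (C * t)" for t
  have e: "(e has_real_derivative (w t * (1 + (k t - 1) * (sin (\<theta> t))\<^sup>2) + C * \<theta> t) * exp (C * t)) (at t)" for t
    unfolding e_def using p unfolding prufer_def by (auto intro!: derivative_eq_intros simp: algebra_simps)
  have "e 0 < e x"
  proof (rule DERIV_pos_imp_increasing[OF x])
    fix t assume "0 \<le> t" "t \<le> x"
    then have "0 < w t * (1 + (k t - 1) * (sin (\<theta> t))\<^sup>2) + C * \<theta> t" using low[of t] nn[of t] w_pos[of t] by simp
    then show "\<exists>y. (e has_real_derivative y) (at t) \<and> 0 < y" using e[of t] by (intro exI[of _ "(w t * (1 + (k t - 1) * (sin (\<theta> t))\<^sup>2) + C * \<theta> t) * exp (C * t)"]) auto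
  qed
  then have "0 < \<theta> x * exp (C * x)" using 0 by (simp add: e_def)
  then show ?thesis by (simp add: zero_less_mult_iff)
qed

text \<open>The constant depends on \<open>k1\<close> alone; this will give continuity of the end
  angle in the eigenvalue parameter.\<close>

lemma prufer_lipschitz:
  assumes k: "bcont k1" obtains D where "\<And>k2 \<theta>1 \<theta>2 \<delta>. prufer k1 \<theta>1 \<Longrightarrow> prufer k2 \<theta>2 \<Longrightarrow> \<theta>1 0 = \<theta>2 0 \<Longrightarrow>
    (\<And>x. \<bar>k1 x - k2 x\<bar> \<le> \<delta>) \<Longrightarrow> \<bar>\<theta>1 (pi/2) - \<theta>2 (pi/2)\<bar> \<le> D * \<delta>"
proof -
  obtain C where C: "C > 0" "\<And>x. w x * \<bar>k1 x - 1\<bar> \<le> C" "\<And>x. w x \<le> C" using bcont_bound[OF k] by metis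
  have main: "s * (\<theta>1 (pi/2) - \<theta>2 (pi/2)) \<le> (exp (2 * C * (pi/2))) * \<delta>"
    if p: "prufer k1 \<theta>1" "prufer k2 \<theta>2" and 0: "\<theta>1 0 = \<theta>2 0" and \<delta>: "\<And>x. \<bar>k1 x - k2 x\<bar> \<le> \<delta>" and s: "\<bar>s\<bar> = 1"
    for k2 \<theta>1 \<theta>2 \<delta> s
  proof -
    have "\<delta> \<ge> 0" using \<delta>[of 0] by linarith
    \<comment> \<open>\<open>exp (2 * C * t) * \<delta>\<close> is a supersolution for the
      difference of the angles: one \<open>C\<close> pays for the Lipschitz term, the other for the
      inhomogeneity \<open>C * \<delta>\<close>. The sign \<open>s\<close> covers both halves of the
      absolute value.\<close>
    define g where "g t = exp (2 * C * t) * \<delta> - s * (\<theta>1 t - \<theta>2 t)" for t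
    define g' where "g' t = 2 * C * exp (2 * C * t) * \<delta> - s * (w t * (1 + (k1 t - 1) * (sin (\<theta>1 t))\<^sup>2) - w t * (1 + (k2 t - 1) * (sin (\<theta>2 t))\<^sup>2))" for t
    have "(g has_real_derivative g' t) (at t)" for t
      unfolding g_def g'_def using p unfolding prufer_def by (auto intro!: derivative_eq_intros)
    moreover have "- C * \<bar>g t\<bar> \<le> g' t" if "t \<ge> 0" for t
    proof -
      define u where "u = (w t * (k1 t - 1)) * ((sin (\<theta>1 t))\<^sup>2 - (sin (\<theta>2 t))\<^sup>2)"
      define v where "v = w t * (k1 t - k2 t) * (sin (\<theta>2 t))\<^sup>2"
      have e: "g' t = 2 * C * exp (2 * C * t) * \<delta> - s * (u + v)" by (simp add: g'_def u_def v_def algebra_simps)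
      have u: "\<bar>u\<bar> \<le> C * \<bar>\<theta>1 t - \<theta>2 t\<bar>"
        unfolding abs_mult u_def using C w_pos[of t] by (intro mult_mono sin_squared_diff_le) auto
      have v: "\<bar>v\<bar> \<le> C * \<delta> * 1"
        unfolding abs_mult v_def using C w_pos[of t] \<delta>[of t] \<open>\<delta> \<ge> 0\<close> by (intro mult_mono) (auto simp: abs_square_le_1)
      define E where "E = exp (2 * C * t)"
      define D where "D = s * (\<theta>1 t - \<theta>2 t)"
      have "1 * \<delta> \<le> E * \<delta>" using C that \<open>\<delta> \<ge> 0\<close> by (intro mult_right_mono) (auto simp: E_def)
      then have E: "C * \<delta> \<le> C * (E * \<delta>)" using C by simp
      have D: "\<bar>D\<bar> = \<bar>\<theta>1 t - \<theta>2 t\<bar>" using s by (simp add: D_def abs_mult)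
      have su: "s * (u + v) \<le> C * \<bar>D\<bar> + C * \<delta>"
      proof -
        have "s * (u + v) \<le> \<bar>s * (u + v)\<bar>" by simp
        also have "\<dots> = \<bar>u + v\<bar>" using s by (simp add: abs_mult)
        finally show ?thesis using u v unfolding D by linarith
      qed
      have g: "g t = E * \<delta> - D" by (simp add: g_def E_def D_def)
      have "2 * (C * (E * \<delta>)) - C * \<bar>D\<bar> - C * \<delta> \<le> g' t" using su unfolding e E_def[symmetric] by (simp add: mult.assoc)
      moreover have "C * \<bar>D\<bar> \<le> C * (E * \<delta>) + C * \<bar>g t\<bar>"
      proof -
        have "0 \<le> E * \<delta>" using \<open>\<delta> \<ge> 0\<close> by (simp add: E_def)
        then have "\<bar>D\<bar> \<le> E * \<delta> + \<bar>g t\<bar>" unfolding g by linarith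
        then show ?thesis using C(1) by (metis distrib_left less_imp_le mult_left_mono)
      qed
      ultimately show ?thesis using E by linarith
    qed
    ultimately have "0 \<le> g (pi/2)"
      by (rule gronwall_nonneg[of g g' C "pi/2"]) (use 0 \<open>\<delta> \<ge> 0\<close> in \<open>auto simp: g_def\<close>)
    then show ?thesis by (simp add: g_def)
  qed
  show ?thesis by (rule that[of "exp (2 * C * (pi/2))"]) (use main[of _ _ _ _ 1] main[of _ _ _ _ "-1"] in \<open>force simp: abs_le_iff\<close>)
qed

end

text \<open>Boundary conditions are encoded by truth values: \<open>nu\<close> for the end point \<open>0\<close> and \<open>nu'\<close> for
  \<open>pi/2\<close>, where \<open>True\<close> is the Neumann condition (solutions even under the reflection at that point)
  and \<open>False\<close> the Dirichlet condition (odd solutions).\<close>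

abbreviation sg :: "bool \<Rightarrow> real" where "sg nu \<equiv> (if nu then 1 else - 1)"

context sturm
begin

section \<open>Solutions of the linear system\<close>

lemma solutionD:
  "solution k a b \<Longrightarrow> (a has_real_derivative w x * b x) (at x)"
  "solution k a b \<Longrightarrow> (b has_real_derivative - (w x * k x * a x)) (at x)"
  by (auto simp: solution_def)

text \<open>The energy \<open>a^2 + b^2\<close> changes at most at the exponential rate
  \<open>C\<close>, to the right and to the left, so it stays 0 once it is 0.\<close>

lemma solution_unique:
  assumes k: "bcont k" and s: "solution k a b" and 0: "a x0 = 0" "b x0 = 0"
  shows "a x = 0 \<and> b x = 0"
proof -
  obtain C where C: "C > 0" "\<And>x. w x * \<bar>k x - 1\<bar> \<le> C" using bcont_bound[OF k] by metis
  define e where "e x = (a x)\<^sup>2 + (b x)\<^sup>2" for x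
  define e' where "e' x = 2 * w x * (1 - k x) * (a x * b x)" for x
  have e: "(e has_real_derivative e' x) (at x)" for x
  proof -
    have "(e has_real_derivative 2 * a x * (w x * b x) + 2 * b x * (- (w x * k x * a x))) (at x)"
      unfolding e_def by (auto intro!: derivative_eq_intros solutionD[OF s])
    then show ?thesis by (simp add: e'_def algebra_simps)
  qed
  have bd: "\<bar>e' x\<bar> \<le> C * e x" for x
  proof -
    have "2 * \<bar>a x * b x\<bar> \<le> e x"
      using sum_squares_bound[of "\<bar>a x\<bar>" "\<bar>b x\<bar>"] by (simp add: e_def abs_mult)
    then have "(w x * \<bar>k x - 1\<bar>) * (2 * \<bar>a x * b x\<bar>) \<le> C * e x"
      using C w_pos[of x] by (intro mult_mono) auto
    moreover have "\<bar>e' x\<bar> = (w x * \<bar>k x - 1\<bar>) * (2 * \<bar>a x * b x\<bar>)"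
      using w_pos[of x] by (simp add: e'_def abs_mult abs_minus_commute)
    ultimately show ?thesis by simp
  qed
  have e0: "e x0 = 0" using 0 by (simp add: e_def)
  have nn: "0 \<le> e x" for x by (simp add: e_def)
  have "e x \<le> 0"
  proof (cases "x0 \<le> x")
    case True
    have "e x * exp (- C * x) \<le> e x0 * exp (- C * x0)"
    proof (rule DERIV_nonpos_imp_nonincreasing[OF True])
      fix t
      have "((\<lambda>x. e x * exp (- C * x)) has_real_derivative (e' t - C * e t) * exp (- C * t)) (at t)"
        by (rule derivative_eq_intros e refl | simp add: algebra_simps)+
      moreover have "(e' t - C * e t) * exp (- C * t) \<le> 0"
        using bd[of t] by (intro mult_nonpos_nonneg) auto
      ultimately show "\<exists>y. ((\<lambda>x. e x * exp (- C * x)) has_real_derivative y) (at t) \<and> y \<le> 0" by blast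
    qed
    then show ?thesis using e0 by (simp add: mult_le_0_iff not_le)
  next
    case False
    then have "x \<le> x0" by simp
    have "e x * exp (C * x) \<le> e x0 * exp (C * x0)"
    proof (rule DERIV_nonneg_imp_nondecreasing[OF \<open>x \<le> x0\<close>])
      fix t
      have "((\<lambda>x. e x * exp (C * x)) has_real_derivative (e' t + C * e t) * exp (C * t)) (at t)"
        by (rule derivative_eq_intros e refl | simp add: algebra_simps)+
      moreover have "0 \<le> (e' t + C * e t) * exp (C * t)"
        using bd[of t] by (intro mult_nonneg_nonneg) auto
      ultimately show "\<exists>y. ((\<lambda>x. e x * exp (C * x)) has_real_derivative y) (at t) \<and> 0 \<le> y" by blast
    qed
    then show ?thesis using e0 by (simp add: mult_le_0_iff not_le)
  qed
  then have "e x = 0" using nn[of x] by simp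
  then show ?thesis by (simp add: e_def sum_power2_eq_zero_iff)
qed

lemma solution_lincomb:
  assumes "solution k a b" "solution k c d"
  shows "solution k (\<lambda>x. s * a x + t * c x) (\<lambda>x. s * b x + t * d x)"
  unfolding solution_def
proof (intro allI conjI)
  fix x
  show "((\<lambda>x. s * a x + t * c x) has_real_derivative w x * (s * b x + t * d x)) (at x)"
    using DERIV_add[OF DERIV_cmult[OF solutionD(1)[OF assms(1)], of s x] DERIV_cmult[OF solutionD(1)[OF assms(2)], of t x]]
    by (simp add: algebra_simps)
  show "((\<lambda>x. s * b x + t * d x) has_real_derivative - (w x * k x * (s * a x + t * c x))) (at x)"
    using DERIV_add[OF DERIV_cmult[OF solutionD(2)[OF assms(1)], of s x] DERIV_cmult[OF solutionD(2)[OF assms(2)], of t x]]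
    by (simp add: algebra_simps)
qed

lemma solution_eq_at:
  assumes k: "bcont k" and s: "solution k a b" "solution k c d" and 0: "a x0 = c x0" "b x0 = d x0"
  shows "a x = c x" "b x = d x"
  using solution_unique[OF k solution_lincomb[OF s, of 1 "-1"], of x0 x] 0 by auto

text \<open>Applied with \<open>e = -1\<close>, \<open>c = 0\<close> or \<open>c = pi\<close> for
  the reflections and with \<open>e = 1\<close>, \<open>c = pi\<close> for the shift, all of them
  symmetries of \<open>w\<close> and \<open>\<rho>\<close>.\<close>

lemma solution_affine:
  assumes s: "solution k a b" and e: "\<bar>e\<bar> = 1"
    and k: "\<And>x. k (e * x + c) = k x" and w: "\<And>x. w (e * x + c) = w x"
  shows "solution k (\<lambda>x. a (e * x + c)) (\<lambda>x. e * b (e * x + c))"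
  unfolding solution_def
proof (intro allI conjI)
  fix x
  have d: "((\<lambda>x. e * x + c) has_real_derivative e) (at x)" by (auto intro!: derivative_eq_intros)
  show "((\<lambda>x. a (e * x + c)) has_real_derivative w x * (e * b (e * x + c))) (at x)"
    using DERIV_chain2[OF solutionD(1)[OF s] d] by (simp add: w mult_ac)
  have "((\<lambda>x. e * b (e * x + c)) has_real_derivative e * (- (w x * k x * a (e * x + c)) * e)) (at x)"
    using DERIV_cmult[OF DERIV_chain2[OF solutionD(2)[OF s] d], of e] by (simp add: w k)
  moreover have "e * (- W * e) = - W" for W using e by (cases "e \<ge> 0") auto
  ultimately show "((\<lambda>x. e * b (e * x + c)) has_real_derivative - (w x * k x * a (e * x + c))) (at x)"
    by metis
qed

text \<open>Reverses the substitution: once the angle is known, the logarithm of the amplitude is a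
  primitive of \<open>w (1 - k) sin \<theta> cos \<theta>\<close>. Existence for the linear system
  thus reduces to the scalar equation.\<close>

lemma solution_of_prufer:
  assumes k: "bcont k" and p: "prufer k \<theta>"
  obtains R where "\<And>x. R x > 0" "R 0 = 1" "solution k (\<lambda>x. R x * sin (\<theta> x)) (\<lambda>x. R x * cos (\<theta> x))"
proof -
  have \<theta>: "(\<theta> has_real_derivative w x * (1 + (k x - 1) * (sin (\<theta> x))\<^sup>2)) (at x)" for x
    using p by (simp add: prufer_def)
  have \<theta>c: "continuous_on UNIV \<theta>" by (meson \<theta> DERIV_isCont continuous_at_imp_continuous_on)
  have kc: "continuous_on UNIV k" using k by (simp add: bcont_def)
  have c: "continuous_on UNIV (\<lambda>x. w x * (1 - k x) * sin (\<theta> x) * cos (\<theta> x))"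
    by (intro continuous_intros \<theta>c kc w_cont)
  obtain r where r: "\<And>x. (r has_real_derivative w x * (1 - k x) * sin (\<theta> x) * cos (\<theta> x)) (at x)" "r 0 = 0"
    by (rule primitive_exists[OF c]) (rule that)
  show ?thesis
  proof (rule that[of "\<lambda>x. exp (r x)"])
    show "solution k (\<lambda>x. exp (r x) * sin (\<theta> x)) (\<lambda>x. exp (r x) * cos (\<theta> x))"
      unfolding solution_def
    proof (intro allI conjI)
      fix x
      define S C where "S = sin (\<theta> x)" and "C = cos (\<theta> x)"
      have sc: "C * C = 1 - S * S" using sin_cos_squared_add[of "\<theta> x"] by (simp add: S_def C_def power2_eq_square algebra_simps)
      have 1: "((\<lambda>x. exp (r x) * sin (\<theta> x)) has_real_derivative
         exp (r x) * (w x * (1 - k x) * S * C) * S + C * (w x * (1 + (k x - 1) * S\<^sup>2)) * exp (r x)) (at x)"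
        unfolding S_def C_def by (rule DERIV_mult[OF DERIV_chain2[OF DERIV_exp r(1)] DERIV_chain2[OF DERIV_sin \<theta>]])
      show "((\<lambda>x. exp (r x) * sin (\<theta> x)) has_real_derivative w x * (exp (r x) * cos (\<theta> x))) (at x)"
        by (rule DERIV_cong[OF 1]) (simp add: C_def[symmetric] power2_eq_square algebra_simps)
      have 2: "((\<lambda>x. exp (r x) * cos (\<theta> x)) has_real_derivative
         exp (r x) * (w x * (1 - k x) * S * C) * C + (- S * (w x * (1 + (k x - 1) * S\<^sup>2))) * exp (r x)) (at x)"
        unfolding S_def C_def by (rule DERIV_mult[OF DERIV_chain2[OF DERIV_exp r(1)] DERIV_chain2[OF DERIV_cos \<theta>]])
      have "exp (r x) * (w x * (1 - k x) * S * C) * C = exp (r x) * w x * (1 - k x) * S * (C * C)" by simp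
      also have "\<dots> = exp (r x) * w x * (1 - k x) * S * (1 - S * S)" unfolding sc ..
      finally have 3: "exp (r x) * (w x * (1 - k x) * S * C) * C = exp (r x) * w x * (1 - k x) * S * (1 - S * S)" .
      show "((\<lambda>x. exp (r x) * cos (\<theta> x)) has_real_derivative - (w x * k x * (exp (r x) * sin (\<theta> x)))) (at x)"
        by (rule DERIV_cong[OF 2], unfold 3) (simp add: S_def[symmetric] power2_eq_square algebra_simps)
    qed
  qed (use r(2) in auto)
qed

text \<open>At 0 the angle \<open>pi/2\<close> means \<open>b = 0\<close> (Neumann) and the angle 0
  means \<open>a = 0\<close> (Dirichlet).\<close>

definition theta :: "bool \<Rightarrow> (real \<Rightarrow> real) \<Rightarrow> real \<Rightarrow> real" where
  "theta nu k = (SOME \<theta>. prufer k \<theta> \<and> \<theta> 0 = (if nu then pi/2 else 0))"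

lemma theta:
  assumes "bcont k" shows "prufer k (theta nu k)" "theta nu k 0 = (if nu then pi/2 else 0)"
proof -
  have "\<exists>\<theta>. prufer k \<theta> \<and> \<theta> 0 = (if nu then pi/2 else 0)" using prufer_exists[OF assms] by metis
  then have "prufer k (theta nu k) \<and> theta nu k 0 = (if nu then pi/2 else 0)"
    unfolding theta_def by (rule someI_ex)
  then show "prufer k (theta nu k)" "theta nu k 0 = (if nu then pi/2 else 0)" by auto
qed

definition amp :: "bool \<Rightarrow> (real \<Rightarrow> real) \<Rightarrow> real \<Rightarrow> real" where
  "amp nu k = (SOME R. (\<forall>x. R x > 0) \<and> R 0 = 1 \<and>
     solution k (\<lambda>x. R x * sin (theta nu k x)) (\<lambda>x. R x * cos (theta nu k x)))"

definition base :: "bool \<Rightarrow> (real \<Rightarrow> real) \<Rightarrow> real \<Rightarrow> real" where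
  "base nu k x = amp nu k x * sin (theta nu k x)"
definition base' :: "bool \<Rightarrow> (real \<Rightarrow> real) \<Rightarrow> real \<Rightarrow> real" where
  "base' nu k x = amp nu k x * cos (theta nu k x)"

lemma amp:
  assumes "bcont k" shows "amp nu k x > 0" "amp nu k 0 = 1" "solution k (base nu k) (base' nu k)"
proof -
  have "\<exists>R. (\<forall>x. R x > 0) \<and> R 0 = 1 \<and> solution k (\<lambda>x. R x * sin (theta nu k x)) (\<lambda>x. R x * cos (theta nu k x))"
    using solution_of_prufer[OF assms theta(1)[OF assms]] by metis
  from someI_ex[OF this, folded amp_def]
  show "amp nu k x > 0" "amp nu k 0 = 1" "solution k (base nu k) (base' nu k)"
    by (auto simp: base_def[abs_def] base'_def[abs_def])
qed

lemma base_0: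
  assumes "bcont k" shows "base nu k 0 = (if nu then 1 else 0)" "base' nu k 0 = (if nu then 0 else 1)"
  using amp(2)[OF assms] theta(2)[OF assms] by (auto simp: base_def base'_def)

section \<open>The angle at the right end point\<close>

definition ang :: "bool \<Rightarrow> (real \<Rightarrow> real) \<Rightarrow> real" where "ang nu k = theta nu k (pi/2)"

lemma base_end:
  assumes "bcont k"
  shows "base nu k (pi/2) = 0 \<longleftrightarrow> sin (ang nu k) = 0" "base' nu k (pi/2) = 0 \<longleftrightarrow> cos (ang nu k) = 0"
  using amp(1)[OF assms, of nu "pi/2"] by (auto simp: base_def base'_def ang_def)

lemma ang_mono:
  assumes "bcont k1" "bcont k2" "\<And>x. k1 x \<le> k2 x" shows "ang nu k1 \<le> ang nu k2"
  unfolding ang_def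
  using prufer_mono[OF assms(1) theta(1)[OF assms(1)] theta(1)[OF assms(2)] assms(3), of nu nu "pi/2"]
  by (simp add: theta(2) assms)

lemma ang_strict_mono:
  assumes "bcont k1" "bcont k2" "\<And>x. k1 x < k2 x" shows "ang nu k1 < ang nu k2"
  unfolding ang_def
  using prufer_strict_mono[OF assms(1) theta(1)[OF assms(1)] theta(1)[OF assms(2)] less_imp_le[OF assms(3)], of nu nu "pi/2"]
    assms(3) by (simp add: theta(2) assms(1,2))

lemma ang_pos: "bcont k \<Longrightarrow> ang nu k > 0"
  unfolding ang_def by (rule prufer_pos[OF _ theta(1)]) (auto simp: theta(2))

lemma ang_False_less: "bcont k \<Longrightarrow> ang False k < ang True k"
  unfolding ang_def by (rule prufer_strict_mono[OF _ theta(1) theta(1)]) (auto simp: theta(2))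

text \<open>The Dirichlet angle raised by \<open>pi\<close> solves the same equation and starts
  above \<open>pi/2\<close>, so Neumann and Dirichlet angles interlace.\<close>

lemma ang_True_less: assumes "bcont k" shows "ang True k < ang False k + pi"
proof -
  have "prufer k (\<lambda>x. theta False k x + pi)"
    using theta(1)[OF assms, of False] unfolding prufer_def by (auto intro!: derivative_eq_intros)
  from prufer_strict_mono[OF assms theta(1)[OF assms] this, of True "pi/2"] show ?thesis
    using theta(2)[OF assms] by (simp add: ang_def)
qed

lemma bcont_const: "bcont (\<lambda>x. c)"
  by (simp add: bcont_def)

text \<open>For \<open>k = 0\<close> constants solve the Neumann problem, and their angle stays at
  \<open>pi/2\<close>. This is the reference value for coefficients of one sign.\<close>

lemma ang_0: "ang True (\<lambda>x. 0) = pi/2"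
proof -
  have p: "prufer (\<lambda>x. 0) (\<lambda>x. pi/2)" by (simp add: prufer_def)
  note t = theta[where nu = True and k = "\<lambda>x. 0", OF bcont_const]
  show ?thesis unfolding ang_def
    using prufer_mono[OF bcont_const t(1) p, where x = "pi/2"] prufer_mono[OF bcont_const p t(1), where x = "pi/2"] t(2)
    by (intro antisym) auto
qed

lemma ang_nonpos: assumes "bcont k" "\<And>x. k x \<le> 0" shows "ang nu k \<le> pi/2"
proof -
  have "ang nu k \<le> ang True k" using ang_False_less[OF assms(1)] by (cases nu) auto
  also have "\<dots> \<le> pi/2" using ang_mono[OF assms(1) bcont_const[of 0] assms(2), of True] ang_0 by simp
  finally show ?thesis .
qed

lemma ang_neg: assumes "bcont k" "\<And>x. k x < 0" shows "ang nu k < pi/2"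
proof -
  have "ang nu k \<le> ang True k" using ang_False_less[OF assms(1)] by (cases nu) auto
  also have "\<dots> < pi/2" using ang_strict_mono[OF assms(1) bcont_const[of 0] assms(2), of True] ang_0 by simp
  finally show ?thesis .
qed

lemma ang_nonneg: assumes "bcont k" "\<And>x. 0 \<le> k x" shows "ang True k \<ge> pi/2"
  using ang_mono[OF bcont_const[of 0] assms, of True] ang_0 by simp

section \<open>Spectra of the Sturm-Liouville problems\<close>

definition kap :: "real \<Rightarrow> real \<Rightarrow> real \<Rightarrow> real" where "kap l lam x = lam * \<rho> x - l\<^sup>2"

lemma kap_even: "kap l lam (- x) = kap l lam x" and kap_periodic: "kap l lam (x + pi) = kap l lam x"
  by (simp_all add: kap_def \<rho>_even \<rho>_periodic)

lemma kap_reflect: "kap l lam (pi - x) = kap l lam x" and w_reflect: "w (pi - x) = w x"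
  using kap_periodic[of l lam "- x"] w_periodic[of "- x"] by (simp_all add: kap_even w_even)

lemma bcont_kap: "bcont (kap l lam)"
proof -
  obtain c d where cd: "c > 0" "\<And>x. c \<le> \<rho> x" "\<And>x. \<rho> x \<le> d" using \<rho>_bounded by metis
  have "\<bar>kap l lam x\<bar> \<le> \<bar>lam\<bar> * d + l\<^sup>2" for x
  proof -
    have "\<bar>lam * \<rho> x\<bar> \<le> \<bar>lam\<bar> * d"
      unfolding abs_mult using cd \<rho>_pos[of x] by (intro mult_left_mono) auto
    then show ?thesis unfolding kap_def by (smt (verit) zero_le_power2)
  qed
  then have "bounded (range (kap l lam))" unfolding bounded_iff by auto
  moreover have "continuous_on UNIV (kap l lam)"
    unfolding kap_def[abs_def] by (intro continuous_intros \<rho>_cont)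
  ultimately show ?thesis by (simp add: bcont_def)
qed

abbreviation Ang :: "bool \<Rightarrow> real \<Rightarrow> real \<Rightarrow> real" where "Ang nu l lam \<equiv> ang nu (kap l lam)"

lemma Ang_strict_mono: "lam1 < lam2 \<Longrightarrow> Ang nu l lam1 < Ang nu l lam2"
  by (intro ang_strict_mono bcont_kap) (simp add: kap_def \<rho>_pos)

lemma Ang_strict_antimono: "l1\<^sup>2 < l2\<^sup>2 \<Longrightarrow> Ang nu l2 lam < Ang nu l1 lam"
  by (intro ang_strict_mono bcont_kap) (simp add: kap_def)

lemma Ang_inj: "Ang nu l lam1 = Ang nu l lam2 \<Longrightarrow> lam1 = lam2"
  by (metis Ang_strict_mono less_irrefl linorder_neqE)

lemma Ang_cont: "continuous_on S (Ang nu l)"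
proof -
  obtain c d where cd: "c > 0" "\<And>x. c \<le> \<rho> x" "\<And>x. \<rho> x \<le> d" using \<rho>_bounded by metis
  have d: "d > 0" using cd(1) cd(2)[of 0] cd(3)[of 0] by linarith
  have "isCont (Ang nu l) lam" for lam
  proof -
    obtain D where D: "\<And>k2 \<theta>1 \<theta>2 \<delta>. prufer (kap l lam) \<theta>1 \<Longrightarrow> prufer k2 \<theta>2 \<Longrightarrow> \<theta>1 0 = \<theta>2 0 \<Longrightarrow>
      (\<And>x. \<bar>kap l lam x - k2 x\<bar> \<le> \<delta>) \<Longrightarrow> \<bar>\<theta>1 (pi/2) - \<theta>2 (pi/2)\<bar> \<le> D * \<delta>"
      using prufer_lipschitz[OF bcont_kap] by metis
    have lip: "\<bar>Ang nu l lam - Ang nu l mu\<bar> \<le> D * (\<bar>lam - mu\<bar> * d)" for mu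
      unfolding ang_def
    proof (rule D)
      show "prufer (kap l lam) (theta nu (kap l lam))" "prufer (kap l mu) (theta nu (kap l mu))"
        by (intro theta(1) bcont_kap)+
      show "theta nu (kap l lam) 0 = theta nu (kap l mu) 0" by (simp add: theta(2) bcont_kap)
      fix x
      have "kap l lam x - kap l mu x = (lam - mu) * \<rho> x" by (simp add: kap_def algebra_simps)
      then show "\<bar>kap l lam x - kap l mu x\<bar> \<le> \<bar>lam - mu\<bar> * d"
        using cd(3)[of x] \<rho>_pos[of x] by (simp add: abs_mult mult_left_mono)
    qed
    have "((\<lambda>mu. Ang nu l mu - Ang nu l lam) \<longlongrightarrow> 0) (at lam)"
    proof (rule Lim_null_comparison)
      show "\<forall>\<^sub>F mu in at lam. norm (Ang nu l mu - Ang nu l lam) \<le> D * (\<bar>lam - mu\<bar> * d)"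
        using lip by (intro always_eventually) (simp add: abs_minus_commute)
      show "((\<lambda>mu. D * (\<bar>lam - mu\<bar> * d)) \<longlongrightarrow> 0) (at lam)" by (auto intro!: tendsto_eq_intros)
    qed
    then show ?thesis unfolding isCont_def using LIM_zero_iff by blast
  qed
  then show ?thesis by (simp add: continuous_at_imp_continuous_on)
qed

lemma Ang_value_exists:
  assumes "Ang nu l a \<le> t" "t \<le> Ang nu l b" "a \<le> b"
  shows "\<exists>lam\<ge>a. lam \<le> b \<and> Ang nu l lam = t"
  using IVT'[of "Ang nu l" a t b] assms Ang_cont by blast

definition spec :: "bool \<Rightarrow> bool \<Rightarrow> real \<Rightarrow> real set" where
  "spec nu nu' l = {lam. if nu' then cos (Ang nu l lam) = 0 else sin (Ang nu l lam) = 0}"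

text \<open>At an eigenvalue the end angle is a multiple of \<open>pi/2\<close>. Below
  \<open>c\<close> it lies between 0 and its value at \<open>c\<close>, which leaves finitely many
  multiples, each taken at most once by strict monotonicity.\<close>

lemma finite_spec: "finite {lam \<in> spec nu nu' l. lam \<le> c}"
proof -
  have ang: "0 \<le> Ang nu l lam" "Ang nu l lam \<le> Ang nu l c" if "lam \<le> c" for lam
  proof -
    show "0 \<le> Ang nu l lam" using ang_pos[OF bcont_kap] less_imp_le by blast
    show "Ang nu l lam \<le> Ang nu l c" using Ang_strict_mono[of lam c nu l] that by (cases "lam = c") auto
  qed
  define N where "N = nat \<lceil>Ang nu l c * 2 / pi\<rceil>"
  have "Ang nu l ` {lam \<in> spec nu nu' l. lam \<le> c} \<subseteq> (\<lambda>j. real j * (pi/2)) ` {..N}"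
  proof
    fix t assume "t \<in> Ang nu l ` {lam \<in> spec nu nu' l. lam \<le> c}"
    then obtain lam where lam: "t = Ang nu l lam" "lam \<in> spec nu nu' l" "lam \<le> c" by blast
    have "sin (2 * t) = 0" using lam(1,2) by (auto simp: spec_def sin_double split: if_splits)
    then obtain i :: int where i: "2 * t = real_of_int i * pi" unfolding sin_zero_iff_int2 by blast
    have "0 \<le> real_of_int i * pi" using i ang(1)[OF lam(3)] lam(1) by linarith
    then have i0: "0 \<le> i" using pi_gt_zero by (auto simp: zero_le_mult_iff)
    have "real_of_int i * pi \<le> Ang nu l c * 2" using i ang(2)[OF lam(3)] lam(1) by linarith
    then have "real_of_int i \<le> Ang nu l c * 2 / pi" by (simp add: field_simps)
    then have "nat i \<le> N" unfolding N_def by (intro nat_mono) (simp add: le_ceiling_iff)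
    moreover have "t = real (nat i) * (pi/2)" using i i0 by simp
    ultimately show "t \<in> (\<lambda>j. real j * (pi/2)) ` {..N}" by blast
  qed
  then have "finite (Ang nu l ` {lam \<in> spec nu nu' l. lam \<le> c})" using finite_subset by blast
  moreover have "inj_on (Ang nu l) {lam \<in> spec nu nu' l. lam \<le> c}" using Ang_inj by (blast intro: inj_onI)
  ultimately show ?thesis using finite_imageD by blast
qed

text \<open>A negative coefficient keeps the end angle strictly between 0 and \<open>pi/2\<close>,
  where neither sine nor cosine vanishes.\<close>

lemma spec_empty:
  assumes "\<And>x. kap l c x < 0" "lam \<le> c" shows "lam \<notin> spec nu nu' l"
proof
  assume "lam \<in> spec nu nu' l"
  have "Ang nu l lam \<le> Ang nu l c" using Ang_strict_mono[of lam c nu l] assms(2) by (cases "lam = c") auto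
  then have "0 < Ang nu l lam" "Ang nu l lam < pi/2"
    using ang_pos[OF bcont_kap] ang_neg[OF bcont_kap assms(1), of nu] by force+
  then have "sin (Ang nu l lam) > 0" "cos (Ang nu l lam) > 0" by (auto intro: sin_gt_zero2 cos_gt_zero)
  then show False using \<open>lam \<in> spec nu nu' l\<close> by (auto simp: spec_def split: if_splits)
qed

text \<open>Frequencies large compared with \<open>c\<close> make the coefficient negative. This
  cutoff in \<open>l\<close> makes the set of two-dimensional modes below a level finite, and it
  also drives the unboundedness of the spectrum.\<close>

lemma spec_bound: "\<exists>L. \<forall>l. L \<le> \<bar>l\<bar> \<longrightarrow> (\<forall>nu nu'. \<forall>lam\<le>c. lam \<notin> spec nu nu' l)"
proof -
  obtain e d where cd: "e > 0" "\<And>x. e \<le> \<rho> x" "\<And>x. \<rho> x \<le> d" using \<rho>_bounded by metis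
  have d: "d > 0" using cd(1) cd(2)[of 0] cd(3)[of 0] by linarith
  have "kap l c x < 0" if "\<bar>c\<bar> * d + 1 \<le> \<bar>l\<bar>" for l x
  proof -
    have "c * \<rho> x \<le> \<bar>c\<bar> * d" using cd(3)[of x] \<rho>_pos[of x] by (intro mult_mono) auto
    moreover have "\<bar>l\<bar> \<le> l\<^sup>2"
    proof -
      have "0 \<le> \<bar>c\<bar> * d" using d by simp
      then have "\<bar>l\<bar> * 1 \<le> \<bar>l\<bar> * \<bar>l\<bar>" using that by (intro mult_left_mono) linarith+
      then show ?thesis by (simp add: power2_eq_square)
    qed
    ultimately show ?thesis using that by (simp add: kap_def)
  qed
  then show ?thesis using spec_empty by blast
qed

text \<open>The end angle is at most \<open>pi/2\<close> for \<open>lam = 0\<close> and at least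
  \<open>pi/2\<close> once \<open>lam * \<rho>\<close> dominates \<open>l^2\<close>; continuity
  gives an eigenvalue in between.\<close>

lemma spec_nonempty: "\<exists>lam\<ge>0. lam \<in> spec True True l"
proof -
  obtain c d where cd: "c > 0" "\<And>x. c \<le> \<rho> x" "\<And>x. \<rho> x \<le> d" using \<rho>_bounded by metis
  have 1: "Ang True l 0 \<le> pi/2" by (intro ang_nonpos bcont_kap) (simp add: kap_def)
  have 2: "pi/2 \<le> Ang True l (l\<^sup>2/c)"
  proof (intro ang_nonneg bcont_kap)
    fix x
    have "l\<^sup>2 / c * c \<le> l\<^sup>2 / c * \<rho> x" using cd by (intro mult_left_mono) auto
    then show "0 \<le> kap l (l\<^sup>2/c) x" using cd(1) by (simp add: kap_def)
  qed
  obtain lam where lam: "lam \<ge> 0" "Ang True l lam = pi/2"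
    using Ang_value_exists[OF 1 2] cd(1) by auto
  then have "lam \<in> spec True True l" by (simp only: spec_def mem_Collect_eq if_True cos_pi_half)
  with lam(1) show ?thesis by blast
qed

section \<open>Eigenfunctions and their parities\<close>

definition eig :: "bool \<Rightarrow> real \<Rightarrow> real \<Rightarrow> real \<Rightarrow> real" where "eig nu l lam = base nu (kap l lam)"
definition eig' :: "bool \<Rightarrow> real \<Rightarrow> real \<Rightarrow> real \<Rightarrow> real" where "eig' nu l lam = base' nu (kap l lam)"

lemma eig_solution: "solution (kap l lam) (eig nu l lam) (eig' nu l lam)"
  and eig_0: "eig nu l lam 0 = (if nu then 1 else 0)" "eig' nu l lam 0 = (if nu then 0 else 1)"
  by (simp_all only: eig_def eig'_def amp base_0 bcont_kap)

lemma solution_minus: "solution (kap l lam) a b \<Longrightarrow> solution (kap l lam) (\<lambda>x. a (- x)) (\<lambda>x. - b (- x))"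
  using solution_affine[of "kap l lam" a b "-1" 0] by (simp add: kap_even w_even)

lemma solution_reflect: "solution (kap l lam) a b \<Longrightarrow> solution (kap l lam) (\<lambda>x. a (pi - x)) (\<lambda>x. - b (pi - x))"
  using solution_affine[of "kap l lam" a b "-1" pi] kap_reflect[of l lam] w_reflect by simp

lemma solution_shift: "solution (kap l lam) a b \<Longrightarrow> solution (kap l lam) (\<lambda>x. a (x + pi)) (\<lambda>x. b (x + pi))"
  using solution_affine[of "kap l lam" a b 1 pi] by (simp add: kap_periodic w_periodic)

lemma spec_iff: "lam \<in> spec nu nu' l \<longleftrightarrow> (if nu' then eig' nu l lam (pi/2) = 0 else eig nu l lam (pi/2) = 0)"
  using base_end[OF bcont_kap] by (simp add: spec_def eig_def eig'_def)

lemma eig_minus: "eig nu l lam (- x) = sg nu * eig nu l lam x"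
proof -
  note s = solution_lincomb[OF eig_solution eig_solution, of l lam "sg nu" nu 0 nu]
  show ?thesis
    using solution_eq_at(1)[OF bcont_kap solution_minus[OF eig_solution] s, of nu 0 x] eig_0 by auto
qed

lemma eig_reflect:
  assumes "lam \<in> spec nu nu' l" shows "eig nu l lam (pi - x) = sg nu' * eig nu l lam x"
proof -
  note s = solution_lincomb[OF eig_solution eig_solution, of l lam "sg nu'" nu 0 nu]
  show ?thesis
    using solution_eq_at(1)[OF bcont_kap solution_reflect[OF eig_solution] s, of nu "pi/2" x] assms
    by (auto simp: spec_iff split: if_splits)
qed

text \<open>Parity at 0 annihilates one of the two initial values, so the solution is a multiple of
  \<open>eig\<close>. Parity at \<open>pi/2\<close> annihilates a value there in the same way, and
  that is the boundary condition defining \<open>spec\<close>.\<close>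

lemma solution_symmetric:
  assumes s: "solution (kap l lam) a b" and m: "\<And>x. a (- x) = sg nu * a x" and r: "\<And>x. a (pi - x) = sg nu' * a x"
  defines "c \<equiv> (if nu then a 0 else b 0)"
  shows "a x = c * eig nu l lam x" "c \<noteq> 0 \<Longrightarrow> lam \<in> spec nu nu' l"
proof -
  \<comment> \<open>The parity of \<open>b\<close> is opposite to that of \<open>a\<close>, read off
    by differentiating \<open>a (- x)\<close> in two ways.\<close>
  have sb: "b x0 * (- 1) = sg nu * b x0" if "x0 = 0" for x0
  proof -
    have "((\<lambda>x. a (- x)) has_real_derivative w x0 * (- b (- x0))) (at x0)" by (rule solutionD(1)[OF solution_minus[OF s]])
    moreover have "((\<lambda>x. a (- x)) has_real_derivative sg nu * (w x0 * b x0)) (at x0)"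
      unfolding m by (intro DERIV_cmult solutionD(1)[OF s])
    ultimately have "w x0 * (- b (- x0)) = sg nu * (w x0 * b x0)" by (rule DERIV_unique)
    then show ?thesis using w_pos[of x0] that by (auto split: if_splits)
  qed
  have rb: "b (pi/2) * (- 1) = sg nu' * b (pi/2)"
  proof -
    have "((\<lambda>x. a (pi - x)) has_real_derivative w (pi/2) * (- b (pi - pi/2))) (at (pi/2))" by (rule solutionD(1)[OF solution_reflect[OF s]])
    moreover have "((\<lambda>x. a (pi - x)) has_real_derivative sg nu' * (w (pi/2) * b (pi/2))) (at (pi/2))"
      unfolding r by (intro DERIV_cmult solutionD(1)[OF s])
    ultimately have "w (pi/2) * (- b (pi - pi/2)) = sg nu' * (w (pi/2) * b (pi/2))" by (rule DERIV_unique)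
    then show ?thesis using w_pos[of "pi/2"] by (auto split: if_splits)
  qed
  have 0: "a 0 = c * eig nu l lam 0 + 0 * eig nu l lam 0" "b 0 = c * eig' nu l lam 0 + 0 * eig' nu l lam 0"
    using sb[of 0] m[of 0] unfolding eig_0 c_def by (auto split: if_splits)
  note e = solution_eq_at[OF bcont_kap s solution_lincomb[OF eig_solution eig_solution] 0]
  show "a x = c * eig nu l lam x" using e(1)[of x] by simp
  show "c \<noteq> 0 \<Longrightarrow> lam \<in> spec nu nu' l"
    using e[of "pi/2"] rb r[of "pi/2"] by (auto simp: spec_iff split: if_splits)
qed

text \<open>Below \<open>c\<close> the end angle increases strictly with \<open>lam\<close> and
  stays inside \<open>(0, u)\<close>, where the boundary condition singles out the one value
  \<open>t\<close>; the intermediate value theorem decides whether \<open>t\<close> is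
  reached.\<close>

lemma spec_counting:
  assumes "Ang nu l 0 \<le> t" "0 \<le> c" "Ang nu l c \<le> u"
    and vals: "\<And>s. 0 < s \<Longrightarrow> s < u \<Longrightarrow> (if nu' then cos s = 0 else sin s = 0) \<longleftrightarrow> s = t"
  shows "card {lam \<in> spec nu nu' l. lam < c} = (if t < Ang nu l c then 1 else 0)"
proof -
  have "{lam \<in> spec nu nu' l. lam < c} = {lam. lam < c \<and> Ang nu l lam = t}"
  proof -
    have "lam \<in> spec nu nu' l \<longleftrightarrow> Ang nu l lam = t" if "lam < c" for lam
      using vals[of "Ang nu l lam"] ang_pos[OF bcont_kap, of nu l lam] Ang_strict_mono[OF that, of nu l] assms(3)
      by (simp add: spec_def)
    then show ?thesis by blast
  qed
  moreover have "{lam. lam < c \<and> Ang nu l lam = t} = {}" if "\<not> t < Ang nu l c"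
    using that Ang_strict_mono[of _ c nu l] by force
  moreover have "\<exists>lam. {lam. lam < c \<and> Ang nu l lam = t} = {lam}" if lt: "t < Ang nu l c"
  proof -
    obtain lam where lam: "lam \<le> c" "Ang nu l lam = t"
      using Ang_value_exists[OF assms(1) less_imp_le[OF lt] assms(2)] by blast
    moreover have "lam \<noteq> c" using lam lt by auto
    ultimately have "{lam. lam < c \<and> Ang nu l lam = t} = {lam}" using Ang_inj by force
    then show ?thesis by blast
  qed
  ultimately show ?thesis by (metis (no_types) One_nat_def card.empty is_singletonI is_singleton_altdef)
qed

end

section \<open>Fourier coefficients\<close>

definition trig :: "bool \<Rightarrow> nat \<Rightarrow> real \<Rightarrow> real" where
  "trig c l y = (if c then cos (real l * y) else sin (real l * y))"

lemma trig_cont: "continuous_on S (trig c l)"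
  unfolding trig_def[abs_def] by (cases c) (auto intro!: continuous_intros)

lemma trig_periodic: "trig c l (y + 2 * pi) = trig c l y"
proof -
  have e: "real l * (y + 2 * pi) = real l * y + 2 * real l * pi" by (simp add: algebra_simps)
  show ?thesis unfolding trig_def e by (simp only: sin_add cos_add sin_2npi cos_2npi) simp
qed

lemma trig_shift: "trig c l (y + pi) = (- 1) ^ l * trig c l y"
proof -
  have e: "real l * (y + pi) = real l * y + real l * pi" by (simp add: algebra_simps)
  show ?thesis unfolding trig_def e by (simp add: sin_add cos_add)
qed

lemma has_integral_trig_int:
  "((\<lambda>y. cos (of_int k * y)) has_integral (if k = 0 then 2 * pi else 0)) {0..2*pi}"
  "((\<lambda>y. sin (of_int k * y)) has_integral 0) {0..2*pi}"
proof -
  have per: "sin (of_int k * (2 * pi)) = 0" "cos (of_int k * (2 * pi)) = 1"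
    by (simp_all add: mult.commute[of _ "2 * pi"])
  show "((\<lambda>y. cos (of_int k * y)) has_integral (if k = 0 then 2 * pi else 0)) {0..2*pi}"
  proof (cases "k = 0")
    case True
    then show ?thesis using has_integral_const_real[of "1::real" 0 "2*pi"] by simp
  next
    case False
    have "((\<lambda>y. cos (of_int k * y)) has_integral (sin (of_int k * (2*pi)) / of_int k - sin (of_int k * 0) / of_int k)) {0..2*pi}"
      using False by (intro fundamental_theorem_of_calculus)
        (auto intro!: derivative_eq_intros simp: has_real_derivative_iff_has_vector_derivative[symmetric])
    then show ?thesis using False per by simp
  qed
  show "((\<lambda>y. sin (of_int k * y)) has_integral 0) {0..2*pi}"
  proof (cases "k = 0")
    case False
    have "((\<lambda>y. sin (of_int k * y)) has_integral (- cos (of_int k * (2*pi)) / of_int k - - cos (of_int k * 0) / of_int k)) {0..2*pi}"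
      using False by (intro fundamental_theorem_of_calculus)
        (auto intro!: derivative_eq_intros simp: has_real_derivative_iff_has_vector_derivative[symmetric])
    then show ?thesis using per by simp
  qed simp
qed

definition trig_norm :: "nat \<Rightarrow> real" where "trig_norm l = (if l = 0 then 2 * pi else pi)"

lemma trig_norm_pos: "trig_norm l > 0" by (simp add: trig_norm_def)

lemma integral_trig_mult:
  assumes "l = 0 \<Longrightarrow> c" "l' = 0 \<Longrightarrow> c'"
  shows "integral {0..2*pi} (\<lambda>y. trig c l y * trig c' l' y) = (if c = c' \<and> l = l' then trig_norm l else 0)"
proof -
  define A where "A = int l - int l'"
  define B where "B = int l + int l'"
  have e: "of_int A * y = real l * y - real l' * y" "of_int B * y = real l * y + real l' * y" for y :: real
    by (simp_all add: A_def B_def algebra_simps)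
  note I = has_integral_trig_int
  have half: "(f has_integral a / 2) S" if "((\<lambda>y. 2 * f y) has_integral a) S" for f :: "real \<Rightarrow> real" and a S
    using has_integral_mult_right[OF that, of "1/2"] by simp
  have cc: "((\<lambda>y. cos (real l * y) * cos (real l' * y)) has_integral
      ((if A = 0 then 2 * pi else 0) + (if B = 0 then 2 * pi else 0)) / 2) {0..2*pi}"
    using has_integral_add[OF I(1)[of A] I(1)[of B]]
    by (intro half) (simp add: e cos_add cos_diff)
  have ss: "((\<lambda>y. sin (real l * y) * sin (real l' * y)) has_integral
      ((if A = 0 then 2 * pi else 0) - (if B = 0 then 2 * pi else 0)) / 2) {0..2*pi}"
    using has_integral_diff[OF I(1)[of A] I(1)[of B]]
    by (intro half) (simp add: e cos_add cos_diff)
  have p1: "2 * (sin a * cos b) = sin (a - b) + sin (a + b)" and p2: "2 * (cos a * sin b) = sin (a + b) - sin (a - b)" for a b :: real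
    by (simp_all add: sin_add sin_diff)
  have sc: "((\<lambda>y. sin (real l * y) * cos (real l' * y)) has_integral (0 + 0) / 2) {0..2*pi}"
    using has_integral_add[OF I(2)[of A] I(2)[of B]]
    by (intro half) (simp only: p1 e)
  have cs: "((\<lambda>y. cos (real l * y) * sin (real l' * y)) has_integral (0 - 0) / 2) {0..2*pi}"
    using has_integral_diff[OF I(2)[of B] I(2)[of A]]
    by (intro half) (simp only: p2 e)
  have AB: "A = 0 \<longleftrightarrow> l = l'" "B = 0 \<longleftrightarrow> l = 0 \<and> l' = 0" by (auto simp: A_def B_def)
  show ?thesis
    using integral_unique[OF cc] integral_unique[OF ss] integral_unique[OF sc] integral_unique[OF cs] assms
    unfolding AB by (cases c; cases c') (auto simp: trig_def trig_norm_def)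
qed

text \<open>Products of sines and cosines stay orthogonal to a function all of whose Fourier
  coefficients vanish, hence so does every polynomial in \<open>cos y\<close> and \<open>sin y\<close>.\<close>

inductive trig_poly :: "(real \<Rightarrow> real) \<Rightarrow> bool" where
  tp_cos: "trig_poly (\<lambda>y. cos (of_int k * y))"
| tp_sin: "trig_poly (\<lambda>y. sin (of_int k * y))"
| tp_add: "trig_poly f \<Longrightarrow> trig_poly g \<Longrightarrow> trig_poly (\<lambda>y. f y + g y)"
| tp_scale: "trig_poly f \<Longrightarrow> trig_poly (\<lambda>y. c * f y)"

lemma trig_poly_diff: "trig_poly f \<Longrightarrow> trig_poly g \<Longrightarrow> trig_poly (\<lambda>y. f y - g y)"
  using tp_add[OF _ tp_scale[of g "-1"]] by fastforce

lemma trig_poly_mult_cos: "trig_poly f \<Longrightarrow> trig_poly (\<lambda>y. f y * cos (of_int j * y))"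
  and trig_poly_mult_sin: "trig_poly f \<Longrightarrow> trig_poly (\<lambda>y. f y * sin (of_int j * y))"
proof (induction rule: trig_poly.induct)
  case (tp_cos k)
  { case 1
    have "(\<lambda>y. cos (of_int k * y) * cos (of_int j * y)) = (\<lambda>y::real. 1/2 * (cos (of_int (k + j) * y) + cos (of_int (k - j) * y)))"
      by (simp add: fun_eq_iff distrib_right left_diff_distrib cos_add cos_diff)
    then show ?case by (simp only: trig_poly.intros)
  next
    case 2
    have "(\<lambda>y. cos (of_int k * y) * sin (of_int j * y)) = (\<lambda>y::real. 1/2 * (sin (of_int (k + j) * y) - sin (of_int (k - j) * y)))"
      by (simp add: fun_eq_iff distrib_right left_diff_distrib sin_add sin_diff)
    then show ?case by (simp only: trig_poly.intros trig_poly_diff) }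
next
  case (tp_sin k)
  { case 1
    have "(\<lambda>y. sin (of_int k * y) * cos (of_int j * y)) = (\<lambda>y::real. 1/2 * (sin (of_int (k + j) * y) + sin (of_int (k - j) * y)))"
      by (simp add: fun_eq_iff distrib_right left_diff_distrib sin_add sin_diff)
    then show ?case by (simp only: trig_poly.intros)
  next
    case 2
    have "(\<lambda>y. sin (of_int k * y) * sin (of_int j * y)) = (\<lambda>y::real. 1/2 * (cos (of_int (k - j) * y) - cos (of_int (k + j) * y)))"
      by (simp add: fun_eq_iff distrib_right left_diff_distrib cos_add cos_diff)
    then show ?case by (simp only: trig_poly.intros trig_poly_diff) }
next
  case (tp_add f g)
  then show "trig_poly (\<lambda>y. (f y + g y) * cos (of_int j * y))" "trig_poly (\<lambda>y. (f y + g y) * sin (of_int j * y))"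
    by (simp_all only: distrib_right trig_poly.tp_add)
next
  case (tp_scale f c)
  then show "trig_poly (\<lambda>y. c * f y * cos (of_int j * y))" "trig_poly (\<lambda>y. c * f y * sin (of_int j * y))"
    by (simp_all only: mult.assoc trig_poly.tp_scale)
qed

lemma trig_poly_mult: "trig_poly g \<Longrightarrow> trig_poly f \<Longrightarrow> trig_poly (\<lambda>y. f y * g y)"
proof (induction rule: trig_poly.induct)
  case (tp_add f' g')
  then show ?case by (simp add: distrib_left trig_poly.tp_add)
next
  case (tp_scale f' c)
  then show ?case using trig_poly.tp_scale[of "\<lambda>y. f y * f' y" c] by (simp add: mult_ac)
qed (auto intro: trig_poly_mult_cos trig_poly_mult_sin)

lemma trig_poly_const: "trig_poly (\<lambda>y. c)"
  using tp_scale[OF tp_cos[of 0], of c] by simp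

text \<open>By Stone-Weierstrass on the unit circle, \<open>v\<close> is uniformly close to some
  \<open>trig_poly\<close> \<open>h\<close>; orthogonality to \<open>h\<close> turns the integral of
  \<open>v^2\<close> into that of \<open>v (v - h)\<close>, which is arbitrarily small.\<close>

lemma fourier_uniqueness:
  fixes v :: "real \<Rightarrow> real"
  assumes v: "continuous_on UNIV v" and per: "\<And>y. v (y + 2 * pi) = v y"
    and 0: "\<And>c l. integral {0..2*pi} (\<lambda>y. v y * trig c l y) = 0"
  shows "v y = 0"
proof -
  have vS: "continuous_on S v" for S using v continuous_on_subset by blast
  have int: "(\<lambda>y. v y * h y) integrable_on {0..2*pi}" if "continuous_on {0..2*pi} h" for h
    by (intro integrable_continuous_interval continuous_intros vS that)
  have perk: "v (y + 2 * pi * of_int k) = v y" for y and k :: int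
  proof (induction k rule: int_induct[where k=0])
    case (step1 i)
    have "v (y + 2 * pi * of_int (i + 1)) = v ((y + 2 * pi * of_int i) + 2 * pi)" by (simp add: algebra_simps)
    then show ?case using per step1 by simp
  next
    case (step2 i)
    have "v (y + 2 * pi * of_int i) = v ((y + 2 * pi * of_int (i - 1)) + 2 * pi)" by (simp add: algebra_simps)
    then show ?case using per step2 by simp
  qed simp
  have orth: "continuous_on {0..2*pi} h \<and> integral {0..2*pi} (\<lambda>y. v y * h y) = 0" if "trig_poly h" for h
    using that
  proof (induction rule: trig_poly.induct)
    case (tp_cos k)
    have "cos (of_int k * y) = trig True (nat \<bar>k\<bar>) y" for y :: real
      by (auto simp: trig_def abs_if)
    then show ?case by (simp only: 0 trig_cont simp_thms)
  next
    case (tp_sin k)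
    have "sin (of_int k * y) = (if k \<ge> 0 then 1 else - 1) * trig False (nat \<bar>k\<bar>) y" for y :: real
      by (auto simp: trig_def abs_if)
    moreover have "integral {0..2*pi} (\<lambda>y. v y * (s * trig False l y)) = 0" for s l
    proof -
      have "(\<lambda>y. v y * (s * trig False l y)) = (\<lambda>y. s * (v y * trig False l y))" by (simp only: mult.left_commute)
      then show ?thesis by (simp only: integral_mult_right 0 mult_zero_right)
    qed
    ultimately show ?case by (simp only: continuous_on_mult_left[OF trig_cont] simp_thms)
  next
    case (tp_add f g)
    then have "integral {0..2*pi} (\<lambda>y. v y * f y + v y * g y) = 0"
      using integral_add[OF int int, of f g] by simp
    then show ?case using tp_add continuous_on_add[of "{0..2*pi}" f g] by (simp add: distrib_left)
  next
    case (tp_scale f c)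
    have "integral {0..2*pi} (\<lambda>y. v y * (c * f y)) = c * integral {0..2*pi} (\<lambda>y. v y * f y)"
      using integral_mult_right[of "{0..2*pi}" c "\<lambda>y. v y * f y"] by (simp add: mult.left_commute)
    then show ?case using tp_scale continuous_on_mult_left[of "{0..2*pi}" f c] by simp
  qed
  define S where "S = (\<lambda>y. pt (cos y) (sin y)) ` {0..2*pi}"
  have e: "continuous_on {0..2*pi} (\<lambda>y. pt (cos y) (sin y))" by (intro continuous_intros)
  have "compact S" unfolding S_def by (intro compact_continuous_image e compact_Icc)
  \<comment> \<open>\<open>v\<close> as a function on the circle; the choice of the angle does not
    matter by periodicity.\<close>
  define F where "F z = v (SOME y. pt (cos y) (sin y) = z)" for z
  have F: "F (pt (cos y) (sin y)) = v y" for y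
  proof -
    define y' where "y' = (SOME y'. pt (cos y') (sin y') = pt (cos y) (sin y))"
    have "pt (cos y') (sin y') = pt (cos y) (sin y)" unfolding y'_def by (rule someI) simp
    then have "cos y' = cos y" "sin y' = sin y" by (metis vector_2)+
    then obtain k :: int where "y' = y + 2 * pi * of_int k" using sin_cos_eq_iff[of y' y] by auto
    then show ?thesis using perk by (simp add: F_def y'_def)
  qed
  \<comment> \<open>The parametrisation of the circle is a closed map on the compact interval, so
    preimages of closed sets under \<open>F\<close> are images of compact sets.\<close>
  have Fc: "continuous_on S F"
    unfolding continuous_on_closed_vimage[OF compact_imp_closed[OF \<open>compact S\<close>]]
  proof (intro allI impI)
    fix B :: "real set" assume "closed B"
    have "F -` B \<inter> S = (\<lambda>y. pt (cos y) (sin y)) ` ({0..2*pi} \<inter> v -` B)"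
      unfolding S_def using F by auto
    moreover have "closed ({0..2*pi} \<inter> v -` B)"
      using continuous_closed_preimage[OF vS _ \<open>closed B\<close>] by simp
    then have "compact ({0..2*pi} \<inter> v -` B)"
      by (metis Int_lower1 bounded_subset bounded_closed_interval cbox_interval compact_eq_bounded_closed bounded_cbox)
    then have "compact ((\<lambda>y. pt (cos y) (sin y)) ` ({0..2*pi} \<inter> v -` B))"
      by (rule compact_continuous_image[OF continuous_on_subset[OF e Int_lower1]])
    ultimately show "closed (F -` B \<inter> S)" using compact_imp_closed by simp
  qed
  have approx: "\<exists>h. trig_poly h \<and> (\<forall>y\<in>{0..2*pi}. \<bar>v y - h y\<bar> < \<epsilon>)" if e0: "\<epsilon> > 0" for \<epsilon>
  proof -
    obtain g where g: "real_polynomial_function g" "\<And>z. z \<in> S \<Longrightarrow> \<bar>F z - g z\<bar> < \<epsilon>"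
      using Stone_Weierstrass_real_polynomial_function[OF \<open>compact S\<close> Fc e0] by metis
    have "trig_poly (\<lambda>y. g (pt (cos y) (sin y)))" using g(1)
    proof (induction rule: real_polynomial_function.induct)
      case (linear f)
      then interpret bounded_linear f .
      have "f (pt (cos y) (sin y)) = f (axis 1 1) * cos (of_int 1 * y) + f (axis 2 1) * sin (of_int 1 * y)" for y
        unfolding pt_axis by (simp add: add scaleR mult.commute)
      then show ?case by (simp only: trig_poly.intros)
    qed (auto intro: trig_poly_const trig_poly_mult trig_poly.intros)
    moreover have "\<bar>v y - g (pt (cos y) (sin y))\<bar> < \<epsilon>" if "y \<in> {0..2*pi}" for y
      using g(2)[of "pt (cos y) (sin y)"] that F by (auto simp: S_def)
    ultimately show ?thesis by blast
  qed
  have vv: "(\<lambda>y. v y * v y) integrable_on {0..2*pi}" by (rule int[OF vS])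
  obtain V where V': "\<forall>z\<in>v ` {0..2*pi}. norm z \<le> V"
    using compact_imp_bounded[OF compact_continuous_image[OF vS[of "{0..2*pi}"] compact_Icc]]
    unfolding bounded_iff by blast
  then have V: "\<bar>v y\<bar> \<le> V" if "y \<in> {0..2*pi}" for y using that by simp
  have small: "integral {0..2*pi} (\<lambda>y. v y * v y) \<le> \<epsilon> * (V * (2 * pi))" if \<epsilon>: "\<epsilon> > 0" for \<epsilon>
  proof -
    obtain h where h: "trig_poly h" "\<And>y. y \<in> {0..2*pi} \<Longrightarrow> \<bar>v y - h y\<bar> < \<epsilon>" using approx[OF \<epsilon>] by blast
    have ih: "(\<lambda>y. v y * h y) integrable_on {0..2*pi}" using int orth[OF h(1)] by blast
    have "integral {0..2*pi} (\<lambda>y. v y * v y) = integral {0..2*pi} (\<lambda>y. v y * v y - v y * h y)"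
      using integral_diff[OF vv ih] orth[OF h(1)] by simp
    also have "\<dots> \<le> integral {0..2*pi} (\<lambda>y. \<epsilon> * V)"
    proof (rule integral_le)
      show "(\<lambda>y. v y * v y - v y * h y) integrable_on {0..2*pi}" by (rule integrable_diff[OF vv ih])
      fix y assume y: "y \<in> {0..2*pi}"
      have "v y * v y - v y * h y \<le> \<bar>v y\<bar> * \<bar>v y - h y\<bar>"
        by (metis abs_ge_self abs_mult right_diff_distrib)
      also have "\<dots> \<le> V * \<epsilon>" using V[OF y] h(2)[OF y] by (intro mult_mono) auto
      finally show "v y * v y - v y * h y \<le> \<epsilon> * V" by (simp add: mult.commute)
    qed auto
    also have "\<dots> = \<epsilon> * (V * (2 * pi))" by simp
    finally show ?thesis .
  qed
  have "integral {0..2*pi} (\<lambda>y. v y * v y) \<le> 0"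
  proof (rule field_le_epsilon)
    fix e :: real assume "e > 0"
    have "0 \<le> V" using V[of 0] by simp
    then have "V * (2 * pi) < V * (2 * pi) + 1" "0 \<le> V * (2 * pi)" by auto
    have "integral {0..2*pi} (\<lambda>y. v y * v y) \<le> e / (V * (2 * pi) + 1) * (V * (2 * pi))"
      using \<open>e > 0\<close> \<open>0 \<le> V * (2 * pi)\<close> by (intro small divide_pos_pos) linarith+
    also have "\<dots> \<le> e" using \<open>e > 0\<close> \<open>0 \<le> V * (2 * pi)\<close> by (simp add: field_simps)
    finally show "integral {0..2*pi} (\<lambda>y. v y * v y) \<le> 0 + e" by simp
  qed
  moreover have "0 \<le> integral {0..2*pi} (\<lambda>y. v y * v y)" by (rule integral_nonneg[OF vv]) simp
  ultimately have i0: "integral {0..2*pi} (\<lambda>y. v y * v y) = 0" by linarith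
  have c2: "continuous_on {0..2*pi} (\<lambda>y. v y * v y)" by (intro continuous_intros vS)
  have z: "v y * v y = 0" if "y \<in> {0..2*pi}" for y
    using integral_eq_0_iff[OF c2] i0 that by simp
  define k where "k = \<lfloor>y / (2 * pi)\<rfloor>"
  have "y + 2 * pi * of_int (- k) \<in> {0..2*pi}"
    using floor_divide_lower[of "2*pi" y] floor_divide_upper[of "2*pi" y] by (auto simp: k_def algebra_simps)
  with z[OF this] perk[of y "- k"] show ?thesis by simp
qed

text \<open>Passes from families to sets: linear independence as a family makes \<open>f\<close>
  injective on \<open>I\<close>, so the image has the cardinality of \<open>I\<close>.\<close>

lemma funvs_basis:
  fixes f :: "'i \<Rightarrow> real^2 \<Rightarrow> real"
  assumes I: "finite I"
    and ind: "\<And>k. (\<And>p. (\<Sum>i\<in>I. k i * f i p) = 0) \<Longrightarrow> \<forall>i\<in>I. k i = 0"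
  shows "\<exists>B. finite B \<and> funvs.independent B \<and> funvs.span B = {(\<lambda>p. \<Sum>i\<in>I. k i * f i p) | k. True} \<and> card B = card I"
proof -
  have sa: "(\<Sum>x\<in>A. g x) p = (\<Sum>x\<in>A. g x p)" for A :: "'x set" and g :: "'x \<Rightarrow> real^2 \<Rightarrow> real" and p
    by (induction A rule: infinite_finite_induct) auto
  have inj: "inj_on f I"
  proof (rule inj_onI, rule ccontr)
    fix i j assume ij: "i \<in> I" "j \<in> I" "f i = f j" "i \<noteq> j"
    define k where "k x = (if x = i then 1 else if x = j then -1 else 0 :: real)" for x
    have "(\<Sum>x\<in>I. k x * f x p) = 0" for p
    proof -
      have "(\<Sum>x\<in>I. k x * f x p) = (\<Sum>x\<in>{i,j}. k x * f x p)"
        using ij I by (intro sum.mono_neutral_right) (auto simp: k_def)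
      then show ?thesis using ij by (simp add: k_def)
    qed
    from ind[OF this] ij show False by (auto simp: k_def)
  qed
  have fin: "finite (f ` I)" using I by simp
  have re: "(\<Sum>v\<in>f ` I. (\<lambda>p. u v * v p)) = (\<lambda>p. \<Sum>i\<in>I. u (f i) * f i p)" for u
    by (rule ext) (simp add: sa sum.reindex[OF inj])
  have "funvs.independent (f ` I)"
    unfolding funvs.dependent_finite[OF fin]
  proof
    assume "\<exists>u. (\<exists>v\<in>f ` I. u v \<noteq> 0) \<and> (\<Sum>v\<in>f ` I. (\<lambda>p. u v * v p)) = 0"
    then obtain u where u: "\<exists>v\<in>f ` I. u v \<noteq> 0" "(\<lambda>p. \<Sum>i\<in>I. u (f i) * f i p) = 0" unfolding re by blast
    from u(2) have "(\<Sum>i\<in>I. u (f i) * f i p) = 0" for p by (simp add: fun_eq_iff)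
    from ind[OF this] u(1) show False by auto
  qed
  moreover have "funvs.span (f ` I) = {(\<lambda>p. \<Sum>i\<in>I. k i * f i p) | k. True}"
  proof -
    have "funvs.span (f ` I) = range (\<lambda>u. (\<lambda>p. \<Sum>i\<in>I. u (f i) * f i p))"
      unfolding funvs.span_finite[OF fin] re ..
    also have "\<dots> = {(\<lambda>p. \<Sum>i\<in>I. k i * f i p) | k. True}"
    proof (intro equalityI subsetI)
      fix h assume "h \<in> {(\<lambda>p. \<Sum>i\<in>I. k i * f i p) | k. True}"
      then obtain k where h: "h = (\<lambda>p. \<Sum>i\<in>I. k i * f i p)" by blast
      have "h = (\<lambda>p. \<Sum>i\<in>I. (k \<circ> the_inv_into I f) (f i) * f i p)"
        unfolding h by (intro ext sum.cong) (auto simp: the_inv_into_f_f[OF inj])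
      then show "h \<in> range (\<lambda>u. (\<lambda>p. \<Sum>i\<in>I. u (f i) * f i p))" by (rule image_eqI[where x = "k \<circ> the_inv_into I f"]) simp
    next
      fix h assume "h \<in> range (\<lambda>u. (\<lambda>p. \<Sum>i\<in>I. u (f i) * f i p))"
      then obtain u where "h = (\<lambda>p. \<Sum>i\<in>I. u (f i) * f i p)" by (rule rangeE)
      then show "h \<in> {(\<lambda>p. \<Sum>i\<in>I. k i * f i p) | k. True}"
        by (intro CollectI exI[of _ "\<lambda>i. u (f i)"] conjI TrueI)
    qed
    finally show ?thesis .
  qed
  moreover have "card (f ` I) = card I" by (rule card_image[OF inj])
  ultimately show ?thesis using fin by blast
qed

definition biperiodic :: "(real^2 \<Rightarrow> real) \<Rightarrow> bool" where
  "biperiodic U \<longleftrightarrow> (\<forall>x y. U (pt (x + 2 * pi) y) = U (pt x y) \<and> U (pt x (y + 2 * pi)) = U (pt x y))"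

definition fc :: "bool \<Rightarrow> nat \<Rightarrow> (real^2 \<Rightarrow> real) \<Rightarrow> real \<Rightarrow> real" where
  "fc c l U x = integral {0..2*pi} (\<lambda>y. U (pt x y) * trig c l y) / trig_norm l"

text \<open>The projection to a character of the four-group generated by the reflections
  \<open>- x\<close> and \<open>pi - x\<close> modulo \<open>2 pi\<close>, whose remaining element
  is the shift by \<open>pi\<close>.\<close>

definition proj :: "bool \<Rightarrow> bool \<Rightarrow> (real \<Rightarrow> real) \<Rightarrow> real \<Rightarrow> real" where
  "proj nu nu' a x = (a x + sg nu * a (- x) + sg nu' * a (pi - x) + sg nu * sg nu' * a (x + pi)) / 4"

lemma proj_sum: "a x = proj True True a x + proj True False a x + proj False True a x + proj False False a x"
  by (simp add: proj_def field_simps)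

lemma proj_minus: "proj nu nu' a (- x) = sg nu * proj nu nu' a x"
  by (auto simp: proj_def add.commute field_simps)

lemma proj_reflect:
  assumes "\<And>x. a (x + 2 * pi) = a x" shows "proj nu nu' a (pi - x) = sg nu' * proj nu nu' a x"
proof -
  have "a (- (pi - x)) = a (x + pi)" using assms[of "- (pi - x)"] by (simp add: algebra_simps)
  moreover have "a (pi - x + pi) = a (- x)" using assms[of "- x"] by (simp add: algebra_simps)
  ultimately show ?thesis by (auto simp: proj_def field_simps)
qed

lemma fc_periodic: "biperiodic U \<Longrightarrow> fc c l U (x + 2 * pi) = fc c l U x"
  by (simp add: fc_def biperiodic_def)

lemma partial_1_eqI:
  assumes "smooth U" "((\<lambda>x. U (pt x y) :: real) has_real_derivative D) (at x)"
  shows "partial 1 U (pt x y) = D"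
  using DERIV_unique[OF smooth_has_real_derivative(1)[OF assms(1)] assms(2)] .

lemma partial_2_eqI:
  assumes "smooth U" "((\<lambda>y. U (pt x y) :: real) has_real_derivative D) (at y)"
  shows "partial 2 U (pt x y) = D"
  using DERIV_unique[OF smooth_has_real_derivative(2)[OF assms(1)] assms(2)] .

lemma partial_biperiodic:
  assumes "smooth U" "biperiodic U" shows "biperiodic (partial i U)"
  unfolding biperiodic_def
proof (intro allI conjI)
  fix x y
  have i: "i = 1 \<or> i = 2" using exhaust_2 by blast
  have s: "((\<lambda>x. x + 2 * pi) has_real_derivative 1) (at x)" for x by (auto intro!: derivative_eq_intros)
  have per: "U (pt (x + 2 * pi) y) = U (pt x y)" "U (pt x (y + 2 * pi)) = U (pt x y)" for x y
    using assms(2) by (simp_all add: biperiodic_def)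
  note d = smooth_has_real_derivative[OF assms(1)]
  have "partial 1 U (pt x y) = partial 1 U (pt (x + 2 * pi) y)"
    using DERIV_chain2[OF d(1)[of y "x + 2 * pi" UNIV] s] by (intro partial_1_eqI[OF assms(1)]) (simp add: per)
  moreover have "partial 2 U (pt x y) = partial 2 U (pt (x + 2 * pi) y)"
    using d(2)[of "x + 2 * pi" y UNIV] by (intro partial_2_eqI[OF assms(1)]) (simp add: per)
  ultimately show "partial i U (pt (x + 2 * pi) y) = partial i U (pt x y)" using i by auto
  have "partial 2 U (pt x y) = partial 2 U (pt x (y + 2 * pi))"
    using DERIV_chain2[OF d(2)[of x "y + 2 * pi" UNIV] s] by (intro partial_2_eqI[OF assms(1)]) (simp add: per)
  moreover have "partial 1 U (pt x y) = partial 1 U (pt x (y + 2 * pi))"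
    using d(1)[of "y + 2 * pi" x UNIV] by (intro partial_1_eqI[OF assms(1)]) (simp add: per)
  ultimately show "partial i U (pt x (y + 2 * pi)) = partial i U (pt x y)" using i by auto
qed

lemma integral_partial2_trig:
  assumes "smooth U" "biperiodic U"
  shows "integral {0..2*pi} (\<lambda>y. partial 2 (partial 2 U) (pt x y) * trig c l y) =
    - (real l)\<^sup>2 * integral {0..2*pi} (\<lambda>y. U (pt x y) * trig c l y)"
proof -
  define s :: real where "s = (if c then - 1 else 1)"
  define t' where "t' y = s * real l * trig (\<not> c) l y" for y
  have t: "(trig c l has_real_derivative t' y) (at y)" "(t' has_real_derivative - (real l)\<^sup>2 * trig c l y) (at y)" for y
    unfolding t'_def trig_def[abs_def] s_def
    by (cases c; auto intro!: derivative_eq_intros simp: power2_eq_square)+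
  have tp: "trig c l (2 * pi) = trig c l 0" "t' (2 * pi) = t' 0"
    using trig_periodic[of _ l 0] by (auto simp: t'_def)
  note U2 = smooth_partial[OF assms(1), of 2]
  \<comment> \<open>The boundary term of two integrations by parts; its factors are periodic, so it
    takes the same value at 0 and \<open>2 pi\<close>.\<close>
  define F where "F y = partial 2 U (pt x y) * trig c l y - U (pt x y) * t' y" for y
  have "(F has_real_derivative (partial 2 (partial 2 U) (pt x y) * trig c l y - U (pt x y) * (- (real l)\<^sup>2 * trig c l y))) (at y)" for y
    unfolding F_def
    by (rule DERIV_cong[OF DERIV_diff[OF DERIV_mult[OF smooth_has_real_derivative(2)[OF U2] t(1)] DERIV_mult[OF smooth_has_real_derivative(2)[OF assms(1)] t(2)]]])
       (simp add: algebra_simps)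
  then have "((\<lambda>y. partial 2 (partial 2 U) (pt x y) * trig c l y - U (pt x y) * (- (real l)\<^sup>2 * trig c l y)) has_integral (F (2*pi) - F 0)) {0..2*pi}"
    by (intro fundamental_theorem_of_calculus)
       (auto simp: has_real_derivative_iff_has_vector_derivative[symmetric] has_field_derivative_at_within)
  moreover have "F (2*pi) = F 0"
    using assms(2) partial_biperiodic[OF assms, of 2] tp unfolding F_def biperiodic_def by (metis add_0)
  ultimately have 1: "((\<lambda>y. partial 2 (partial 2 U) (pt x y) * trig c l y + (real l)\<^sup>2 * (U (pt x y) * trig c l y)) has_integral 0) {0..2*pi}"
    by (simp add: algebra_simps)
  have i1: "(\<lambda>y. partial 2 (partial 2 U) (pt x y) * trig c l y) integrable_on {0..2*pi}"
    by (intro integrable_continuous_interval continuous_intros trig_cont smooth_continuous_compose[OF smooth_partial[OF U2]])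
  have i2: "(\<lambda>y. (real l)\<^sup>2 * (U (pt x y) * trig c l y)) integrable_on {0..2*pi}"
    by (intro integrable_continuous_interval continuous_intros trig_cont smooth_continuous_compose[OF assms(1)])
  show ?thesis using integral_unique[OF 1] unfolding integral_add[OF i1 i2] by simp
qed

lemma sum_bool4: "(\<Sum>(a, b)\<in>(UNIV :: (bool \<times> bool) set). f a b) = f True True + f True False + f False True + f False False"
  by (simp add: UNIV_Times_UNIV[symmetric] sum.cartesian_product[symmetric] UNIV_bool add_ac del: UNIV_Times_UNIV)

section \<open>Separation of variables\<close>

context sturm
begin

text \<open>The eigenvalue equation multiplied by \<open>\<rho>\<close>. In dimension two the
  conformal factor \<open>\<rho>\<close> then occurs on the right only.\<close>

definition pde :: "real \<Rightarrow> (real^2 \<Rightarrow> real) \<Rightarrow> bool" where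
  "pde lam U \<longleftrightarrow> (\<forall>p. partial 1 (\<lambda>q. partial 1 U q / w (q $ 1)) p / w (p $ 1)
     + partial 2 (partial 2 U) p = - lam * \<rho> (p $ 1) * U p)"

text \<open>The flag \<open>tw\<close> enlarges the lattice of periods of the plane by the half period \<open>(pi, pi)\<close>.\<close>

definition pspace :: "bool \<Rightarrow> real \<Rightarrow> (real^2 \<Rightarrow> real) set" where
  "pspace tw lam = {U. smooth U \<and> biperiodic U \<and> pde lam U \<and> (tw \<longrightarrow> (\<forall>x y. U (pt (x + pi) (y + pi)) = U (pt x y)))}"

lemma smooth_w_inverse: "smooth U \<Longrightarrow> smooth (\<lambda>q. U q / w (q $ 1))"
  by (rule smooth_divide[OF _ elementary_smooth[OF w_elementary]]) (auto simp: w_pos less_imp_neq[symmetric])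

text \<open>Integration against \<open>trig c l\<close> commutes with the derivatives in
  \<open>x\<close> and, after two integrations by parts, replaces the second derivative in
  \<open>y\<close> by the factor \<open>- l^2\<close>. The companion \<open>b\<close> is the
  coefficient of \<open>partial 1 U / w\<close>.\<close>

lemma fc_solution:
  assumes U: "smooth U" "biperiodic U" "pde lam U"
  shows "\<exists>b. solution (kap (real l) lam) (fc c l U) b"
proof
  define V where "V q = partial 1 U q / w (q $ 1)" for q
  have V: "smooth V" unfolding V_def by (intro smooth_w_inverse smooth_partial U)
  define b where "b x = integral {0..2*pi} (\<lambda>y. V (pt x y) * trig c l y) / trig_norm l" for x
  show "solution (kap (real l) lam) (fc c l U) b"
    unfolding solution_def
  proof (intro allI conjI)
    fix x
    have "integral {0..2*pi} (\<lambda>y. partial 1 U (pt x y) * trig c l y) = w x * integral {0..2*pi} (\<lambda>y. V (pt x y) * trig c l y)"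
      using w_pos[of x] by (subst integral_mult_right[symmetric]) (simp add: V_def)
    moreover have "((\<lambda>x. integral {0..2*pi} (\<lambda>y. U (pt x y) * trig c l y)) has_real_derivative
        integral {0..2*pi} (\<lambda>y. partial 1 U (pt x y) * trig c l y)) (at x)"
      by (rule deriv_integral_pt[OF U(1) trig_cont])
    note DERIV_cdivide[OF this, of "trig_norm l"]
    ultimately show "(fc c l U has_real_derivative w x * b x) (at x)"
      by (simp add: fc_def[abs_def] b_def)
    have eq: "partial 1 V (pt x y) * trig c l y =
       - (w x * lam * \<rho> x) * (U (pt x y) * trig c l y) - w x * (partial 2 (partial 2 U) (pt x y) * trig c l y)" for y
    proof -
      have "partial 1 V (pt x y) / w x + partial 2 (partial 2 U) (pt x y) = - lam * \<rho> x * U (pt x y)"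
        using U(3)[unfolded pde_def, rule_format, of "pt x y"] by (simp add: V_def[abs_def])
      then have "partial 1 V (pt x y) = w x * (- lam * \<rho> x * U (pt x y) - partial 2 (partial 2 U) (pt x y))"
        using w_pos[of x] by (simp add: field_simps)
      then show ?thesis by (simp only:) (simp add: algebra_simps)
    qed
    have i1: "(\<lambda>y. - (w x * lam * \<rho> x) * (U (pt x y) * trig c l y)) integrable_on {0..2*pi}"
      by (intro integrable_continuous_interval continuous_intros trig_cont smooth_continuous_compose[OF U(1)])
    have i2: "(\<lambda>y. w x * (partial 2 (partial 2 U) (pt x y) * trig c l y)) integrable_on {0..2*pi}"
      by (intro integrable_continuous_interval continuous_intros trig_cont smooth_continuous_compose[OF smooth_partial[OF smooth_partial[OF U(1)]]])
    have "integral {0..2*pi} (\<lambda>y. partial 1 V (pt x y) * trig c l y)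
       = - (w x * lam * \<rho> x) * integral {0..2*pi} (\<lambda>y. U (pt x y) * trig c l y)
         - w x * (- (real l)\<^sup>2 * integral {0..2*pi} (\<lambda>y. U (pt x y) * trig c l y))"
      unfolding eq integral_diff[OF i1 i2] integral_mult_right integral_partial2_trig[OF U(1,2)] ..
    also have "\<dots> = - (w x * kap (real l) lam x * integral {0..2*pi} (\<lambda>y. U (pt x y) * trig c l y))"
      by (simp add: kap_def algebra_simps)
    moreover have "((\<lambda>x. integral {0..2*pi} (\<lambda>y. V (pt x y) * trig c l y)) has_real_derivative
        integral {0..2*pi} (\<lambda>y. partial 1 V (pt x y) * trig c l y)) (at x)"
      by (rule deriv_integral_pt[OF V trig_cont])
    note DERIV_cdivide[OF this, of "trig_norm l"]
    ultimately show "(b has_real_derivative - (w x * kap (real l) lam x * fc c l U x)) (at x)"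
      by (simp add: fc_def b_def[abs_def])
  qed
qed

lemma solution_proj:
  assumes "solution (kap l lam) a b" shows "\<exists>b. solution (kap l lam) (proj nu nu' a) b"
proof -
  note s = solution_lincomb[OF solution_lincomb[OF assms solution_minus[OF assms], of "1/4" "sg nu / 4"]
     solution_lincomb[OF solution_reflect[OF assms] solution_shift[OF assms], of "sg nu' / 4" "sg nu * sg nu' / 4"], of 1 1]
  have "(\<lambda>x. 1 * (1 / 4 * a x + sg nu / 4 * a (- x)) + 1 * (sg nu' / 4 * a (pi - x) + sg nu * sg nu' / 4 * a (x + pi))) = proj nu nu' a"
    by (rule ext) (simp add: proj_def field_simps)
  with s show ?thesis by metis
qed

type_synonym index = "bool \<times> bool \<times> nat \<times> bool"

text \<open>For \<open>l = 0\<close> the sine vanishes identically and is excluded. The product of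
  signs is the factor that a mode acquires under the shift by \<open>(pi, pi)\<close>.\<close>

definition admissible :: "bool \<Rightarrow> index set" where
  "admissible tw = {(nu, nu', l, c). (l = 0 \<longrightarrow> c) \<and> (tw \<longrightarrow> sg nu * sg nu' * (- 1) ^ l = 1)}"

definition Ix :: "bool \<Rightarrow> real \<Rightarrow> index set" where
  "Ix tw lam = {(nu, nu', l, c). (nu, nu', l, c) \<in> admissible tw \<and> lam \<in> spec nu nu' (real l)}"

definition bas :: "real \<Rightarrow> index \<Rightarrow> real^2 \<Rightarrow> real" where
  "bas lam = (\<lambda>(nu, nu', l, c) p. eig nu (real l) lam (p $ 1) * trig c l (p $ 2))"

lemma eig_nonzero: obtains x where "eig nu l lam x \<noteq> 0"
proof -
  have "\<not> (\<forall>x. eig nu l lam x = 0)"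
  proof
    assume z: "\<forall>x. eig nu l lam x = 0"
    then have "eig nu l lam = (\<lambda>x. 0)" by auto
    then have "w 0 * eig' nu l lam 0 = 0"
      using solutionD(1)[OF eig_solution[of l lam nu], of 0] DERIV_const DERIV_unique by metis
    then show False using w_pos[of 0] z[rule_format, of 0] eig_0[of nu l lam] by (simp split: if_splits)
  qed
  then show ?thesis using that by blast
qed

text \<open>\<open>eig\<close> is known only through its differential equation. The functions
  \<open>eig * u + eig' * v\<close> with smooth \<open>u\<close>, \<open>v\<close> form a class
  stable under \<open>partial\<close>, because the system expresses the derivatives of
  \<open>eig\<close> and \<open>eig'\<close> by each other.\<close>

lemma smooth_bas:
  assumes t: "smooth t" shows "smooth (\<lambda>p. eig nu l lam (p $ 1) * t p)"
proof -
  let ?k = "\<lambda>x. kap l lam x"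
  let ?P = "\<lambda>f. \<exists>u v. smooth u \<and> smooth v \<and> f = (\<lambda>p. eig nu l lam (p $ 1) * u p + eig' nu l lam (p $ 1) * v p)"
  have c1: "((\<lambda>p::real^2. p $ 1) has_derivative (\<lambda>v. v $ 1)) (at p)" for p
    by (intro bounded_linear_imp_has_derivative bounded_linear_vec_nth)
  have "smooth f" if "?P f" for f
  proof (rule smooth_coinduct[where P = ?P, OF that])
    fix f assume "?P f"
    then obtain u v where u: "smooth u" and v: "smooth v"
      and f: "f = (\<lambda>p. eig nu l lam (p $ 1) * u p + eig' nu l lam (p $ 1) * v p)" by blast
    have e: "((\<lambda>p. eig nu l lam (p $ 1)) has_derivative (\<lambda>h. (w (p $ 1) * eig' nu l lam (p $ 1)) * h $ 1)) (at p)" for p :: "real^2"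
      using has_derivative_compose[OF c1 solutionD(1)[OF eig_solution, unfolded has_field_derivative_def]] by simp
    have e': "((\<lambda>p. eig' nu l lam (p $ 1)) has_derivative (\<lambda>h. (- (w (p $ 1) * kap l lam (p $ 1) * eig nu l lam (p $ 1))) * h $ 1)) (at p)" for p :: "real^2"
      using has_derivative_compose[OF c1 solutionD(2)[OF eig_solution, unfolded has_field_derivative_def]] by simp
    have d: "(f has_derivative (\<lambda>h. (eig nu l lam (p $ 1) * frechet_derivative u (at p) h
        + (w (p $ 1) * eig' nu l lam (p $ 1)) * h $ 1 * u p)
      + (eig' nu l lam (p $ 1) * frechet_derivative v (at p) h
        + (- (w (p $ 1) * kap l lam (p $ 1) * eig nu l lam (p $ 1))) * h $ 1 * v p))) (at p)" for p
      unfolding f by (intro has_derivative_add has_derivative_mult e e' smooth_has_derivative u v)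
    have pi': "partial i f = (\<lambda>p. eig nu l lam (p $ 1) * (partial i u p + (- 1) * (w (p $ 1) * (lam * \<rho> (p $ 1) - l\<^sup>2) * axis i 1 $ 1 * v p))
        + eig' nu l lam (p $ 1) * (partial i v p + w (p $ 1) * axis i 1 $ 1 * u p))" for i
      using partial_eq[OF d] by (simp add: partial_def[abs_def] kap_def algebra_simps)
    have "?P (partial i f)" for i
      unfolding pi'
      by (rule exI[of _ "\<lambda>p. partial i u p + (- 1) * (w (p $ 1) * (lam * \<rho> (p $ 1) - l\<^sup>2) * axis i 1 $ 1 * v p)"],
          rule exI[of _ "\<lambda>p. partial i v p + w (p $ 1) * axis i 1 $ 1 * u p"]) (intro conjI refl smooth_add smooth_mult smooth_diff smooth_partial u v smooth_const
          elementary_smooth[OF w_elementary] elementary_smooth[OF \<rho>_elementary])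
    then show "(\<forall>p. f differentiable (at p)) \<and> (\<forall>i. ?P (partial i f))"
      using d by (auto simp: differentiable_def)
  qed
  moreover have "?P (\<lambda>p. eig nu l lam (p $ 1) * t p)"
    by (rule exI[of _ t], rule exI[of _ "\<lambda>p. 0"]) (simp add: t)
  ultimately show ?thesis by blast
qed

lemma smooth_trig: "smooth (\<lambda>p. trig c l (p $ 2))"
  unfolding trig_def by (cases c) (auto intro!: smooth_sin smooth_cos smooth_mult)

lemma bas_shift:
  assumes "lam \<in> spec nu nu' (real l)"
  shows "bas lam (nu, nu', l, c) (pt (x + pi) (y + pi)) = sg nu * sg nu' * (- 1) ^ l * bas lam (nu, nu', l, c) (pt x y)"
    and "eig nu (real l) lam (x + pi) = sg nu * sg nu' * eig nu (real l) lam x"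
proof -
  show e: "eig nu (real l) lam (x + pi) = sg nu * sg nu' * eig nu (real l) lam x"
    using eig_reflect[OF assms, of "- x"] eig_minus[of nu "real l" lam x] by (simp add: add.commute)
  show "bas lam (nu, nu', l, c) (pt (x + pi) (y + pi)) = sg nu * sg nu' * (- 1) ^ l * bas lam (nu, nu', l, c) (pt x y)"
    unfolding bas_def by (simp add: e trig_shift)
qed

lemma bas_pspace:
  assumes i: "i \<in> Ix tw lam" shows "bas lam i \<in> pspace tw lam"
proof -
  obtain nu nu' l c where ie: "i = (nu, nu', l, c)" by (cases i)
  have adm: "tw \<longrightarrow> sg nu * sg nu' * (- 1) ^ l = 1" and sp: "lam \<in> spec nu nu' (real l)"
    using i unfolding ie Ix_def admissible_def by auto
  define e e' where "e = eig nu (real l) lam" and "e' = eig' nu (real l) lam"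
  have s: "solution (kap (real l) lam) e e'" unfolding e_def e'_def by (rule eig_solution)
  have U: "bas lam i = (\<lambda>p. e (p $ 1) * trig c l (p $ 2))" by (simp add: ie bas_def e_def)
  have sm: "smooth (bas lam i)" unfolding U e_def by (intro smooth_bas smooth_trig)
  have shift: "e (x + pi) = sg nu * sg nu' * e x" for x
    unfolding e_def by (rule bas_shift(2)[OF sp])
  have "e (x + 2 * pi) = e x" for x
    using shift[of "x + pi"] shift[of x] by (auto simp: algebra_simps split: if_splits)
  then have per: "biperiodic (bas lam i)" unfolding U biperiodic_def by (simp add: trig_periodic)
  have tw: "tw \<longrightarrow> (\<forall>x y. bas lam i (pt (x + pi) (y + pi)) = bas lam i (pt x y))"
  proof (intro impI allI)
    fix x y assume tw
    then show "bas lam i (pt (x + pi) (y + pi)) = bas lam i (pt x y)"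
      using adm bas_shift(1)[OF sp] unfolding ie by simp
  qed
  have p1: "partial 1 (bas lam i) (pt x y) = (w x * e' x) * trig c l y" for x y
    using DERIV_cmult_right[OF solutionD(1)[OF s, of x], of "trig c l y"] by (intro partial_1_eqI sm) (simp add: U)
  have V: "smooth (\<lambda>q. partial 1 (bas lam i) q / w (q $ 1))" by (intro smooth_w_inverse smooth_partial sm)
  have V': "partial 1 (bas lam i) (pt x y) / w x = e' x * trig c l y" for x y
    using w_pos[of x] by (simp add: p1)
  have p11: "partial 1 (\<lambda>q. partial 1 (bas lam i) q / w (q $ 1)) (pt x y) = - (w x * kap (real l) lam x * e x) * trig c l y" for x y
    using DERIV_cmult_right[OF solutionD(2)[OF s, of x], of "trig c l y"] by (intro partial_1_eqI V) (simp add: V')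
  define \<sigma> :: real where "\<sigma> = (if c then - 1 else 1)"
  have t: "(trig c l has_real_derivative \<sigma> * real l * trig (\<not> c) l y) (at y)"
    "((\<lambda>y. \<sigma> * real l * trig (\<not> c) l y) has_real_derivative - (real l)\<^sup>2 * trig c l y) (at y)" for y
    unfolding trig_def[abs_def] \<sigma>_def
    by (cases c; auto intro!: derivative_eq_intros simp: power2_eq_square)+
  have p2: "partial 2 (bas lam i) (pt x y) = e x * (\<sigma> * real l * trig (\<not> c) l y)" for x y
    using DERIV_cmult[OF t(1), of "e x" y] by (intro partial_2_eqI sm) (simp add: U)
  have p22: "partial 2 (partial 2 (bas lam i)) (pt x y) = e x * (- (real l)\<^sup>2 * trig c l y)" for x y
    using DERIV_cmult[OF t(2), of "e x" y] by (intro partial_2_eqI smooth_partial sm) (simp add: p2)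
  have "pde lam (bas lam i)"
    unfolding pde_def
  proof
    fix p :: "real^2"
    define x y where "x = p $ 1" and "y = p $ 2"
    have p: "p = pt x y" by (simp add: x_def y_def pt_eta)
    show "partial 1 (\<lambda>q. partial 1 (bas lam i) q / w (q $ 1)) p / w (p $ 1) + partial 2 (partial 2 (bas lam i)) p
       = - lam * \<rho> (p $ 1) * bas lam i p"
    proof -
      have "w x \<noteq> 0" using w_pos[of x] by simp
      then have "- (w x * kap (real l) lam x * e x) * trig c l y / w x = - (kap (real l) lam x * e x * trig c l y)" by simp
      then show ?thesis unfolding p p11 p22 by (simp add: U kap_def algebra_simps)
    qed
  qed
  with sm per tw show ?thesis by (simp add: pspace_def)
qed

text \<open>For given \<open>nu\<close> and \<open>l\<close> at most one condition at
  \<open>pi/2\<close> occurs for \<open>lam\<close>, so the same function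
  \<open>eig nu l lam\<close> is never listed under two indices; independence of the modes rests on
  this.\<close>

lemma spec_exclusive: "lam \<in> spec nu True l \<Longrightarrow> lam \<notin> spec nu False l"
  using sin_cos_squared_add[of "Ang nu l lam"] by (auto simp: spec_def)

lemma finite_Ix: "finite (Ix tw lam)"
proof -
  obtain L where L: "\<forall>l. L \<le> \<bar>l\<bar> \<longrightarrow> (\<forall>nu nu'. \<forall>lam'\<le>lam. lam' \<notin> spec nu nu' l)"
    using spec_bound by blast
  have "Ix tw lam \<subseteq> UNIV \<times> UNIV \<times> {..nat \<lceil>L\<rceil>} \<times> UNIV"
  proof
    fix i assume "i \<in> Ix tw lam"
    then obtain nu nu' l c where i: "i = (nu, nu', l, c)" "(nu, nu', l, c) \<in> Ix tw lam" by (cases i) auto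
    then have "lam \<in> spec nu nu' (real l)" by (simp add: Ix_def)
    then have "\<not> L \<le> \<bar>real l\<bar>" using L by blast
    then have "l \<le> nat \<lceil>L\<rceil>" by linarith
    then show "i \<in> UNIV \<times> UNIV \<times> {..nat \<lceil>L\<rceil>} \<times> UNIV" by (simp add: i)
  qed
  then show ?thesis by (rule finite_subset) (intro finite_cartesian_product finite_atMost finite)
qed

text \<open>Orthogonality retains only the indices with this \<open>(l, c)\<close>, at most one for
  each of the four pairs of boundary conditions.\<close>

lemma fc_sum_bas:
  assumes J: "finite J" "J \<subseteq> admissible False" and cl: "l = 0 \<longrightarrow> c"
  shows "fc c l (\<lambda>p. \<Sum>i\<in>J. k i * bas lam i p) x =
    (\<Sum>(nu, nu')\<in>UNIV. if (nu, nu', l, c) \<in> J then k (nu, nu', l, c) * eig nu (real l) lam x else 0)"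
proof -
  define g where "g = (\<lambda>(nu::bool, nu'::bool, l'::nat, c'::bool). if c' = c \<and> l' = l then eig nu (real l) lam x else 0)"
  have "integral {0..2*pi} (\<lambda>y. (\<Sum>i\<in>J. k i * bas lam i (pt x y)) * trig c l y)
      = integral {0..2*pi} (\<lambda>y. \<Sum>i\<in>J. k i * (bas lam i (pt x y) * trig c l y))"
    by (simp add: sum_distrib_right mult.assoc)
  also have "\<dots> = (\<Sum>i\<in>J. integral {0..2*pi} (\<lambda>y. k i * (bas lam i (pt x y) * trig c l y)))"
  proof (rule integral_sum[OF J(1)])
    fix i assume "i \<in> J"
    show "(\<lambda>y. k i * (bas lam i (pt x y) * trig c l y)) integrable_on {0..2*pi}"
      by (cases i) (auto simp: bas_def intro!: integrable_continuous_interval continuous_intros trig_cont)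
  qed
  also have "\<dots> = (\<Sum>i\<in>J. k i * (g i * trig_norm l))"
  proof (rule sum.cong[OF refl])
    fix i assume "i \<in> J"
    obtain nu nu' l' c' where ie: "i = (nu, nu', l', c')" by (cases i)
    have cl': "l' = 0 \<longrightarrow> c'" using \<open>i \<in> J\<close> J(2) unfolding ie admissible_def by auto
    have "integral {0..2*pi} (\<lambda>y. k i * (bas lam i (pt x y) * trig c l y))
        = k i * (eig nu (real l') lam x * integral {0..2*pi} (\<lambda>y. trig c' l' y * trig c l y))"
      unfolding ie bas_def by (simp add: mult.assoc)
    also have "\<dots> = k i * (g i * trig_norm l)"
      using integral_trig_mult[of l' c' l c] cl cl' by (auto simp: ie g_def)
    finally show "integral {0..2*pi} (\<lambda>y. k i * (bas lam i (pt x y) * trig c l y)) = k i * (g i * trig_norm l)" .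
  qed
  finally have "fc c l (\<lambda>p. \<Sum>i\<in>J. k i * bas lam i p) x = (\<Sum>i\<in>J. k i * g i)"
    using trig_norm_pos[of l] by (simp add: fc_def mult.assoc[symmetric] sum_distrib_right[symmetric])
  also have "\<dots> = (\<Sum>i\<in>J \<inter> (\<lambda>(nu, nu'). (nu, nu', l, c)) ` UNIV. k i * g i)"
    by (rule sum.mono_neutral_right) (use J(1) in \<open>auto simp: g_def image_iff split: prod.splits\<close>)
  also have "\<dots> = (\<Sum>i\<in>(\<lambda>(nu, nu'). (nu, nu', l, c)) ` UNIV. if i \<in> J then k i * g i else 0)"
    by (subst Int_commute, subst sum.inter_restrict) auto
  also have "\<dots> = (\<Sum>(nu, nu')\<in>UNIV. if (nu, nu', l, c) \<in> J then k (nu, nu', l, c) * eig nu (real l) lam x else 0)"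
    by (subst sum.reindex) (auto simp: inj_on_def g_def o_def intro!: sum.cong)
  finally show ?thesis .
qed

lemma bas_independent:
  assumes "\<And>p. (\<Sum>i\<in>Ix tw lam. k i * bas lam i p) = 0"
  shows "\<forall>i\<in>Ix tw lam. k i = 0"
proof clarify
  fix nu nu' l c assume i: "(nu, nu', l, c) \<in> Ix tw lam"
  then have cl: "l = 0 \<longrightarrow> c" by (auto simp: Ix_def admissible_def)
  define K where "K nu nu' = (if (nu, nu', l, c) \<in> Ix tw lam then k (nu, nu', l, c) else 0)" for nu nu'
  have J: "Ix tw lam \<subseteq> admissible False" by (auto simp: Ix_def admissible_def)
  have "fc c l (\<lambda>p. \<Sum>i\<in>Ix tw lam. k i * bas lam i p) x = 0" for x
    unfolding assms by (simp add: fc_def)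
  then have "(\<Sum>(nu, nu')\<in>UNIV. if (nu, nu', l, c) \<in> Ix tw lam then k (nu, nu', l, c) * eig nu (real l) lam x else 0) = 0" for x
    unfolding fc_sum_bas[OF finite_Ix J cl] .
  then have "(\<Sum>(nu, nu')\<in>UNIV. K nu nu' * eig nu (real l) lam x) = 0" for x
    unfolding K_def by (simp add: if_distrib[of "\<lambda>t. t * _"] cong: if_cong)
  then have z: "(K True True + K True False) * eig True (real l) lam x + (K False True + K False False) * eig False (real l) lam x = 0" for x
    unfolding sum_bool4 by (simp add: algebra_simps)
  \<comment> \<open>At 0 the Neumann solution is 1 and the Dirichlet solution 0, which separates the
    two sums; \<open>spec_exclusive\<close> then leaves at most one term in each.\<close>
  have kT: "K True True + K True False = 0" using z[of 0] eig_0(1)[of _ "real l" lam] by simp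
  have kF: "K False True + K False False = 0"
  proof -
    obtain x where "eig False (real l) lam x \<noteq> 0" by (rule eig_nonzero)
    then show ?thesis using z[of x] kT by simp
  qed
  have "K nu True = 0 \<or> K nu False = 0" for nu
    using spec_exclusive[of lam nu "real l"] by (auto simp: K_def Ix_def)
  then have "K nu nu' = 0" using kT kF by (cases nu; cases nu') (metis add.left_neutral add.right_neutral)+
  then show "k (nu, nu', l, c) = 0" using i by (simp add: K_def)
qed

text \<open>Every Fourier coefficient of \<open>U\<close> splits into four parity parts, each a
  multiple of an \<open>eig\<close> that can be nonzero only if \<open>lam\<close> lies in the
  corresponding spectrum. The sum over the finite set \<open>Ix\<close> therefore has all Fourier
  coefficients of \<open>U\<close>, and \<open>fourier_uniqueness\<close> identifies the two for
  every \<open>x\<close>.\<close>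

lemma pspace_expansion:
  assumes U: "smooth U" "biperiodic U" "pde lam U"
  obtains k where "\<And>p. U p = (\<Sum>i\<in>Ix False lam. k i * bas lam i p)"
proof -
  define P where "P nu nu' l c \<kappa> \<longleftrightarrow> (\<forall>x. proj nu nu' (fc c l U) x = \<kappa> * eig nu (real l) lam x) \<and>
    (\<kappa> \<noteq> 0 \<longrightarrow> lam \<in> spec nu nu' (real l))" for nu nu' l c \<kappa>
  define \<kappa> where "\<kappa> nu nu' l c = (SOME \<kappa>. P nu nu' l c \<kappa>)" for nu nu' l c
  have "P nu nu' l c (\<kappa> nu nu' l c)" for nu nu' l c
    unfolding \<kappa>_def
  proof (rule someI_ex)
    obtain b where "solution (kap (real l) lam) (fc c l U) b" using fc_solution[OF U] by blast
    then obtain b where b: "solution (kap (real l) lam) (proj nu nu' (fc c l U)) b" using solution_proj by blast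
    note * = solution_symmetric[OF b proj_minus proj_reflect[where a = "fc c l U", OF fc_periodic[OF U(2)]]]
    show "\<exists>\<kappa>. P nu nu' l c \<kappa>"
      unfolding P_def by (rule exI, rule conjI, rule allI, rule *(1), rule impI, rule *(2))
  qed
  then have \<kappa>: "\<And>nu nu' l c x. proj nu nu' (fc c l U) x = \<kappa> nu nu' l c * eig nu (real l) lam x"
    "\<And>nu nu' l c. \<kappa> nu nu' l c \<noteq> 0 \<Longrightarrow> lam \<in> spec nu nu' (real l)"
    unfolding P_def by blast+
  define k where "k = (\<lambda>(nu, nu', l, c). \<kappa> nu nu' l c)"
  define W where "W p = (\<Sum>i\<in>Ix False lam. k i * bas lam i p)" for p
  have J: "Ix False lam \<subseteq> admissible False" by (auto simp: Ix_def)
  have Wfc: "fc c l W x = fc c l U x" if cl: "l = 0 \<longrightarrow> c" for c l x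
  proof -
    have "(if (nu, nu', l, c) \<in> Ix False lam then k (nu, nu', l, c) * eig nu (real l) lam x else 0) = proj nu nu' (fc c l U) x" for nu nu'
      using \<kappa>(2)[of nu nu' l c] cl by (auto simp: \<kappa>(1) k_def Ix_def admissible_def)
    then have "fc c l W x = (\<Sum>(nu, nu')\<in>UNIV. proj nu nu' (fc c l U) x)"
      unfolding W_def fc_sum_bas[OF finite_Ix J cl] by simp
    also have "\<dots> = fc c l U x" unfolding sum_bool4 using proj_sum[of "fc c l U" x] by simp
    finally show ?thesis .
  qed
  have Wp: "W (pt x (y + 2 * pi)) = W (pt x y)" for x y
    unfolding W_def bas_def by (auto intro!: sum.cong simp: trig_periodic)
  have Wc: "continuous_on S (\<lambda>y. W (pt x y))" for x S
    unfolding W_def bas_def split_beta by (intro continuous_intros) (auto intro!: continuous_intros trig_cont)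
  have "U (pt x y) = W (pt x y)" for x y
  proof -
    have "U (pt x y) - W (pt x y) = 0"
    proof (rule fourier_uniqueness[where v = "\<lambda>y. U (pt x y) - W (pt x y)"])
      show "continuous_on UNIV (\<lambda>y. U (pt x y) - W (pt x y))"
        by (intro continuous_intros smooth_continuous_compose[OF U(1)] Wc)
      show "U (pt x (y + 2 * pi)) - W (pt x (y + 2 * pi)) = U (pt x y) - W (pt x y)" for y
        using U(2) by (simp add: Wp biperiodic_def)
      fix c l
      have i: "(\<lambda>y. U (pt x y) * trig c l y) integrable_on {0..2*pi}" "(\<lambda>y. W (pt x y) * trig c l y) integrable_on {0..2*pi}"
        by (intro integrable_continuous_interval continuous_intros smooth_continuous_compose[OF U(1)] Wc trig_cont)+
      show "integral {0..2*pi} (\<lambda>y. (U (pt x y) - W (pt x y)) * trig c l y) = 0"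
      proof (cases "l = 0 \<longrightarrow> c")
        case True
        then show ?thesis using Wfc[OF True, of x] trig_norm_pos[of l] integral_diff[OF i]
          by (simp add: fc_def left_diff_distrib)
      qed (simp add: trig_def)
    qed
    then show ?thesis by simp
  qed
  then have "U (pt (p $ 1) (p $ 2)) = W (pt (p $ 1) (p $ 2))" for p :: "real^2" by blast
  then have "U p = W p" for p unfolding pt_eta .
  then show ?thesis using that[of k] by (simp add: W_def)
qed

lemma partial_lincomb:
  assumes "smooth U" "smooth V"
  shows "partial i (\<lambda>p. a * U p + V p :: real) = (\<lambda>p. a * partial i U p + partial i V p)"
proof -
  have "((\<lambda>p. a * U p + V p) has_derivative (\<lambda>h. a * frechet_derivative U (at p) h + frechet_derivative V (at p) h)) (at p)" for p
    by (intro has_derivative_add has_derivative_mult_right smooth_has_derivative assms)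
  from partial_eq[OF this] show ?thesis by (simp add: partial_def)
qed

lemma pspace_lincomb:
  assumes "U \<in> pspace tw lam" "V \<in> pspace tw lam" shows "(\<lambda>p. a * U p + V p) \<in> pspace tw lam"
proof -
  have U: "smooth U" "biperiodic U" "pde lam U" and V: "smooth V" "biperiodic V" "pde lam V"
    using assms by (auto simp: pspace_def)
  note sm = smooth_partial[OF U(1)] smooth_partial[OF V(1)]
  have "pde lam (\<lambda>p. a * U p + V p)"
    unfolding pde_def
  proof
    fix p :: "real^2"
    have 1: "(\<lambda>q. (a * partial 1 U q + partial 1 V q) / w (q $ 1)) = (\<lambda>q. a * (partial 1 U q / w (q $ 1)) + partial 1 V q / w (q $ 1))"
      by (simp add: add_divide_distrib)
    show "partial 1 (\<lambda>q. partial 1 (\<lambda>p. a * U p + V p) q / w (q $ 1)) p / w (p $ 1) + partial 2 (partial 2 (\<lambda>p. a * U p + V p)) p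
       = - lam * \<rho> (p $ 1) * (a * U p + V p)"
      unfolding partial_lincomb[OF U(1) V(1)] 1 partial_lincomb[OF smooth_w_inverse[OF sm(1)] smooth_w_inverse[OF sm(2)]]
        partial_lincomb[OF sm]
      using arg_cong2[where f = "\<lambda>s t. a * s + t", OF U(3)[unfolded pde_def, rule_format, of p] V(3)[unfolded pde_def, rule_format, of p]]
      by (simp add: algebra_simps add_divide_distrib)
  qed
  then show ?thesis using assms
    by (auto simp: pspace_def biperiodic_def intro!: smooth_add smooth_mult)
qed

lemma pspace_zero: "(\<lambda>p. 0) \<in> pspace tw lam"
proof -
  have "partial i (\<lambda>p. 0 :: real) = (\<lambda>p. 0)" for i
    using partial_eq[of "\<lambda>p. 0 :: real" "\<lambda>p v. 0" i] by simp
  then show ?thesis by (simp add: pspace_def biperiodic_def pde_def)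
qed

text \<open>For the larger lattice, expand first without the flag. Each mode is multiplied by a sign
  under the shift by \<open>(pi, pi)\<close>, so invariance and independence annihilate the
  coefficients of the modes with sign \<open>-1\<close>.\<close>

theorem pspace_eq: "{(\<lambda>p. \<Sum>i\<in>Ix tw lam. k i * bas lam i p) | k. True} = pspace tw lam"
proof (intro equalityI subsetI)
  fix h assume "h \<in> {(\<lambda>p. \<Sum>i\<in>Ix tw lam. k i * bas lam i p) | k. True}"
  then obtain k where h: "h = (\<lambda>p. \<Sum>i\<in>Ix tw lam. k i * bas lam i p)" by blast
  have "(\<lambda>p. \<Sum>i\<in>J. k i * bas lam i p) \<in> pspace tw lam" if "finite J" "J \<subseteq> Ix tw lam" for J
    using that
  proof (induction J rule: finite_induct)
    case empty
    then show ?case using pspace_zero by simp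
  next
    case (insert i J)
    then show ?case using pspace_lincomb[OF bas_pspace[of i tw lam], of "\<lambda>p. \<Sum>i\<in>J. k i * bas lam i p" "k i"] by simp
  qed
  then show "h \<in> pspace tw lam" unfolding h using finite_Ix by blast
next
  fix U assume U: "U \<in> pspace tw lam"
  then have U': "smooth U" "biperiodic U" "pde lam U" by (auto simp: pspace_def)
  obtain k where k: "\<And>p. U p = (\<Sum>i\<in>Ix False lam. k i * bas lam i p)" by (rule pspace_expansion[OF U'], rule that)
  have sub: "Ix tw lam \<subseteq> Ix False lam" by (auto simp: Ix_def admissible_def)
  have "k i = 0" if i: "i \<in> Ix False lam - Ix tw lam" for i
  proof -
    have tw: tw using i by (auto simp: Ix_def admissible_def)
    define s where "s = (\<lambda>(nu, nu', l :: nat, c :: bool). sg nu * sg nu' * (- 1) ^ l)"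
    have sh: "bas lam i (pt (x + pi) (y + pi)) = s i * bas lam i (pt x y)" if "i \<in> Ix False lam" for i x y
      using that bas_shift(1) by (cases i) (auto simp: Ix_def s_def)
    have "(\<Sum>i\<in>Ix False lam. (k i * (s i - 1)) * bas lam i p) = 0" for p
    proof -
      have "(\<Sum>i\<in>Ix False lam. (k i * (s i - 1)) * bas lam i (pt x y)) = U (pt (x + pi) (y + pi)) - U (pt x y)" for x y
        unfolding k sum_subtractf[symmetric] by (intro sum.cong refl) (simp only: sh, simp add: algebra_simps)
      also have "U (pt (x + pi) (y + pi)) - U (pt x y) = 0" for x y using U tw by (simp add: pspace_def)
      finally have "(\<Sum>i\<in>Ix False lam. (k i * (s i - 1)) * bas lam i (pt (p $ 1) (p $ 2))) = 0" .
      then show ?thesis unfolding pt_eta .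
    qed
    from bas_independent[OF this] i have "k i * (s i - 1) = 0" by blast
    moreover have "s i \<noteq> 1" using i tw by (cases i) (auto simp: Ix_def admissible_def s_def)
    ultimately show ?thesis by simp
  qed
  then have "U p = (\<Sum>i\<in>Ix tw lam. k i * bas lam i p)" for p
    unfolding k by (intro sum.mono_neutral_right finite_Ix sub) auto
  then show "U \<in> {(\<lambda>p. \<Sum>i\<in>Ix tw lam. k i * bas lam i p) | k. True}"
    by (intro CollectI exI[of _ k]) auto
qed

end

section \<open>Eigenvalues from multiplicities\<close>

text \<open>Let \<open>N' \<mu>\<close> and \<open>N \<mu>\<close> be the total multiplicity below
  \<open>\<mu>\<close> and up to \<open>\<mu>\<close>. The intervals from \<open>N' \<mu>\<close> to
  \<open>N \<mu>\<close>, half-open, partition the natural numbers; the sequence takes the value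
  \<open>\<mu>\<close> on its interval.\<close>

lemma mult_sequence_exists:
  fixes d :: "real \<Rightarrow> nat"
  assumes fin: "\<And>c. finite {\<mu>. \<mu> \<le> c \<and> 0 < d \<mu>}" and inf: "infinite {\<mu>. 0 < d \<mu>}"
  shows "\<exists>s. mono s \<and> (\<forall>\<mu>. finite {i::nat. s i = \<mu>} \<and> card {i. s i = \<mu>} = d \<mu>)"
proof -
  define D where "D c = {\<mu>. \<mu> \<le> c \<and> 0 < d \<mu>}" for c
  define D' where "D' c = {\<mu>. \<mu> < c \<and> 0 < d \<mu>}" for c
  have fD: "finite (D c)" "finite (D' c)" for c
    using fin[of c] by (auto simp: D_def D'_def intro: finite_subset[rotated])
  define N where "N c = sum d (D c)" for c
  define N' where "N' c = sum d (D' c)" for c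
  have N_mono: "N a \<le> N b" if "a \<le> b" for a b
    unfolding N_def by (rule sum_mono2[OF fD(1)]) (use that in \<open>auto simp: D_def\<close>)
  have N_le_N': "N a \<le> N' b" if "a < b" for a b
    unfolding N_def N'_def by (rule sum_mono2[OF fD(2)]) (use that in \<open>auto simp: D_def D'_def\<close>)
  have N_step: "N c = N' c + d c" for c
  proof (cases "0 < d c")
    case True
    then have "D c = insert c (D' c)" "c \<notin> D' c" by (auto simp: D_def D'_def)
    then show ?thesis using fD(2)[of c] by (simp add: N_def N'_def)
  next
    case False
    then have "D c = D' c" by (auto simp: D_def D'_def order.order_iff_strict)
    then show ?thesis using False by (simp add: N_def N'_def)
  qed
  have unb: "\<exists>c. k < N c" for k
  proof -
    obtain A where A: "finite A" "card A = Suc k" "A \<subseteq> {\<mu>. 0 < d \<mu>}"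
      using infinite_arbitrarily_large[OF inf, of "Suc k"] by blast
    then have "A \<noteq> {}" by auto
    have "A \<subseteq> D (Max A)" using A Max_ge[OF A(1)] by (auto simp: D_def)
    then have "sum d A \<le> N (Max A)" unfolding N_def by (intro sum_mono2 fD) auto
    moreover have "(\<Sum>\<mu>\<in>A. 1) \<le> sum d A" using A by (intro sum_mono) (auto simp: Suc_le_eq)
    ultimately show ?thesis using A(2) by (intro exI[of _ "Max A"]) simp
  qed
  have least: "\<exists>\<mu>. 0 < d \<mu> \<and> N' \<mu> \<le> k \<and> k < N \<mu>" for k
  proof -
    obtain c where c: "k < N c" using unb by blast
    define S where "S = {\<mu> \<in> D c. k < N \<mu>}"
    have fS: "finite S" using fD(1) by (simp add: S_def)
    have "D c \<noteq> {}" using c by (auto simp: N_def)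
    then have M: "Max (D c) \<in> D c" using Max_in fD(1) by blast
    have "D (Max (D c)) = D c"
    proof
      show "D c \<subseteq> D (Max (D c))" using Max_ge[OF fD(1)[of c]] by (auto simp: D_def)
      show "D (Max (D c)) \<subseteq> D c" using M by (auto simp: D_def)
    qed
    then have "N (Max (D c)) = N c" by (simp add: N_def)
    then have "S \<noteq> {}" using M c by (auto simp: S_def)
    define \<mu> where "\<mu> = Min S"
    have \<mu>: "\<mu> \<in> S" unfolding \<mu>_def by (rule Min_in[OF fS \<open>S \<noteq> {}\<close>])
    have "N' \<mu> \<le> k"
    proof (cases "D' \<mu> = {}")
      case False
      \<comment> \<open>The eigenvalue preceding \<open>\<mu>\<close>; by minimality of
        \<open>\<mu>\<close> its count \<open>N \<nu> = N' \<mu>\<close> does not exceed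
        \<open>k\<close>.\<close>
      define \<nu> where "\<nu> = Max (D' \<mu>)"
      have \<nu>: "\<nu> \<in> D' \<mu>" unfolding \<nu>_def by (rule Max_in[OF fD(2) False])
      have "D' \<mu> = D \<nu>"
      proof
        show "D' \<mu> \<subseteq> D \<nu>" using Max_ge[OF fD(2)[of \<mu>]] by (auto simp: D_def D'_def \<nu>_def)
        show "D \<nu> \<subseteq> D' \<mu>" using \<nu> by (auto simp: D_def D'_def)
      qed
      then have e: "N' \<mu> = N \<nu>" by (simp add: N_def N'_def)
      have "\<nu> \<notin> S"
      proof
        assume "\<nu> \<in> S"
        then have "\<mu> \<le> \<nu>" unfolding \<mu>_def by (rule Min_le[OF fS])
        then show False using \<nu> by (simp add: D'_def)
      qed
      moreover have "\<nu> \<in> D c" using \<nu> \<mu> by (auto simp: S_def D_def D'_def)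
      ultimately show ?thesis unfolding e S_def by simp
    qed (simp add: N'_def)
    then show ?thesis using \<mu> by (auto simp: S_def D_def)
  qed
  define s where "s k = (SOME \<mu>. 0 < d \<mu> \<and> N' \<mu> \<le> k \<and> k < N \<mu>)" for k
  have s: "0 < d (s k) \<and> N' (s k) \<le> k \<and> k < N (s k)" for k
    unfolding s_def by (rule someI_ex[OF least])
  have s_eq: "s k = \<mu> \<longleftrightarrow> N' \<mu> \<le> k \<and> k < N \<mu>" for k \<mu>
  proof
    assume *: "N' \<mu> \<le> k \<and> k < N \<mu>"
    show "s k = \<mu>"
    proof (rule antisym; rule ccontr)
      assume "\<not> s k \<le> \<mu>"
      then show False using N_le_N'[of \<mu> "s k"] s[of k] * by simp
    next
      assume "\<not> \<mu> \<le> s k"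
      then show False using N_le_N'[of "s k" \<mu>] s[of k] * by simp
    qed
  qed (use s in blast)
  have "mono s"
  proof (rule monoI, rule ccontr)
    fix i j :: nat assume "i \<le> j" "\<not> s i \<le> s j"
    then show False using N_le_N'[of "s j" "s i"] s[of i] s[of j] by simp
  qed
  moreover have "{i. s i = \<mu>} = {N' \<mu>..<N \<mu>}" for \<mu> by (auto simp: s_eq)
  then have "finite {i. s i = \<mu>} \<and> card {i. s i = \<mu>} = d \<mu>" for \<mu> by (simp add: N_step)
  ultimately show ?thesis by blast
qed

text \<open>By monotonicity these indices form an initial segment, which is determined by its size;
  the fibres add up to that size.\<close>

lemma mono_below_eq:
  fixes s :: "nat \<Rightarrow> real" and d :: "real \<Rightarrow> nat"
  assumes s: "mono s" and c: "\<And>\<mu>. finite {i. s i = \<mu>}" "\<And>\<mu>. card {i. s i = \<mu>} = d \<mu>"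
    and fin: "\<And>c. finite {\<mu>. \<mu> \<le> c \<and> 0 < d \<mu>}"
  shows "{i. s i < \<nu>} = {..<\<Sum>\<mu> | \<mu> < \<nu> \<and> 0 < d \<mu>. d \<mu>}" 
proof -
  define D where "D = {\<mu>. \<mu> < \<nu> \<and> 0 < d \<mu>}"
  have fD: "finite D" by (rule finite_subset[OF _ fin[of \<nu>]]) (auto simp: D_def)
  have pos: "0 < d (s i)" for i
    using card_gt_0_iff[of "{j. s j = s i}"] c by auto
  have U: "{i. s i < \<nu>} = (\<Union>\<mu>\<in>D. {i. s i = \<mu>})" using pos by (auto simp: D_def)
  have f: "finite {i. s i < \<nu>}" unfolding U using fD c(1) by simp
  have card: "card {i. s i < \<nu>} = sum d D"
    unfolding U by (subst card_UN_disjoint) (use fD c in auto)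
  have down: "j \<in> {i. s i < \<nu>}" if "i \<in> {i. s i < \<nu>}" "j \<le> i" for i j
    using that monoD[OF s that(2)] by simp
  have "{i. s i < \<nu>} = {..<card {i. s i < \<nu>}}"
  proof (rule card_subset_eq[OF finite_lessThan, symmetric, THEN sym])
    show "{i. s i < \<nu>} \<subseteq> {..<card {i. s i < \<nu>}}"
    proof
      fix i assume i: "i \<in> {i. s i < \<nu>}"
      have "{..i} \<subseteq> {i. s i < \<nu>}" using down[OF i] by blast
      then have "card {..i} \<le> card {i. s i < \<nu>}" by (rule card_mono[OF f])
      then show "i \<in> {..<card {i. s i < \<nu>}}" by simp
    qed
  qed simp
  then show ?thesis unfolding card D_def .
qed

text \<open>\<open>mono_below_eq\<close> also shows that two such sequences coincide, which
  justifies the definite description. Counting from 0, the first index with value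
  \<open>\<nu>\<close> is the number of eigenvalues below \<open>\<nu>\<close>.\<close>

lemma eigenvalue_eq:
  fixes d :: "real \<Rightarrow> nat"
  assumes basis: "\<And>\<mu>. \<exists>B. finite B \<and> funvs.independent B \<and> funvs.span B = eigenspace g \<mu> \<and> card B = d \<mu>"
    and fin: "\<And>c. finite {\<mu>. \<mu> \<le> c \<and> 0 < d \<mu>}" and inf: "infinite {\<mu>. 0 < d \<mu>}"
    and \<nu>: "0 < d \<nu>"
  shows "eigenvalue (\<Sum>\<mu> | \<mu> < \<nu> \<and> 0 < d \<mu>. d \<mu>) g = \<nu>"
proof -
  obtain s where s: "mono s" "\<And>\<mu>. finite {i::nat. s i = \<mu>}" "\<And>\<mu>. card {i. s i = \<mu>} = d \<mu>"
    using mult_sequence_exists[OF fin inf] by blast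
  have "eigenvalue_sequence g s"
    unfolding eigenvalue_sequence_def using s basis by auto
  moreover have "t = s" if t: "eigenvalue_sequence g t" for t
  proof -
    have tm: "mono t" and tf: "finite {i. t i = \<mu>}" for \<mu>
      using t by (auto simp: eigenvalue_sequence_def)
    have tc: "card {i. t i = \<mu>} = d \<mu>" for \<mu>
    proof -
      obtain B where B: "funvs.independent B" "funvs.span B = eigenspace g \<mu>" "card B = card {i. t i = \<mu>}"
        using t unfolding eigenvalue_sequence_def by blast
      obtain B' where B': "funvs.independent B'" "funvs.span B' = eigenspace g \<mu>" "card B' = d \<mu>"
        using basis[of \<mu>] by blast
      have "funvs.dim B = card B" "funvs.dim B = card B'"
        using funvs.dim_eq_card[of B B] funvs.dim_eq_card[of B' B] B B' by auto
      then show ?thesis using B B' by simp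
    qed
    have "{i. t i < \<mu>} = {i. s i < \<mu>}" for \<mu>
      using mono_below_eq[OF tm tf tc fin, of \<mu>] mono_below_eq[OF s fin, of \<mu>] by simp
    then have *: "t i < \<mu> \<longleftrightarrow> s i < \<mu>" for i \<mu> by blast
    show "t = s"
    proof
      fix i show "t i = s i" using *[of i "t i"] *[of i "s i"] by linarith
    qed
  qed
  ultimately have the: "(THE s. eigenvalue_sequence g s) = s" by (rule the_equality)
  define k where "k = (\<Sum>\<mu> | \<mu> < \<nu> \<and> 0 < d \<mu>. d \<mu>)"
  note below = mono_below_eq[OF s fin, of \<nu>, folded k_def]
  have "\<not> s k < \<nu>" using below by blast
  moreover have "s k \<le> \<nu>"
  proof -
    have "{i. s i = \<nu>} \<noteq> {}" using s(3)[of \<nu>] \<nu> by (metis card.empty less_irrefl)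
    then obtain i where i: "s i = \<nu>" by blast
    then have "k \<le> i" using below by (metis lessThan_iff less_irrefl mem_Collect_eq not_le)
    then show ?thesis using monoD[OF s(1)] i by metis
  qed
  ultimately show ?thesis unfolding eigenvalue_def the k_def[symmetric] by simp
qed

context sturm
begin

abbreviation ispec :: "index \<Rightarrow> real set" where
  "ispec \<equiv> \<lambda>(nu, nu', l, c). spec nu nu' (real l)"

lemma Ix_iff: "i \<in> Ix tw lam \<longleftrightarrow> i \<in> admissible tw \<and> lam \<in> ispec i"
  by (cases i) (simp add: Ix_def)

lemma finite_spectrum: "finite {lam. lam \<le> c \<and> 0 < card (Ix tw lam)}"
proof -
  obtain L where L: "\<forall>l. L \<le> \<bar>l\<bar> \<longrightarrow> (\<forall>nu nu'. \<forall>lam\<le>c. lam \<notin> spec nu nu' l)"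
    using spec_bound by blast
  have "{lam. lam \<le> c \<and> 0 < card (Ix tw lam)} \<subseteq>
     (\<Union>(nu, nu', l)\<in>UNIV \<times> UNIV \<times> {..nat \<lceil>L\<rceil>}. {lam \<in> spec nu nu' (real l). lam \<le> c})"
  proof
    fix lam assume lam: "lam \<in> {lam. lam \<le> c \<and> 0 < card (Ix tw lam)}"
    then have "Ix tw lam \<noteq> {}" by auto
    then obtain nu nu' l c' where i: "(nu, nu', l, c') \<in> Ix tw lam" by auto
    then have sp: "lam \<in> spec nu nu' (real l)" by (simp add: Ix_def)
    then have "\<not> L \<le> \<bar>real l\<bar>" using L lam by blast
    then have "l \<le> nat \<lceil>L\<rceil>" by linarith
    then show "lam \<in> (\<Union>(nu, nu', l)\<in>UNIV \<times> UNIV \<times> {..nat \<lceil>L\<rceil>}. {lam \<in> spec nu nu' (real l). lam \<le> c})"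
      using sp lam by blast
  qed
  then show ?thesis
    by (rule finite_subset) (auto intro!: finite_UN_I finite_cartesian_product finite_spec)
qed

lemma infinite_spectrum: "infinite {lam. 0 < card (Ix tw lam)}"
proof
  assume f: "finite {lam. 0 < card (Ix tw lam)}"
  obtain c where c: "\<And>lam. 0 < card (Ix tw lam) \<Longrightarrow> lam \<le> c"
    using f by (metis Max_ge mem_Collect_eq)
  obtain L where L: "\<forall>l. L \<le> \<bar>l\<bar> \<longrightarrow> (\<forall>nu nu'. \<forall>lam\<le>c. lam \<notin> spec nu nu' l)"
    using spec_bound by blast
  define l where "l = 2 * nat \<lceil>L\<rceil>"
  obtain lam where lam: "lam \<in> spec True True (real l)" using spec_nonempty by blast
  have "(True, True, l, True) \<in> Ix tw lam" using lam by (simp add: Ix_def admissible_def l_def)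
  then have "0 < card (Ix tw lam)" using finite_Ix by (auto simp: card_gt_0_iff)
  then have "lam \<le> c" by (rule c)
  moreover have "L \<le> \<bar>real l\<bar>" unfolding l_def by linarith
  ultimately show False using L lam by blast
qed

text \<open>The pairs of a mode and an eigenvalue below \<open>\<nu>\<close> are counted once by
  eigenvalue and once by mode.\<close>

lemma count_below:
  assumes A: "finite A" "A \<subseteq> admissible tw"
    and out: "\<And>i lam. i \<in> admissible tw \<Longrightarrow> i \<notin> A \<Longrightarrow> lam \<in> ispec i \<Longrightarrow> lam < \<nu> \<Longrightarrow> False"
  shows "(\<Sum>lam | lam < \<nu> \<and> 0 < card (Ix tw lam). card (Ix tw lam)) = (\<Sum>i\<in>A. card {lam \<in> ispec i. lam < \<nu>})"
proof -
  define T where "T = {lam. lam < \<nu> \<and> 0 < card (Ix tw lam)}"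
  have fT: "finite T" by (rule finite_subset[OF _ finite_spectrum[of \<nu> tw]]) (auto simp: T_def)
  have fs: "finite {lam \<in> ispec i. lam < \<nu>}" for i
    by (cases i) (auto intro: finite_subset[OF _ finite_spec[of _ _ _ \<nu>]])
  have "(\<Sum>lam\<in>T. card (Ix tw lam)) = card (SIGMA lam:T. Ix tw lam)"
    using fT finite_Ix by (simp add: card_SigmaI)
  also have "\<dots> = card ((\<lambda>(i, lam). (lam, i)) ` (SIGMA i:A. {lam \<in> ispec i. lam < \<nu>}))"
  proof (rule arg_cong[where f = card], intro equalityI subsetI)
    fix z assume "z \<in> (SIGMA lam:T. Ix tw lam)"
    then obtain lam i where z: "z = (lam, i)" "lam < \<nu>" "i \<in> admissible tw" "lam \<in> ispec i"
      by (auto simp: T_def Ix_iff simp del: split_paired_Ex)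
    then have "i \<in> A" using out by blast
    then have "(i, lam) \<in> (SIGMA i:A. {lam \<in> ispec i. lam < \<nu>})" using z by simp
    then show "z \<in> (\<lambda>(i, lam). (lam, i)) ` (SIGMA i:A. {lam \<in> ispec i. lam < \<nu>})"
      by (rule rev_image_eqI) (simp add: z)
  next
    fix z assume "z \<in> (\<lambda>(i, lam). (lam, i)) ` (SIGMA i:A. {lam \<in> ispec i. lam < \<nu>})"
    then obtain i lam where z: "z = (lam, i)" "i \<in> A" "lam \<in> ispec i" "lam < \<nu>" by auto
    then have "i \<in> Ix tw lam" using A(2) by (auto simp: Ix_iff)
    then show "z \<in> (SIGMA lam:T. Ix tw lam)" using z finite_Ix by (auto simp: T_def card_gt_0_iff)
  qed
  also have "\<dots> = card (SIGMA i:A. {lam \<in> ispec i. lam < \<nu>})"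
    by (rule card_image) (auto simp: inj_on_def)
  also have "\<dots> = (\<Sum>i\<in>A. card {lam \<in> ispec i. lam < \<nu>})"
    using A(1) fs by (simp add: card_SigmaI)
  finally show ?thesis unfolding T_def .
qed

text \<open>\<open>F\<close> stands for the chart. Composition with it carries bases of
  \<open>pspace\<close> to bases of the eigenspaces, because by \<open>inj\<close> it has trivial
  kernel on \<open>pspace\<close>.\<close>

theorem eigenvalue_count:
  assumes eig: "\<And>lam. eigenspace g lam = {(\<lambda>p. U (F p)) | U. U \<in> pspace tw lam}"
    and inj: "\<And>lam U. U \<in> pspace tw lam \<Longrightarrow> (\<And>p. U (F p) = 0) \<Longrightarrow> U = (\<lambda>p. 0)"
    and A: "finite A" "A \<subseteq> admissible tw"
    and out: "\<And>i lam. i \<in> admissible tw \<Longrightarrow> i \<notin> A \<Longrightarrow> lam \<in> ispec i \<Longrightarrow> lam < \<nu> \<Longrightarrow> False"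
    and \<nu>: "Ix tw \<nu> \<noteq> {}"
  shows "eigenvalue (\<Sum>i\<in>A. card {lam \<in> ispec i. lam < \<nu>}) g = \<nu>"
proof -
  have "\<exists>B. finite B \<and> funvs.independent B \<and> funvs.span B = eigenspace g lam \<and> card B = card (Ix tw lam)" for lam
  proof -
    have "{(\<lambda>p. \<Sum>i\<in>Ix tw lam. k i * bas lam i (F p)) | k. True} = eigenspace g lam"
      unfolding eig pspace_eq[symmetric]
    proof (intro equalityI subsetI)
      fix h assume "h \<in> {(\<lambda>p. \<Sum>i\<in>Ix tw lam. k i * bas lam i (F p)) | k. True}"
      then obtain k where "h = (\<lambda>p. \<Sum>i\<in>Ix tw lam. k i * bas lam i (F p))" by blast
      then show "h \<in> {(\<lambda>p. U (F p)) | U. U \<in> {(\<lambda>p. \<Sum>i\<in>Ix tw lam. k i * bas lam i p) | k. True}}"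
        by (intro CollectI exI[of _ "\<lambda>p. \<Sum>i\<in>Ix tw lam. k i * bas lam i p"]) auto
    next
      fix h assume "h \<in> {(\<lambda>p. U (F p)) | U. U \<in> {(\<lambda>p. \<Sum>i\<in>Ix tw lam. k i * bas lam i p) | k. True}}"
      then obtain k where "h = (\<lambda>p. \<Sum>i\<in>Ix tw lam. k i * bas lam i (F p))" by auto
      then show "h \<in> {(\<lambda>p. \<Sum>i\<in>Ix tw lam. k i * bas lam i (F p)) | k. True}" by blast
    qed
    moreover have "\<exists>B. finite B \<and> funvs.independent B \<and>
        funvs.span B = {(\<lambda>p. \<Sum>i\<in>Ix tw lam. k i * bas lam i (F p)) | k. True} \<and> card B = card (Ix tw lam)"
    proof (rule funvs_basis[OF finite_Ix])
      fix k assume z: "\<And>p. (\<Sum>i\<in>Ix tw lam. k i * bas lam i (F p)) = 0"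
      have "(\<lambda>p. \<Sum>i\<in>Ix tw lam. k i * bas lam i p) \<in> pspace tw lam" unfolding pspace_eq[symmetric] by blast
      from inj[OF this z] have "(\<Sum>i\<in>Ix tw lam. k i * bas lam i p) = 0" for p by meson
      then show "\<forall>i\<in>Ix tw lam. k i = 0" by (rule bas_independent)
    qed
    ultimately show ?thesis by simp
  qed
  moreover have "0 < card (Ix tw \<nu>)" using \<nu> finite_Ix by (simp add: card_gt_0_iff)
  ultimately have "eigenvalue (\<Sum>lam | lam < \<nu> \<and> 0 < card (Ix tw lam). card (Ix tw lam)) g = \<nu>"
    by (rule eigenvalue_eq[OF _ finite_spectrum infinite_spectrum])
  moreover have "(\<Sum>lam | lam < \<nu> \<and> 0 < card (Ix tw lam). card (Ix tw lam)) = (\<Sum>i\<in>A. card {lam \<in> ispec i. lam < \<nu>})"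
    by (rule count_below[OF A]) (rule out)
  ultimately show ?thesis by simp
qed

end

section \<open>Charts of the torus\<close>

lemma matrix_inv_2:
  fixes A :: "real^2^2"
  assumes "det A \<noteq> 0"
  shows "matrix_inv A = (\<chi> i j. (if i = j then A $ (if i = 1 then 2 else 1) $ (if i = 1 then 2 else 1) else - A $ i $ j) / det A)"
    (is "_ = ?B")
proof -
  have d: "A $ 1 $ 1 * A $ 2 $ 2 - A $ 1 $ 2 * A $ 2 $ 1 \<noteq> 0" using assms by (simp add: det_2)
  have inv: "invertible A" using assms invertible_det_nz by blast
  have "A ** ?B = mat 1"
    using d by (simp add: vec_eq_iff forall_2 matrix_matrix_mult_def sum_2 mat_def det_2 divide_simps)
  then have "matrix_inv A ** (A ** ?B) = matrix_inv A" by simp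
  moreover have "matrix_inv A ** A = mat 1"
    using someI_ex[OF inv[unfolded invertible_def]] unfolding matrix_inv_def by blast
  ultimately show ?thesis by (simp add: matrix_mul_assoc)
qed

text \<open>Makes \<open>\<bar>jac\<bar>\<close>, which enters through the square root of the
  determinant, differentiable: on the connected plane it is a constant sign times
  \<open>jac\<close>.\<close>

lemma continuous_nonzero_sign:
  fixes f :: "real^2 \<Rightarrow> real"
  assumes "continuous_on UNIV f" "\<And>p. f p \<noteq> 0"
  obtains s :: real where "s = 1 \<or> s = - 1" "\<And>p. \<bar>f p\<bar> = s * f p"
proof -
  have c: "connected (range f)" by (rule connected_continuous_image[OF assms(1) connected_UNIV])
  have "(\<forall>p. f p > 0) \<or> (\<forall>p. f p < 0)"
  proof (rule ccontr)
    assume "\<not> ?thesis"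
    then obtain p q where "f p < 0" "0 < f q" using assms(2) by (metis linorder_neqE)
    then have "0 \<in> range f" using connectedD_interval[OF c rangeI[of f p] rangeI[of f q], of 0] by simp
    then show False using assms(2) by (metis rangeE)
  qed
  then show ?thesis
  proof
    assume "\<forall>p. f p > 0"
    then show ?thesis by (intro that[of 1]) (auto intro: abs_of_pos)
  next
    assume "\<forall>p. f p < 0"
    then show ?thesis by (intro that[of "- 1"]) (auto intro: abs_of_neg)
  qed
qed

definition jac :: "(real^2 \<Rightarrow> real) \<Rightarrow> (real^2 \<Rightarrow> real) \<Rightarrow> real^2 \<Rightarrow> real" where
  "jac X Y p = partial 1 X p * partial 2 Y p - partial 2 X p * partial 1 Y p"

lemma smooth_jac: "smooth X \<Longrightarrow> smooth Y \<Longrightarrow> smooth (jac X Y)"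
  unfolding jac_def[abs_def] by (intro smooth_diff smooth_mult smooth_partial)

lemma partial_translate:
  fixes U :: "real^2 \<Rightarrow> real"
  assumes "\<And>p. U differentiable (at p)"
  shows "partial i (\<lambda>z. U (z + c)) = (\<lambda>z. partial i U (z + c))"
proof -
  have "((\<lambda>z. U (z + c)) has_derivative (\<lambda>h. frechet_derivative U (at (z + c)) h)) (at z)" for z
  proof -
    have t: "((\<lambda>z. z + c) has_derivative (\<lambda>h. h)) (at z)" by (auto intro!: derivative_eq_intros)
    have "(U has_derivative frechet_derivative U (at (z + c))) (at (z + c))"
      using assms frechet_derivative_works by blast
    from has_derivative_compose[OF t this] show ?thesis .
  qed
  from partial_eq[OF this] show ?thesis by (simp add: partial_def)
qed

text \<open>With \<open>V1 = partial 1 U / w\<close> and \<open>V2 = w * partial 2 U\<close> the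
  flux in the chart is the cofactor matrix of the Jacobian applied to \<open>(V1, V2)\<close>. The
  cofactors are divergence free by the symmetry of second derivatives, so the divergence is
  \<open>jac\<close> times that of \<open>(V1, V2)\<close>, up to the constant sign
  \<open>s\<close>.\<close>

lemma (in sturm) laplace_chart:
  assumes X: "smooth X" and Y: "smooth Y" and J: "\<And>p. jac X Y p \<noteq> 0"
    and g: "\<And>p i j. g p $ i $ j = (w (X p))\<^sup>2 * \<rho> (X p) * (partial i X p * partial j X p) + \<rho> (X p) * (partial i Y p * partial j Y p)"
    and U: "smooth U"
  shows "laplace_beltrami g (\<lambda>p. U (pt (X p) (Y p))) p =
    - (partial 1 (\<lambda>q. partial 1 U q / w (q $ 1)) (pt (X p) (Y p)) / w (X p) + partial 2 (partial 2 U) (pt (X p) (Y p))) / \<rho> (X p)"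
proof -
  obtain s where s: "s = 1 \<or> s = - 1" "\<And>p. \<bar>jac X Y p\<bar> = s * jac X Y p"
    using continuous_nonzero_sign[OF smooth_continuous_on[OF smooth_jac[OF X Y]] J] by metis
  have wn: "w x \<noteq> 0" and rn: "\<rho> x \<noteq> 0" for x using w_pos[of x] \<rho>_pos[of x] by auto
  have det: "det (g q) = (w (X q) * \<rho> (X q) * jac X Y q)\<^sup>2" for q
    unfolding det_2 g jac_def by (simp add: power2_eq_square algebra_simps)
  have sqrt: "sqrt (det (g q)) = w (X q) * \<rho> (X q) * (s * jac X Y q)" for q
    unfolding det using w_pos[of "X q"] \<rho>_pos[of "X q"] s(2)[of q] by (simp add: abs_mult)
  have dn: "det (g q) \<noteq> 0" for q unfolding det using wn rn J by simp
  define u where "u = (\<lambda>p. U (pt (X p) (Y p)))"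
  define V1 where "V1 q = partial 1 U q / w (q $ 1)" for q
  define V2 where "V2 q = w (q $ 1) * partial 2 U q" for q
  have V1: "smooth V1" unfolding V1_def by (intro smooth_w_inverse smooth_partial U)
  have V2: "smooth V2" unfolding V2_def by (intro smooth_mult elementary_smooth[OF w_elementary] smooth_partial U)
  define C1 C2 where "C1 = (\<lambda>p. V1 (pt (X p) (Y p)))" and "C2 = (\<lambda>p. V2 (pt (X p) (Y p)))"
  have C: "smooth C1" "smooth C2" unfolding C1_def C2_def by (intro smooth_compose V1 V2 X Y)+
  have pu: "partial j u q = partial j X q * partial 1 U (pt (X q) (Y q)) + partial j Y q * partial 2 U (pt (X q) (Y q))" for j q
    unfolding u_def by (subst partial_compose_pt) (use X Y U smooth_differentiable in auto)
  have pC: "partial j C1 q = partial j X q * partial 1 V1 (pt (X q) (Y q)) + partial j Y q * partial 2 V1 (pt (X q) (Y q))"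
    "partial j C2 q = partial j X q * partial 1 V2 (pt (X q) (Y q)) + partial j Y q * partial 2 V2 (pt (X q) (Y q))" for j q
    unfolding C1_def C2_def by (subst partial_compose_pt; use X Y V1 V2 smooth_differentiable in auto)+
  define f where "f i q = sqrt (det (g q)) * (\<Sum>j\<in>UNIV. matrix_inv (g q) $ i $ j * partial j u q)" for i q
  have f_eq: "f i q = s / (w (X q) * \<rho> (X q) * jac X Y q) *
     (if i = 1 then g q $ 2 $ 2 * partial 1 u q - g q $ 1 $ 2 * partial 2 u q
      else - g q $ 2 $ 1 * partial 1 u q + g q $ 1 $ 1 * partial 2 u q)" for i q
  proof -
    have i: "i = 1 \<or> i = 2" using exhaust_2 by blast
    have "sqrt (det (g q)) / det (g q) = s / (w (X q) * \<rho> (X q) * jac X Y q)"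
    proof -
      have "sqrt (det (g q)) / det (g q) = w (X q) * \<rho> (X q) * (s * jac X Y q) / (w (X q) * \<rho> (X q) * jac X Y q)\<^sup>2"
        by (subst sqrt, subst det, rule refl)
      then show ?thesis using wn[of "X q"] rn[of "X q"] J[of q] by (simp add: field_simps power2_eq_square)
    qed
    moreover have "f i q = (sqrt (det (g q)) / det (g q)) *
     (if i = 1 then g q $ 2 $ 2 * partial 1 u q - g q $ 1 $ 2 * partial 2 u q
      else - g q $ 2 $ 1 * partial 1 u q + g q $ 1 $ 1 * partial 2 u q)"
      unfolding f_def matrix_inv_2[OF dn] using i dn[of q] by (auto simp: sum_2 field_simps)
    ultimately show ?thesis by simp
  qed
  have f1: "f 1 q = s * (partial 2 Y q * C1 q - partial 2 X q * C2 q)" for q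
  proof -
    define a b where "a = partial 1 U (pt (X q) (Y q))" and "b = partial 2 U (pt (X q) (Y q))"
    have "g q $ 2 $ 2 * partial 1 u q - g q $ 1 $ 2 * partial 2 u q
      = \<rho> (X q) * jac X Y q * (partial 2 Y q * a - (w (X q))\<^sup>2 * partial 2 X q * b)"
      unfolding pu g jac_def a_def[symmetric] b_def[symmetric] by (simp add: algebra_simps)
    also have "\<dots> = (w (X q) * \<rho> (X q) * jac X Y q) * (partial 2 Y q * C1 q - partial 2 X q * C2 q)"
      using wn[of "X q"] by (simp add: C1_def C2_def V1_def V2_def a_def b_def power2_eq_square field_simps)
    finally show ?thesis unfolding f_eq using wn[of "X q"] rn[of "X q"] J[of q] by simp
  qed
  have f2: "f 2 q = s * (partial 1 X q * C2 q - partial 1 Y q * C1 q)" for q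
  proof -
    define a b where "a = partial 1 U (pt (X q) (Y q))" and "b = partial 2 U (pt (X q) (Y q))"
    have "- g q $ 2 $ 1 * partial 1 u q + g q $ 1 $ 1 * partial 2 u q
      = \<rho> (X q) * jac X Y q * ((w (X q))\<^sup>2 * partial 1 X q * b - partial 1 Y q * a)"
      unfolding pu g jac_def a_def[symmetric] b_def[symmetric] by (simp add: algebra_simps)
    also have "\<dots> = (w (X q) * \<rho> (X q) * jac X Y q) * (partial 1 X q * C2 q - partial 1 Y q * C1 q)"
      using wn[of "X q"] by (simp add: C1_def C2_def V1_def V2_def a_def b_def power2_eq_square field_simps)
    finally show ?thesis unfolding f_eq using wn[of "X q"] rn[of "X q"] J[of q] by simp
  qed
  have pd: "partial i (\<lambda>q. s * (A q * B q - A' q * B' q)) =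
     (\<lambda>q. s * (partial i A q * B q + A q * partial i B q - (partial i A' q * B' q + A' q * partial i B' q)))"
    if "smooth A" "smooth B" "smooth A'" "smooth B'" for i and A B A' B' :: "real^2 \<Rightarrow> real"
  proof -
    have "((\<lambda>q. s * (A q * B q - A' q * B' q)) has_derivative
      (\<lambda>h. s * ((A q * frechet_derivative B (at q) h + frechet_derivative A (at q) h * B q)
              - (A' q * frechet_derivative B' (at q) h + frechet_derivative A' (at q) h * B' q)))) (at q)" for q
      by (intro has_derivative_mult_right has_derivative_diff has_derivative_mult smooth_has_derivative that)
    from partial_eq[OF this] show ?thesis by (simp add: partial_def algebra_simps)
  qed
  have mixed: "partial 2 (partial 1 X) = partial 1 (partial 2 X)" "partial 2 (partial 1 Y) = partial 1 (partial 2 Y)"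
    by (rule partial_commute[OF X], rule partial_commute[OF Y])
  have d1: "partial 1 (f 1) p = s * (partial 1 (partial 2 Y) p * C1 p + partial 2 Y p * partial 1 C1 p
      - (partial 1 (partial 2 X) p * C2 p + partial 2 X p * partial 1 C2 p))"
    unfolding f1[abs_def] by (subst pd) (intro smooth_partial X Y C refl)+
  have d2: "partial 2 (f 2) p = s * (partial 2 (partial 1 X) p * C2 p + partial 1 X p * partial 2 C2 p
      - (partial 2 (partial 1 Y) p * C1 p + partial 1 Y p * partial 2 C1 p))"
    unfolding f2[abs_def] by (subst pd) (intro smooth_partial X Y C refl)+
  have div: "partial 1 (f 1) p + partial 2 (f 2) p = s * jac X Y p * (partial 1 V1 (pt (X p) (Y p)) + partial 2 V2 (pt (X p) (Y p)))"
    unfolding d1 d2 pC mixed jac_def by (simp add: algebra_simps)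
  have dV2: "partial 2 V2 (pt (X p) (Y p)) = w (X p) * partial 2 (partial 2 U) (pt (X p) (Y p))"
  proof (rule partial_2_eqI[OF V2])
    show "((\<lambda>y. V2 (pt (X p) y)) has_real_derivative w (X p) * partial 2 (partial 2 U) (pt (X p) (Y p))) (at (Y p))"
      unfolding V2_def using DERIV_cmult[OF smooth_has_real_derivative(2)[OF smooth_partial[OF U]]] by simp
  qed
  have "laplace_beltrami g u p = - (s * jac X Y p * (partial 1 V1 (pt (X p) (Y p)) + w (X p) * partial 2 (partial 2 U) (pt (X p) (Y p)))) / (w (X p) * \<rho> (X p) * (s * jac X Y p))"
  proof -
    have "laplace_beltrami g u p = - (\<Sum>i\<in>UNIV. partial i (f i) p) / sqrt (det (g p))"
      unfolding laplace_beltrami_def f_def[abs_def] ..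
    then show ?thesis
      unfolding sum_2 sqrt div dV2 .
  qed
  also have "\<dots> = - (partial 1 V1 (pt (X p) (Y p)) / w (X p) + partial 2 (partial 2 U) (pt (X p) (Y p))) / \<rho> (X p)"
    using wn[of "X p"] rn[of "X p"] J[of p] s(1) by (auto simp: field_simps)
  finally show ?thesis unfolding u_def V1_def[abs_def] .
qed

section \<open>Lattices of periods\<close>

definition lat :: "bool \<Rightarrow> real \<Rightarrow> real \<Rightarrow> bool" where
  "lat tw x y \<longleftrightarrow> (\<exists>k l :: int. x = pi * of_int k \<and> y = pi * of_int l \<and> (if tw then even (k + l) else even k \<and> even l))"

lemma lat_minus: "lat tw x y \<Longrightarrow> lat tw (- x) (- y)"
proof -
  assume "lat tw x y"
  then obtain k l :: int where *: "x = pi * of_int k" "y = pi * of_int l" "if tw then even (k + l) else even k \<and> even l"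
    unfolding lat_def by blast
  show ?thesis unfolding lat_def by (rule exI[of _ "- k"], rule exI[of _ "- l"]) (use * in auto)
qed

lemma lat_add: "lat tw x y \<Longrightarrow> lat tw x' y' \<Longrightarrow> lat tw (x + x') (y + y')"
proof -
  assume "lat tw x y" "lat tw x' y'"
  then obtain k l k' l' :: int where *: "x = pi * of_int k" "y = pi * of_int l" "if tw then even (k + l) else even k \<and> even l"
    "x' = pi * of_int k'" "y' = pi * of_int l'" "if tw then even (k' + l') else even k' \<and> even l'"
    unfolding lat_def by blast
  show ?thesis unfolding lat_def
    by (rule exI[of _ "k + k'"], rule exI[of _ "l + l'"]) (use * in \<open>auto simp: algebra_simps split: if_splits\<close>)
qed

definition lat_inv :: "bool \<Rightarrow> (real^2 \<Rightarrow> real) \<Rightarrow> bool" where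
  "lat_inv tw U \<longleftrightarrow> (\<forall>x y a b. lat tw a b \<longrightarrow> U (pt (x + a) (y + b)) = U (pt x y))"

lemma int_step_invariant:
  fixes f :: "real \<Rightarrow> 'a"
  assumes "\<And>t. f (t + c) = f t"
  shows "f (t + of_int k * c) = f t"
proof (induction k rule: int_induct[where k=0])
  case (step1 i)
  have "f (t + of_int (i + 1) * c) = f ((t + of_int i * c) + c)" by (simp add: algebra_simps)
  then show ?case using assms step1 by simp
next
  case (step2 i)
  have "f (t + of_int i * c) = f ((t + of_int (i - 1) * c) + c)" by (simp add: algebra_simps)
  then show ?case using assms step2 by simp
qed simp

lemma lat_inv_iff: "lat_inv tw U \<longleftrightarrow> biperiodic U \<and> (tw \<longrightarrow> (\<forall>x y. U (pt (x + pi) (y + pi)) = U (pt x y)))"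
proof
  assume L: "lat_inv tw U"
  have 1: "lat tw (2 * pi) 0" unfolding lat_def by (rule exI[of _ 2], rule exI[of _ 0]) auto
  have 2: "lat tw 0 (2 * pi)" unfolding lat_def by (rule exI[of _ 0], rule exI[of _ 2]) auto
  have 3: "lat True pi pi" unfolding lat_def by (rule exI[of _ 1], rule exI[of _ 1]) auto
  show "biperiodic U \<and> (tw \<longrightarrow> (\<forall>x y. U (pt (x + pi) (y + pi)) = U (pt x y)))"
    using L[unfolded lat_inv_def, rule_format, OF 1] L[unfolded lat_inv_def, rule_format, OF 2]
      L[unfolded lat_inv_def, rule_format, of pi pi] 3 by (auto simp: biperiodic_def)
next
  assume *: "biperiodic U \<and> (tw \<longrightarrow> (\<forall>x y. U (pt (x + pi) (y + pi)) = U (pt x y)))"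
  have px: "U (pt (x + of_int k * (2 * pi)) y) = U (pt x y)" for x y and k :: int
    by (rule int_step_invariant[where f = "\<lambda>x. U (pt x y)"]) (use * in \<open>auto simp: biperiodic_def\<close>)
  have py: "U (pt x (y + of_int k * (2 * pi))) = U (pt x y)" for x y and k :: int
    by (rule int_step_invariant[where f = "\<lambda>y. U (pt x y)"]) (use * in \<open>auto simp: biperiodic_def\<close>)
  show "lat_inv tw U"
    unfolding lat_inv_def
  proof (intro allI impI)
    fix x y a b assume "lat tw a b"
    then obtain k l :: int where kl: "a = pi * of_int k" "b = pi * of_int l" "if tw then even (k + l) else even k \<and> even l"
      unfolding lat_def by blast
    show "U (pt (x + a) (y + b)) = U (pt x y)"
    proof (cases tw)
      case False
      then obtain k' l' where "k = 2 * k'" "l = 2 * l'" using kl by (auto elim!: evenE)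
      then have "x + a = x + of_int k' * (2 * pi)" "y + b = y + of_int l' * (2 * pi)" using kl by auto
      then show ?thesis using px py by presburger
    next
      case True
      have pd: "U (pt (x + (t + of_int j * pi)) (y + (t + of_int j * pi))) = U (pt (x + t) (y + t))" for x y t and j :: int
        by (rule int_step_invariant[where f = "\<lambda>t. U (pt (x + t) (y + t))"]) (use * True in \<open>simp add: add.assoc[symmetric]\<close>)
      have "even (k - l)" using kl(3) True by simp
      then obtain j where "k - l = 2 * j" by (rule evenE)
      then have k: "k = l + 2 * j" by simp
      have "x + a = (x + of_int l * pi) + of_int j * (2 * pi)" "y + b = y + of_int l * pi" using kl(1,2) k by (auto simp: algebra_simps)
      then have "U (pt (x + a) (y + b)) = U (pt (x + of_int l * pi) (y + of_int l * pi))" using px by presburger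
      also have "\<dots> = U (pt x y)" using pd[of x 0 l y] by simp
      finally show ?thesis .
    qed
  qed
qed

text \<open>\<open>(X, Y)\<close> lifts an isometry from the torus with metric \<open>g\<close> onto
  the plane modulo \<open>lat tw\<close> with metric \<open>\<rho> (w^2 dx^2 + dy^2)\<close>:
  \<open>fibre\<close> says that it is well defined and injective on the quotients,
  \<open>onto\<close> that it is surjective.\<close>

locale torus_chart = sturm +
  fixes tw :: bool and X Y :: "real^2 \<Rightarrow> real" and g :: metric
  assumes X: "smooth X" and Y: "smooth Y" and jac: "jac X Y p \<noteq> 0"
    and g: "g p $ i $ j = (w (X p))\<^sup>2 * \<rho> (X p) * (partial i X p * partial j X p) + \<rho> (X p) * (partial i Y p * partial j Y p)"
    and fibre: "lat tw (X p - X q) (Y p - Y q) \<longleftrightarrow> (\<forall>i. p $ i - q $ i \<in> \<int>)"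
    and onto: "\<exists>p. lat tw (x - X p) (y - Y p)"
begin

section \<open>Descent of functions along a chart\<close>

lemma lat_inv_eq_zero:
  assumes "lat_inv tw U" "\<And>p. U (pt (X p) (Y p)) = 0" shows "U = (\<lambda>p. 0)"
proof
  fix z :: "real^2"
  obtain p where "lat tw (z $ 1 - X p) (z $ 2 - Y p)" using onto by blast
  then have "U (pt (X p + (z $ 1 - X p)) (Y p + (z $ 2 - Y p))) = U (pt (X p) (Y p))"
    using assms(1) unfolding lat_inv_def by blast
  then show "U z = 0" using assms(2) pt_eta[of z] by simp
qed

text \<open>The derivative is invertible because \<open>jac\<close> is nonzero, with
  \<open>G'\<close> as its inverse by Cramer's rule, and it depends continuously on the point
  because \<open>X\<close> and \<open>Y\<close> are smooth.\<close>

lemma local_inverse: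
  obtains r where "r > 0" "inj_on (\<lambda>p. pt (X p) (Y p)) (ball p r)"
proof -
  define F where "F p = pt (X p) (Y p)" for p
  define F' where "F' p h = pt (h $ 1 * partial 1 X p + h $ 2 * partial 2 X p) (h $ 1 * partial 1 Y p + h $ 2 * partial 2 Y p)" for p h :: "real^2"
  have dF: "(F has_derivative F' p) (at p)" for p
    unfolding F_def F'_def
    using has_derivative_pt[OF has_derivative_partial[OF smooth_differentiable[OF X]] has_derivative_partial[OF smooth_differentiable[OF Y]]]
    by simp
  define G' where "G' h = pt ((h $ 1 * partial 2 Y p - h $ 2 * partial 2 X p) / jac X Y p)
      ((h $ 2 * partial 1 X p - h $ 1 * partial 1 Y p) / jac X Y p)" for h :: "real^2"
  have lin: "bounded_linear (\<lambda>h::real^2. pt (h $ 1 * a + h $ 2 * b) (h $ 1 * c + h $ 2 * d))" for a b c d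
    unfolding pt_axis by (intro bounded_linear_intros bounded_linear_vec_nth)
  have G': "bounded_linear G'"
    using lin[of "partial 2 Y p / jac X Y p" "- partial 2 X p / jac X Y p" "- partial 1 Y p / jac X Y p" "partial 1 X p / jac X Y p"]
    unfolding G'_def by (simp add: diff_divide_distrib algebra_simps)
  have inv: "G' \<circ> F' p = id"
  proof
    fix h :: "real^2"
    have j: "jac X Y p \<noteq> 0" by (rule jac)
    have "(h $ 1 * partial 1 X p + h $ 2 * partial 2 X p) * partial 2 Y p - (h $ 1 * partial 1 Y p + h $ 2 * partial 2 Y p) * partial 2 X p = h $ 1 * jac X Y p"
      "(h $ 1 * partial 1 Y p + h $ 2 * partial 2 Y p) * partial 1 X p - (h $ 1 * partial 1 X p + h $ 2 * partial 2 X p) * partial 1 Y p = h $ 2 * jac X Y p"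
      by (simp_all add: jac_def algebra_simps)
    then show "(G' \<circ> F' p) h = id h"
      using j by (simp add: G'_def F'_def pt_eta)
  qed
  have small: "\<exists>d>0. \<forall>x. dist p x < d \<longrightarrow> onorm (\<lambda>v. F' x v - F' p v) < e" if e: "e > 0" for e
  proof -
    have c: "isCont (partial i Z) p" if "smooth Z" for i and Z :: "real^2 \<Rightarrow> real"
      using smooth_continuous_on[OF smooth_partial[OF that], of UNIV] by (simp add: continuous_on_eq_continuous_at)
    define D where "D x = \<bar>partial 1 X x - partial 1 X p\<bar> + \<bar>partial 2 X x - partial 2 X p\<bar> + \<bar>partial 1 Y x - partial 1 Y p\<bar> + \<bar>partial 2 Y x - partial 2 Y p\<bar>" for x
    have "isCont D p" unfolding D_def by (intro continuous_intros c X Y)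
    moreover have "D p = 0" by (simp add: D_def)
    ultimately have "\<forall>\<^sub>F x in at p. dist (D x) 0 < e" using e unfolding isCont_def tendsto_iff by auto
    then obtain d where d: "d > 0" "\<And>x. x \<noteq> p \<Longrightarrow> dist x p < d \<Longrightarrow> dist (D x) 0 < e"
      unfolding eventually_at by auto
    have "onorm (\<lambda>v. F' x v - F' p v) < e" if "dist p x < d" for x
    proof -
      have "onorm (\<lambda>v. F' x v - F' p v) \<le> D x"
      proof (rule onorm_bound)
        show "0 \<le> D x" by (simp add: D_def)
        fix h :: "real^2"
        have h: "\<bar>h $ i\<bar> \<le> norm h" for i by (rule component_le_norm_cart)
        have 1: "\<bar>h $ i * c\<bar> \<le> norm h * \<bar>c\<bar>" for i c unfolding abs_mult by (intro mult_right_mono h) auto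
        have "F' x h - F' p h = pt (h $ 1 * (partial 1 X x - partial 1 X p) + h $ 2 * (partial 2 X x - partial 2 X p))
            (h $ 1 * (partial 1 Y x - partial 1 Y p) + h $ 2 * (partial 2 Y x - partial 2 Y p))" (is "_ = pt ?a ?b")
          unfolding F'_def pt_minus by (simp add: algebra_simps)
        moreover have "norm (pt a b) \<le> \<bar>a\<bar> + \<bar>b\<bar>" for a b
          using norm_le_l1_cart[of "pt a b"] by (simp add: sum_2)
        ultimately have "norm (F' x h - F' p h) \<le> \<bar>?a\<bar> + \<bar>?b\<bar>" by simp
        also have "\<dots> \<le> (\<bar>h $ 1 * (partial 1 X x - partial 1 X p)\<bar> + \<bar>h $ 2 * (partial 2 X x - partial 2 X p)\<bar>)
            + (\<bar>h $ 1 * (partial 1 Y x - partial 1 Y p)\<bar> + \<bar>h $ 2 * (partial 2 Y x - partial 2 Y p)\<bar>)"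
          by (intro add_mono abs_triangle_ineq)
        also have "\<dots> \<le> (norm h * \<bar>partial 1 X x - partial 1 X p\<bar> + norm h * \<bar>partial 2 X x - partial 2 X p\<bar>)
            + (norm h * \<bar>partial 1 Y x - partial 1 Y p\<bar> + norm h * \<bar>partial 2 Y x - partial 2 Y p\<bar>)"
          by (intro add_mono 1)
        also have "\<dots> = norm h * D x" by (simp add: D_def distrib_left)
        finally show "norm (F' x h - F' p h) \<le> D x * norm h" by (simp add: mult.commute)
      qed
      also have "D x < e" using d(2)[of x] that \<open>D p = 0\<close> e by (cases "x = p") (auto simp: dist_commute D_def)
      finally show ?thesis .
    qed
    then show ?thesis using d(1) by blast
  qed
  obtain r where "0 < r" "inj_on F (ball p r)"
    using has_derivative_locally_injective[OF UNIV_I open_UNIV G' inv dF small] by blast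
  then show ?thesis using that by (simp add: F_def[abs_def])
qed

text \<open>Near \<open>z\<close> the function \<open>U\<close> is \<open>v\<close> composed with a
  local inverse of the translated chart. Invariance of domain makes the image of a small ball an
  open neighbourhood of \<open>z\<close>.\<close>

lemma descend_differentiable:
  assumes U: "lat_inv tw U" and v: "smooth v" and e: "\<And>p. U (pt (X p) (Y p)) = v p"
  shows "U differentiable (at z)"
proof -
  obtain p where p: "lat tw (z $ 1 - X p) (z $ 2 - Y p)" using onto by blast
  \<comment> \<open>A lattice vector moving the chart so that it passes through \<open>z\<close>;
    \<open>U\<close> is invariant under it.\<close>
  define c where "c = pt (z $ 1 - X p) (z $ 2 - Y p)"
  define F where "F q = pt (X q) (Y q) + c" for q
  have zF: "z = F p" by (simp add: F_def c_def vec_eq_iff forall_2)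
  have UF: "U (F q) = v q" for q
  proof -
    have "F q = pt (X q + (z $ 1 - X p)) (Y q + (z $ 2 - Y p))" by (simp add: F_def c_def vec_eq_iff forall_2)
    then show ?thesis using U p e unfolding lat_inv_def by metis
  qed
  obtain r where r: "r > 0" "inj_on (\<lambda>p. pt (X p) (Y p)) (ball p r)" by (rule local_inverse)
  have inj: "inj_on F (ball p r)" using r(2) by (simp add: F_def inj_on_def)
  have cont: "continuous_on S F" for S
    unfolding F_def by (intro continuous_intros smooth_continuous_on X Y)
  define G where "G = inv_into (ball p r) F"
  have G: "G (F q) = q" if "q \<in> ball p r" for q unfolding G_def by (rule inv_into_f_f[OF inj that])
  define F' where "F' h = pt (h $ 1 * partial 1 X p + h $ 2 * partial 2 X p) (h $ 1 * partial 1 Y p + h $ 2 * partial 2 Y p)" for h :: "real^2"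
  define G' where "G' h = pt ((h $ 1 * partial 2 Y p - h $ 2 * partial 2 X p) / jac X Y p)
      ((h $ 2 * partial 1 X p - h $ 1 * partial 1 Y p) / jac X Y p)" for h :: "real^2"
  have dF: "(F has_derivative F') (at p)"
    unfolding F_def F'_def
    using has_derivative_add_const[OF has_derivative_pt[OF has_derivative_partial[OF smooth_differentiable[OF X]] has_derivative_partial[OF smooth_differentiable[OF Y]]]]
    by simp
  have FG: "F' \<circ> G' = id"
  proof
    fix h :: "real^2"
    have j: "jac X Y p \<noteq> 0" by (rule jac)
    have "(h $ 1 * partial 2 Y p - h $ 2 * partial 2 X p) * partial 1 X p + (h $ 2 * partial 1 X p - h $ 1 * partial 1 Y p) * partial 2 X p = h $ 1 * jac X Y p"
      "(h $ 1 * partial 2 Y p - h $ 2 * partial 2 X p) * partial 1 Y p + (h $ 2 * partial 1 X p - h $ 1 * partial 1 Y p) * partial 2 Y p = h $ 2 * jac X Y p"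
      by (simp_all add: jac_def algebra_simps)
    then show "(F' \<circ> G') h = id h"
      using j by (simp add: G'_def F'_def pt_eta add_divide_distrib[symmetric])
  qed
  have "p \<in> ball p r" using r(1) by simp
  have "(G has_derivative G') (at (F p))"
    by (rule has_derivative_inverse_strong[OF open_ball \<open>p \<in> ball p r\<close> cont G dF FG])
  then have "(G has_derivative G') (at z)" using zF by simp
  moreover have "(v has_derivative frechet_derivative v (at p)) (at (G z))"
    using smooth_has_derivative[OF v, of p] G[OF \<open>p \<in> ball p r\<close>] zF by simp
  ultimately have "((\<lambda>y. v (G y)) has_derivative (\<lambda>h. frechet_derivative v (at p) (G' h))) (at z)"
    by (rule has_derivative_compose)
  moreover have "open (F ` ball p r)" by (rule invariance_of_domain[OF cont open_ball inj])
  moreover have "z \<in> F ` ball p r" using zF \<open>p \<in> ball p r\<close> by blast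
  moreover have "v (G y) = U y" if "y \<in> F ` ball p r" for y using that G UF by auto
  ultimately have "(U has_derivative (\<lambda>h. frechet_derivative v (at p) (G' h))) (at z)"
    by (rule has_derivative_transform_within_open)
  then show ?thesis by (rule differentiableI)
qed

lemma partial_lat_inv:
  assumes "\<And>p. U differentiable (at p)" "lat_inv tw U" shows "lat_inv tw (partial i U)"
  unfolding lat_inv_def
proof (intro allI impI)
  fix x y a b assume ab: "lat tw a b"
  have pa: "pt (z $ 1 + a) (z $ 2 + b) = z + pt a b" for z :: "real^2" by (simp add: vec_eq_iff forall_2)
  have "U (z + pt a b) = U z" for z :: "real^2"
    using assms(2)[unfolded lat_inv_def, rule_format, OF ab, of "z $ 1" "z $ 2"] unfolding pt_eta pa .
  then have "(\<lambda>z. U (z + pt a b)) = U" by blast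
  then have "partial i U (pt x y + pt a b) = partial i U (pt x y)"
    using fun_cong[OF partial_translate[OF assms(1), of i "pt a b"], of "pt x y"] by simp
  moreover have "pt x y + pt a b = pt (x + a) (y + b)" by (simp add: vec_eq_iff forall_2)
  ultimately show "partial i U (pt (x + a) (y + b)) = partial i U (pt x y)" by simp
qed

text \<open>The partial derivatives of \<open>U\<close> descend again: they are lattice invariant,
  and by Cramer's rule their composites with the chart are smooth combinations of those of
  \<open>v\<close> divided by \<open>jac\<close>. So the property is stable under
  \<open>partial\<close>.\<close>

lemma descend_smooth:
  assumes U: "lat_inv tw U" and v: "smooth v" and e: "\<And>p. U (pt (X p) (Y p)) = v p"
  shows "smooth U"
proof (rule smooth_coinduct[where P = "\<lambda>U. lat_inv tw U \<and> (\<exists>v. smooth v \<and> (\<forall>p. U (pt (X p) (Y p)) = v p))"])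
  fix U assume "lat_inv tw U \<and> (\<exists>v. smooth v \<and> (\<forall>p. U (pt (X p) (Y p)) = v p))"
  then obtain v where U: "lat_inv tw U" and v: "smooth v" and e: "\<And>p. U (pt (X p) (Y p)) = v p" by blast
  have d: "U differentiable (at z)" for z by (rule descend_differentiable[OF U v e])
  have ve: "v = (\<lambda>p. U (pt (X p) (Y p)))" using e by auto
  have pv: "partial j v p = partial j X p * partial 1 U (pt (X p) (Y p)) + partial j Y p * partial 2 U (pt (X p) (Y p))" for j p
    unfolding ve by (subst partial_compose_pt) (use d X Y smooth_differentiable in auto)
  have 1: "partial 1 U (pt (X p) (Y p)) = (partial 2 Y p * partial 1 v p - partial 1 Y p * partial 2 v p) / jac X Y p" for p
    unfolding pv using jac[of p] by (simp add: jac_def field_simps)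
  have 2: "partial 2 U (pt (X p) (Y p)) = (partial 1 X p * partial 2 v p - partial 2 X p * partial 1 v p) / jac X Y p" for p
    unfolding pv using jac[of p] by (simp add: jac_def field_simps)
  have s1: "smooth (\<lambda>p. (partial 2 Y p * partial 1 v p - partial 1 Y p * partial 2 v p) / jac X Y p)"
    "smooth (\<lambda>p. (partial 1 X p * partial 2 v p - partial 2 X p * partial 1 v p) / jac X Y p)"
    by (intro smooth_divide smooth_diff smooth_mult smooth_partial X Y v smooth_jac jac)+
  have "\<exists>v. smooth v \<and> (\<forall>p. partial i U (pt (X p) (Y p)) = v p)" for i
  proof -
    have "i = 1 \<or> i = 2" using exhaust_2 by blast
    then show ?thesis using 1 2 s1 by blast
  qed
  then show "(\<forall>p. U differentiable (at p)) \<and>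
      (\<forall>i. lat_inv tw (partial i U) \<and> (\<exists>v. smooth v \<and> (\<forall>p. partial i U (pt (X p) (Y p)) = v p)))"
    using d partial_lat_inv[OF d U] by blast
qed (use assms in blast)

theorem eigenspace_chart: "eigenspace g lam = {(\<lambda>p. U (pt (X p) (Y p))) | U. U \<in> pspace tw lam}"
proof (intro equalityI subsetI)
  fix h assume "h \<in> {(\<lambda>p. U (pt (X p) (Y p))) | U. U \<in> pspace tw lam}"
  then obtain U where h: "h = (\<lambda>p. U (pt (X p) (Y p)))" and U: "U \<in> pspace tw lam" by blast
  have Us: "smooth U" and Ul: "lat_inv tw U" and Up: "pde lam U" using U by (auto simp: pspace_def lat_inv_iff)
  have "smooth h" unfolding h by (intro smooth_compose Us X Y)
  moreover have "lattice_periodic h"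
    unfolding lattice_periodic_def
  proof (intro allI impI)
    fix p v :: "real^2" assume "\<forall>i. v $ i \<in> \<int>"
    then have "lat tw (X (p + v) - X p) (Y (p + v) - Y p)" unfolding fibre by simp
    then have "U (pt (X p + (X (p + v) - X p)) (Y p + (Y (p + v) - Y p))) = U (pt (X p) (Y p))"
      using Ul unfolding lat_inv_def by blast
    then show "h (p + v) = h p" by (simp add: h)
  qed
  moreover have "laplace_beltrami g h p = lam * h p" for p
  proof -
    have "laplace_beltrami g h p = - (- lam * \<rho> (X p) * U (pt (X p) (Y p))) / \<rho> (X p)"
      unfolding h laplace_chart[OF X Y jac g Us] using Up[unfolded pde_def, rule_format, of "pt (X p) (Y p)"] by simp
    then show ?thesis using \<rho>_pos[of "X p"] by (simp add: h)
  qed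
  ultimately show "h \<in> eigenspace g lam" by (simp add: eigenspace_def)
next
  fix v assume "v \<in> eigenspace g lam"
  then have v: "smooth v" and vp: "lattice_periodic v" and ve: "\<And>p. laplace_beltrami g v p = lam * v p"
    by (auto simp: eigenspace_def)
  \<comment> \<open>A function on the torus defines \<open>U\<close> through any preimage under the
    chart modulo the lattice; \<open>key\<close> is the independence of the preimage.\<close>
  define sel where "sel z = (SOME p. lat tw (z $ 1 - X p) (z $ 2 - Y p))" for z :: "real^2"
  have sel: "lat tw (z $ 1 - X (sel z)) (z $ 2 - Y (sel z))" for z
    unfolding sel_def by (rule someI_ex[OF onto])
  define U where "U z = v (sel z)" for z
  have key: "U z = v p" if "lat tw (z $ 1 - X p) (z $ 2 - Y p)" for z p
  proof -
    have "lat tw (X p - X (sel z)) (Y p - Y (sel z))"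
      using lat_add[OF sel[of z] lat_minus[OF that]] by simp
    then have "\<forall>i. (p - sel z) $ i \<in> \<int>" unfolding fibre by simp
    then have "v (sel z + (p - sel z)) = v (sel z)" using vp unfolding lattice_periodic_def by blast
    then show ?thesis by (simp add: U_def)
  qed
  have lat0: "lat tw 0 0" unfolding lat_def by (rule exI[of _ 0], rule exI[of _ 0]) simp
  have UF: "U (pt (X p) (Y p)) = v p" for p by (rule key) (simp add: lat0)
  have Ul: "lat_inv tw U"
    unfolding lat_inv_def
  proof (intro allI impI)
    fix x y a b assume "lat tw a b"
    from lat_add[OF this sel[of "pt x y"]] have "lat tw (x + a - X (sel (pt x y))) (y + b - Y (sel (pt x y)))"
      by (simp add: algebra_simps)
    then show "U (pt (x + a) (y + b)) = U (pt x y)" using key[of "pt (x + a) (y + b)" "sel (pt x y)"] by (simp add: U_def)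
  qed
  have Us: "smooth U" by (rule descend_smooth[OF Ul v UF])
  have "pde lam U"
    unfolding pde_def
  proof
    fix z :: "real^2"
    define a b where "a = z $ 1 - X (sel z)" and "b = z $ 2 - Y (sel z)"
    have ab: "lat tw a b" unfolding a_def b_def by (rule sel)
    \<comment> \<open>\<open>laplace_chart\<close> speaks only of points in the image of the chart.
      Translating the chart by a lattice vector brings the given \<open>z\<close> into the image,
      and periodicity of \<open>w\<close> and \<open>\<rho>\<close> keeps the metric.\<close>
    define X' Y' where "X' = (\<lambda>p. X p + a)" and "Y' = (\<lambda>p. Y p + b)"
    have s: "smooth X'" "smooth Y'" unfolding X'_def Y'_def by (intro smooth_add X Y smooth_const)+
    have pX: "partial i X' = partial i X" "partial i Y' = partial i Y" for i
    proof -
      have c: "partial i (\<lambda>p. c) = (\<lambda>p. 0)" for c :: real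
        using partial_eq[of "\<lambda>p. c" "\<lambda>p v. 0" i] by simp
      show "partial i X' = partial i X" "partial i Y' = partial i Y"
        unfolding X'_def Y'_def
        using partial_add[OF smooth_differentiable[OF X] differentiable_const, of i a]
          partial_add[OF smooth_differentiable[OF Y] differentiable_const, of i b]
        by (simp_all add: c)
    qed
    obtain k :: int where k: "a = of_int k * pi" using ab unfolding lat_def by (auto simp: mult.commute)
    have wr: "w (X' p) = w (X p)" "\<rho> (X' p) = \<rho> (X p)" for p
      unfolding X'_def k by (rule int_step_invariant[where f = w, OF w_periodic], rule int_step_invariant[where f = \<rho>, OF \<rho>_periodic])
    have j: "jac X' Y' p \<noteq> 0" for p using jac[of p] unfolding jac_def pX .
    have g': "g p $ i $ j = (w (X' p))\<^sup>2 * \<rho> (X' p) * (partial i X' p * partial j X' p) + \<rho> (X' p) * (partial i Y' p * partial j Y' p)" for p i j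
      unfolding wr pX by (rule g)
    have v': "(\<lambda>p. U (pt (X' p) (Y' p))) = v"
      using Ul ab UF unfolding lat_inv_def X'_def Y'_def by auto
    define p where "p = sel z"
    have zp: "pt (X' p) (Y' p) = z" by (simp add: X'_def Y'_def p_def a_def b_def pt_eta)
    have X'z: "X' p = z $ 1" by (simp add: X'_def p_def a_def)
    have "lam * U z = - (partial 1 (\<lambda>q. partial 1 U q / w (q $ 1)) z / w (z $ 1) + partial 2 (partial 2 U) z) / \<rho> (z $ 1)"
      using laplace_chart[OF s j g' Us, of p, unfolded v' zp] unfolding X'z ve U_def[of z] p_def[symmetric] .
    then show "partial 1 (\<lambda>q. partial 1 U q / w (q $ 1)) z / w (z $ 1) + partial 2 (partial 2 U) z = - lam * \<rho> (z $ 1) * U z"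
      using \<rho>_pos[of "z $ 1"] by (simp add: field_simps)
  qed
  then have "U \<in> pspace tw lam" using Us Ul by (simp add: pspace_def lat_inv_iff)
  moreover have "v = (\<lambda>p. U (pt (X p) (Y p)))" using UF by auto
  ultimately show "v \<in> {(\<lambda>p. U (pt (X p) (Y p))) | U. U \<in> pspace tw lam}" by blast
qed

theorem eigenvalue_chart:
  assumes A: "finite A" "A \<subseteq> admissible tw"
    and out: "\<And>i lam. i \<in> admissible tw \<Longrightarrow> i \<notin> A \<Longrightarrow> lam \<in> ispec i \<Longrightarrow> lam < \<nu> \<Longrightarrow> False"
    and \<nu>: "Ix tw \<nu> \<noteq> {}"
  shows "eigenvalue (\<Sum>i\<in>A. card {lam \<in> ispec i. lam < \<nu>}) g = \<nu>"
proof (rule eigenvalue_count[OF eigenspace_chart _ A out \<nu>])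
  fix lam U assume "U \<in> pspace tw lam" "\<And>p. U (pt (X p) (Y p)) = 0"
  then show "U = (\<lambda>p. 0)" by (intro lat_inv_eq_zero) (auto simp: pspace_def lat_inv_iff)
qed

end

section \<open>Area\<close>

lemma nn_integral_translate:
  fixes h :: "'a::euclidean_space \<Rightarrow> ennreal"
  assumes "h \<in> borel_measurable borel" shows "(\<integral>\<^sup>+z. h (c + z) \<partial>lborel) = (\<integral>\<^sup>+z. h z \<partial>lborel)"
proof -
  have "(\<integral>\<^sup>+z. h z \<partial>lborel) = (\<integral>\<^sup>+z. h z \<partial>(distr lborel borel ((+) c)))" by (simp add: lborel_distr_plus)
  also have "\<dots> = (\<integral>\<^sup>+z. h (c + z) \<partial>lborel)" by (rule nn_integral_distr) (use assms in auto)
  finally show ?thesis ..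
qed

text \<open>Unfolding: insert the sum of the translated indicators of \<open>B\<close>, which is 1,
  exchange sum and integral, translate each summand using the invariance of \<open>f\<close>, and
  sum up the indicators of \<open>A\<close> instead.\<close>

lemma nn_integral_fundamental_domain:
  fixes A B \<Gamma> :: "'a::euclidean_space set" and f :: "'a \<Rightarrow> ennreal"
  assumes \<Gamma>: "countable \<Gamma>" "\<And>c. c \<in> \<Gamma> \<Longrightarrow> - c \<in> \<Gamma>"
    and [measurable]: "A \<in> sets borel" "B \<in> sets borel" "f \<in> borel_measurable borel"
    and inv: "\<And>c z. c \<in> \<Gamma> \<Longrightarrow> f (c + z) = f z"
    and AB: "\<And>z. \<exists>!c. c \<in> \<Gamma> \<and> c + z \<in> A" "\<And>z. \<exists>!c. c \<in> \<Gamma> \<and> c + z \<in> B"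
  shows "(\<integral>\<^sup>+z. f z * indicator A z \<partial>lborel) = (\<integral>\<^sup>+z. f z * indicator B z \<partial>lborel)"
proof -
  have one: "(\<integral>\<^sup>+c. indicator S (c + z) \<partial>count_space \<Gamma>) = (1::ennreal)" if S: "\<And>z. \<exists>!c. c \<in> \<Gamma> \<and> c + z \<in> S" for S :: "'a set" and z
  proof -
    obtain c where c: "c \<in> \<Gamma> \<and> c + z \<in> S" "\<forall>c'. c' \<in> \<Gamma> \<and> c' + z \<in> S \<longrightarrow> c' = c"
      using S[of z] by (elim ex1E)
    have "(\<integral>\<^sup>+c. indicator S (c + z) \<partial>count_space \<Gamma>) = (\<Sum>c\<in>{c}. indicator S (c + z) :: ennreal)"
    proof (rule nn_integral_count_space')
      show "indicator S (x + z) = (0 :: ennreal)" if "x \<in> \<Gamma>" "x \<notin> {c}" for x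
      proof -
        have "x + z \<notin> S" using c(2) that by blast
        then show ?thesis by (rule indicator_simps(2))
      qed
    qed (use c(1) in auto)
    also have "\<dots> = 1" using c(1) by (simp only: sum.insert_if finite.emptyI empty_iff if_False sum.empty indicator_simps add_0_right)
    finally show ?thesis .
  qed
  have "(\<integral>\<^sup>+z. f z * indicator A z \<partial>lborel) = (\<integral>\<^sup>+z. (\<integral>\<^sup>+c. f z * indicator A z * indicator B (c + z) \<partial>count_space \<Gamma>) \<partial>lborel)"
  proof (rule nn_integral_cong)
    fix z
    have "(\<integral>\<^sup>+c. f z * indicator A z * indicator B (c + z) \<partial>count_space \<Gamma>) = f z * indicator A z * (\<integral>\<^sup>+c. indicator B (c + z) \<partial>count_space \<Gamma>)"
      by (rule nn_integral_cmult) simp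
    then show "f z * indicator A z = (\<integral>\<^sup>+c. f z * indicator A z * indicator B (c + z) \<partial>count_space \<Gamma>)"
      by (simp only: one[OF AB(2)] mult_1_right)
  qed
  also have "\<dots> = (\<integral>\<^sup>+c. (\<integral>\<^sup>+z. f z * indicator A z * indicator B (c + z) \<partial>lborel) \<partial>count_space \<Gamma>)"
    by (rule nn_integral_count_space_nn_integral[OF \<Gamma>(1)]) measurable
  also have "\<dots> = (\<integral>\<^sup>+c. (\<integral>\<^sup>+z. f z * indicator A (- c + z) * indicator B z \<partial>lborel) \<partial>count_space \<Gamma>)"
  proof (rule nn_integral_cong)
    fix c assume "c \<in> space (count_space \<Gamma>)"
    then have c: "c \<in> \<Gamma>" by simp
    have "(\<integral>\<^sup>+z. f z * indicator A (- c + z) * indicator B z \<partial>lborel) = (\<integral>\<^sup>+z. f (c + z) * indicator A (- c + (c + z)) * indicator B (c + z) \<partial>lborel)"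
      by (rule nn_integral_translate[symmetric]) measurable
    then show "(\<integral>\<^sup>+z. f z * indicator A z * indicator B (c + z) \<partial>lborel) = (\<integral>\<^sup>+z. f z * indicator A (- c + z) * indicator B z \<partial>lborel)"
      by (simp add: inv[OF c])
  qed
  also have "\<dots> = (\<integral>\<^sup>+c. (\<integral>\<^sup>+z. f z * indicator A (c + z) * indicator B z \<partial>lborel) \<partial>count_space \<Gamma>)"
  proof -
    have "bij_betw uminus \<Gamma> \<Gamma>" by (rule bij_betwI[where g = uminus]) (use \<Gamma>(2) in auto)
    from nn_integral_bij_count_space[OF this, where f = "\<lambda>c. \<integral>\<^sup>+z. f z * indicator A (c + z) * indicator B z \<partial>lborel"] show ?thesis .
  qed
  also have "\<dots> = (\<integral>\<^sup>+z. (\<integral>\<^sup>+c. f z * indicator A (c + z) * indicator B z \<partial>count_space \<Gamma>) \<partial>lborel)"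
    by (rule nn_integral_count_space_nn_integral[OF \<Gamma>(1), symmetric]) measurable
  also have "\<dots> = (\<integral>\<^sup>+z. f z * indicator B z \<partial>lborel)"
  proof (rule nn_integral_cong)
    fix z
    have "(\<integral>\<^sup>+c. f z * indicator A (c + z) * indicator B z \<partial>count_space \<Gamma>) = (\<integral>\<^sup>+c. f z * indicator B z * indicator A (c + z) \<partial>count_space \<Gamma>)"
      by (intro nn_integral_cong) (simp only: mult_ac)
    also have "\<dots> = f z * indicator B z * (\<integral>\<^sup>+c. indicator A (c + z) \<partial>count_space \<Gamma>)"
      by (rule nn_integral_cmult) simp
    also have "\<dots> = f z * indicator B z" by (simp only: one[OF AB(1)] mult_1_right)
    finally show "(\<integral>\<^sup>+c. f z * indicator A (c + z) * indicator B z \<partial>count_space \<Gamma>) = f z * indicator B z" .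
  qed
  finally show ?thesis .
qed

lemma nn_integral_indicator_integral:
  fixes f :: "'a::euclidean_space \<Rightarrow> real"
  assumes "S \<in> sets borel" "f \<in> borel_measurable borel" "\<And>z. 0 \<le> f z" "f integrable_on S"
  shows "(\<integral>\<^sup>+z. ennreal (f z) * indicator S z \<partial>lborel) = ennreal (integral S f)"
proof -
  have "((\<lambda>z. if z \<in> S then f z else 0) has_integral integral S f) UNIV"
    using assms(4) has_integral_restrict_UNIV integrable_integral by blast
  moreover have "(\<lambda>z. if z \<in> S then f z else 0) \<in> borel_measurable borel"
    using assms(1,2) by (intro measurable_If_set) auto
  ultimately have "(\<integral>\<^sup>+z. ennreal (if z \<in> S then f z else 0) \<partial>lborel) = ennreal (integral S f)"
    using assms(3) by (intro nn_integral_has_integral_lborel) auto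
  moreover have "ennreal (if z \<in> S then f z else 0) = ennreal (f z) * indicator S z" for z by simp
  ultimately show ?thesis by simp
qed

text \<open>Fubini's theorem for pairs, transported to \<open>real^2\<close> by an identification
  that maps boxes to boxes of the same content.\<close>

lemma has_integral_pt:
  fixes f :: "real \<Rightarrow> real"
  assumes f: "continuous_on {0..a} f" and ab: "0 \<le> a" "0 \<le> b"
  shows "((\<lambda>p. f (p $ 1)) has_integral b * integral {0..a} f) (cbox (pt 0 0) (pt a b))"
proof -
  have c: "continuous_on (cbox (0, 0) (a, b)) (\<lambda>z. f (fst z))"
    by (rule continuous_on_compose2[OF f]) (auto intro!: continuous_intros simp: cbox_Pair_eq)
  have "integral (cbox (0, 0) (a, b)) (\<lambda>z. f (fst z)) = integral (cbox 0 a) (\<lambda>x. integral (cbox 0 b) (\<lambda>y. f x))"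
    using integral_prod_continuous[OF c] by simp
  also have "\<dots> = b * integral {0..a} f" using ab by simp
  finally have 1: "((\<lambda>z. f (fst z)) has_integral b * integral {0..a} f) (cbox (0, 0) (a, b))"
    using integrable_integral[OF integrable_continuous[OF c]] by simp
  have g: "(\<lambda>v::real^2. (v $ 1, v $ 2)) ` cbox u v = cbox (u $ 1, u $ 2) (v $ 1, v $ 2)" for u v
  proof (intro equalityI subsetI)
    fix z assume "z \<in> cbox (u $ 1, u $ 2) (v $ 1, v $ 2)"
    then have "pt (fst z) (snd z) \<in> cbox u v" by (cases z) (auto simp: cbox_Pair_eq mem_box_cart forall_2)
    then show "z \<in> (\<lambda>v::real^2. (v $ 1, v $ 2)) ` cbox u v" by (rule rev_image_eqI) simp
  qed (auto simp: cbox_Pair_eq mem_box_cart forall_2)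
  have h: "(\<lambda>z. pt (fst z) (snd z)) ` cbox u v = cbox (pt (fst u) (snd u)) (pt (fst v) (snd v))" for u v
  proof (intro equalityI subsetI)
    fix z assume "z \<in> cbox (pt (fst u) (snd u)) (pt (fst v) (snd v))"
    then have "(z $ 1, z $ 2) \<in> cbox u v" by (cases u; cases v) (auto simp: cbox_Pair_eq mem_box_cart forall_2)
    then show "z \<in> (\<lambda>z. pt (fst z) (snd z)) ` cbox u v" by (rule rev_image_eqI) (simp add: pt_eta)
  next
    fix z assume "z \<in> (\<lambda>z. pt (fst z) (snd z)) ` cbox u v"
    then show "z \<in> cbox (pt (fst u) (snd u)) (pt (fst v) (snd v))"
      by (cases u; cases v) (auto simp: cbox_Pair_eq mem_box_cart forall_2)
  qed
  have cont: "Henstock_Kurzweil_Integration.content (cbox (u $ 1, u $ 2) (v $ 1, v $ 2)) = 1 * Henstock_Kurzweil_Integration.content (cbox u v)" for u v :: "real^2"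
  proof (cases "cbox u v = {}")
    case True
    then show ?thesis using g[of u v] by simp
  next
    case False
    then have "u $ 1 \<le> v $ 1" "u $ 2 \<le> v $ 2" by (auto simp: interval_ne_empty_cart)
    then show ?thesis unfolding content_Pair content_cbox_cart[OF False] by (simp add: UNIV_2)
  qed
  have "((\<lambda>v::real^2. f (fst (v $ 1, v $ 2))) has_integral (1 / 1) *\<^sub>R (b * integral {0..a} f))
      ((\<lambda>z. pt (fst z) (snd z)) ` cbox (0, 0) (a, b))"
  proof (rule has_integral_twiddle[OF zero_less_one _ _ _ _ _ _ 1])
    show "isCont (\<lambda>v::real^2. (v $ 1, v $ 2)) x" for x by (intro continuous_intros)
    show "\<exists>w z. (\<lambda>v::real^2. (v $ 1, v $ 2)) ` cbox u v = cbox w z" for u v using g by blast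
    show "\<exists>w z. (\<lambda>z. pt (fst z) (snd z)) ` cbox u v = cbox w z" for u v using h by blast
    show "Henstock_Kurzweil_Integration.content ((\<lambda>v::real^2. (v $ 1, v $ 2)) ` cbox u v) = 1 * Henstock_Kurzweil_Integration.content (cbox u v)" for u v
      unfolding g by (rule cont)
  qed (auto simp: pt_eta)
  then show ?thesis unfolding h by simp
qed

context sturm
begin

text \<open>The symmetries of the integrand make \<open>G (pi - x) + G x\<close> and
  \<open>G (x + pi) - G x\<close> constant for a primitive \<open>G\<close>.\<close>

lemma integral_symmetric:
  fixes f :: "real \<Rightarrow> real"
  assumes f: "continuous_on UNIV f" and per: "\<And>x. f (x + pi) = f x" and ev: "\<And>x. f (- x) = f x"
  shows "integral {0..pi} f = 2 * integral {0..pi/2} f" "integral {0..2*pi} f = 4 * integral {0..pi/2} f"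
proof -
  obtain G where G: "\<And>x. (G has_real_derivative f x) (at x)" by (rule primitive_exists[OF f], rule that)
  have I: "integral {a..b} f = G b - G a" if "a \<le> b" for a b
    by (intro integral_unique fundamental_theorem_of_calculus that)
       (use G in \<open>auto simp: has_real_derivative_iff_has_vector_derivative[symmetric] has_field_derivative_at_within\<close>)
  have s: "((\<lambda>x. x + pi) has_real_derivative 1) (at x)" "((\<lambda>x. pi - x) has_real_derivative - 1) (at x)" for x
    by (auto intro!: derivative_eq_intros)
  have fr: "f (pi - x) = f x" for x using per[of "- x"] ev[of x] by simp
  have "((\<lambda>x. G (pi - x) + G x) has_real_derivative f (pi - x) * - 1 + f x) (at x)" for x
    by (intro DERIV_add DERIV_chain2[OF G s(2)] G)
  then have "((\<lambda>x. G (pi - x) + G x) has_real_derivative 0) (at x)" for x by (simp add: fr)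
  then have 1: "G (pi - pi/2) + G (pi/2) = G (pi - 0) + G 0" by (intro DERIV_isconst_all allI)
  have "((\<lambda>x. G (x + pi) - G x) has_real_derivative f (x + pi) * 1 - f x) (at x)" for x
    by (intro DERIV_diff DERIV_chain2[OF G s(1)] G)
  then have "((\<lambda>x. G (x + pi) - G x) has_real_derivative 0) (at x)" for x by (simp add: per)
  then have 2: "G (pi + pi) - G pi = G (0 + pi) - G 0"
    using DERIV_isconst_all[of "\<lambda>x. G (x + pi) - G x" pi 0] by blast
  show "integral {0..pi} f = 2 * integral {0..pi/2} f" using 1 I[of 0 pi] I[of 0 "pi/2"] by simp
  show "integral {0..2*pi} f = 4 * integral {0..pi/2} f" using 1 2 I[of 0 "2*pi"] I[of 0 "pi/2"] by simp
qed

end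

context torus_chart
begin

lemma sqrt_det: "sqrt (det (g p)) = w (X p) * \<rho> (X p) * \<bar>jac X Y p\<bar>"
proof -
  have "det (g p) = (w (X p) * \<rho> (X p) * jac X Y p)\<^sup>2"
    unfolding det_2 g jac_def by (simp add: power2_eq_square algebra_simps)
  then show ?thesis using w_pos[of "X p"] \<rho>_pos[of "X p"] by (simp add: abs_mult)
qed

text \<open>The substitution theorem turns the area into the integral of \<open>w * \<rho>\<close>
  over the image of the unit square, a fundamental domain of unknown shape. The rectangle
  \<open>D\<close> is another fundamental domain of the same lattice, and invariance allows the
  exchange.\<close>

theorem area_chart: "area g = (if tw then 4 else 8) * pi * integral {0..pi/2} (\<lambda>x. w x * \<rho> x)"
proof -
  define F where "F p = pt (X p) (Y p)" for p
  define F' where "F' p h = pt (h $ 1 * partial 1 X p + h $ 2 * partial 2 X p) (h $ 1 * partial 1 Y p + h $ 2 * partial 2 Y p)" for p h :: "real^2"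
  define d where "d z = w (z $ 1) * \<rho> (z $ 1)" for z :: "real^2"
  \<comment> \<open>Half-open, so that each class modulo the integer lattice occurs once and
    \<open>F\<close> is injective on it.\<close>
  define Q where "Q = {p :: real^2. \<forall>i. 0 \<le> p $ i \<and> p $ i < 1}"
  \<comment> \<open>With the extra period \<open>(pi, pi)\<close> a rectangle of width
    \<open>pi\<close> and height \<open>2 pi\<close> is a fundamental domain.\<close>
  define T where "T = (if tw then pi else 2 * pi)"
  define D where "D = {p :: real^2. 0 \<le> p $ 1 \<and> p $ 1 < T \<and> 0 \<le> p $ 2 \<and> p $ 2 < 2 * pi}"
  define \<Gamma> where "\<Gamma> = {pt a b | a b. lat tw a b}"
  have T: "0 < T" by (simp add: T_def)
  have dF: "(F has_derivative F' p) (at p)" for p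
    unfolding F_def F'_def
    using has_derivative_pt[OF has_derivative_partial[OF smooth_differentiable[OF X]] has_derivative_partial[OF smooth_differentiable[OF Y]]]
    by simp
  have det: "\<bar>det (matrix (F' p))\<bar> = \<bar>jac X Y p\<bar>" for p
    by (simp add: det_2 matrix_def F'_def jac_def axis_def mult.commute)
  have Fc: "continuous_on S F" for S unfolding F_def by (intro continuous_intros smooth_continuous_on X Y)
  have dc: "continuous_on S d" for S unfolding d_def
    by (intro continuous_intros continuous_on_compose2[OF w_cont[of UNIV]] continuous_on_compose2[OF \<rho>_cont[of UNIV]]) auto
  have dpos: "0 \<le> d z" for z unfolding d_def using w_pos \<rho>_pos by (simp add: less_imp_le)
  have jc: "continuous_on S (\<lambda>p. \<bar>jac X Y p\<bar> * d (F p))" for S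
    by (intro continuous_intros smooth_continuous_on smooth_jac X Y continuous_on_compose2[OF dc[of UNIV] Fc]) auto
  have area: "area g = integral (cbox 0 1) (\<lambda>p. \<bar>jac X Y p\<bar> * d (F p))"
    unfolding area_def sqrt_det by (simp add: d_def F_def mult_ac)
  have hyper: "negligible {p :: real^2. p $ i = c}" for i c
    using negligible_standard_hyperplane[of "axis i (1::real)" c] by (simp add: inner_axis)
  have half: "negligible (cbox (pt 0 0) (pt a b) - {p. 0 \<le> p $ 1 \<and> p $ 1 < a \<and> 0 \<le> p $ 2 \<and> p $ 2 < b})" for a b
    by (rule negligible_subset[OF negligible_Un[OF hyper[of 1 a] hyper[of 2 b]]]) (auto simp: mem_box_cart forall_2)
  have spike: "integral (cbox (pt 0 0) (pt a b)) f = integral {p. 0 \<le> p $ 1 \<and> p $ 1 < a \<and> 0 \<le> p $ 2 \<and> p $ 2 < b} f"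
    "f integrable_on cbox (pt 0 0) (pt a b) \<Longrightarrow> f integrable_on {p. 0 \<le> p $ 1 \<and> p $ 1 < a \<and> 0 \<le> p $ 2 \<and> p $ 2 < b}" for a b and f :: "real^2 \<Rightarrow> real"
  proof -
    let ?S = "{p :: real^2. 0 \<le> p $ 1 \<and> p $ 1 < a \<and> 0 \<le> p $ 2 \<and> p $ 2 < b}"
    have 1: "negligible {x \<in> cbox (pt 0 0) (pt a b) - ?S. f x \<noteq> 0}" by (rule negligible_subset[OF half[of a b]]) auto
    have "{x \<in> ?S - cbox (pt 0 0) (pt a b). f x \<noteq> 0} = {}" by (auto simp: mem_box_cart forall_2)
    then have 2: "negligible {x \<in> ?S - cbox (pt 0 0) (pt a b). f x \<noteq> 0}" by (simp only: negligible_empty)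
    show "integral (cbox (pt 0 0) (pt a b)) f = integral ?S f" by (rule integral_spike_set[OF 1 2])
    show "f integrable_on cbox (pt 0 0) (pt a b) \<Longrightarrow> f integrable_on ?S"
      unfolding integrable_on_def has_integral_spike_set_eq[OF 1 2] .
  qed
  have box01: "cbox 0 1 = cbox (pt 0 0) (pt 1 1)" "Q = {p. 0 \<le> p $ 1 \<and> p $ 1 < 1 \<and> 0 \<le> p $ 2 \<and> p $ 2 < 1}"
    by (auto simp: Q_def mem_box_cart forall_2)
  have meas: "{p :: real^2. 0 \<le> p $ 1 \<and> p $ 1 < a \<and> 0 \<le> p $ 2 \<and> p $ 2 < b} \<in> sets borel" for a b
  proof -
    have "{p :: real^2. 0 \<le> p $ 1} \<in> sets borel" "{p :: real^2. 0 \<le> p $ 2} \<in> sets borel"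
      by (intro borel_closed closed_Collect_le continuous_intros)+
    moreover have "{p :: real^2. p $ 1 < a} \<in> sets borel" "{p :: real^2. p $ 2 < b} \<in> sets borel"
      by (intro borel_open open_Collect_less continuous_intros)+
    ultimately have "{p :: real^2. 0 \<le> p $ 1} \<inter> {p. p $ 1 < a} \<inter> {p. 0 \<le> p $ 2} \<inter> {p. p $ 2 < b} \<in> sets borel" by blast
    moreover have "{p :: real^2. 0 \<le> p $ 1} \<inter> {p. p $ 1 < a} \<inter> {p. 0 \<le> p $ 2} \<inter> {p. p $ 2 < b} = {p. 0 \<le> p $ 1 \<and> p $ 1 < a \<and> 0 \<le> p $ 2 \<and> p $ 2 < b}" by auto
    ultimately show ?thesis by simp
  qed
  have lat_sub: "lat tw a b \<Longrightarrow> lat tw a' b' \<Longrightarrow> lat tw (a - a') (b - b')" for a b a' b'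
    using lat_add[of tw a b "- a'" "- b'"] lat_minus[of tw a' b'] by simp
  have frac: "\<exists>q\<in>Q. lat tw (X p - X q) (Y p - Y q)" for p
  proof
    define q where "q = (\<chi> i. p $ i - of_int \<lfloor>p $ i\<rfloor>)"
    show "q \<in> Q" unfolding Q_def q_def using floor_correct by (auto simp: algebra_simps)
    show "lat tw (X p - X q) (Y p - Y q)" unfolding fibre by (simp add: q_def)
  qed
  have Quniq: "p = q" if pq: "p \<in> Q" "q \<in> Q" "lat tw (X p - X q) (Y p - Y q)" for p q
  proof -
    have "p $ i = q $ i" for i
    proof -
      obtain k :: int where k: "p $ i - q $ i = of_int k" using pq(3) unfolding fibre by (meson Ints_cases)
      have "\<bar>p $ i - q $ i\<bar> < 1" using pq(1,2) unfolding Q_def by (smt (verit) mem_Collect_eq)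
      then have "k = 0" using k by simp
      then show ?thesis using k by simp
    qed
    then show ?thesis by (simp add: vec_eq_iff)
  qed
  have lat0: "lat tw 0 0" unfolding lat_def by (rule exI[of _ 0], rule exI[of _ 0]) simp
  have inj: "inj_on F Q"
  proof (rule inj_onI)
    fix p q assume pq: "p \<in> Q" "q \<in> Q" "F p = F q"
    then have "F p $ 1 = F q $ 1" "F p $ 2 = F q $ 2" by auto
    then have "X p = X q" "Y p = Y q" by (simp_all add: F_def)
    then show "p = q" using Quniq[OF pq(1,2)] lat0 by simp
  qed
  have absint: "(\<lambda>p. \<bar>jac X Y p\<bar> * d (F p)) absolutely_integrable_on Q"
  proof -
    have "(\<lambda>p. \<bar>jac X Y p\<bar> * d (F p)) integrable_on cbox (pt 0 0) (pt 1 1)" by (rule integrable_continuous[OF jc])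
    then have "(\<lambda>p. \<bar>jac X Y p\<bar> * d (F p)) integrable_on Q" unfolding box01(2) by (rule spike(2))
    then show ?thesis by (rule nonnegative_absolutely_integrable_1) (simp add: dpos)
  qed
  have Qm: "Q \<in> sets lebesgue" using meas[of 1 1] unfolding box01(2) by simp
  have areaQ: "area g = integral Q (\<lambda>p. \<bar>jac X Y p\<bar> * d (F p))"
    unfolding area box01 by (rule spike(1))
  \<comment> \<open>The substitution theorem is vector valued, hence the detour through
    \<open>real^1\<close>.\<close>
  have "(\<lambda>p. \<bar>det (matrix (F' p))\<bar> *\<^sub>R (vec (d (F p)) :: real^1)) absolutely_integrable_on Q \<and>
      integral Q (\<lambda>p. \<bar>det (matrix (F' p))\<bar> *\<^sub>R (vec (d (F p)) :: real^1)) = vec (area g) \<longleftrightarrow>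
      (\<lambda>z. vec (d z) :: real^1) absolutely_integrable_on F ` Q \<and> integral (F ` Q) (\<lambda>z. vec (d z) :: real^1) = vec (area g)"
    by (rule has_absolute_integral_change_of_variables[where f = "\<lambda>z. vec (d z) :: real^1", OF Qm has_derivative_at_withinI[OF dF] inj])
  then have cov: "d absolutely_integrable_on F ` Q \<and> integral (F ` Q) d = area g"
    using absint unfolding det by (simp add: absolutely_integrable_on_1_iff integral_on_1_eq areaQ)
  then have area2: "area g = integral (F ` Q) d" "d integrable_on F ` Q"
    using set_lebesgue_integral_eq_integral(1) by auto
  have DT: "lat tw a b \<Longrightarrow> \<bar>a\<bar> < T \<Longrightarrow> \<bar>b\<bar> < 2 * pi \<Longrightarrow> a = 0 \<and> b = 0" for a b
  proof -
    assume l: "lat tw a b" and ab: "\<bar>a\<bar> < T" "\<bar>b\<bar> < 2 * pi"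
    obtain k l :: int where kl: "a = pi * of_int k" "b = pi * of_int l" "if tw then even (k + l) else even k \<and> even l"
      using l unfolding lat_def by blast
    have l2: "\<bar>l\<bar> < 2" 
    proof -
      have "pi * \<bar>real_of_int l\<bar> < pi * 2" using ab(2) kl(2) by (simp add: abs_mult)
      then show ?thesis by simp
    qed
    have k2: "\<bar>k\<bar> < (if tw then 1 else 2)"
    proof -
      have "pi * \<bar>real_of_int k\<bar> < pi * (if tw then 1 else 2)" using ab(1) kl(1) by (cases tw) (simp_all add: abs_mult T_def)
      then show ?thesis by (cases tw) simp_all
    qed
    have "k = 0 \<and> l = 0"
    proof (cases tw)
      case True
      then have "k = 0" using k2 by simp
      then have "even l" using kl(3) True by simp
      then have "l = 0" using l2 by (auto elim!: evenE)
      with \<open>k = 0\<close> show ?thesis by simp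
    next
      case False
      then have "even k" "even l" "\<bar>k\<bar> < 2" using kl(3) k2 by auto
      then show ?thesis using l2 by (auto elim!: evenE)
    qed
    then show "a = 0 \<and> b = 0" using kl by simp
  qed
  have Dex: "\<exists>a b. lat tw a b \<and> pt a b + z \<in> D" for z
  proof -
    define k where "k = \<lfloor>z $ 1 / T\<rfloor>"
    define e :: int where "e = (if tw then 1 else 2)"
    have Te: "T = pi * of_int e" by (simp add: T_def e_def)
    \<comment> \<open>In the twisted case moving \<open>x\<close> by \<open>k\<close> steps of
      length \<open>pi\<close> moves \<open>y\<close> by the same amount; only afterwards is
      \<open>y\<close> reduced modulo \<open>2 pi\<close>.\<close>
    define y where "y = z $ 2 - (if tw then pi * of_int k else 0)"
    define l where "l = \<lfloor>y / (2 * pi)\<rfloor>"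
    have x: "0 \<le> z $ 1 - T * of_int k" "z $ 1 - T * of_int k < T"
      using floor_divide_lower[OF T, of "z $ 1"] floor_divide_upper[OF T, of "z $ 1"] by (auto simp: k_def algebra_simps)
    have y: "0 \<le> y - 2 * pi * of_int l" "y - 2 * pi * of_int l < 2 * pi"
      using floor_divide_lower[of "2 * pi" y] floor_divide_upper[of "2 * pi" y] by (auto simp: l_def algebra_simps)
    define l' where "l' = - (if tw then k else 0) - 2 * l"
    have "lat tw (pi * of_int (- e * k)) (pi * of_int l')"
      unfolding lat_def by (rule exI[of _ "- e * k"], rule exI[of _ l']) (auto simp: e_def l'_def)
    moreover have "pt (pi * of_int (- e * k)) (pi * of_int l') + z \<in> D"
      unfolding D_def using x y by (auto simp: Te y_def l'_def algebra_simps split: if_splits)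
    ultimately show ?thesis by blast
  qed
  have uniqD: "\<exists>!c. c \<in> \<Gamma> \<and> c + z \<in> D" for z
  proof -
    obtain a b where ab: "lat tw a b" "pt a b + z \<in> D" using Dex by blast
    show ?thesis
    proof (rule ex1I[of _ "pt a b"])
      show "pt a b \<in> \<Gamma> \<and> pt a b + z \<in> D" using ab by (auto simp: \<Gamma>_def)
      fix c assume "c \<in> \<Gamma> \<and> c + z \<in> D"
      then obtain a' b' where c: "c = pt a' b'" "lat tw a' b'" "pt a' b' + z \<in> D" by (auto simp: \<Gamma>_def)
      have "\<bar>a' - a\<bar> < T" "\<bar>b' - b\<bar> < 2 * pi" using ab(2) c(3) unfolding D_def by auto
      with DT[OF lat_sub[OF c(2) ab(1)]] show "c = pt a b" using c(1) by simp
    qed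
  qed
  have uniqF: "\<exists>!c. c \<in> \<Gamma> \<and> c + z \<in> F ` Q" for z
  proof -
    obtain p where p: "lat tw (z $ 1 - X p) (z $ 2 - Y p)" using onto by blast
    obtain q where q: "q \<in> Q" "lat tw (X p - X q) (Y p - Y q)" using frac by blast
    have pq: "lat tw (z $ 1 - X q) (z $ 2 - Y q)" using lat_add[OF p q(2)] by simp
    have mem: "pt a b + z = F r \<longleftrightarrow> a = - (z $ 1 - X r) \<and> b = - (z $ 2 - Y r)" for a b r
      by (auto simp: F_def vec_eq_iff forall_2)
    show ?thesis
    proof (rule ex1I[of _ "pt (- (z $ 1 - X q)) (- (z $ 2 - Y q))"])
      have "pt (- (z $ 1 - X q)) (- (z $ 2 - Y q)) + z = F q" unfolding mem by simp
      then show "pt (- (z $ 1 - X q)) (- (z $ 2 - Y q)) \<in> \<Gamma> \<and> pt (- (z $ 1 - X q)) (- (z $ 2 - Y q)) + z \<in> F ` Q"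
        using q(1) lat_minus[OF pq] unfolding \<Gamma>_def by auto
      fix c assume "c \<in> \<Gamma> \<and> c + z \<in> F ` Q"
      then obtain a b r where c: "c = pt a b" "lat tw a b" "r \<in> Q" "pt a b + z = F r" by (auto simp: \<Gamma>_def)
      then have ab: "a = - (z $ 1 - X r)" "b = - (z $ 2 - Y r)" unfolding mem by auto
      have "lat tw (X r - X q) (Y r - Y q)" using lat_add[OF c(2) pq] unfolding ab by simp
      then have "r = q" by (rule Quniq[OF c(3) q(1)])
      then show "c = pt (- (z $ 1 - X q)) (- (z $ 2 - Y q))" using c(1) ab by simp
    qed
  qed
  \<comment> \<open>\<open>Q\<close> is a countable union of compact boxes, so its continuous image
    is Borel.\<close>
  have Fm: "F ` Q \<in> sets borel"
  proof -
    define K where "K n = cbox (pt 0 0) (pt (1 - 1 / real (Suc n)) (1 - 1 / real (Suc n)))" for n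
    have "Q = (\<Union>n. K n)"
    proof (intro equalityI subsetI)
      fix p assume "p \<in> Q"
      then have p: "0 \<le> p $ 1" "p $ 1 < 1" "0 \<le> p $ 2" "p $ 2 < 1" by (auto simp: box01(2))
      obtain n where n: "1 / real (Suc n) < min (1 - p $ 1) (1 - p $ 2)"
        using reals_Archimedean[of "min (1 - p $ 1) (1 - p $ 2)"] p by (auto simp: inverse_eq_divide)
      then have "p \<in> K n" using p by (auto simp: K_def mem_box_cart forall_2)
      then show "p \<in> (\<Union>n. K n)" by blast
    next
      fix p assume "p \<in> (\<Union>n. K n)"
      then obtain n where p: "p \<in> K n" by blast
      have "1 - 1 / real (Suc n) < 1" by simp
      then show "p \<in> Q" using p unfolding K_def box01(2) mem_box_cart forall_2 vector_2 mem_Collect_eq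
        by (intro conjI) (elim conjE, erule (1) order.strict_trans1 | blast)+
    qed
    then have "F ` Q = (\<Union>n. F ` K n)" by blast
    moreover have "F ` K n \<in> sets borel" for n
      by (rule borel_compact[OF compact_continuous_image[OF Fc]]) (simp add: K_def compact_cbox)
    ultimately show ?thesis by auto
  qed
  have Dm: "D \<in> sets borel" unfolding D_def by (rule meas)
  have c\<Gamma>: "countable \<Gamma>"
  proof -
    have "\<Gamma> \<subseteq> (\<lambda>(k, l). pt (pi * of_int k) (pi * of_int l)) ` (UNIV :: (int \<times> int) set)"
      unfolding \<Gamma>_def lat_def by auto
    then show ?thesis by (rule countable_subset) auto
  qed
  have nn: "(\<integral>\<^sup>+z. ennreal (d z) * indicator (F ` Q) z \<partial>lborel) = (\<integral>\<^sup>+z. ennreal (d z) * indicator D z \<partial>lborel)"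
  proof (rule nn_integral_fundamental_domain[OF c\<Gamma> _ Fm Dm _ _ uniqF uniqD])
    show "- c \<in> \<Gamma>" if cG: "c \<in> \<Gamma>" for c
    proof -
      obtain a b where "c = pt a b" "lat tw a b" using cG by (auto simp: \<Gamma>_def)
      moreover have "- pt a b = pt (- a) (- b)" by (simp add: vec_eq_iff forall_2)
      ultimately show ?thesis using lat_minus[of tw a b] unfolding \<Gamma>_def
        by (intro CollectI exI[of _ "- a"] exI[of _ "- b"]) simp
    qed
    show "(\<lambda>z. ennreal (d z)) \<in> borel_measurable borel"
      using borel_measurable_continuous_onI[OF dc] by simp
    fix c z assume "c \<in> \<Gamma>"
    then obtain a b where "c = pt a b" "lat tw a b" by (auto simp: \<Gamma>_def)
    then obtain k :: int where "c $ 1 = of_int k * pi" unfolding lat_def by (auto simp: mult.commute)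
    then have e: "(c + z) $ 1 = z $ 1 + of_int k * pi" by simp
    show "ennreal (d (c + z)) = ennreal (d z)"
      unfolding d_def e using int_step_invariant[where f = w, OF w_periodic] int_step_invariant[where f = \<rho>, OF \<rho>_periodic] by simp
  qed
  have wr: "continuous_on S (\<lambda>x. w x * \<rho> x)" for S by (intro continuous_intros w_cont \<rho>_cont)
  have Dint: "(d has_integral 2 * pi * integral {0..T} (\<lambda>x. w x * \<rho> x)) (cbox (pt 0 0) (pt T (2 * pi)))"
    unfolding d_def by (rule has_integral_pt[OF wr]) (use T in auto)
  have D2: "integral D d = 2 * pi * integral {0..T} (\<lambda>x. w x * \<rho> x)" "d integrable_on D"
  proof -
    show "integral D d = 2 * pi * integral {0..T} (\<lambda>x. w x * \<rho> x)"
      using integral_unique[OF Dint] spike(1)[of T "2 * pi" d] by (simp add: D_def)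
    show "d integrable_on D" unfolding D_def by (rule spike(2)) (use Dint in \<open>auto simp: integrable_on_def\<close>)
  qed
  have "ennreal (integral (F ` Q) d) = ennreal (integral D d)"
    using nn unfolding nn_integral_indicator_integral[OF Fm borel_measurable_continuous_onI[OF dc] dpos area2(2)]
      nn_integral_indicator_integral[OF Dm borel_measurable_continuous_onI[OF dc] dpos D2(2)] .
  moreover have "0 \<le> integral (F ` Q) d" "0 \<le> integral D d" using dpos area2(2) D2(2) by (simp_all add: integral_nonneg)
  ultimately have "area g = 2 * pi * integral {0..T} (\<lambda>x. w x * \<rho> x)" using area2(1) D2(1) by simp
  moreover note integral_symmetric[OF wr, unfolded w_periodic \<rho>_periodic w_even \<rho>_even, OF refl refl]
  ultimately show ?thesis by (simp add: T_def)
qed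

end

section \<open>Lifting embeddings along the parametrisation\<close>

text \<open>A continuous argument exists since the plane is contractible. It is smooth because near
  \<open>p\<close> it differs from its value at \<open>p\<close> by the arctangent of a quotient of
  smooth functions.\<close>

lemma smooth_polar:
  fixes u v :: "real^2 \<Rightarrow> real"
  assumes u: "smooth u" and v: "smooth v" and nz: "\<And>p. u p \<noteq> 0 \<or> v p \<noteq> 0"
  obtains \<theta> r where "smooth \<theta>" "\<And>p. r p > 0" "\<And>p. u p = r p * cos (\<theta> p)" "\<And>p. v p = r p * sin (\<theta> p)"
proof -
  have uc: "continuous_on UNIV u" and vc: "continuous_on UNIV v" using smooth_continuous_on u v by blast+
  have fc: "continuous_on UNIV (\<lambda>p. Complex (u p) (v p))" unfolding Complex_eq by (intro continuous_intros uc vc)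
  have fn: "Complex (u p) (v p) \<noteq> 0" for p using nz[of p] by (simp add: complex_eq_iff)
  have contr: "contractible (UNIV :: (real^2) set)" by (simp add: convex_imp_contractible)
  obtain h where h: "continuous_on UNIV h" "\<And>p. p \<in> UNIV \<Longrightarrow> Complex (u p) (v p) = exp (h p)"
    by (rule continuous_logarithm_on_contractible[OF fc contr fn], rule that)
  define \<theta> where "\<theta> p = Im (h p)" for p
  define r where "r p = exp (Re (h p))" for p
  have r: "r p > 0" for p by (simp add: r_def)
  have ur: "u p = r p * cos (\<theta> p)" and vr: "v p = r p * sin (\<theta> p)" for p
    using h(2)[of p] by (simp_all add: complex_eq_iff Re_exp Im_exp r_def \<theta>_def)
  have \<theta>c: "isCont \<theta> p" for p
    using h(1) unfolding \<theta>_def by (simp add: continuous_on_eq_continuous_at continuous_Im)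
  define N where "N q = (u q)\<^sup>2 + (v q)\<^sup>2" for q
  have Nn: "N q \<noteq> 0" for q using nz[of q] by (simp add: N_def sum_power2_eq_zero_iff)
  have d: "(\<theta> has_derivative (\<lambda>h. (frechet_derivative v (at p) h * u p - frechet_derivative u (at p) h * v p) / N p)) (at p)" for p
  proof -
    \<comment> \<open>\<open>A\<close> and \<open>B\<close> are the imaginary and the real part of
      \<open>u + i v\<close> at \<open>q\<close> times the conjugate of its value at
      \<open>p\<close>.\<close>
    define A where "A q = v q * u p - u q * v p" for q
    define B where "B q = u q * u p + v q * v p" for q
    have AB: "A q = r q * r p * sin (\<theta> q - \<theta> p)" "B q = r q * r p * cos (\<theta> q - \<theta> p)" for q
      unfolding A_def B_def ur vr sin_diff cos_diff by (simp_all add: algebra_simps)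
    have A0: "A p = 0" and B0: "B p = N p" by (simp_all add: A_def B_def N_def power2_eq_square)
    have "((\<lambda>q. \<theta> q) \<longlongrightarrow> \<theta> p) (nhds p)" using \<theta>c[of p] by (simp add: isCont_def tendsto_nhds_iff)
    then have "\<forall>\<^sub>F q in nhds p. dist (\<theta> q) (\<theta> p) < pi/2" by (rule tendstoD) simp
    then have loc: "\<forall>\<^sub>F q in nhds p. \<theta> p + arctan (A q / B q) = \<theta> q"
    proof (rule eventually_mono)
      fix q assume "dist (\<theta> q) (\<theta> p) < pi/2"
      then have b: "- (pi/2) < \<theta> q - \<theta> p" "\<theta> q - \<theta> p < pi/2" unfolding dist_real_def by linarith+
      have "A q / B q = tan (\<theta> q - \<theta> p)" unfolding AB tan_def using r[of p] r[of q] by simp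
      then show "\<theta> p + arctan (A q / B q) = \<theta> q" using arctan_tan[OF b] by simp
    qed
    note ud = smooth_has_derivative[OF u, of p] and vd = smooth_has_derivative[OF v, of p]
    have Ad: "(A has_derivative (\<lambda>h. frechet_derivative v (at p) h * u p - frechet_derivative u (at p) h * v p)) (at p)"
      unfolding A_def by (intro has_derivative_diff has_derivative_mult_left ud vd)
    have Bd: "(B has_derivative (\<lambda>h. frechet_derivative u (at p) h * u p + frechet_derivative v (at p) h * v p)) (at p)"
      unfolding B_def by (intro has_derivative_add has_derivative_mult_left ud vd)
    have q: "((\<lambda>q. A q / B q) has_derivative (\<lambda>h. (frechet_derivative v (at p) h * u p - frechet_derivative u (at p) h * v p) / N p)) (at p)"
      by (rule has_derivative_eq_rhs[OF has_derivative_divide'[OF Ad Bd]]) (use Nn[of p] A0 B0 in \<open>auto simp: fun_eq_iff field_simps\<close>)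
    have "(arctan has_derivative (\<lambda>t. t)) (at (A p / B p))"
    proof -
      have "(*) (1 :: real) = (\<lambda>t. t)" by auto
      then show ?thesis using DERIV_arctan[of 0] by (simp add: A0 has_field_derivative_def)
    qed
    note at = has_derivative_compose[OF q this]
    have "((\<lambda>q. \<theta> p + arctan (A q / B q)) has_derivative (\<lambda>h. (frechet_derivative v (at p) h * u p - frechet_derivative u (at p) h * v p) / N p)) (at p)"
      using has_derivative_add[OF has_derivative_const[of "\<theta> p"] at] by simp
    then show ?thesis by (rule has_derivative_transform_eventually) (use loc eventually_nhds_x_imp_x[OF loc] in \<open>auto simp: eventually_at_filter elim: eventually_mono\<close>)
  qed
  have p: "partial i \<theta> = (\<lambda>p. (partial i v p * u p - partial i u p * v p) / N p)" for i
    using partial_eq[OF d] by (simp add: partial_def)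
  have "smooth N" unfolding N_def power2_eq_square by (intro smooth_add smooth_mult u v)
  then have "smooth (partial i \<theta>)" for i
    unfolding p by (intro smooth_divide smooth_diff smooth_mult smooth_partial u v Nn)
  moreover have "\<theta> differentiable (at p)" for p using d by (rule differentiableI)
  ultimately have "smooth \<theta>" using smooth_iff by blast
  then show ?thesis using that r ur vr by blast
qed

lemma cis_eq_1_power: "cis t = 1 \<Longrightarrow> cis (real k * t) = 1"
  using Complex.DeMoivre[of t k] by simp

text \<open>The third coordinate never vanishes, so its argument gives \<open>(m + n) y\<close>
  smoothly. The moduli of the first two give \<open>cos (2 x)\<close>, and their product, with the
  phase \<open>(m + n) y\<close> removed, gives \<open>sin (2 x)\<close>. This determines
  \<open>x\<close> modulo \<open>pi\<close> and \<open>y\<close> modulo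
  \<open>2 pi / (m + n)\<close>; the remaining ambiguity is a root of unity \<open>\<omega>\<close>,
  which is continuous and hence constant.\<close>

lemma phi_lift:
  assumes mn: "m > 0" "n > 0" and \<psi>: "smooth \<psi>" and range: "\<And>p. \<exists>x y. \<psi> p = phi m n x y"
  obtains X Y where "smooth X" "smooth Y" "\<And>p. \<psi> p = phi m n (X p) (Y p)"
proof -
  define N where "N = real (m + n)"
  have N: "N > 0" using mn by (simp add: N_def)
  note A = amplitude_pos[OF mn]
  have An: "A1 m n \<noteq> 0" "A2 m n \<noteq> 0" using A by auto
  define Z where "Z k p = \<psi> p $ k" for k :: 3 and p
  have Zs: "smooth (\<lambda>p. Re (Z k p))" "smooth (\<lambda>p. Im (Z k p))" for k
  proof -
    have "(\<lambda>p. Re (Z k p)) = (\<lambda>p. \<psi> p \<bullet> axis k 1)" "(\<lambda>p. Im (Z k p)) = (\<lambda>p. \<psi> p \<bullet> axis k \<i>)"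
      by (auto simp: inner_axis inner_complex_def Z_def)
    then show "smooth (\<lambda>p. Re (Z k p))" "smooth (\<lambda>p. Im (Z k p))" using smooth_component[OF \<psi>] by simp_all
  qed
  have "\<exists>x0 y0. \<forall>p. \<psi> p = phi m n (x0 p) (y0 p)" using range by metis
  then obtain x0 y0 where xy: "\<And>p. \<psi> p = phi m n (x0 p) (y0 p)" by blast
  have Z: "Z 1 p = of_real (A1 m n * sin (x0 p)) * cis (real m * y0 p)"
    "Z 2 p = of_real (A2 m n * cos (x0 p)) * cis (real n * y0 p)"
    "Z 3 p = of_real (R3 m n (x0 p)) * cis (- (N * y0 p))" for p
    unfolding Z_def xy phi_nth N_def by simp_all
  have R3n: "R3 m n x > 0" for x by (rule A(3))
  have nz3: "Re (Z 3 p) \<noteq> 0 \<or> Im (Z 3 p) \<noteq> 0" for p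
  proof -
    have "Z 3 p \<noteq> 0" unfolding Z(3) using R3n[of "x0 p"] by (simp add: cis_neq_zero)
    then show ?thesis by (simp add: complex_eq_iff)
  qed
  obtain \<theta> r where \<theta>: "smooth \<theta>" "\<And>p. r p > 0" "\<And>p. Re (Z 3 p) = r p * cos (\<theta> p)" "\<And>p. Im (Z 3 p) = r p * sin (\<theta> p)"
    by (rule smooth_polar[OF Zs nz3], rule that)
  define Y where "Y p = - (1 / N) * \<theta> p" for p
  have Ys: "smooth Y" unfolding Y_def by (intro smooth_mult smooth_const \<theta>(1))
  define \<delta> where "\<delta> p = y0 p - Y p" for p
  have \<delta>1: "cis (N * \<delta> p) = 1" for p
  proof -
    have e: "of_real (R3 m n (x0 p)) * cis (- (N * y0 p)) = of_real (r p) * cis (\<theta> p)"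
      using \<theta>(3,4)[of p] Z(3)[of p] by (simp add: complex_eq_iff)
    then have "norm (of_real (R3 m n (x0 p)) * cis (- (N * y0 p))) = norm (of_real (r p) * cis (\<theta> p))" by simp
    then have "R3 m n (x0 p) = r p" using R3n[of "x0 p"] \<theta>(2)[of p] by (simp add: norm_mult)
    then have "cis (- (N * y0 p)) = cis (\<theta> p)" using e \<theta>(2)[of p] by simp
    then have "cis (- (N * y0 p)) * cis (N * y0 p) = cis (\<theta> p) * cis (N * y0 p)" by simp
    moreover have "N * \<delta> p = \<theta> p + N * y0 p" using N by (simp add: \<delta>_def Y_def algebra_simps)
    ultimately show ?thesis by (simp add: cis_mult)
  qed
  have y0: "y0 p = Y p + \<delta> p" for p by (simp add: \<delta>_def)
  define u where "u p = ((Re (Z 2 p))\<^sup>2 + (Im (Z 2 p))\<^sup>2) / (A2 m n)\<^sup>2 - ((Re (Z 1 p))\<^sup>2 + (Im (Z 1 p))\<^sup>2) / (A1 m n)\<^sup>2" for p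
  define v where "v p = 2 / (A1 m n * A2 m n) * ((Re (Z 1 p) * Re (Z 2 p) - Im (Z 1 p) * Im (Z 2 p)) * cos (N * Y p)
     + (Re (Z 1 p) * Im (Z 2 p) + Im (Z 1 p) * Re (Z 2 p)) * sin (N * Y p))" for p
  have us: "smooth u" unfolding u_def power2_eq_square divide_inverse
    by (intro smooth_diff smooth_mult smooth_add Zs smooth_const)
  have vs: "smooth v" unfolding v_def
    by (intro smooth_diff smooth_mult smooth_add Zs smooth_const smooth_cos smooth_sin Ys)
  have sq: "(Re (of_real a * cis t))\<^sup>2 + (Im (of_real a * cis t))\<^sup>2 = a\<^sup>2" for a t
    by (simp add: power_mult_distrib distrib_left[symmetric] flip: distrib_left)
  have u: "u p = cos (2 * x0 p)" for p
    unfolding u_def Z sq cos_double using An by (simp add: power_mult_distrib)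
  have v: "v p = sin (2 * x0 p)" for p
  proof -
    have "v p = 2 / (A1 m n * A2 m n) * Re (Z 1 p * Z 2 p * cis (- (N * Y p)))" by (simp add: v_def algebra_simps)
    also have "Z 1 p * Z 2 p * cis (- (N * Y p)) = of_real (A1 m n * A2 m n * (sin (x0 p) * cos (x0 p))) * (cis (real m * y0 p) * cis (real n * y0 p) * cis (- (N * Y p)))"
      unfolding Z by (simp add: mult_ac)
    also have "cis (real m * y0 p) * cis (real n * y0 p) * cis (- (N * Y p)) = cis (N * \<delta> p)"
      by (simp add: cis_mult N_def \<delta>_def algebra_simps)
    finally show ?thesis unfolding \<delta>1 using An by (simp add: sin_double)
  qed
  have nzuv: "u p \<noteq> 0 \<or> v p \<noteq> 0" for p
    unfolding u v using sin_zero_abs_cos_one[of "2 * x0 p"] by auto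
  obtain \<eta> s where \<eta>: "smooth \<eta>" "\<And>p. s p > 0" "\<And>p. u p = s p * cos (\<eta> p)" "\<And>p. v p = s p * sin (\<eta> p)"
    by (rule smooth_polar[OF us vs nzuv], rule that)
  define X where "X p = (1 / 2) * \<eta> p" for p
  have Xs: "smooth X" unfolding X_def by (intro smooth_mult smooth_const \<eta>(1))
  have "\<exists>k :: int. X p = x0 p + pi * of_int k" for p
  proof -
    have "(u p)\<^sup>2 + (v p)\<^sup>2 = (s p)\<^sup>2" unfolding \<eta>(3,4) by (simp add: power_mult_distrib flip: distrib_left)
    then have "(s p)\<^sup>2 = 1" unfolding u v by simp
    then have "s p = 1" using \<eta>(2)[of p] by (simp add: power2_eq_1_iff)
    then have "cos (\<eta> p) = cos (2 * x0 p)" "sin (\<eta> p) = sin (2 * x0 p)" using \<eta>(3,4)[of p] u v by auto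
    then obtain k :: int where "\<eta> p = 2 * x0 p + 2 * pi * of_int k" using sin_cos_eq_iff[of "\<eta> p" "2 * x0 p"] by auto
    then show ?thesis by (intro exI[of _ k]) (simp add: X_def)
  qed
  then obtain k :: "real^2 \<Rightarrow> int" where k: "\<And>p. X p = x0 p + pi * of_int (k p)" by metis
  define \<epsilon> where "\<epsilon> p = (if even (k p) then 1 else - 1 :: real)" for p
  have \<epsilon>: "\<epsilon> p * \<epsilon> p = 1" for p by (simp add: \<epsilon>_def)
  have sc: "sin (X p) = \<epsilon> p * sin (x0 p)" "cos (X p) = \<epsilon> p * cos (x0 p)" for p
    by (simp_all add: k sin_add cos_add cos_int_pi_cases sin_int_pi \<epsilon>_def)
  \<comment> \<open>The discrepancy between \<open>\<psi> p\<close> and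
    \<open>phi m n (X p) (Y p)\<close>: it multiplies the first coordinate and, conjugated, the
    second, because \<open>cis (N * \<delta> p) = 1\<close>.\<close>
  define \<omega> where "\<omega> p = of_real (\<epsilon> p) * cis (real m * \<delta> p)" for p
  have n\<delta>: "cis (real n * \<delta> p) = cnj (cis (real m * \<delta> p))" for p
  proof -
    have "cis (real m * \<delta> p) * cis (real n * \<delta> p) = 1" using \<delta>1[of p] by (simp add: cis_mult N_def algebra_simps)
    then have "cnj (cis (real m * \<delta> p)) * (cis (real m * \<delta> p) * cis (real n * \<delta> p)) = cnj (cis (real m * \<delta> p))" by simp
    then show ?thesis by (simp add: mult.assoc[symmetric] cis_cnj cis_mult)
  qed
  have Z\<omega>: "Z 1 p = of_real (A1 m n * sin (X p)) * \<omega> p * cis (real m * Y p)"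
    "Z 2 p = of_real (A2 m n * cos (X p)) * cnj (\<omega> p) * cis (real n * Y p)" for p
  proof -
    have m1: "cis (real m * y0 p) = cis (real m * \<delta> p) * cis (real m * Y p)" "cis (real n * y0 p) = cis (real n * \<delta> p) * cis (real n * Y p)"
      unfolding y0 by (simp_all add: cis_mult algebra_simps)
    show "Z 1 p = of_real (A1 m n * sin (X p)) * \<omega> p * cis (real m * Y p)"
      unfolding Z m1 sc \<omega>_def by (cases "even (k p)") (simp_all add: \<epsilon>_def mult_ac)
    show "Z 2 p = of_real (A2 m n * cos (X p)) * cnj (\<omega> p) * cis (real n * Y p)"
      unfolding Z m1 sc \<omega>_def n\<delta> by (cases "even (k p)") (simp_all add: \<epsilon>_def mult_ac)
  qed
  \<comment> \<open>Either coordinate may vanish; the weights \<open>sin^2\<close> and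
    \<open>cos^2\<close> combine both into a formula for \<open>\<omega>\<close> that is continuous
    everywhere.\<close>
  have \<omega>_eq: "\<omega> p = Z 1 p * cis (- (real m * Y p)) * of_real (sin (X p) / A1 m n) + cnj (Z 2 p * cis (- (real n * Y p))) * of_real (cos (X p) / A2 m n)" for p
  proof -
    have 1: "Z 1 p * cis (- (real m * Y p)) = of_real (A1 m n * sin (X p)) * \<omega> p"
      unfolding Z\<omega> by (simp add: mult.assoc cis_mult)
    have 2: "Z 2 p * cis (- (real n * Y p)) = of_real (A2 m n * cos (X p)) * cnj (\<omega> p)"
      unfolding Z\<omega> by (simp add: mult.assoc cis_mult)
    have r: "A1 m n * sin (X p) * (sin (X p) / A1 m n) = (sin (X p))\<^sup>2" "A2 m n * cos (X p) * (cos (X p) / A2 m n) = (cos (X p))\<^sup>2"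
      using An by (simp_all add: power2_eq_square)
    have "of_real (A1 m n * sin (X p)) * \<omega> p * of_real (sin (X p) / A1 m n) = of_real (A1 m n * sin (X p) * (sin (X p) / A1 m n)) * \<omega> p"
      "of_real (A2 m n * cos (X p)) * \<omega> p * of_real (cos (X p) / A2 m n) = of_real (A2 m n * cos (X p) * (cos (X p) / A2 m n)) * \<omega> p"
      by (simp_all only: of_real_mult mult_ac)
    then have "of_real (A1 m n * sin (X p)) * \<omega> p * of_real (sin (X p) / A1 m n) + of_real (A2 m n * cos (X p)) * \<omega> p * of_real (cos (X p) / A2 m n)
        = (of_real ((sin (X p))\<^sup>2) + of_real ((cos (X p))\<^sup>2)) * \<omega> p"
      unfolding r by (simp only: distrib_right)
    also have "\<dots> = \<omega> p" by (simp only: of_real_add[symmetric] sin_cos_squared_add of_real_1 mult_1)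
    finally show ?thesis unfolding 1 2 by simp
  qed
  have Zc: "continuous_on UNIV (\<lambda>p. Z j p)" for j
  proof -
    have "continuous_on UNIV (\<lambda>p. Complex (Re (Z j p)) (Im (Z j p)))"
      unfolding Complex_eq by (intro continuous_intros smooth_continuous_on Zs)
    then show ?thesis by simp
  qed
  have "\<omega> = (\<lambda>p. Z 1 p * cis (- (real m * Y p)) * of_real (sin (X p) / A1 m n) + cnj (Z 2 p * cis (- (real n * Y p))) * of_real (cos (X p) / A2 m n))"
    by (rule ext, rule \<omega>_eq)
  moreover note Xc = smooth_continuous_on[OF Xs, of UNIV] and Yc = smooth_continuous_on[OF Ys, of UNIV]
  have "continuous_on UNIV (\<lambda>p. Z 1 p * cis (- (real m * Y p)) * of_real (sin (X p) / A1 m n) + cnj (Z 2 p * cis (- (real n * Y p))) * of_real (cos (X p) / A2 m n))"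
    unfolding cis_conv_exp by (intro continuous_intros Zc Xc Yc) (use An in auto)
  ultimately have \<omega>c: "continuous_on UNIV \<omega>" by simp
  have pow: "\<omega> p ^ (2 * (m + n)) = 1" for p
  proof -
    have w2: "\<omega> p ^ 2 = cis (real m * \<delta> p) ^ 2"
      by (cases "even (k p)") (simp_all add: \<omega>_def \<epsilon>_def)
    have "\<omega> p ^ (2 * (m + n)) = (\<omega> p ^ 2) ^ (m + n)" by (rule power_mult)
    also have "\<dots> = (cis (real m * \<delta> p) ^ (m + n)) ^ 2" unfolding w2 by (simp only: power_mult[symmetric] mult.commute)
    finally have "\<omega> p ^ (2 * (m + n)) = (cis (real m * \<delta> p) ^ (m + n)) ^ 2" .
    moreover have "cis (real m * \<delta> p) ^ (m + n) = 1"
      using cis_eq_1_power[OF \<delta>1[of p], of m] by (simp add: Complex.DeMoivre N_def mult_ac)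
    ultimately show ?thesis by simp
  qed
  have "finite {z :: complex. z ^ (2 * (m + n)) = 1}"
    using mn by (intro finite_roots_unity) auto
  then have fin: "finite (range \<omega>)" by (rule finite_subset[rotated]) (use pow in auto)
  have "\<omega> constant_on UNIV"
    using continuous_finite_range_constant[OF connected_UNIV \<omega>c fin] .
  then have \<omega>0: "\<omega> p = \<omega> 0" for p unfolding constant_on_def by (metis UNIV_I)
  \<comment> \<open>Shifting by the constants found at the base point 0 removes
    \<open>\<omega>\<close> and makes the lift exact.\<close>
  define X' where "X' p = X p + - (pi * of_int (k 0))" for p
  define Y' where "Y' p = Y p + \<delta> 0" for p
  have s': "smooth X'" "smooth Y'" unfolding X'_def Y'_def by (intro smooth_add Xs Ys smooth_const)+
  have sc': "sin (X' p) = \<epsilon> 0 * sin (X p)" "cos (X' p) = \<epsilon> 0 * cos (X p)" for p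
    by (simp_all add: X'_def sin_diff cos_diff cos_int_pi_cases sin_int_pi \<epsilon>_def)
  have "(cos (X' p))\<^sup>2 = (cos (x0 p))\<^sup>2" "(sin (X' p))\<^sup>2 = (sin (x0 p))\<^sup>2" for p
    unfolding sc' sc by (simp_all add: power_mult_distrib \<epsilon>_def)
  then have R': "R3 m n (X' p) = R3 m n (x0 p)" for p by (simp add: R3_def)
  have "\<psi> p = phi m n (X' p) (Y' p)" for p
  proof -
    have e1: "cis (real m * Y' p) = cis (real m * \<delta> 0) * cis (real m * Y p)" "cis (real n * Y' p) = cis (real n * \<delta> 0) * cis (real n * Y p)"
      unfolding Y'_def by (simp_all add: cis_mult algebra_simps)
    note Z0 = Z\<omega>[of p, unfolded \<omega>0[of p]]
    have "phi m n (X' p) (Y' p) $ 1 = Z 1 p"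
      unfolding phi_nth Z0 e1 sc' \<omega>_def by (simp add: mult_ac)
    moreover have "phi m n (X' p) (Y' p) $ 2 = Z 2 p"
      unfolding phi_nth Z0 e1 sc' \<omega>_def n\<delta> by (simp add: mult_ac)
    moreover have "phi m n (X' p) (Y' p) $ 3 = Z 3 p"
    proof -
      have "cis (- (N * Y' p)) = cis (- (N * y0 p)) * cis (N * \<delta> p) * cnj (cis (N * \<delta> 0))"
        by (simp add: cis_cnj cis_mult Y'_def \<delta>_def algebra_simps)
      then show ?thesis unfolding phi_nth Z R' N_def[symmetric] \<delta>1 by simp
    qed
    ultimately show ?thesis by (simp add: vec_eq_iff forall_3 Z_def)
  qed
  then show ?thesis using that s' by blast
qed

section \<open>Counting eigenvalues below 2\<close>

context sturm
begin

section \<open>Angles from explicit positive solutions\<close>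

lemma solution_base:
  assumes k: "bcont k" and s: "solution k a b" and 0: "a 0 = (if nu then c else 0)" "b 0 = (if nu then 0 else c)"
  shows "a x = c * (amp nu k x * sin (theta nu k x))" "b x = c * (amp nu k x * cos (theta nu k x))"
proof -
  note l = solution_lincomb[OF amp(3)[OF k] amp(3)[OF k], of c nu 0 nu]
  have e: "a 0 = c * base nu k 0 + 0 * base nu k 0" "b 0 = c * base' nu k 0 + 0 * base' nu k 0"
    using 0 unfolding base_0[OF k] by auto
  show "a x = c * (amp nu k x * sin (theta nu k x))" "b x = c * (amp nu k x * cos (theta nu k x))"
    using solution_eq_at[OF k s l e, of x] by (simp_all add: base_def base'_def)
qed

text \<open>When the angle passes \<open>pi\<close> the solution vanishes, so positivity on the open
  interval keeps the end angle at most \<open>pi\<close>. A known boundary condition then pins the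
  angle down, as the next two lemmas do.\<close>

lemma ang_le_pi:
  assumes k: "bcont k" and s: "solution k a b" and 0: "a 0 = (if nu then c else 0)" "b 0 = (if nu then 0 else c)"
    and pos: "\<And>x. 0 < x \<Longrightarrow> x < pi/2 \<Longrightarrow> 0 < a x"
  shows "ang nu k \<le> pi"
proof (rule ccontr)
  assume "\<not> ang nu k \<le> pi"
  then have gt: "pi < theta nu k (pi/2)" by (simp add: ang_def)
  have c: "continuous_on {0..pi/2} (theta nu k)"
    using theta(1)[OF k] unfolding prufer_def by (meson DERIV_isCont continuous_at_imp_continuous_on)
  have "theta nu k 0 \<le> pi" using theta(2)[OF k, of nu] by simp
  then obtain x where x: "0 \<le> x" "x \<le> pi/2" "theta nu k x = pi"
    using IVT'[of "theta nu k" 0 pi "pi/2"] gt c by auto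
  have "theta nu k 0 < pi" unfolding theta(2)[OF k] by (cases nu) simp_all
  then have "x \<noteq> 0" using x(3) by auto
  moreover have "x \<noteq> pi/2"
  proof
    assume "x = pi/2"
    then have "theta nu k (pi/2) = pi" using x(3) by (simp only:)
    then show False using gt by linarith
  qed
  ultimately have "0 < a x" using pos x by simp
  then show False using solution_base(1)[OF k s 0, of x] x(3) by simp
qed

lemma ang_eq_half_pi:
  assumes k: "bcont k" and s: "solution k a b" and 0: "a 0 = (if nu then c else 0)" "b 0 = (if nu then 0 else c)"
    and pos: "\<And>x. 0 < x \<Longrightarrow> x < pi/2 \<Longrightarrow> 0 < a x" and c: "c > 0" and e: "b (pi/2) = 0"
  shows "ang nu k = pi/2"
proof -
  have "cos (ang nu k) = 0"
    using solution_base(2)[OF k s 0, of "pi/2"] e c amp(1)[OF k, of nu "pi/2"] by (simp add: ang_def)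
  then have "cos (ang nu k) = cos (pi/2)" by simp
  then show ?thesis using cos_inj_pi[of "ang nu k" "pi/2"] ang_pos[OF k, of nu] ang_le_pi[OF k s 0 pos] by simp
qed

lemma ang_eq_pi:
  assumes k: "bcont k" and s: "solution k a b" and 0: "a 0 = (if nu then c else 0)" "b 0 = (if nu then 0 else c)"
    and pos: "\<And>x. 0 < x \<Longrightarrow> x < pi/2 \<Longrightarrow> 0 < a x" and c: "c > 0" and e: "a (pi/2) = 0"
  shows "ang nu k = pi"
proof -
  have "sin (ang nu k) = 0"
    using solution_base(1)[OF k s 0, of "pi/2"] e c amp(1)[OF k, of nu "pi/2"] by (simp add: ang_def)
  then show ?thesis using sin_gt_zero[of "ang nu k"] ang_pos[OF k, of nu] ang_le_pi[OF k s 0 pos] by force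
qed

end

section \<open>Explicit solutions for the surfaces\<close>

definition qM :: "nat \<Rightarrow> nat \<Rightarrow> real \<Rightarrow> real" where
  "qM m n x = 2 * real m * real n + (real n)\<^sup>2 * (cos x)\<^sup>2 + (real m)\<^sup>2 * (sin x)\<^sup>2"
definition wM :: "nat \<Rightarrow> nat \<Rightarrow> real \<Rightarrow> real" where "wM m n x = inverse (sqrt (qM m n x))"
definition rM :: "nat \<Rightarrow> nat \<Rightarrow> real \<Rightarrow> real" where "rM m n x = qM m n x - real m * real n"

locale clifford =
  fixes m n :: nat
  assumes m_pos: "m > 0" and n_pos: "n > 0"
begin

abbreviation (input) "q \<equiv> qM m n"

lemma q_ge: "2 * (real m * real n) \<le> q x"
  unfolding qM_def by simp

lemma mn_pos: "real m * real n > 0"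
  using m_pos n_pos by simp

lemma q_pos: "q x > 0"
  using q_ge[of x] mn_pos by linarith

lemma q_alt: "q x = (2 * real m * real n + (real n)\<^sup>2) + ((real m)\<^sup>2 - (real n)\<^sup>2) * (sin x)\<^sup>2"
  "q x = (2 * real m * real n + (real m)\<^sup>2) - ((real m)\<^sup>2 - (real n)\<^sup>2) * (cos x)\<^sup>2"
  by (simp add: qM_def cos_squared_eq algebra_simps, simp add: qM_def sin_squared_eq algebra_simps)

lemma elementary_q: "elementary (\<lambda>p. q (p $ 1))"
proof -
  have "elementary (\<lambda>p. 2 * real m * real n + (real n)\<^sup>2 * (cos (p $ 1) * cos (p $ 1)) + (real m)\<^sup>2 * (sin (p $ 1) * sin (p $ 1)))"
    by (intro el_add el_mult el_const el_sin el_cos el_coord)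
  then show ?thesis unfolding qM_def power2_eq_square .
qed

lemma sturm: "sturm (wM m n) (rM m n)"
proof
  show "elementary (\<lambda>p. wM m n (p $ 1))"
    unfolding wM_def by (rule el_inverse[OF el_sqrt[OF elementary_q q_pos]]) (use q_pos in \<open>simp add: less_imp_neq[symmetric]\<close>)
  have "elementary (\<lambda>p. q (p $ 1) + - (real m * real n))" by (intro el_add elementary_q el_const)
  then show "elementary (\<lambda>p. rM m n (p $ 1))" unfolding rM_def by simp
  show "wM m n x > 0" for x using q_pos[of x] by (simp add: wM_def)
  show "rM m n x > 0" for x using q_ge[of x] mn_pos by (simp add: rM_def)
  show "wM m n (- x) = wM m n x" "rM m n (- x) = rM m n x" "wM m n (x + pi) = wM m n x" "rM m n (x + pi) = rM m n x" for x
    by (simp_all add: wM_def rM_def qM_def)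
qed

end

sublocale clifford \<subseteq> sturm "wM m n" "rM m n"
  by (rule sturm)

context clifford
begin

lemma q_deriv: "(q has_real_derivative 2 * ((real m)\<^sup>2 - (real n)\<^sup>2) * (sin x * cos x)) (at x)"
  unfolding qM_def by (auto intro!: derivative_eq_intros simp: algebra_simps)

lemma sqrt_q_deriv: "((\<lambda>x. sqrt (q x)) has_real_derivative wM m n x * (((real m)\<^sup>2 - (real n)\<^sup>2) * (sin x * cos x))) (at x)"
proof -
  have "((\<lambda>x. sqrt (q x)) has_real_derivative (inverse (sqrt (q x)) / 2) * (2 * ((real m)\<^sup>2 - (real n)\<^sup>2) * (sin x * cos x))) (at x)"
    by (rule DERIV_chain2[OF DERIV_real_sqrt[OF q_pos] q_deriv])
  then show ?thesis by (rule DERIV_cong) (simp add: wM_def)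
qed

lemma w_sqrt: "wM m n x * sqrt (q x) = 1" "sqrt (q x) * sqrt (q x) = q x" "wM m n x * q x = sqrt (q x)"
  using q_pos[of x] by (simp_all add: wM_def field_simps)

lemma kap_eq: "kap l 2 x = 2 * q x - 2 * real m * real n - l\<^sup>2"
  by (simp add: kap_def rM_def)

text \<open>The third coordinate function: its amplitude is \<open>sqrt q\<close> up to a constant,
  its frequency \<open>m + n\<close>. The next two lemmas treat the second and the first
  coordinate.\<close>

lemma solution_r: "solution (kap (real m + real n) 2) (\<lambda>x. sqrt (q x)) (\<lambda>x. ((real m)\<^sup>2 - (real n)\<^sup>2) * (sin x * cos x))"
  unfolding solution_def
proof (intro allI conjI sqrt_q_deriv)
  fix x
  define D where "D = (real m)\<^sup>2 - (real n)\<^sup>2"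
  have 1: "((\<lambda>x. D * (sin x * cos x)) has_real_derivative D * ((cos x)\<^sup>2 - (sin x)\<^sup>2)) (at x)"
    by (auto intro!: derivative_eq_intros simp: power2_eq_square algebra_simps)
  have "2 * q x - 2 * real m * real n - (real m + real n)\<^sup>2 = D * (sin x)\<^sup>2 - D * (cos x)\<^sup>2"
  proof -
    have "2 * q x = (2 * real m * real n + (real n)\<^sup>2 + D * (sin x)\<^sup>2) + (2 * real m * real n + (real m)\<^sup>2 - D * (cos x)\<^sup>2)"
      using q_alt[of x, folded D_def] by linarith
    then show ?thesis unfolding power2_sum by linarith
  qed
  then have "- (wM m n x * kap (real m + real n) 2 x * sqrt (q x)) = - ((D * (sin x)\<^sup>2 - D * (cos x)\<^sup>2) * (wM m n x * sqrt (q x)))"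
    unfolding kap_eq by (simp only: mult_ac)
  also have "\<dots> = D * ((cos x)\<^sup>2 - (sin x)\<^sup>2)" unfolding w_sqrt by (simp add: algebra_simps)
  finally show "((\<lambda>x. ((real m)\<^sup>2 - (real n)\<^sup>2) * (sin x * cos x)) has_real_derivative - (wM m n x * kap (real m + real n) 2 x * sqrt (q x))) (at x)"
    using 1 unfolding D_def by simp
qed

lemma solution_cos: "solution (kap (real n) 2) cos (\<lambda>x. sqrt (q x) * (- sin x))"
  unfolding solution_def
proof (intro allI conjI)
  fix x
  define D where "D = (real m)\<^sup>2 - (real n)\<^sup>2"
  define W where "W = wM m n x"
  have e: "wM m n x * (sqrt (q x) * t) = t" for t using w_sqrt(1)[of x] by (simp add: mult.assoc[symmetric])
  show "(cos has_real_derivative wM m n x * (sqrt (q x) * (- sin x))) (at x)"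
    unfolding e by (rule DERIV_cos)
  have 1: "((\<lambda>x. sqrt (q x) * (- sin x)) has_real_derivative
     W * (D * (sin x * cos x)) * (- sin x) + (- cos x) * sqrt (q x)) (at x)"
    unfolding W_def D_def by (rule DERIV_mult[OF sqrt_q_deriv DERIV_minus[OF DERIV_sin]])
  have "W * (D * (sin x * cos x)) * (- sin x) + (- cos x) * sqrt (q x) = - W * cos x * (q x + D * (sin x)\<^sup>2)"
    unfolding w_sqrt(3)[of x, symmetric] W_def[symmetric] by (simp add: power2_eq_square algebra_simps)
  also have "q x + D * (sin x)\<^sup>2 = kap (real n) 2 x"
    unfolding kap_eq using q_alt(1)[of x] by (simp add: D_def)
  finally show "((\<lambda>x. sqrt (q x) * (- sin x)) has_real_derivative - (wM m n x * kap (real n) 2 x * cos x)) (at x)"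
    using 1 by (simp add: W_def mult_ac)
qed

lemma solution_sin: "solution (kap (real m) 2) sin (\<lambda>x. sqrt (q x) * cos x)"
  unfolding solution_def
proof (intro allI conjI)
  fix x
  define D where "D = (real m)\<^sup>2 - (real n)\<^sup>2"
  define W where "W = wM m n x"
  have e: "wM m n x * (sqrt (q x) * t) = t" for t using w_sqrt(1)[of x] by (simp add: mult.assoc[symmetric])
  show "(sin has_real_derivative wM m n x * (sqrt (q x) * cos x)) (at x)"
    unfolding e by (rule DERIV_sin)
  have 1: "((\<lambda>x. sqrt (q x) * cos x) has_real_derivative
     W * (D * (sin x * cos x)) * cos x + (- sin x) * sqrt (q x)) (at x)"
    unfolding W_def D_def by (rule DERIV_mult[OF sqrt_q_deriv DERIV_cos])
  have "W * (D * (sin x * cos x)) * cos x + (- sin x) * sqrt (q x) = - W * sin x * (q x - D * (cos x)\<^sup>2)"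
    unfolding w_sqrt(3)[of x, symmetric] W_def[symmetric] by (simp add: power2_eq_square algebra_simps)
  also have "q x - D * (cos x)\<^sup>2 = kap (real m) 2 x"
    unfolding kap_eq using q_alt(2)[of x] by (simp add: D_def)
  finally show "((\<lambda>x. sqrt (q x) * cos x) has_real_derivative - (wM m n x * kap (real m) 2 x * sin x)) (at x)"
    using 1 by (simp add: W_def mult_ac)
qed

text \<open>The three amplitudes are positive inside the interval, so each belongs to the lowest
  eigenvalue for its boundary conditions, and the end angle is the first one satisfying the
  condition.\<close>

lemma Ang_values:
  "Ang True (real m + real n) 2 = pi/2" "Ang True (real n) 2 = pi" "Ang False (real m) 2 = pi/2"
proof -
  show "Ang True (real m + real n) 2 = pi/2"
    by (rule ang_eq_half_pi[OF bcont_kap solution_r, where c = "sqrt (q 0)"]) (use q_pos in auto)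
  show "Ang True (real n) 2 = pi"
    by (rule ang_eq_pi[OF bcont_kap solution_cos, where c = 1]) (auto intro: cos_gt_zero)
  show "Ang False (real m) 2 = pi/2"
    by (rule ang_eq_half_pi[OF bcont_kap solution_sin, where c = "sqrt (q 0)"]) (use q_pos in \<open>auto intro: sin_gt_zero\<close>)
qed

text \<open>For \<open>l = 0\<close> and \<open>lam = 2\<close> the equation is a Lame equation with one gap: the product \<open>G\<close> of two
  solutions is explicit, and there are solutions \<open>sqrt G * sin \<zeta>\<close> with \<open>\<zeta>' = const * wM / G\<close>.\<close>

definition G :: "real \<Rightarrow> real" where "G x = (real m)\<^sup>2 * (cos x)\<^sup>2 + (real n)\<^sup>2 * (sin x)\<^sup>2"

lemma G_pos: "G x > 0"
proof (cases "cos x = 0")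
  case True
  then have "(sin x)\<^sup>2 = 1" by (simp add: sin_squared_eq)
  then show ?thesis using n_pos True by (simp add: G_def)
next
  case False
  then show ?thesis using m_pos by (simp add: G_def add_pos_nonneg)
qed

lemma G_q: "G x + q x = (real m + real n)\<^sup>2"
  by (simp add: G_def qM_def cos_squared_eq power2_sum algebra_simps)

lemma phase_exists:
  obtains \<zeta> where "\<And>x. (\<zeta> has_real_derivative wM m n x * (real m * real n * (real m + real n)) / G x) (at x)" "\<zeta> 0 = 0"
proof -
  have "continuous_on UNIV G" unfolding G_def by (intro continuous_intros)
  then have c: "continuous_on UNIV (\<lambda>x. wM m n x * (real m * real n * (real m + real n)) / G x)"
    using G_pos by (intro continuous_intros w_cont) (auto simp: less_imp_neq[symmetric])
  show ?thesis by (rule primitive_exists[OF c], rule that)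
qed

lemma solution_phase:
  assumes z: "\<And>x. (\<zeta> has_real_derivative wM m n x * (real m * real n * (real m + real n)) / G x) (at x)"
  shows "solution (kap 0 2) (\<lambda>x. sqrt (G x) * sin (\<zeta> x))
    (\<lambda>x. (- ((real m)\<^sup>2 - (real n)\<^sup>2) * (sin x * cos x) * sqrt (q x) * sin (\<zeta> x) + real m * real n * (real m + real n) * cos (\<zeta> x)) / sqrt (G x))"
  unfolding solution_def
proof (intro allI conjI)
  fix x
  define a b where "a = real m" and "b = real n"
  define D where "D = a\<^sup>2 - b\<^sup>2"
  define o' where "o' = a * b * (a + b)"
  define W where "W = wM m n x"
  define s c where "s = sin x" and "c = cos x"
  define S C where "S = sin (\<zeta> x)" and "C = cos (\<zeta> x)"
  define Q where "Q = sqrt (q x)"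
  define A where "A = sqrt (G x)"
  have A: "A > 0" "A * A = G x" using G_pos[of x] by (auto simp: A_def)
  have Q: "Q > 0" "Q * Q = q x" "W * Q = 1" using q_pos[of x] by (auto simp: Q_def W_def w_sqrt)
  have W: "W = 1 / Q" using Q by (simp add: field_simps)
  have sc: "c * c = 1 - s * s" using sin_cos_squared_add[of x] by (simp add: s_def c_def power2_eq_square algebra_simps)
  have Gd: "(G has_real_derivative - 2 * D * (s * c)) (at x)"
    unfolding G_def D_def a_def b_def s_def c_def by (auto intro!: derivative_eq_intros simp: algebra_simps)
  have sG: "((\<lambda>x. sqrt (G x)) has_real_derivative - D * (s * c) / A) (at x)"
    by (rule DERIV_cong[OF DERIV_chain2[OF DERIV_real_sqrt[OF G_pos] Gd]]) (simp add: A_def field_simps)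
  have zd: "(\<zeta> has_real_derivative W * o' / G x) (at x)"
    using z[of x] by (simp add: W_def o'_def a_def b_def)
  have S: "((\<lambda>x. sin (\<zeta> x)) has_real_derivative C * (W * o' / G x)) (at x)"
    unfolding C_def by (rule DERIV_chain2[OF DERIV_sin zd])
  have C: "((\<lambda>x. cos (\<zeta> x)) has_real_derivative - S * (W * o' / G x)) (at x)"
    unfolding S_def by (rule DERIV_chain2[OF DERIV_cos zd])
  have "((\<lambda>x. sqrt (G x) * sin (\<zeta> x)) has_real_derivative - D * (s * c) / A * S + C * (W * o' / G x) * A) (at x)"
    unfolding S_def A_def by (rule DERIV_mult[OF sG[unfolded A_def] S])
  moreover have "- D * (s * c) / A * S + C * (W * o' / G x) * A = W * ((- D * (s * c) * Q * S + o' * C) / A)"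
    unfolding W A(2)[symmetric] using A(1) Q(1) by (simp add: field_simps)
  ultimately show "((\<lambda>x. sqrt (G x) * sin (\<zeta> x)) has_real_derivative
     wM m n x * ((- ((real m)\<^sup>2 - (real n)\<^sup>2) * (sin x * cos x) * sqrt (q x) * sin (\<zeta> x) + real m * real n * (real m + real n) * cos (\<zeta> x)) / sqrt (G x))) (at x)"
    by (simp only: W_def Q_def A_def S_def C_def s_def c_def D_def o'_def a_def b_def)
  have scd: "((\<lambda>x. - D * (sin x * cos x)) has_real_derivative - D * (c * c - s * s)) (at x)"
    unfolding s_def c_def by (auto intro!: derivative_eq_intros simp: algebra_simps)
  have Qd: "((\<lambda>x. sqrt (q x)) has_real_derivative W * (D * (s * c))) (at x)"
    using sqrt_q_deriv[of x] by (simp add: W_def D_def a_def b_def s_def c_def)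
  have N: "((\<lambda>x. - D * (sin x * cos x) * sqrt (q x) * sin (\<zeta> x) + o' * cos (\<zeta> x)) has_real_derivative
      (((- D * (c * c - s * s)) * Q + W * (D * (s * c)) * (- D * (s * c))) * S + C * (W * o' / G x) * (- D * (s * c) * Q)) + o' * (- S * (W * o' / G x))) (at x)"
    unfolding Q_def S_def[symmetric] using DERIV_add[OF DERIV_mult[OF DERIV_mult[OF scd Qd] S] DERIV_cmult[OF C, of o']]
    by (simp add: S_def s_def c_def)
  have 2: "((\<lambda>x. (- D * (sin x * cos x) * sqrt (q x) * sin (\<zeta> x) + o' * cos (\<zeta> x)) / sqrt (G x)) has_real_derivative
     (((((- D * (c * c - s * s)) * Q + W * (D * (s * c)) * (- D * (s * c))) * S + C * (W * o' / G x) * (- D * (s * c) * Q)) + o' * (- S * (W * o' / G x))) * A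
      - (- D * (s * c) * Q * S + o' * C) * (- D * (s * c) / A)) / (A * A)) (at x)"
    using DERIV_divide[OF N sG] A(1) by (simp add: A_def Q_def S_def C_def s_def c_def)
  \<comment> \<open>With derivatives taken along \<open>dt = w dx\<close>, this is
    \<open>G G''/2 - G'^2/4 + k G^2 = o'^2\<close>, the first integral for a product of two
    solutions. It fixes the constant \<open>o' = m n (m + n)\<close> of the phase equation.\<close>
  have poly: "- D * (q x * (c * c - s * s) + D * (s * c) * (s * c)) * G x - o' * o' - q x * (D * (s * c)) * (D * (s * c)) = - (2 * q x - 2 * a * b) * (G x * G x)"
  proof -
    have cc: "(s * c) * (s * c) = s * s * (1 - s * s)" by (simp add: mult_ac flip: sc)
    have q: "q x = 2 * a * b + b * b + D * (s * s)" unfolding q_alt(1) by (simp add: a_def b_def D_def s_def power2_eq_square)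
    have G: "G x = a * a - D * (s * s)" unfolding G_def cos_squared_eq by (simp add: a_def b_def D_def s_def power2_eq_square algebra_simps)
    have e: "- D * (q x * (c * c - s * s) + D * (s * c) * (s * c)) * G x - o' * o' - q x * (D * (s * c)) * (D * (s * c))
       = - D * (q x * (c * c - s * s) + D * ((s * c) * (s * c))) * G x - o' * o' - q x * (D * D * ((s * c) * (s * c)))"
      by (simp add: algebra_simps)
    show ?thesis unfolding e unfolding cc unfolding sc q G D_def o'_def power2_eq_square by algebra
  qed
  have "(((((- D * (c * c - s * s)) * Q + W * (D * (s * c)) * (- D * (s * c))) * S + C * (W * o' / G x) * (- D * (s * c) * Q)) + o' * (- S * (W * o' / G x))) * A
      - (- D * (s * c) * Q * S + o' * C) * (- D * (s * c) / A)) / (A * A)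
     = S / (Q * A * (G x)) * (- D * (Q * Q * (c * c - s * s) + D * (s * c) * (s * c)) * G x - o' * o' - Q * Q * (D * (s * c)) * (D * (s * c)))"
    unfolding W A(2)[symmetric] using A(1) Q(1) by (simp add: field_simps)
  also have "\<dots> = S / (Q * A * (G x)) * (- (2 * q x - 2 * a * b) * (G x * G x))"
    unfolding Q(2) poly ..
  also have "\<dots> = - (W * kap 0 2 x * (A * S))"
    unfolding W kap_eq A(2)[symmetric] using A(1) Q(1) by (simp add: field_simps a_def b_def)
  finally show "((\<lambda>x. (- ((real m)\<^sup>2 - (real n)\<^sup>2) * (sin x * cos x) * sqrt (q x) * sin (\<zeta> x) + real m * real n * (real m + real n) * cos (\<zeta> x)) / sqrt (G x)) has_real_derivative
     - (wM m n x * kap 0 2 x * (sqrt (G x) * sin (\<zeta> x)))) (at x)"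
    using 2 by (simp only: W_def A_def S_def D_def o'_def a_def b_def)
qed

text \<open>Without the factor \<open>wM * (m + n)\<close> the phase would be the angle of \<open>(m cos x, n sin x)\<close>, up to the
  order of \<open>m\<close> and \<open>n\<close>; the factor adds at most \<open>1/2\<close> to the derivative.\<close>

lemma phase_bound:
  assumes z: "\<And>x. (\<zeta> has_real_derivative wM m n x * (real m * real n * (real m + real n)) / G x) (at x)" "\<zeta> 0 = 0"
    and x: "0 < x" "x \<le> pi/2"
  shows "0 < \<zeta> x" "\<zeta> x < pi"
proof -
  define a b where "a = real m" and "b = real n"
  have ab: "a > 0" "b > 0" using m_pos n_pos by (auto simp: a_def b_def)
  show "0 < \<zeta> x"
  proof -
    have "\<zeta> 0 < \<zeta> x"
      by (rule DERIV_pos_imp_increasing[OF x(1)])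
         (use z(1) w_pos G_pos m_pos n_pos in \<open>force intro!: divide_pos_pos mult_pos_pos\<close>)
    then show ?thesis using z(2) by simp
  qed
  define H where "H x = a * (cos x)\<^sup>2 + b * (sin x)\<^sup>2" for x
  have H: "H x > 0" for x
  proof (cases "cos x = 0")
    case True
    then have "(sin x)\<^sup>2 = 1" by (simp add: sin_squared_eq)
    then show ?thesis using ab True by (simp add: H_def)
  next
    case False
    then show ?thesis using ab by (simp add: H_def add_pos_nonneg)
  qed
  \<comment> \<open>The tangent of the difference between the angle of
    \<open>(a cos x, b sin x)\<close> and \<open>x\<close>. Measured from \<open>x\<close>, that
    angle stays in the range of \<open>arctan\<close> and needs no branches.\<close>
  define K where "K x = (b - a) * (sin x * cos x) / H x" for x
  have Hd: "(H has_real_derivative 2 * (b - a) * (sin x * cos x)) (at x)" for x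
    unfolding H_def by (auto intro!: derivative_eq_intros simp: algebra_simps)
  have scd: "((\<lambda>x. (b - a) * (sin x * cos x)) has_real_derivative (b - a) * ((cos x)\<^sup>2 - (sin x)\<^sup>2)) (at x)" for x
    by (auto intro!: derivative_eq_intros simp: power2_eq_square algebra_simps)
  have Kd: "((\<lambda>x. arctan (K x)) has_real_derivative a * b / G x - 1) (at x)" for x
  proof -
    define s c where "s = sin x" and "c = cos x"
    have sc: "c * c = 1 - s * s" using sin_cos_squared_add[of x] by (simp add: s_def c_def power2_eq_square algebra_simps)
    have Hn: "H x \<noteq> 0" using H[of x] by simp
    have 1: "(K has_real_derivative ((b - a) * (c\<^sup>2 - s\<^sup>2) * H x - (b - a) * (s * c) * (2 * (b - a) * (s * c))) / (H x * H x)) (at x)"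
      unfolding K_def s_def c_def by (rule DERIV_divide[OF scd Hd Hn])
    have GH: "G x = H x * H x + ((b - a) * (s * c)) * ((b - a) * (s * c))"
    proof -
      have "G x * (c * c + s * s) = H x * H x + ((b - a) * (s * c)) * ((b - a) * (s * c))"
        unfolding G_def H_def s_def[symmetric] c_def[symmetric] a_def[symmetric] b_def[symmetric] power2_eq_square by algebra
      then show ?thesis unfolding sc by simp
    qed
    have "1 + (K x)\<^sup>2 = G x / (H x * H x)"
      unfolding GH K_def s_def c_def using Hn by (simp add: power2_eq_square field_simps)
    moreover have "((b - a) * (c\<^sup>2 - s\<^sup>2) * H x - (b - a) * (s * c) * (2 * (b - a) * (s * c))) = a * b - G x"
      unfolding H_def G_def s_def[symmetric] c_def[symmetric] a_def[symmetric] b_def[symmetric] power2_eq_square sc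
      using sc by algebra
    ultimately have "inverse (1 + (K x)\<^sup>2) * (((b - a) * (c\<^sup>2 - s\<^sup>2) * H x - (b - a) * (s * c) * (2 * (b - a) * (s * c))) / (H x * H x)) = a * b / G x - 1"
      using Hn G_pos[of x] by (simp add: field_simps)
    then show ?thesis using DERIV_chain2[OF DERIV_arctan 1] by simp
  qed
  \<comment> \<open>The slack in \<open>\<zeta> x \<le> x + arctan (K x) + x / 2\<close>, where
    \<open>x / 2\<close> pays for the excess of the phase speed over that of the elementary
    angle.\<close>
  define e where "e x = x + arctan (K x) + x / 2 - \<zeta> x" for x
  have ed: "(e has_real_derivative 1 + (a * b / G x - 1) + 1 / 2 - wM m n x * (a * b * (a + b)) / G x) (at x)" for x
    unfolding e_def a_def b_def
    by (intro DERIV_diff DERIV_add DERIV_ident Kd[unfolded a_def b_def] z DERIV_cdivide)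
  have nn: "0 \<le> 1 + (a * b / G x - 1) + 1 / 2 - wM m n x * (a * b * (a + b)) / G x" for x
  proof -
    define Q where "Q = sqrt (q x)"
    have Q: "Q > 0" "Q * Q = q x" "wM m n x = 1 / Q" using q_pos[of x] by (auto simp: Q_def wM_def inverse_eq_divide)
    have g: "G x = (a + b - Q) * (a + b + Q)" using G_q[of x] Q(2) by (simp add: a_def b_def power2_eq_square algebra_simps)
    have gp: "a + b - Q > 0" using G_pos[of x] ab Q(1) unfolding g by (simp add: zero_less_mult_iff)
    \<comment> \<open>Since \<open>G + q = (a + b)^2\<close>, the factor \<open>a + b - Q\<close>
      cancels against \<open>G\<close>; the bound 1/2 then comes from
      \<open>q \<ge> 2 a b\<close>.\<close>
    have "wM m n x * (a * b * (a + b)) / G x - a * b / G x = a * b * (a + b - Q) / (Q * G x)"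
      unfolding Q(3) using Q(1) G_pos[of x] by (simp add: field_simps)
    also have "\<dots> = a * b / (Q * (a + b + Q))" unfolding g using gp by simp
    also have "\<dots> \<le> a * b / (Q * Q)" using ab Q(1) by (intro divide_left_mono mult_left_mono mult_pos_pos) auto
    also have "\<dots> \<le> 1 / 2" unfolding Q(2) using q_ge[of x] q_pos[of x] by (simp add: a_def b_def field_simps)
    finally show ?thesis by linarith
  qed
  have "e 0 \<le> e x"
    by (rule DERIV_nonneg_imp_nondecreasing) (use x ed nn in \<open>auto intro!: exI\<close>)
  moreover have "e 0 = 0" by (simp add: e_def K_def z(2))
  ultimately have "\<zeta> x \<le> x + arctan (K x) + x / 2" by (simp add: e_def)
  also have "x + arctan (K x) \<le> pi / 2"
  proof -
    have d: "((\<lambda>x. x + arctan (K x)) has_real_derivative a * b / G x) (at x)" for x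
      using DERIV_add[OF DERIV_ident Kd[of x]] by simp
    have "x + arctan (K x) \<le> pi/2 + arctan (K (pi/2))"
      by (rule DERIV_nonneg_imp_nondecreasing[OF x(2)]) (use d ab G_pos in \<open>force intro!: less_imp_le divide_pos_pos mult_pos_pos\<close>)
    then show ?thesis by (simp add: K_def)
  qed
  also have "pi / 2 + x / 2 < pi" using x by simp
  finally show "\<zeta> x < pi" by simp
qed

text \<open>The Dirichlet solution \<open>sqrt G sin \<zeta>\<close> is positive because the phase
  stays below \<open>pi\<close>. Advancing the phase by \<open>pi/2\<close> gives the Neumann
  solution, whose \<open>b\<close> is negative at \<open>pi/2\<close> since
  \<open>sin \<zeta>\<close> is positive there. So its end angle has negative cosine, which below
  \<open>2 pi\<close> means less than \<open>3 pi / 2\<close>.\<close>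

lemma Ang_0_bounds: "Ang False 0 2 \<le> pi" "Ang True 0 2 < 3 * pi / 2"
proof -
  obtain \<zeta> where z: "\<And>x. (\<zeta> has_real_derivative wM m n x * (real m * real n * (real m + real n)) / G x) (at x)" "\<zeta> 0 = 0"
    by (rule phase_exists, rule that)
  define o' where "o' = real m * real n * (real m + real n)"
  have o': "o' > 0" using m_pos n_pos by (simp add: o'_def)
  have G0: "sqrt (G x) > 0" for x using G_pos by simp
  show D: "Ang False 0 2 \<le> pi"
  proof (rule ang_le_pi[OF bcont_kap solution_phase[OF z(1)], where c = "o' / sqrt (G 0)"])
    show "0 < sqrt (G x) * sin (\<zeta> x)" if "0 < x" "x < pi/2" for x
      using phase_bound[OF z] that G0[of x] by (intro mult_pos_pos sin_gt_zero) auto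
  qed (auto simp: z(2) o'_def)
  have z': "((\<lambda>x. \<zeta> x + pi/2) has_real_derivative wM m n x * (real m * real n * (real m + real n)) / G x) (at x)" for x
    using DERIV_add[OF z(1) DERIV_const[of "pi/2"]] by simp
  have "(- ((real m)\<^sup>2 - (real n)\<^sup>2) * (sin (pi/2) * cos (pi/2)) * sqrt (q (pi/2)) * sin (\<zeta> (pi/2) + pi/2) + real m * real n * (real m + real n) * cos (\<zeta> (pi/2) + pi/2)) / sqrt (G (pi/2))
     = sqrt (G 0) * (amp True (kap 0 2) (pi/2) * cos (theta True (kap 0 2) (pi/2)))"
    by (rule solution_base(2)[OF bcont_kap solution_phase[OF z']]) (auto simp: z(2))
  then have e: "- (o' * sin (\<zeta> (pi/2))) / sqrt (G (pi/2)) = sqrt (G 0) * (amp True (kap 0 2) (pi/2) * cos (Ang True 0 2))"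
    by (simp add: cos_add o'_def ang_def)
  have "0 < sin (\<zeta> (pi/2))" using phase_bound[OF z, of "pi/2"] by (intro sin_gt_zero) auto
  then have "- (o' * sin (\<zeta> (pi/2))) / sqrt (G (pi/2)) < 0" using o' G0 by (simp add: divide_neg_pos)
  then have "cos (Ang True 0 2) < 0"
    unfolding e using G0[of 0] amp(1)[OF bcont_kap, of True 0 2 "pi/2"] by (simp add: mult_less_0_iff not_less)
  moreover have "Ang True 0 2 < 2 * pi" using ang_True_less[OF bcont_kap[of 0 2]] D by linarith
  ultimately have c: "cos (Ang True 0 2) < 0" and l: "Ang True 0 2 < 2 * pi" by auto
  show "Ang True 0 2 < 3 * pi / 2"
  proof (rule ccontr)
    assume "\<not> Ang True 0 2 < 3 * pi / 2"
    then have "0 \<le> cos (2 * pi - Ang True 0 2)" using l by (intro cos_ge_zero) linarith+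
    then show False using c by (simp add: cos_diff)
  qed
qed

definition Lim :: "bool \<Rightarrow> bool \<Rightarrow> nat" where
  "Lim nu nu' = (if nu then (if nu' then m + n else n) else (if nu' then m else 0))"

text \<open>The angle decreases in \<open>l\<close>, so the bounds at \<open>l = 0\<close> exclude a
  second zero of the boundary condition for every frequency. The first zero is passed below 2
  exactly when \<open>l\<close> is smaller than the frequency of the coordinate function that
  attains it at 2, and never for two Dirichlet conditions.\<close>

lemma card_spec_below_2: "card {lam \<in> spec nu nu' (real l). lam < 2} = (if l < Lim nu nu' then 1 else 0)"
proof -
  have le0: "Ang nu (real l) 2 \<le> Ang nu 0 2" for nu
    using Ang_strict_antimono[of 0 "real l" nu 2] by (cases "l = 0") auto
  have z: "Ang nu (real l) 0 \<le> pi/2" for nu by (intro ang_nonpos bcont_kap) (simp add: kap_def)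
  have cmp: "t < Ang nu (real l) 2 \<longleftrightarrow> l < k" if "Ang nu (real k) 2 = t" for nu t k
  proof (cases l k rule: linorder_cases)
    case less
    then show ?thesis using Ang_strict_antimono[of "real l" "real k" nu 2] that by (simp add: power_strict_mono)
  next
    case greater
    then show ?thesis using Ang_strict_antimono[of "real k" "real l" nu 2] that by (simp add: power_strict_mono)
  qed (use that in auto)
  have cos0: "cos s = 0 \<longleftrightarrow> s = pi/2" if "0 < s" "s < 3 * pi / 2" for s :: real
  proof
    assume c: "cos s = 0"
    have "sin (s - pi/2) = 0" using c by (simp add: sin_diff)
    moreover have "sin (s - pi/2) > 0" if "s > pi/2" using that \<open>s < _\<close> by (intro sin_gt_zero) auto
    moreover have "sin (pi/2 - s) > 0" if "s < pi/2" using that \<open>0 < s\<close> by (intro sin_gt_zero) auto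
    moreover have "sin (pi/2 - s) = - sin (s - pi/2)" by (simp add: sin_diff)
    ultimately show "s = pi/2" by linarith
  qed (simp only: cos_pi_half)
  have sin0: "sin s = 0 \<longleftrightarrow> s = pi" if "0 < s" "s < 3 * pi / 2" for s :: real
  proof
    assume c: "sin s = 0"
    have "sin s > 0" if "s < pi" using that \<open>0 < s\<close> by (intro sin_gt_zero) auto
    moreover have "sin (s - pi) > 0" if "s > pi" using that \<open>s < _\<close> by (intro sin_gt_zero) auto
    moreover have "sin (s - pi) = - sin s" by (simp add: sin_diff)
    ultimately show "s = pi" using c by linarith
  qed simp
  consider "nu" "nu'" | "nu" "\<not> nu'" | "\<not> nu" "nu'" | "\<not> nu" "\<not> nu'" by blast
  then show ?thesis
  proof cases
    case 1
    have "card {lam \<in> spec True True (real l). lam < 2} = (if pi/2 < Ang True (real l) 2 then 1 else 0)"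
      by (rule spec_counting[where u = "3 * pi / 2"]) (use z le0[of True] Ang_0_bounds cos0 in auto)
    then show ?thesis using 1 cmp[of True "m + n" "pi/2"] Ang_values by (simp add: Lim_def)
  next
    case 2
    have "card {lam \<in> spec True False (real l). lam < 2} = (if pi < Ang True (real l) 2 then 1 else 0)"
    proof (rule spec_counting[where u = "3 * pi / 2"])
      show "Ang True (real l) 0 \<le> pi" using z[of True] pi_gt_zero by linarith
    qed (use le0[of True] Ang_0_bounds sin0 in auto)
    then show ?thesis using 2 cmp[of True n pi] Ang_values by (simp add: Lim_def)
  next
    case 3
    have "card {lam \<in> spec False True (real l). lam < 2} = (if pi/2 < Ang False (real l) 2 then 1 else 0)"
    proof (rule spec_counting[where u = pi])
      show "(if True then cos s = 0 else sin s = 0) \<longleftrightarrow> s = pi/2" if "0 < s" "s < pi" for s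
        using cos0[of s] that by auto
    qed (use z le0[of False] Ang_0_bounds in auto)
    then show ?thesis using 3 cmp[of False m "pi/2"] Ang_values by (simp add: Lim_def)
  next
    case 4
    have "card {lam \<in> spec False False (real l). lam < 2} = (if pi < Ang False (real l) 2 then 1 else 0)"
    proof (rule spec_counting[where u = pi])
      show "(if False then cos s = 0 else sin s = 0) \<longleftrightarrow> s = pi" if "0 < s" "s < pi" for s
        using sin0[of s] that by auto
      show "Ang False (real l) 0 \<le> pi" using z[of False] pi_gt_zero by linarith
    qed (use le0[of False] Ang_0_bounds in auto)
    moreover have "\<not> pi < Ang False (real l) 2" using le0[of False] Ang_0_bounds(1) by linarith
    ultimately show ?thesis using 4 by (simp add: Lim_def)
  qed
qed

end

section \<open>Charts of the surfaces\<close>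

lemma partial_Re_Im_component:
  fixes \<Phi> :: "real^2 \<Rightarrow> complex^3"
  assumes "smooth \<Phi>"
  shows "smooth (\<lambda>z. Re (\<Phi> z $ k))" "smooth (\<lambda>z. Im (\<Phi> z $ k))"
    "partial i (\<lambda>z. Re (\<Phi> z $ k)) p = Re (partial i \<Phi> p $ k)"
    "partial i (\<lambda>z. Im (\<Phi> z $ k)) p = Im (partial i \<Phi> p $ k)"
proof -
  have e: "(\<lambda>z. Re (\<Phi> z $ k)) = (\<lambda>z. \<Phi> z \<bullet> axis k 1)" "(\<lambda>z. Im (\<Phi> z $ k)) = (\<lambda>z. \<Phi> z \<bullet> axis k \<i>)"
    by (auto simp: inner_axis inner_complex_def)
  show "smooth (\<lambda>z. Re (\<Phi> z $ k))" "smooth (\<lambda>z. Im (\<Phi> z $ k))" unfolding e by (rule smooth_component[OF assms])+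
  have d: "((\<lambda>z. \<Phi> z \<bullet> b) has_derivative (\<lambda>v. frechet_derivative \<Phi> (at p) v \<bullet> b)) (at p)" for b p
    using has_derivative_inner_left[OF smooth_has_derivative[OF assms]] .
  show "partial i (\<lambda>z. Re (\<Phi> z $ k)) p = Re (partial i \<Phi> p $ k)"
    "partial i (\<lambda>z. Im (\<Phi> z $ k)) p = Im (partial i \<Phi> p $ k)"
    unfolding e partial_eq[OF d] by (simp_all add: partial_def[of i \<Phi>] inner_axis inner_complex_def)
qed

context clifford
begin

definition PQ :: real where "PQ = (2 * real m + real n) * (real m + 2 * real n)"

lemma PQ_pos: "PQ > 0"
  using m_pos n_pos by (simp add: PQ_def)

lemma R3_eq: "R3 m n x = sqrt (q x) * (1 / sqrt PQ)"
proof -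
  define P Q where "P = 2 * real m + real n" and "Q = real m + 2 * real n"
  have PQ: "P > 0" "Q > 0" using m_pos n_pos by (auto simp: P_def Q_def)
  have "real n * (cos x)\<^sup>2 / Q + real m * (sin x)\<^sup>2 / P = (real n * P * (cos x)\<^sup>2 + real m * Q * (sin x)\<^sup>2) / (P * Q)"
    using PQ by (simp add: field_simps)
  also have "real n * P * (cos x)\<^sup>2 + real m * Q * (sin x)\<^sup>2 = 2 * real m * real n * ((cos x)\<^sup>2 + (sin x)\<^sup>2) + (real n)\<^sup>2 * (cos x)\<^sup>2 + (real m)\<^sup>2 * (sin x)\<^sup>2"
    unfolding P_def Q_def by algebra
  also have "\<dots> = q x" by (simp add: qM_def)
  finally have "real n * (cos x)\<^sup>2 / Q + real m * (sin x)\<^sup>2 / P = q x / (P * Q)" .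
  then have "R3 m n x = sqrt (q x / (P * Q))" by (simp add: R3_def P_def Q_def)
  then show ?thesis unfolding PQ_def P_def Q_def by (simp add: real_sqrt_divide)
qed

definition amp3 :: "3 \<Rightarrow> real \<Rightarrow> real" where
  "amp3 k x = (if k = 1 then A1 m n * sin x else if k = 2 then A2 m n * cos x else R3 m n x)"
definition amp3' :: "3 \<Rightarrow> real \<Rightarrow> real" where
  "amp3' k x = (if k = 1 then A1 m n * cos x else if k = 2 then - (A2 m n * sin x)
     else wM m n x * (((real m)\<^sup>2 - (real n)\<^sup>2) * (sin x * cos x)) * (1 / sqrt PQ))"
definition freq :: "3 \<Rightarrow> real" where
  "freq k = (if k = 1 then real m else if k = 2 then real n else - (real m + real n))"

lemma amp3_deriv: "(amp3 k has_real_derivative amp3' k x) (at x)"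
proof -
  have 3: "k = 1 \<or> k = 2 \<or> k = 3" using exhaust_3 by blast
  have r: "(R3 m n has_real_derivative wM m n x * (((real m)\<^sup>2 - (real n)\<^sup>2) * (sin x * cos x)) * (1 / sqrt PQ)) (at x)"
    unfolding R3_eq[abs_def] by (rule DERIV_cmult_right[OF sqrt_q_deriv])
  have s: "((\<lambda>x. A1 m n * sin x) has_real_derivative A1 m n * cos x) (at x)"
    "((\<lambda>x. A2 m n * cos x) has_real_derivative - (A2 m n * sin x)) (at x)"
    by (auto intro!: derivative_eq_intros)
  show ?thesis using 3 r s unfolding amp3_def[abs_def] amp3'_def by auto
qed

lemma phi_amp3: "phi m n x y $ k = of_real (amp3 k x) * cis (freq k * y)"
proof -
  have 3: "k = 1 \<or> k = 2 \<or> k = 3" using exhaust_3 by blast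
  have n123: "(2::3) \<noteq> 1" "(3::3) \<noteq> 1" "(3::3) \<noteq> 2" by simp_all
  have e: "- (real (m + n) * y) = - (real m + real n) * y" by (simp add: algebra_simps)
  show ?thesis using 3 unfolding amp3_def freq_def by (elim disjE) (simp_all only: phi_nth e simp_thms if_True if_False n123)
qed

definition Phi :: "real^2 \<Rightarrow> complex^3" where "Phi z = phi m n (z $ 1) (z $ 2)"

lemma smooth_Phi: "smooth Phi"
  unfolding Phi_def by (rule smooth_phi[OF m_pos n_pos el_coord el_coord])

lemma partial_Phi:
  "Re (partial 1 Phi (pt x y) $ k) = amp3' k x * cos (freq k * y)"
  "Im (partial 1 Phi (pt x y) $ k) = amp3' k x * sin (freq k * y)"
  "Re (partial 2 Phi (pt x y) $ k) = - (freq k * amp3 k x * sin (freq k * y))"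
  "Im (partial 2 Phi (pt x y) $ k) = freq k * amp3 k x * cos (freq k * y)"
proof -
  note s = partial_Re_Im_component[OF smooth_Phi, where k = k]
  have f: "Re (Phi (pt x y) $ k) = amp3 k x * cos (freq k * y)" "Im (Phi (pt x y) $ k) = amp3 k x * sin (freq k * y)" for x y
    by (simp_all add: Phi_def phi_amp3)
  show "Re (partial 1 Phi (pt x y) $ k) = amp3' k x * cos (freq k * y)"
    unfolding s(3)[symmetric] by (rule partial_1_eqI[OF s(1)]) (simp only: f DERIV_cmult_right[OF amp3_deriv])
  show "Im (partial 1 Phi (pt x y) $ k) = amp3' k x * sin (freq k * y)"
    unfolding s(4)[symmetric] by (rule partial_1_eqI[OF s(2)]) (simp only: f DERIV_cmult_right[OF amp3_deriv])
  show "Re (partial 2 Phi (pt x y) $ k) = - (freq k * amp3 k x * sin (freq k * y))"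
    unfolding s(3)[symmetric] by (rule partial_2_eqI[OF s(1)]) (auto simp: f intro!: derivative_eq_intros)
  show "Im (partial 2 Phi (pt x y) $ k) = freq k * amp3 k x * cos (freq k * y)"
    unfolding s(4)[symmetric] by (rule partial_2_eqI[OF s(2)]) (auto simp: f intro!: derivative_eq_intros)
qed

lemma inner_complex3: "(a :: complex^3) \<bullet> b = (\<Sum>k\<in>UNIV. Re (a $ k) * Re (b $ k) + Im (a $ k) * Im (b $ k))"
  by (simp add: inner_vec_def inner_complex_def)

lemma A12_squared: "A1 m n * A1 m n = (real m + real n) / (2 * real m + real n)" "A2 m n * A2 m n = (real m + real n) / (real m + 2 * real n)"
  by (simp_all add: A1_def A2_def)

lemma Phi_metric:
  "partial 1 Phi (pt x y) \<bullet> partial 1 Phi (pt x y) = (wM m n x)\<^sup>2 * rM m n x"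
  "partial 2 Phi (pt x y) \<bullet> partial 2 Phi (pt x y) = rM m n x"
  "partial 1 Phi (pt x y) \<bullet> partial 2 Phi (pt x y) = 0"
  "partial 2 Phi (pt x y) \<bullet> partial 1 Phi (pt x y) = 0"
proof -
  define a b where "a = real m" and "b = real n"
  define s c where "s = sin x" and "c = cos x"
  define P Q where "P = 2 * a + b" and "Q = a + 2 * b"
  have ab: "a > 0" "b > 0" using m_pos n_pos by (auto simp: a_def b_def)
  have PQp: "P > 0" "Q > 0" using ab by (auto simp: P_def Q_def)
  have PQe: "PQ = P * Q" by (simp add: PQ_def P_def Q_def a_def b_def)
  have sq: "sqrt PQ * sqrt PQ = P * Q" using PQ_pos by (simp add: PQe)
  have sc: "c * c = 1 - s * s" using sin_cos_squared_add[of x] by (simp add: s_def c_def power2_eq_square algebra_simps)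
  have one: "u * cos t * (u * cos t) + u * sin t * (u * sin t) = u * u" for u t :: real
  proof -
    have "u * cos t * (u * cos t) + u * sin t * (u * sin t) = u * u * ((sin t)\<^sup>2 + (cos t)\<^sup>2)"
      by (simp only: power2_eq_square distrib_left mult_ac add_ac)
    then show ?thesis by simp
  qed
  have w2: "(wM m n x)\<^sup>2 = 1 / q x" using q_pos[of x] by (simp add: wM_def power_inverse inverse_eq_divide power_divide)
  have q: "q x = 2 * a * b + b * b + (a * a - b * b) * (s * s)" unfolding q_alt(1) by (simp add: a_def b_def s_def power2_eq_square)
  have r: "rM m n x = q x - a * b" by (simp add: rM_def a_def b_def)
  have qn: "q x \<noteq> 0" using q_pos[of x] by simp
  have "partial 1 Phi (pt x y) \<bullet> partial 1 Phi (pt x y) = (\<Sum>k\<in>UNIV. amp3' k x * amp3' k x)"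
    unfolding inner_complex3 partial_Phi one ..
  also have "\<dots> = (A1 m n * A1 m n) * (c * c) + (A2 m n * A2 m n) * (s * s)
      + (wM m n x)\<^sup>2 * ((a * a - b * b) * (a * a - b * b) * (s * s * (c * c))) / (sqrt PQ * sqrt PQ)"
    unfolding sum_3 amp3'_def by (simp add: s_def c_def a_def b_def power2_eq_square)
  also have "\<dots> = (a + b) / P * (c * c) + (a + b) / Q * (s * s) + ((a * a - b * b) * (a * a - b * b) * (s * s * (c * c))) / (q x * (P * Q))"
    unfolding A12_squared sq w2 by (simp add: P_def Q_def a_def b_def)
  also have "\<dots> = ((a + b) * (Q * (c * c) + P * (s * s)) * q x + (a * a - b * b) * (a * a - b * b) * (s * s * (c * c))) / (q x * (P * Q))"
    using PQp qn by (simp add: field_simps)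
  also have "(a + b) * (Q * (c * c) + P * (s * s)) * q x + (a * a - b * b) * (a * a - b * b) * (s * s * (c * c)) = P * Q * (q x - a * b)"
    unfolding sc q P_def Q_def by algebra
  also have "P * Q * (q x - a * b) / (q x * (P * Q)) = (wM m n x)\<^sup>2 * rM m n x"
    unfolding w2 r using PQp qn by simp
  finally show "partial 1 Phi (pt x y) \<bullet> partial 1 Phi (pt x y) = (wM m n x)\<^sup>2 * rM m n x" .
  have one': "- (u * v * sin t) * - (u * v * sin t) + u * v * cos t * (u * v * cos t) = (u * u) * (v * v)" for u v t :: real
  proof -
    have "- (u * v * sin t) * - (u * v * sin t) + u * v * cos t * (u * v * cos t) = u * u * (v * v) * ((sin t)\<^sup>2 + (cos t)\<^sup>2)"
      by (simp only: power2_eq_square distrib_left mult_ac minus_mult_minus)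
    then show ?thesis by simp
  qed
  have "partial 2 Phi (pt x y) \<bullet> partial 2 Phi (pt x y) = (\<Sum>k\<in>UNIV. (freq k * freq k) * (amp3 k x * amp3 k x))"
    unfolding inner_complex3 partial_Phi one' ..
  also have "\<dots> = a * a * ((A1 m n * A1 m n) * (s * s)) + b * b * ((A2 m n * A2 m n) * (c * c)) + (a + b) * (a + b) * ((sqrt (q x) * sqrt (q x)) / (sqrt PQ * sqrt PQ))"
    unfolding sum_3 amp3_def freq_def R3_eq by (simp add: s_def c_def a_def b_def algebra_simps)
  also have "\<dots> = a * a * ((a + b) / P * (s * s)) + b * b * ((a + b) / Q * (c * c)) + (a + b) * (a + b) * (q x / (P * Q))"
    unfolding A12_squared sq w_sqrt(2) by (simp add: P_def Q_def a_def b_def)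
  also have "\<dots> = ((a + b) * (a * a * Q * (s * s) + b * b * P * (c * c) + (a + b) * q x)) / (P * Q)"
    using PQp by (simp add: field_simps)
  also have "(a + b) * (a * a * Q * (s * s) + b * b * P * (c * c) + (a + b) * q x) = P * Q * (q x - a * b)"
    unfolding sc q P_def Q_def by algebra
  also have "P * Q * (q x - a * b) / (P * Q) = rM m n x"
    unfolding r using PQp by simp
  finally show "partial 2 Phi (pt x y) \<bullet> partial 2 Phi (pt x y) = rM m n x" .
  show z: "partial 1 Phi (pt x y) \<bullet> partial 2 Phi (pt x y) = 0"
    unfolding inner_complex3 partial_Phi by (simp add: mult_ac)
  show "partial 2 Phi (pt x y) \<bullet> partial 1 Phi (pt x y) = 0"
    using z by (simp add: inner_commute)
qed

abbreviation twisted :: bool where "twisted \<equiv> odd m \<and> odd n"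

lemma phi_eq_iff_lat:
  assumes "gcd m n = 1"
  shows "phi m n x y = phi m n x' y' \<longleftrightarrow> lat twisted (x - x') (y - y')"
proof -
  have odd: "odd m \<or> odd n" using assms by (metis gcd_greatest_iff odd_one)
  have par: "even (k + int m * l) \<and> even (k + int n * l) \<longleftrightarrow> (if twisted then even (k + l) else even k \<and> even l)" for k l
    using odd by auto
  show ?thesis unfolding phi_fibre[OF m_pos n_pos assms] lat_def par ..
qed

text \<open>Needed for every embedding, since the one inside \<open>induced_metric\<close> is
  unspecified. The lift makes \<open>\<psi>\<close> the composite of \<open>Phi\<close> with
  \<open>(X, Y)\<close>, so the metric comes from \<open>Phi_metric\<close>, and fibres and image of
  \<open>\<psi>\<close> translate into the lattice conditions.\<close>

theorem chart_exists:
  assumes gcd: "gcd m n = 1" and emb: "torus_embedding \<psi> (M m n)"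
  obtains X Y where "torus_chart (wM m n) (rM m n) twisted X Y (pullback_metric \<psi>)"
proof -
  have sm: "smooth \<psi>" and imm: "\<And>p v. v \<noteq> 0 \<Longrightarrow> frechet_derivative \<psi> (at p) v \<noteq> 0"
    and fib: "\<And>p q. \<psi> p = \<psi> q \<longleftrightarrow> (\<forall>i. p $ i - q $ i \<in> \<int>)" and rng: "range \<psi> = M m n"
    using emb by (auto simp: torus_embedding_def)
  have ex: "\<exists>x y. \<psi> p = phi m n x y" for p
  proof -
    have "\<psi> p \<in> M m n" unfolding rng[symmetric] by (rule rangeI)
    then show ?thesis unfolding M_def by blast
  qed
  obtain X Y where XY: "smooth X" "smooth Y" "\<And>p. \<psi> p = phi m n (X p) (Y p)"
    by (rule phi_lift[OF m_pos n_pos sm ex], rule that)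
  have \<psi>: "\<psi> = (\<lambda>p. Phi (pt (X p) (Y p)))" using XY(3) by (simp add: Phi_def fun_eq_iff)
  have p\<psi>: "partial i \<psi> p = partial i X p *\<^sub>R partial 1 Phi (pt (X p) (Y p)) + partial i Y p *\<^sub>R partial 2 Phi (pt (X p) (Y p))" for i p
    unfolding \<psi> by (subst partial_compose_pt) (use XY smooth_Phi smooth_differentiable in auto)
  have fr: "frechet_derivative \<psi> (at p) v = (v $ 1 * partial 1 X p + v $ 2 * partial 2 X p) *\<^sub>R partial 1 Phi (pt (X p) (Y p))
      + (v $ 1 * partial 1 Y p + v $ 2 * partial 2 Y p) *\<^sub>R partial 2 Phi (pt (X p) (Y p))" for p v
    unfolding frechet_derivative_partial[OF smooth_differentiable[OF sm]] p\<psi> by (simp add: algebra_simps)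
  have "torus_chart (wM m n) (rM m n) twisted X Y (pullback_metric \<psi>)"
  proof
    show "smooth X" "smooth Y" by (rule XY)+
    show "jac X Y p \<noteq> 0" for p
    proof
      assume j: "jac X Y p = 0"
      have z: "v = 0" if "v $ 1 * partial 1 X p + v $ 2 * partial 2 X p = 0" "v $ 1 * partial 1 Y p + v $ 2 * partial 2 Y p = 0" for v :: "real^2"
        using imm[of v p] fr[of p v] that by auto
      \<comment> \<open>If \<open>jac\<close> vanished, these two vectors would lie in the kernel of
        the derivative; being 0 by immersivity, they make all four partial derivatives vanish, again
        against immersivity.\<close>
      have "pt (partial 2 X p) (- partial 1 X p) = 0" "pt (partial 2 Y p) (- partial 1 Y p) = 0"
        by (rule z; use j in \<open>simp add: jac_def algebra_simps\<close>)+
      then have "partial 1 X p = 0" "partial 2 X p = 0" "partial 1 Y p = 0" "partial 2 Y p = 0"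
        by (auto simp: vec_eq_iff forall_2)
      then have "pt 1 0 = 0" by (intro z) auto
      then show False by (auto simp: vec_eq_iff forall_2)
    qed
    show "pullback_metric \<psi> p $ i $ j = (wM m n (X p))\<^sup>2 * rM m n (X p) * (partial i X p * partial j X p) + rM m n (X p) * (partial i Y p * partial j Y p)" for p i j
      unfolding pullback_metric_def p\<psi> by (simp add: inner_add_left inner_add_right Phi_metric algebra_simps)
    show "lat twisted (X p - X q) (Y p - Y q) \<longleftrightarrow> (\<forall>i. p $ i - q $ i \<in> \<int>)" for p q
      unfolding fib[symmetric] XY(3) phi_eq_iff_lat[OF gcd] ..
    show "\<exists>p. lat twisted (x - X p) (y - Y p)" for x y
    proof -
      have "phi m n x y \<in> range \<psi>" unfolding rng M_def by blast
      then obtain p where "phi m n x y = phi m n (X p) (Y p)" using XY(3) by auto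
      then show ?thesis unfolding phi_eq_iff_lat[OF gcd] by blast
    qed
  qed
  then show ?thesis by (rule that)
qed

text \<open>The indices of the eigenfunctions with eigenvalue below 2.\<close>

definition low :: "bool \<Rightarrow> index set" where
  "low tw = {(nu, nu', l, c). (nu, nu', l, c) \<in> admissible tw \<and> l < Lim nu nu'}"

definition modes :: "(nat \<Rightarrow> bool) \<Rightarrow> nat \<Rightarrow> (nat \<times> bool) set" where
  "modes P L = {(l, c). l < L \<and> P l \<and> (l = 0 \<longrightarrow> c)}"

lemma finite_modes: "finite (modes P L)"
  by (rule finite_subset[of _ "{..<L} \<times> UNIV"]) (auto simp: modes_def)

lemma card_modes_Suc: "card (modes P (Suc L)) = card (modes P L) + (if P L then if L = 0 then 1 else 2 else 0)"
proof -
  have "modes P (Suc L) = modes P L \<union> (if P L then if L = 0 then {(L, True)} else {(L, True), (L, False)} else {})"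
    by (auto simp: modes_def less_Suc_eq)
  moreover have "(L, c) \<notin> modes P L" for c by (simp add: modes_def)
  ultimately show ?thesis using finite_modes[of P L] by auto
qed

lemma card_modes_0: "card (modes P 0) = 0"
  by (simp add: modes_def)

text \<open>Each frequency carries a cosine and a sine, except 0, which carries only the
  constant.\<close>

lemma card_modes:
  "L > 0 \<Longrightarrow> card (modes (\<lambda>l. True) L) = 2 * L - 1"
  "a > 0 \<Longrightarrow> card (modes even (2 * a)) = 2 * a - 1"
  "card (modes odd (2 * a + 1)) = 2 * a"
proof -
  show "L > 0 \<Longrightarrow> card (modes (\<lambda>l. True) L) = 2 * L - 1"
  proof (induction L)
    case (Suc L)
    then show ?case by (cases "L = 0") (simp_all add: card_modes_Suc card_modes_0)
  qed simp
  show "a > 0 \<Longrightarrow> card (modes even (2 * a)) = 2 * a - 1"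
  proof (induction a)
    case (Suc a)
    have e: "2 * Suc a = Suc (Suc (2 * a))" by simp
    show ?case unfolding e card_modes_Suc using Suc by (cases "a = 0") (simp_all add: card_modes_0)
  qed simp
  show "card (modes odd (2 * a + 1)) = 2 * a"
  proof (induction a)
    case 0
    then show ?case by (simp add: card_modes_Suc card_modes_0)
  next
    case (Suc a)
    have e: "2 * Suc a + 1 = Suc (Suc (2 * a + 1))" by simp
    show ?case unfolding e card_modes_Suc using Suc by simp
  qed
qed

lemma low_eq: "low tw = (\<Union>(nu, nu')\<in>UNIV. (\<lambda>(l, c). (nu, nu', l, c)) ` modes (\<lambda>l. tw \<longrightarrow> sg nu * sg nu' * (- 1) ^ l = 1) (Lim nu nu'))"
  by (auto simp: low_def modes_def admissible_def)

lemma finite_low: "finite (low tw)"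
  unfolding low_eq by (auto intro: finite_modes)

lemma card_low: "card (low tw) = (\<Sum>(nu, nu')\<in>UNIV. card (modes (\<lambda>l. tw \<longrightarrow> sg nu * sg nu' * (- 1) ^ l = 1) (Lim nu nu')))"
proof -
  have "card (low tw) = (\<Sum>i\<in>UNIV. card ((\<lambda>(nu, nu'). (\<lambda>(l, c). (nu, nu', l, c)) ` modes (\<lambda>l. tw \<longrightarrow> sg nu * sg nu' * (- 1) ^ l = 1) (Lim nu nu')) i))"
    unfolding low_eq by (rule card_UN_disjoint) (auto intro: finite_modes)
  also have "\<dots> = (\<Sum>(nu, nu')\<in>UNIV. card (modes (\<lambda>l. tw \<longrightarrow> sg nu * sg nu' * (- 1) ^ l = 1) (Lim nu nu')))"
    by (intro sum.cong refl) (auto intro!: card_image simp: inj_on_def)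
  finally show ?thesis .
qed

lemma card_low_untwisted: "card (low False) = 4 * (m + n) - 3"
  unfolding card_low sum_bool4 using m_pos n_pos card_modes_0[of "\<lambda>l. True"]
  by (simp add: Lim_def card_modes(1))

text \<open>Invariance under the shift by \<open>(pi, pi)\<close> keeps even frequencies when the
  two boundary conditions agree and odd ones when they differ.\<close>

lemma card_low_twisted:
  assumes "odd m" "odd n" shows "card (low True) = 2 * (m + n) - 3"
proof -
  have par: "(- 1 :: real) ^ l = 1 \<longleftrightarrow> even l" "- ((- 1 :: real) ^ l) = 1 \<longleftrightarrow> odd l" "(- 1 :: real) ^ l = - 1 \<longleftrightarrow> odd l" for l by (cases "even l"; simp)+
  obtain a where a: "m = 2 * a + 1" using assms(1) by (auto elim: oddE)
  obtain b where b: "n = 2 * b + 1" using assms(2) by (auto elim: oddE)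
  have mn: "m + n = 2 * (a + b + 1)" using a b by simp
  have "card (low True) = card (modes even (m + n)) + card (modes odd n) + card (modes odd m) + card (modes even 0)"
    unfolding card_low sum_bool4 by (simp add: Lim_def par)
  also have "\<dots> = (2 * (a + b + 1) - 1) + 2 * b + 2 * a + 0"
  proof -
    have "card (modes even (m + n)) = 2 * (a + b + 1) - 1" unfolding mn by (rule card_modes(2)) simp
    moreover have "card (modes odd n) = 2 * b" "card (modes odd m) = 2 * a" unfolding a b by (rule card_modes(3))+
    ultimately show ?thesis by (simp only: card_modes_0)
  qed
  also have "\<dots> = 2 * (m + n) - 3" using a b by simp
  finally show ?thesis .
qed

text \<open>Each index in \<open>low\<close> contributes exactly one eigenvalue below 2 and no other
  index contributes any, so the first eigenvalue not below 2 stands at position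
  \<open>card (low twisted)\<close>.\<close>

theorem eigenvalue_2:
  assumes "torus_chart (wM m n) (rM m n) twisted X Y g"
  shows "eigenvalue (card (low twisted)) g = 2"
proof -
  interpret torus_chart "wM m n" "rM m n" twisted X Y g by (rule assms)
  have sub: "low twisted \<subseteq> admissible twisted" by (auto simp: low_def)
  have out: False if "i \<in> admissible twisted" "i \<notin> low twisted" "lam \<in> ispec i" "lam < 2" for i lam
  proof -
    obtain nu nu' l c where i: "i = (nu, nu', l, c)" by (cases i)
    have "\<not> l < Lim nu nu'" using that(1,2) by (auto simp: i low_def)
    then have "card {lam \<in> spec nu nu' (real l). lam < 2} = 0" by (simp add: card_spec_below_2)
    moreover have "finite {lam \<in> spec nu nu' (real l). lam < 2}"
      by (rule finite_subset[OF _ finite_spec[of nu nu' "real l" 2]]) auto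
    ultimately have "{lam \<in> spec nu nu' (real l). lam < 2} = {}" by simp
    then show False using that(3,4) by (auto simp: i)
  qed
  \<comment> \<open>The third coordinate function shows that 2 is an eigenvalue; its frequency
    \<open>m + n\<close> is even in the twisted case.\<close>
  have "2 \<in> spec True True (real (m + n))"
    using Ang_values(1) by (simp only: spec_def mem_Collect_eq if_True of_nat_add cos_pi_half)
  then have "(True, True, m + n, True) \<in> Ix twisted 2" by (auto simp: Ix_def admissible_def)
  then have ne: "Ix twisted 2 \<noteq> {}" by blast
  have "(\<Sum>i\<in>low twisted. card {lam \<in> ispec i. lam < 2}) = (\<Sum>i\<in>low twisted. 1)"
  proof (rule sum.cong[OF refl])
    fix i assume "i \<in> low twisted"
    then show "card {lam \<in> ispec i. lam < 2} = 1" by (cases i) (auto simp: low_def card_spec_below_2)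
  qed
  then have "(\<Sum>i\<in>low twisted. card {lam \<in> ispec i. lam < 2}) = card (low twisted)" by simp
  moreover have "eigenvalue (\<Sum>i\<in>low twisted. card {lam \<in> ispec i. lam < 2}) g = 2"
    by (rule eigenvalue_chart[OF finite_low sub _ ne]) (rule out)
  ultimately show ?thesis by simp
qed

theorem Lambda_induced_metric:
  assumes "gcd m n = 1"
  shows "Lambda (card (low twisted)) (induced_metric (M m n)) = (if twisted then 8 else 16) * pi * integral {0..pi/2} (\<lambda>x. wM m n x * rM m n x)"
proof -
  have emb: "torus_embedding (SOME \<psi>. torus_embedding \<psi> (M m n)) (M m n)"
    using ex_torus_embedding[OF m_pos n_pos assms] by (rule someI_ex)
  obtain X Y where "torus_chart (wM m n) (rM m n) twisted X Y (pullback_metric (SOME \<psi>. torus_embedding \<psi> (M m n)))"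
    by (rule chart_exists[OF assms emb], rule that)
  then have c: "torus_chart (wM m n) (rM m n) twisted X Y (induced_metric (M m n))"
    unfolding induced_metric_def .
  show ?thesis unfolding Lambda_def eigenvalue_2[OF c] torus_chart.area_chart[OF c] by simp
qed

end

section \<open>Elliptic integrals\<close>

text \<open>The composite of a primitive with \<open>arccos\<close> is continuous up to the singular
  end point and differentiable inside, which is enough for the fundamental theorem with the gauge
  integral.\<close>

lemma integral_cos_substitution:
  fixes f :: "real \<Rightarrow> real"
  assumes "continuous_on UNIV (\<lambda>t. f (cos t))"
  shows "integral {0..1} (\<lambda>x. f x / sqrt (1 - x\<^sup>2)) = integral {0..pi/2} (\<lambda>t. f (cos t))"
proof -
  obtain H where H: "\<And>t. (H has_real_derivative f (cos t)) (at t)"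
    by (rule primitive_exists[OF assms], rule that)
  have Hc: "continuous_on S H" for S by (meson H DERIV_isCont continuous_at_imp_continuous_on)
  have "((\<lambda>x. f x / sqrt (1 - x\<^sup>2)) has_integral (- H (arccos 1) - - H (arccos 0))) {0..1}"
  proof (rule fundamental_theorem_of_calculus_interior)
    show "continuous_on {0..1} (\<lambda>x. - H (arccos x))"
      by (intro continuous_on_minus continuous_on_compose2[OF Hc[of UNIV]] continuous_on_arccos continuous_on_id) auto
    fix x :: real assume x: "x \<in> {0<..<1}"
    have "((\<lambda>x. - H (arccos x)) has_real_derivative - (f (cos (arccos x)) * inverse (- sqrt (1 - x\<^sup>2)))) (at x)"
      by (rule DERIV_minus[OF DERIV_chain2[OF H DERIV_arccos]]) (use x in auto)
    then show "((\<lambda>x. - H (arccos x)) has_vector_derivative f x / sqrt (1 - x\<^sup>2)) (at x)"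
      unfolding has_real_derivative_iff_has_vector_derivative[symmetric]
      by (rule DERIV_cong) (use x in \<open>simp add: cos_arccos divide_inverse\<close>)
  qed simp
  moreover have "((\<lambda>t. f (cos t)) has_integral (H (pi/2) - H 0)) {0..pi/2}"
    by (rule fundamental_theorem_of_calculus)
       (auto intro: has_vector_derivative_at_within[OF H[unfolded has_real_derivative_iff_has_vector_derivative]])
  ultimately show ?thesis by (auto simp: integral_unique)
qed

context clifford
begin

lemma w_r: "wM m n x * rM m n x = sqrt (q x) - real m * real n / sqrt (q x)"
  unfolding rM_def right_diff_distrib w_sqrt(3) by (simp add: wM_def divide_inverse mult.commute)

text \<open>With \<open>A = m^2 + 2 m n\<close> one has \<open>q = A (1 - k^2 cos^2)\<close>, so
  \<open>sqrt q\<close> gives \<open>E\<close> and \<open>1 / sqrt q\<close> gives \<open>K\<close>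
  after the substitution by the cosine; \<open>n \<le> m\<close> makes the radicand of
  \<open>k\<close> nonnegative.\<close>

lemma integral_elliptic:
  assumes "n \<le> m"
  defines "a \<equiv> sqrt (real (m^2 + 2 * m * n))" and "k \<equiv> sqrt ((real m ^ 2 - real n ^ 2) / real (m^2 + 2 * m * n))"
  shows "integral {0..pi/2} (\<lambda>x. wM m n x * rM m n x) = a * ellE k - real (m * n) / a * ellK k"
proof -
  define A where "A = real m ^ 2 + 2 * real m * real n"
  have A: "A > 0" using m_pos n_pos by (simp add: A_def add_pos_pos)
  have Ae: "real (m^2 + 2 * m * n) = A" by (simp add: A_def)
  have a: "a = sqrt A" "a > 0" using A by (simp_all only: a_def Ae real_sqrt_gt_0_iff)
  have "real n ^ 2 \<le> real m ^ 2" using assms(1) by simp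
  then have k2: "k\<^sup>2 = (real m ^ 2 - real n ^ 2) / A" unfolding k_def Ae using A by simp
  have q: "q t = A * (1 - k\<^sup>2 * (cos t)\<^sup>2)" for t
    unfolding q_alt(2) k2 using A by (simp add: A_def field_simps)
  have pos: "1 - k\<^sup>2 * (cos t)\<^sup>2 > 0" for t
    using q_pos[of t] A unfolding q by (simp add: zero_less_mult_iff)
  have sq: "sqrt (q t) = a * sqrt (1 - k\<^sup>2 * (cos t)\<^sup>2)" for t unfolding q a(1) by (rule real_sqrt_mult)
  have c: "continuous_on S (\<lambda>t. sqrt (1 - k\<^sup>2 * (cos t)\<^sup>2))" "continuous_on S (\<lambda>t. 1 / sqrt (1 - k\<^sup>2 * (cos t)\<^sup>2))" for S
  proof -
    show c: "continuous_on S (\<lambda>t. sqrt (1 - k\<^sup>2 * (cos t)\<^sup>2))" by (intro continuous_intros)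
    show "continuous_on S (\<lambda>t. 1 / sqrt (1 - k\<^sup>2 * (cos t)\<^sup>2))"
      by (rule continuous_on_divide[OF continuous_on_const c]) (use pos in \<open>simp add: less_imp_neq[symmetric]\<close>)
  qed
  have E: "ellE k = integral {0..pi/2} (\<lambda>t. sqrt (1 - k\<^sup>2 * (cos t)\<^sup>2))"
    unfolding ellE_def by (rule integral_cos_substitution[OF c(1)])
  have K: "ellK k = integral {0..pi/2} (\<lambda>t. 1 / sqrt (1 - k\<^sup>2 * (cos t)\<^sup>2))"
    unfolding ellK_def integral_cos_substitution[where f = "\<lambda>x. 1 / sqrt (1 - k\<^sup>2 * x\<^sup>2)", OF c(2), symmetric]
    by (simp add: mult.commute)
  have "integral {0..pi/2} (\<lambda>x. wM m n x * rM m n x)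
      = integral {0..pi/2} (\<lambda>t. a * sqrt (1 - k\<^sup>2 * (cos t)\<^sup>2) - real (m * n) / a * (1 / sqrt (1 - k\<^sup>2 * (cos t)\<^sup>2)))"
    unfolding w_r sq by simp
  also have "\<dots> = a * ellE k - real (m * n) / a * ellK k"
    unfolding E K integral_mult_right[symmetric]
    by (rule integral_diff) (intro integrable_continuous_real continuous_on_mult continuous_on_const c)+
  finally show ?thesis .
qed

text \<open>Both terms are estimated by their tangents, as functions of \<open>q\<close>, at the mean value of \<open>q\<close>.\<close>

lemma integral_less:
  assumes s: "m + n \<ge> 3"
  shows "integral {0..pi/2} (\<lambda>x. wM m n x * rM m n x) < pi / 2 * (real (m + n) - 1)"
proof -
  define p s where "p = real m * real n" and "s = real m + real n"
  \<comment> \<open>\<open>Q = 2 m n + (m^2 + n^2) / 2\<close> is the mean of \<open>q\<close>, so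
    only the values of the tangents at \<open>Q\<close> survive integration.\<close>
  define Q R where "Q = s\<^sup>2 / 2 + p" and "R = sqrt Q"
  have p: "p > 0" using mn_pos by (simp add: p_def)
  have s3: "s \<ge> 3" using s unfolding s_def by linarith
  have Q: "Q > 0" using p by (simp add: Q_def add_nonneg_pos)
  have R: "R > 0" "R * R = Q" using Q by (auto simp: R_def)
  \<comment> \<open>\<open>\<beta>\<close> and \<open>\<alpha>\<close> are slope and intercept of
    the tangent at \<open>Q\<close> to \<open>sqrt q - p / sqrt q\<close>, which is concave as a
    function of \<open>q\<close>.\<close>
  define \<beta> where "\<beta> = 1 / (2 * R) + p / (2 * Q * R)"
  define \<alpha> where "\<alpha> = Q / (2 * R) - 3 * p / (2 * R)"
  define u where "u x = \<beta> * q x + \<alpha>" for x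
  have le: "wM m n x * rM m n x \<le> u x" for x
  proof -
    define t where "t = sqrt (q x)"
    have t: "t > 0" "t * t = q x" using q_pos[of x] by (auto simp: t_def)
    have "0 \<le> (t - R) * (t - R)" by simp
    then have "2 * R * t \<le> q x + Q" unfolding t(2)[symmetric] R(2)[symmetric] by (simp add: algebra_simps)
    then have 1: "t \<le> (q x + Q) / (2 * R)" using R(1) by (simp add: field_simps)
    \<comment> \<open>Cleared of denominators, this is the convexity of \<open>1 / sqrt q\<close>:
      its tangent at \<open>Q\<close> lies below the graph.\<close>
    have "0 \<le> (t - R) * (t - R) * (t + 2 * R)" using t R by simp
    also have "\<dots> = 2 * R * Q - (3 * Q - q x) * t" unfolding t(2)[symmetric] R(2)[symmetric] by algebra
    finally have "(3 * Q - q x) * t \<le> 2 * Q * R" by (simp add: mult_ac)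
    then have 2: "(3 * Q - q x) / (2 * Q * R) \<le> 1 / t" using t(1) R(1) Q by (simp add: field_simps)
    have "t - p / t \<le> (q x + Q) / (2 * R) - p * ((3 * Q - q x) / (2 * Q * R))"
      using 1 mult_left_mono[OF 2, of p] p by simp
    also have "\<dots> = u x" unfolding u_def \<alpha>_def \<beta>_def using Q R(1) by (simp add: field_simps)
    finally show ?thesis by (simp add: w_r t_def p_def)
  qed
  have qi: "(q has_integral pi / 2 * Q) {0..pi/2}"
  proof -
    define D where "D = (real m)\<^sup>2 - (real n)\<^sup>2"
    define F where "F x = Q * x - D / 2 * (sin x * cos x)" for x
    have "(F has_real_derivative q x) (at x)" for x
    proof -
      have "(F has_real_derivative Q - D / 2 * ((cos x)\<^sup>2 - (sin x)\<^sup>2)) (at x)"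
        unfolding F_def by (auto intro!: derivative_eq_intros simp: power2_eq_square)
      moreover have "2 * Q = 4 * real m * real n + (real m)\<^sup>2 + (real n)\<^sup>2"
        unfolding Q_def s_def p_def power2_sum by simp
      then have "Q - D / 2 * ((cos x)\<^sup>2 - (sin x)\<^sup>2) = q x"
        using q_alt[of x, folded D_def] by (simp add: right_diff_distrib)
      ultimately show ?thesis by simp
    qed
    then have "(F has_vector_derivative q x) (at x within {0..pi/2})" for x
      by (simp add: has_real_derivative_iff_has_vector_derivative has_vector_derivative_at_within)
    then have "(q has_integral F (pi/2) - F 0) {0..pi/2}" by (intro fundamental_theorem_of_calculus) auto
    then show ?thesis by (simp add: F_def mult.commute)
  qed
  have ui: "(u has_integral (\<beta> * (pi / 2 * Q) + \<alpha> * (pi / 2))) {0..pi/2}"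
    unfolding u_def using has_integral_add[OF has_integral_mult_right[OF qi] has_integral_const_real[of \<alpha> 0 "pi/2"]]
    by (simp add: mult.commute)
  have "integral {0..pi/2} (\<lambda>x. wM m n x * rM m n x) \<le> \<beta> * (pi / 2 * Q) + \<alpha> * (pi / 2)"
    by (rule has_integral_le[OF integrable_integral ui le])
       (intro integrable_continuous_real continuous_on_mult w_cont \<rho>_cont)
  also have "\<dots> = pi / 2 * ((s\<^sup>2 / 2) / R)"
  proof -
    have "\<beta> * Q + \<alpha> = (Q - p) / R" unfolding \<alpha>_def \<beta>_def using Q R(1) by (simp add: field_simps)
    then have "\<beta> * Q + \<alpha> = (s\<^sup>2 / 2) / R" by (simp add: Q_def)
    then have "pi / 2 * (\<beta> * Q + \<alpha>) = pi / 2 * ((s\<^sup>2 / 2) / R)" by (simp only:)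
    then show ?thesis by (simp add: algebra_simps)
  qed
  also have "(s\<^sup>2 / 2) / R < s - 1"
  proof -
    \<comment> \<open>For a given sum the product is smallest when one factor is 1, which leaves an
      inequality in \<open>s\<close> alone.\<close>
    have "0 \<le> (real m - 1) * (real n - 1)" using m_pos n_pos by (intro mult_nonneg_nonneg) auto
    then have ps: "p \<ge> s - 1" by (simp add: p_def s_def algebra_simps)
    obtain t where t: "s = t + 3" "t \<ge> 0" using s3 by (metis add.commute le_add_diff_inverse diff_ge_0_iff_ge)
    \<comment> \<open>Expanded at \<open>s = 3\<close>, the polynomial has only positive
      coefficients.\<close>
    have "0 < t^4 + 12 * t^3 + 44 * t^2 + 60 * t + 23" using t(2) by (simp add: add_nonneg_pos)
    also have "\<dots> = 4 * ((s - 1) * (s - 1) * (s\<^sup>2 / 2 + (s - 1)) - (s\<^sup>2 / 2) * (s\<^sup>2 / 2))"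
      unfolding t(1) by (simp add: eval_nat_numeral field_simps)
    finally have "(s\<^sup>2 / 2) * (s\<^sup>2 / 2) < (s - 1) * (s - 1) * (s\<^sup>2 / 2 + (s - 1))" by simp
    also have "\<dots> \<le> (s - 1) * (s - 1) * Q" unfolding Q_def using ps by (intro mult_left_mono) auto
    also have "\<dots> = ((s - 1) * R) * ((s - 1) * R)" unfolding R(2)[symmetric] by (simp only: mult_ac)
    finally have "(s\<^sup>2 / 2)\<^sup>2 < ((s - 1) * R)\<^sup>2" by (simp only: power2_eq_square)
    then have "s\<^sup>2 / 2 < (s - 1) * R" by (rule power2_less_imp_less) (use s3 R in simp)
    then show ?thesis using R(1) by (simp add: pos_divide_less_eq)
  qed
  finally show ?thesis by (simp add: s_def)
qed

end

section \<open>Flat tori\<close>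

definition flatX :: "real^2 \<Rightarrow> real" where "flatX p = 2 * pi * p $ 1"
definition flatY :: "real^2 \<Rightarrow> real" where "flatY p = 2 * pi * p $ 2"
definition flat :: "nat \<Rightarrow> metric" where
  "flat N p = (\<chi> i j. if i = j then if i = 1 then (real N)\<^sup>2 * (2 * pi)\<^sup>2 else (2 * pi)\<^sup>2 else 0)"

locale flat_torus =
  fixes N :: nat
  assumes N_pos: "N > 0"
begin

lemma torus_metric_flat: "torus_metric (flat N)"
proof -
  have "flat N p = flat N 0" for p by (simp add: flat_def)
  then have e: "flat N = (\<lambda>p. flat N 0)" by blast
  have pos: "0 < v \<bullet> (flat N p *v v)" if "v \<noteq> 0" for p v
  proof -
    have "v \<bullet> (flat N p *v v) = (real N * 2 * pi * v $ 1)\<^sup>2 + (2 * pi * v $ 2)\<^sup>2"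
      by (simp add: inner_vec_def sum_2 matrix_vector_mult_def flat_def power2_eq_square)
    moreover have "v $ 1 \<noteq> 0 \<or> v $ 2 \<noteq> 0" using that by (auto simp: vec_eq_iff forall_2)
    ultimately show ?thesis using N_pos by (auto intro: add_pos_nonneg add_nonneg_pos)
  qed
  have "smooth (flat N)" by (subst e) (rule smooth_const)
  moreover have "lattice_periodic (flat N)" unfolding lattice_periodic_def by (simp add: flat_def)
  moreover have "transpose (flat N p) = flat N p" for p by (simp add: transpose_def flat_def vec_eq_iff)
  ultimately show ?thesis using pos by (simp add: torus_metric_def)
qed

text \<open>The length of the first circle is put into \<open>w\<close>, so that the coordinate
  \<open>x\<close> keeps the period \<open>2 pi\<close> of the general theory.\<close>

lemma sturm: "sturm (\<lambda>x. real N) (\<lambda>x. 1)"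
  by unfold_locales (use N_pos in \<open>auto intro: el_const\<close>)

lemma chart: "torus_chart (\<lambda>x. real N) (\<lambda>x. 1) False flatX flatY (flat N)"
proof -
  interpret sturm "\<lambda>x. real N" "\<lambda>x. 1" by (rule sturm)
  have p: "partial i flatX = (\<lambda>p. if i = 1 then 2 * pi else 0)" "partial i flatY = (\<lambda>p. if i = 1 then 0 else 2 * pi)" for i
  proof -
    have "(flatX has_derivative (\<lambda>h. 2 * pi * h $ 1)) (at p)" "(flatY has_derivative (\<lambda>h. 2 * pi * h $ 2)) (at p)" for p
      unfolding flatX_def flatY_def
      by (intro has_derivative_mult_right bounded_linear_imp_has_derivative bounded_linear_vec_nth)+
    note e = this[THEN partial_eq]
    have "i = 1 \<or> i = 2" using exhaust_2 by blast
    then show "partial i flatX = (\<lambda>p. if i = 1 then 2 * pi else 0)" "partial i flatY = (\<lambda>p. if i = 1 then 0 else 2 * pi)"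
      unfolding e by (auto simp: axis_def)
  qed
  have sm: "smooth flatX" "smooth flatY"
    unfolding flatX_def[abs_def] flatY_def[abs_def] by (intro elementary_smooth el_mult el_const el_coord)+
  show ?thesis
  proof
    show "smooth flatX" "smooth flatY" by (rule sm)+
    show "jac flatX flatY x \<noteq> 0" for x by (simp add: jac_def p)
    show "flat N x $ i $ j = (real N)\<^sup>2 * 1 * (partial i flatX x * partial j flatX x) + 1 * (partial i flatY x * partial j flatY x)" for x i j
      using exhaust_2[of i] exhaust_2[of j] by (auto simp: p flat_def power2_eq_square)
    show "lat False (flatX x - flatX y) (flatY x - flatY y) \<longleftrightarrow> (\<forall>i. x $ i - y $ i \<in> \<int>)" for x y
    proof -
      have e: "flatX x - flatX y = pi * (2 * (x $ 1 - y $ 1))" "flatY x - flatY y = pi * (2 * (x $ 2 - y $ 2))"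
        by (simp_all add: flatX_def flatY_def algebra_simps)
      have Z: "(\<exists>k :: int. 2 * t = of_int k \<and> even k) \<longleftrightarrow> t \<in> \<int>" for t :: real
      proof
        assume "\<exists>k :: int. 2 * t = of_int k \<and> even k"
        then obtain j :: int where "2 * t = of_int (2 * j)" by (auto elim!: evenE)
        then have "t = of_int j" by simp
        then show "t \<in> \<int>" by simp
      next
        assume "t \<in> \<int>"
        then obtain j :: int where "t = of_int j" by (rule Ints_cases)
        then show "\<exists>k :: int. 2 * t = of_int k \<and> even k" by (intro exI[of _ "2 * j"]) simp
      qed
      have "lat False (flatX x - flatX y) (flatY x - flatY y) \<longleftrightarrow>
        (\<exists>k :: int. 2 * (x $ 1 - y $ 1) = of_int k \<and> even k) \<and> (\<exists>k :: int. 2 * (x $ 2 - y $ 2) = of_int k \<and> even k)"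
        unfolding lat_def e mult_cancel_left by auto
      then show ?thesis unfolding Z forall_2 .
    qed
    show "\<exists>z. lat False (x - flatX z) (y - flatY z)" for x y
      by (rule exI[of _ "pt (x / (2 * pi)) (y / (2 * pi))"])
         (auto simp: lat_def flatX_def flatY_def intro!: exI[of _ 0])
  qed
qed

end

sublocale flat_torus \<subseteq> torus_chart "\<lambda>x. real N" "\<lambda>x. 1" False flatX flatY "flat N"
  by (rule chart)

context flat_torus
begin

lemma kap_flat: "kap l lam x = lam - l\<^sup>2"
  by (simp add: kap_def)

lemma spec_neg: "lam < l\<^sup>2 \<Longrightarrow> lam \<notin> spec nu nu' l"
  by (rule spec_empty[of l lam]) (simp_all add: kap_flat)

text \<open>\<open>\<nu> = N sqrt lam\<close> is the frequency in \<open>x\<close>: the solutions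
  are \<open>cos (\<nu> x)\<close> and a multiple of \<open>sin (\<nu> x)\<close>, with a linear
  function in place of the latter for \<open>\<nu> = 0\<close>. That function satisfies no condition
  at \<open>pi/2\<close> except the Dirichlet-Neumann exception excluded by its derivative
  1.\<close>

lemma spec_flat:
  assumes "\<nu> \<ge> 0"
  shows "(\<nu> / real N)\<^sup>2 \<in> spec nu nu' 0 \<longleftrightarrow> (nu \<or> \<nu> \<noteq> 0) \<and> (if nu = nu' then sin (\<nu> * (pi / 2)) = 0 else cos (\<nu> * (pi / 2)) = 0)"
proof -
  define \<kappa> where "\<kappa> = \<nu> / real N"
  have \<nu>: "\<nu> = real N * \<kappa>" using N_pos by (simp add: \<kappa>_def)
  have k: "kap 0 (\<kappa>\<^sup>2) = (\<lambda>x. \<kappa> * \<kappa>)" by (simp add: fun_eq_iff kap_flat power2_eq_square)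
  have eq: "eig nu 0 (\<kappa>\<^sup>2) (pi/2) = c (pi/2)" "eig' nu 0 (\<kappa>\<^sup>2) (pi/2) = d (pi/2)"
    if s: "solution (kap 0 (\<kappa>\<^sup>2)) c d" and 0: "c 0 = (if nu then 1 else 0)" "d 0 = (if nu then 0 else 1)" for nu c d
  proof -
    have 1: "eig nu 0 (\<kappa>\<^sup>2) 0 = c 0" "eig' nu 0 (\<kappa>\<^sup>2) 0 = d 0" unfolding eig_0 0 by simp_all
    show "eig nu 0 (\<kappa>\<^sup>2) (pi/2) = c (pi/2)" by (rule solution_eq_at(1)[OF bcont_kap eig_solution s 1])
    show "eig' nu 0 (\<kappa>\<^sup>2) (pi/2) = d (pi/2)" by (rule solution_eq_at(2)[OF bcont_kap eig_solution s 1])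
  qed
  have 1: "solution (kap 0 (\<kappa>\<^sup>2)) (\<lambda>x. cos (real N * \<kappa> * x)) (\<lambda>x. - \<kappa> * sin (real N * \<kappa> * x))"
    unfolding solution_def k by (auto intro!: derivative_eq_intros simp: algebra_simps)
  have T: "eig True 0 (\<kappa>\<^sup>2) (pi/2) = cos (\<nu> * (pi / 2))" "eig' True 0 (\<kappa>\<^sup>2) (pi/2) = - \<kappa> * sin (\<nu> * (pi / 2))"
    unfolding \<nu> by (rule eq[OF 1]; simp)+
  have F: "eig False 0 (\<kappa>\<^sup>2) (pi/2) * \<kappa> = sin (\<nu> * (pi / 2))" "eig' False 0 (\<kappa>\<^sup>2) (pi/2) = cos (\<nu> * (pi / 2))" if "\<kappa> \<noteq> 0"
  proof -
    have 2: "solution (kap 0 (\<kappa>\<^sup>2)) (\<lambda>x. sin (real N * \<kappa> * x) / \<kappa>) (\<lambda>x. cos (real N * \<kappa> * x))"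
      unfolding solution_def k using \<open>\<kappa> \<noteq> 0\<close> by (auto intro!: derivative_eq_intros simp: field_simps)
    have "eig False 0 (\<kappa>\<^sup>2) (pi/2) = sin (\<nu> * (pi / 2)) / \<kappa>" "eig' False 0 (\<kappa>\<^sup>2) (pi/2) = cos (\<nu> * (pi / 2))"
      unfolding \<nu> by (rule eq[OF 2]; simp)+
    then show "eig False 0 (\<kappa>\<^sup>2) (pi/2) * \<kappa> = sin (\<nu> * (pi / 2))" "eig' False 0 (\<kappa>\<^sup>2) (pi/2) = cos (\<nu> * (pi / 2))"
      using \<open>\<kappa> \<noteq> 0\<close> by simp_all
  qed
  have F0: "eig False 0 (\<kappa>\<^sup>2) (pi/2) = real N * (pi/2)" "eig' False 0 (\<kappa>\<^sup>2) (pi/2) = 1" if "\<kappa> = 0"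
  proof -
    have 3: "solution (kap 0 (\<kappa>\<^sup>2)) (\<lambda>x. real N * x) (\<lambda>x. 1)"
      using \<open>\<kappa> = 0\<close> unfolding solution_def k by (auto intro!: derivative_eq_intros)
    show "eig False 0 (\<kappa>\<^sup>2) (pi/2) = real N * (pi/2)" "eig' False 0 (\<kappa>\<^sup>2) (pi/2) = 1"
      by (rule eq[OF 3]; simp)+
  qed
  show ?thesis
  proof (cases "\<kappa> = 0")
    case True
    then have "\<nu> = 0" by (simp add: \<nu>)
    then show ?thesis unfolding \<kappa>_def[symmetric] spec_iff using T F0[OF True] True N_pos by (cases nu; cases nu') auto
  next
    case False
    then have "\<nu> \<noteq> 0" using N_pos by (simp add: \<nu>)
    have "eig False 0 (\<kappa>\<^sup>2) (pi/2) = 0 \<longleftrightarrow> sin (\<nu> * (pi / 2)) = 0"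
      using F(1)[OF False] False by (metis mult_eq_0_iff)
    then show ?thesis unfolding \<kappa>_def[symmetric] spec_iff using T F(2)[OF False] False \<open>\<nu> \<noteq> 0\<close> by (cases nu; cases nu') auto
  qed
qed

lemma trig_half_pi_zero:
  assumes "\<nu> \<ge> 0"
  shows "sin (\<nu> * (pi / 2)) = 0 \<longleftrightarrow> (\<exists>j. \<nu> = real j \<and> even j)" "cos (\<nu> * (pi / 2)) = 0 \<longleftrightarrow> (\<exists>j. \<nu> = real j \<and> odd j)"
proof -
  have nat: "(\<exists>i. \<nu> = of_int i \<and> P i) \<longleftrightarrow> (\<exists>j. \<nu> = real j \<and> P (int j))" for P
    using assms by (metis of_int_0_le_iff of_int_of_nat_eq zero_le_imp_eq_int)
  have "sin (\<nu> * (pi / 2)) = 0 \<longleftrightarrow> (\<exists>i. \<nu> = of_int i \<and> even i)"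
    unfolding sin_zero_iff_int by (auto simp: mult.commute)
  then show "sin (\<nu> * (pi / 2)) = 0 \<longleftrightarrow> (\<exists>j. \<nu> = real j \<and> even j)" unfolding nat by simp
  have "cos (\<nu> * (pi / 2)) = 0 \<longleftrightarrow> (\<exists>i. \<nu> = of_int i \<and> odd i)"
    unfolding cos_zero_iff_int by (auto simp: mult.commute)
  then show "cos (\<nu> * (pi / 2)) = 0 \<longleftrightarrow> (\<exists>j. \<nu> = real j \<and> odd j)" unfolding nat by simp
qed

lemma spec_below_1:
  "{lam \<in> spec nu nu' 0. lam < 1} = (\<lambda>j. (real j / real N)\<^sup>2) ` {j. j < N \<and> (nu \<or> j \<noteq> 0) \<and> (even j \<longleftrightarrow> nu = nu')}"
  (is "?L = ?R")
proof (intro equalityI subsetI)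
  fix lam assume l: "lam \<in> ?L"
  then have "lam \<ge> 0" using spec_neg[of lam 0 nu nu'] by (simp add: not_less[symmetric]) blast
  define \<nu> where "\<nu> = sqrt lam * real N"
  have \<nu>: "\<nu> \<ge> 0" "lam = (\<nu> / real N)\<^sup>2" "\<nu> < real N"
    using \<open>lam \<ge> 0\<close> N_pos l by (simp_all add: \<nu>_def)
  have "(\<nu> / real N)\<^sup>2 \<in> spec nu nu' 0" using l \<nu>(2) by simp
  then obtain j where "\<nu> = real j" "even j \<longleftrightarrow> nu = nu'" "nu \<or> j \<noteq> 0"
    unfolding spec_flat[OF \<nu>(1)] trig_half_pi_zero[OF \<nu>(1)] by (auto split: if_splits)
  then show "lam \<in> ?R" using \<nu> by auto
next
  fix lam assume "lam \<in> ?R"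
  then obtain j where j: "lam = (real j / real N)\<^sup>2" "j < N" "nu \<or> j \<noteq> 0" "even j \<longleftrightarrow> nu = nu'" by blast
  have "lam \<in> spec nu nu' 0" unfolding j(1) spec_flat[OF of_nat_0_le_iff] trig_half_pi_zero[OF of_nat_0_le_iff]
    using j by auto
  moreover have "lam < 1" unfolding j(1) using j(2) by (simp add: power_less_one_iff abs_square_less_1)
  ultimately show "lam \<in> ?L" by simp
qed

lemma card_spec_below_1:
  "card {lam \<in> spec nu nu' 0. lam < 1} = card {j. j < N \<and> (nu \<or> j \<noteq> 0) \<and> (even j \<longleftrightarrow> nu = nu')}"
  unfolding spec_below_1
proof (rule card_image, rule inj_onI)
  fix i j :: nat assume "(real i / real N)\<^sup>2 = (real j / real N)\<^sup>2"
  then show "i = j" using N_pos by (simp add: power2_eq_iff_nonneg)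
qed

text \<open>Below 1 only \<open>l = 0\<close> contributes, with the eigenvalues
  \<open>(j / N)^2\<close> for \<open>j < N\<close>, simple for \<open>j = 0\<close> and double
  otherwise; that makes \<open>2 N - 1\<close>. The next eigenvalue 1 belongs to
  \<open>cos y\<close>, and the area is \<open>4 pi^2 N\<close>.\<close>

theorem Lambda_flat: "Lambda (2 * N - 1) (flat N) = 4 * pi\<^sup>2 * real N"
proof -
  define A :: "index set" where "A = (\<lambda>(nu, nu'). (nu, nu', 0, True)) ` UNIV"
  have A: "finite A" "A \<subseteq> admissible False" by (auto simp: A_def admissible_def)
  have "kap 0 1 = (\<lambda>x. 1)" by (simp add: fun_eq_iff kap_flat)
  have sum: "(\<Sum>i\<in>A. card {lam \<in> ispec i. lam < 1}) = 2 * N - 1"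
  proof -
    \<comment> \<open>For each condition at 0 the parity of \<open>j\<close> decides the condition
      at \<open>pi/2\<close>, so the two choices together exhaust all \<open>j\<close>.\<close>
    have split: "card {j. j < N \<and> (c \<or> j \<noteq> 0) \<and> (even j \<longleftrightarrow> True)} + card {j. j < N \<and> (c \<or> j \<noteq> 0) \<and> (even j \<longleftrightarrow> False)}
        = card {j. j < N \<and> (c \<or> j \<noteq> 0)}" for c
      by (subst card_Un_disjoint[symmetric]) (auto intro!: arg_cong[of _ _ card])
    have c: "card {j. j < N} = N" "card {j. j < N \<and> j \<noteq> 0} = N - 1"
    proof -
      have "{j. j < N \<and> j \<noteq> 0} = {1..<N}" by auto
      then show "card {j. j < N \<and> j \<noteq> 0} = N - 1" by simp
    qed simp
    have "(\<Sum>i\<in>A. card {lam \<in> ispec i. lam < 1}) = (\<Sum>(nu, nu')\<in>UNIV. card {lam \<in> spec nu nu' 0. lam < 1})"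
      unfolding A_def by (subst sum.reindex) (auto simp: inj_on_def intro!: sum.cong)
    also have "\<dots> = N + (N - 1)"
      unfolding sum_bool4 card_spec_below_1 using split[of True] split[of False] c by simp
    finally show ?thesis using N_pos by simp
  qed
  have out: False if i: "i \<in> admissible False" "i \<notin> A" "lam \<in> ispec i" "lam < 1" for i lam
  proof -
    obtain nu nu' l c where e: "i = (nu, nu', l, c)" by (cases i)
    have "l \<noteq> 0" using i(1,2) by (auto simp: e A_def admissible_def image_iff)
    then have "1 \<le> (real l)\<^sup>2" by simp
    then have "lam \<notin> spec nu nu' (real l)" using i(4) by (intro spec_neg) linarith
    then show False using i(3) by (simp add: e)
  qed
  have "1 \<in> spec True True (real 1)"
  proof -
    have "kap 1 1 = (\<lambda>x. 0)" by (simp add: fun_eq_iff kap_flat)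
    then have "Ang True 1 1 = pi/2" using ang_0 by simp
    then show ?thesis by (simp only: spec_def mem_Collect_eq if_True of_nat_1 cos_pi_half)
  qed
  then have "(True, True, 1, True) \<in> Ix False 1" by (simp add: Ix_def admissible_def)
  then have ne: "Ix False 1 \<noteq> {}" by blast
  have "eigenvalue (2 * N - 1) (flat N) = 1"
    unfolding sum[symmetric] by (rule eigenvalue_chart[OF A _ ne]) (rule out)
  then show ?thesis unfolding Lambda_def area_chart by (simp add: power2_eq_square)
qed

end

lemma not_maximal_flat:
  assumes "N > 0" "k = 2 * N - 1" "Lambda k g < 4 * pi\<^sup>2 * real N"
  shows "\<not> maximal_metric k g"
proof
  interpret flat_torus N by unfold_locales (rule assms)
  assume "maximal_metric k g"
  then have "ereal (Lambda k g) = (SUP h\<in>{h. torus_metric h}. ereal (Lambda k h))" by (simp add: maximal_metric_def)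
  moreover have "ereal (Lambda k (flat N)) \<le> (SUP h\<in>{h. torus_metric h}. ereal (Lambda k h))"
    by (rule SUP_upper) (simp add: torus_metric_flat)
  ultimately have "ereal (Lambda k (flat N)) \<le> ereal (Lambda k g)" by simp
  then show False using assms(3) Lambda_flat unfolding assms(2) by simp
qed

theorem proposition1:
  fixes m n :: nat
  assumes "m > 0" and "n > 0" and "m \<ge> n" and "gcd m n = 1"
  shows "(m * n mod 2 = 0 \<longrightarrow>
           Lambda (4 * (m + n) - 3) (induced_metric (M m n)) =
             16 * pi * (sqrt (real (m^2 + 2 * m * n))
                          * ellE (sqrt ((real m ^ 2 - real n ^ 2) / real (m^2 + 2 * m * n)))
                        - real (m * n) / sqrt (real (m^2 + 2 * m * n))
                          * ellK (sqrt ((real m ^ 2 - real n ^ 2) / real (m^2 + 2 * m * n)))))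
       \<and> (m * n mod 2 = 1 \<longrightarrow>
           Lambda (2 * (m + n) - 3) (induced_metric (M m n)) =
             8 * pi * (sqrt (real (m^2 + 2 * m * n))
                          * ellE (sqrt ((real m ^ 2 - real n ^ 2) / real (m^2 + 2 * m * n)))
                        - real (m * n) / sqrt (real (m^2 + 2 * m * n))
                          * ellK (sqrt ((real m ^ 2 - real n ^ 2) / real (m^2 + 2 * m * n)))))
       \<and> ({m, n} \<noteq> {1, 1} \<longrightarrow>
           (m * n mod 2 = 0 \<longrightarrow> \<not> maximal_metric (4 * (m + n) - 3) (induced_metric (M m n))) \<and>
           (m * n mod 2 = 1 \<longrightarrow> \<not> maximal_metric (2 * (m + n) - 3) (induced_metric (M m n))))"
  proof -
  interpret clifford m n by unfold_locales (use assms in auto)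
  define I where "I = integral {0..pi/2} (\<lambda>x. wM m n x * rM m n x)"
  note I = integral_elliptic[OF assms(3), folded I_def]
  have even: "m * n mod 2 = 0 \<longleftrightarrow> \<not> (odd m \<and> odd n)" and odd: "m * n mod 2 = 1 \<longleftrightarrow> odd m \<and> odd n"
    by (metis even_iff_mod_2_eq_zero even_mult_iff, metis odd_iff_mod_2_eq_one even_mult_iff)
  have L: "Lambda (4 * (m + n) - 3) (induced_metric (M m n)) = 16 * pi * I" if "\<not> (odd m \<and> odd n)"
  proof -
    have tw: "(odd m \<and> odd n) = False" using that by simp
    show ?thesis using Lambda_induced_metric[OF assms(4)] unfolding tw card_low_untwisted I_def by simp
  qed
  have L': "Lambda (2 * (m + n) - 3) (induced_metric (M m n)) = 8 * pi * I" if "odd m" "odd n"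
  proof -
    have tw: "(odd m \<and> odd n) = True" using that by simp
    show ?thesis using Lambda_induced_metric[OF assms(4)] unfolding tw card_low_twisted[OF that] I_def by simp
  qed
  have less: "I < pi / 2 * (real (m + n) - 1)" and ge: "m + n \<ge> 3" if "{m, n} \<noteq> {1, 1}"
  proof -
    show "m + n \<ge> 3" using that assms(1-3) by (cases "m = 1") auto
    then show "I < pi / 2 * (real (m + n) - 1)" unfolding I_def by (rule integral_less)
  qed
  have max: "\<not> maximal_metric (4 * (m + n) - 3) (induced_metric (M m n))" if "\<not> (odd m \<and> odd n)" "{m, n} \<noteq> {1, 1}"
  \<comment> \<open>Solves \<open>2 N - 1 = 4 (m + n) - 3\<close>; the comparison has room to spare,
    as \<open>8 (m + n - 1) < 4 N\<close>.\<close>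
  proof (rule not_maximal_flat[where N = "2 * (m + n) - 1"])
    have "16 * pi * I < 16 * pi * (pi / 2 * (real (m + n) - 1))" using less[OF that(2)] by (intro mult_strict_left_mono) auto
    also have "\<dots> = 8 * pi\<^sup>2 * (real (m + n) - 1)" by (simp add: power2_eq_square)
    also have "\<dots> \<le> 4 * pi\<^sup>2 * real (2 * (m + n) - 1)" using ge[OF that(2)] by (simp add: of_nat_diff algebra_simps)
    finally show "Lambda (4 * (m + n) - 3) (induced_metric (M m n)) < 4 * pi\<^sup>2 * real (2 * (m + n) - 1)"
      unfolding L[OF that(1)] .
  qed (use assms(1) in simp_all)
  have max': "\<not> maximal_metric (2 * (m + n) - 3) (induced_metric (M m n))" if "odd m" "odd n" "{m, n} \<noteq> {1, 1}"
  \<comment> \<open>Here \<open>2 N - 1 = 2 (m + n) - 3\<close>, and the bound on the integral is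
    used without slack.\<close>
  proof (rule not_maximal_flat[where N = "m + n - 1"])
    have "8 * pi * I < 8 * pi * (pi / 2 * (real (m + n) - 1))" using less[OF that(3)] by (intro mult_strict_left_mono) auto
    also have "\<dots> = 4 * pi\<^sup>2 * real (m + n - 1)" using ge[OF that(3)] by (simp add: power2_eq_square of_nat_diff)
    finally show "Lambda (2 * (m + n) - 3) (induced_metric (M m n)) < 4 * pi\<^sup>2 * real (m + n - 1)"
      unfolding L'[OF that(1,2)] .
  qed (use ge[OF that(3)] in simp_all)
  show ?thesis unfolding even odd I[symmetric] using L L' max max' by simp
qed

end
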